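(* Let $1\le p < \infty$, $m \in \mathbb{N}$, $a \in \mathbb{R}$, and $0 \le \ell < d$. (i) Let $a\ge\frac{d}{p}$ and either $1<p<\infty$ and $m>d/p$, or $p=1$ and $m\ge d$. Then the Kondratiev space $\mathcal{K}^{m}_{a,p} (\mathbb{R}^d,\mathbb{R}^\ell_* )$ is an algebra with respect to pointwise multiplication, i.e., there exists a constant $c$ such that $$\|u\cdot v|\mathcal{K}^{m}_{a,p} (\mathbb{R}^d,\mathbb{R}^\ell_* )\|\leq c \,\|u|\mathcal{K}^{m}_{a,p} (\mathbb{R}^d,\mathbb{R}^\ell_* )\|\,\|v|\mathcal{K}^{m}_{a,p} (\mathbb{R}^d,\mathbb{R}^\ell_* )\|$$ holds for all $u,v\in \mathcal{K}^{m}_{a,p} (\mathbb{R}^d,\mathbb{R}^\ell_* )$. (ii) Let $\ell =0$. Then the Kondratiev space $\mathcal{K}^{m}_{a,p} (\mathbb{R}^d,\mathbb{R}^0_* )$ is an algebra with respect to pointwise multiplication if, and only if, $a\ge\frac{d}{p}$ and either $1<p<\infty$ and $m>d/p$, or $p=1$ and $m\ge d$.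
   Context: $\mathbb{N}=\{1,2,\dots\}$, $\mathbb{N}_0=\mathbb{N}\cup\{0\}$. For an integer $0\le\ell<d$ put $\mathbb{R}^\ell_*=\{x\in\mathbb{R}^d: x_1=\dots=x_{d-\ell}=0\}$ (so $\mathbb{R}^0_*=\{0\}$) and $\rho(x)=\min\big(1,(\sum_{i=1}^{d-\ell}|x_i|^2)^{1/2}\big)$. For $m\in\mathbb{N}_0$, $a\in\mathbb{R}$, $1\le p<\infty$, the Kondratiev space $\mathcal{K}^m_{a,p}(\mathbb{R}^d,\mathbb{R}^\ell_* )$ consists of all measurable functions $u$ on $\mathbb{R}^d\setminus\mathbb{R}^\ell_*$ having weak derivatives $\partial^\alpha u$, $|\alpha|\le m$, in $\mathbb{R}^d\setminus\mathbb{R}^\ell_*$ with $\|u|\mathcal{K}^m_{a,p}(\mathbb{R}^d,\mathbb{R}^\ell_* )\|=\big(\sum_{|\alpha|\le m}\int_{\mathbb{R}^d\setminus\mathbb{R}^\ell_*}|\rho(x)^{|\alpha|-a}\partial^\alpha u(x)|^p\,dx\big)^{1/p}<\infty$. *)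

theory Defs
  imports "HOL-Analysis.Analysis"
begin

text \<open>
  The ambient space is \<open>real ^ 'd\<close> with \<open>d = CARD('d)\<close>.  The index type is
  linearly ordered, so that it makes sense to speak of the first \<open>k\<close> coordinates.  Functions take
  values in \<open>'b :: {real_normed_field, euclidean_space}\<close>, which covers the real-valued and the
  complex-valued case.
\<close>

definition leading_coords :: "nat \<Rightarrow> 'd::{finite,linorder} set" where
  "leading_coords k = {i. card {j. j \<le> i} \<le> k}"

definition singular_set :: "nat \<Rightarrow> (real ^ 'd::{finite,linorder}) set" where
  "singular_set l = {x. \<forall>i \<in> leading_coords (CARD('d) - l). x $ i = 0}"

definition rho :: "nat \<Rightarrow> real ^ 'd::{finite,linorder} \<Rightarrow> real" where
  "rho l x = min 1 (sqrt (\<Sum>i \<in> leading_coords (CARD('d) - l). \<bar>x $ i\<bar>\<^sup>2))"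

definition partial_deriv :: "'d::finite \<Rightarrow> (real ^ 'd \<Rightarrow> real) \<Rightarrow> real ^ 'd \<Rightarrow> real" where
  "partial_deriv i f x = deriv (\<lambda>t. f (x + t *\<^sub>R axis i 1)) 0"

text \<open>
  Total differentiability of every iterated partial derivative makes all of them exist and be
  continuous, so this is \<open>C\<^sup>\<infinity>\<close> on the whole space.
\<close>

definition smooth :: "(real ^ 'd::finite \<Rightarrow> real) \<Rightarrow> bool" where
  "smooth f \<longleftrightarrow> (\<forall>is. foldr partial_deriv is f differentiable_on UNIV)"

definition test_functions :: "(real ^ 'd::finite) set \<Rightarrow> (real ^ 'd \<Rightarrow> real) set" where
  "test_functions \<Omega> =
     {\<phi>. smooth \<phi> \<and> compact (closure {x. \<phi> x \<noteq> 0}) \<and> closure {x. \<phi> x \<noteq> 0} \<subseteq> \<Omega>}"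

text \<open>
  Multi-indices are functions \<open>'d \<Rightarrow> nat\<close>.  The classical derivative is only applied to smooth
  functions, for which the order of differentiation is irrelevant.
\<close>

definition mindex_order :: "('d::finite \<Rightarrow> nat) \<Rightarrow> nat" where
  "mindex_order \<alpha> = (\<Sum>i\<in>UNIV. \<alpha> i)"

definition classical_deriv ::
    "('d::{finite,linorder} \<Rightarrow> nat) \<Rightarrow> (real ^ 'd::{finite,linorder} \<Rightarrow> real) \<Rightarrow> real ^ 'd::{finite,linorder} \<Rightarrow> real" where
  "classical_deriv \<alpha> f = foldr (\<lambda>i. partial_deriv i ^^ \<alpha> i) (sorted_list_of_set UNIV) f"

definition locally_integrable_on ::
    "(real ^ 'd::finite \<Rightarrow> 'b::euclidean_space) \<Rightarrow> (real ^ 'd) set \<Rightarrow> bool" where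
  "locally_integrable_on u \<Omega> \<longleftrightarrow>
     u \<in> borel_measurable (lebesgue_on \<Omega>) \<and>
     (\<forall>K. compact K \<and> K \<subseteq> \<Omega> \<longrightarrow> set_integrable lebesgue K u)"

definition is_weak_deriv ::
    "(real ^ 'd::{finite,linorder}) set \<Rightarrow> ('d \<Rightarrow> nat) \<Rightarrow>
     (real ^ 'd::{finite,linorder} \<Rightarrow> 'b::euclidean_space) \<Rightarrow> (real ^ 'd::{finite,linorder} \<Rightarrow> 'b) \<Rightarrow> bool" where
  "is_weak_deriv \<Omega> \<alpha> u v \<longleftrightarrow>
     locally_integrable_on u \<Omega> \<and> locally_integrable_on v \<Omega> \<and>
     (\<forall>\<phi> \<in> test_functions \<Omega>.
        (LINT x:\<Omega>|lebesgue. classical_deriv \<alpha> \<phi> x *\<^sub>R u x) =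
        (-1) ^ mindex_order \<alpha> *\<^sub>R (LINT x:\<Omega>|lebesgue. \<phi> x *\<^sub>R v x))"

text \<open>Weak derivatives are unique up to null sets, so integrals do not depend on the choice.\<close>

definition weak_deriv ::
    "(real ^ 'd::{finite,linorder}) set \<Rightarrow> ('d \<Rightarrow> nat) \<Rightarrow>
     (real ^ 'd::{finite,linorder} \<Rightarrow> 'b::euclidean_space) \<Rightarrow> real ^ 'd::{finite,linorder} \<Rightarrow> 'b" where
  "weak_deriv \<Omega> \<alpha> u = (SOME v. is_weak_deriv \<Omega> \<alpha> u v)"

text \<open>The \<open>p\<close>-th power of the Kondratiev norm, possibly infinite.\<close>

definition kondratiev_energy ::
    "nat \<Rightarrow> real \<Rightarrow> real \<Rightarrow> nat \<Rightarrow> (real ^ 'd::{finite,linorder} \<Rightarrow> 'b::euclidean_space) \<Rightarrow> ennreal" where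
  "kondratiev_energy m a p l u =
     (\<Sum>\<alpha> | mindex_order \<alpha> \<le> m.
        \<integral>\<^sup>+ x \<in> - singular_set l.
          ennreal (norm (rho l x powr (real (mindex_order \<alpha>) - a) *\<^sub>R
                         weak_deriv (- singular_set l) \<alpha> u x) powr p) \<partial>lebesgue)"

definition kondratiev_norm ::
    "nat \<Rightarrow> real \<Rightarrow> real \<Rightarrow> nat \<Rightarrow> (real ^ 'd::{finite,linorder} \<Rightarrow> 'b::euclidean_space) \<Rightarrow> real" where
  "kondratiev_norm m a p l u = enn2real (kondratiev_energy m a p l u) powr (1 / p)"

text \<open>
  Elements are represented by total functions; their values on the singular set play no role.
\<close>

definition kondratiev_space ::
    "nat \<Rightarrow> real \<Rightarrow> real \<Rightarrow> nat \<Rightarrow> (real ^ 'd::{finite,linorder} \<Rightarrow> 'b::euclidean_space) set" where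
  "kondratiev_space m a p l =
     {u. u \<in> borel_measurable (lebesgue_on (- singular_set l)) \<and>
         (\<forall>\<alpha>. mindex_order \<alpha> \<le> m \<longrightarrow> (\<exists>v. is_weak_deriv (- singular_set l) \<alpha> u v)) \<and>
         kondratiev_energy m a p l u < \<infinity>}"

text \<open>
  Membership of the product is stated explicitly, because the real-valued norm is
  meaningful only on the space itself.
\<close>

definition pointwise_algebra ::
    "('a \<Rightarrow> 'b::real_normed_field) set \<Rightarrow> (('a \<Rightarrow> 'b) \<Rightarrow> real) \<Rightarrow> bool" where
  "pointwise_algebra K N \<longleftrightarrow>
     (\<exists>c. \<forall>u\<in>K. \<forall>v\<in>K. (\<lambda>x. u x * v x) \<in> K \<and> N (\<lambda>x. u x * v x) \<le> c * N u * N v)"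

end

theory Submission
  imports Defs
begin

text \<open>
  Weak differentiability of order \<open>m\<close> is equivalent to the existence of a family \<open>U \<alpha>\<close>, \<open>|\<alpha>| \<le> m\<close>, of
  locally integrable functions for which \<open>U (\<alpha> + e\<^sub>i)\<close> is the derivative of \<open>U \<alpha>\<close> along almost every line
  in direction \<open>i\<close>.  Line by line, the product rule becomes a statement about one-dimensional integrals.

  Sufficiency: on a unit cube the products \<open>U \<beta> * V \<gamma>\<close>, \<open>|\<beta>| + |\<gamma>| \<le> m\<close>, are bounded in \<open>L\<^sup>p\<close> by the Sobolev
  norms of the factors; for \<open>m p > d\<close> by Sobolev embeddings and Young's inequality with exponents
  \<open>m / |\<beta>|\<close>, \<open>m / (m - |\<beta>|)\<close>, for \<open>p = 1\<close> by a Gagliardo type argument.  This is scaled to the cubes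
  \<open>y + \<kappa> \<rho>(y) [0, 1]\<^sup>d\<close> and integrated over \<open>y\<close> (a continuous Whitney decomposition).  The powers of
  \<open>\<rho>(y)\<close> combine to the factor \<open>\<rho>(y) powr (a p - d)\<close>, which is bounded exactly because \<open>a \<ge> d / p\<close>.

  Necessity: if \<open>u = 1\<close> on a set of positive measure, then the norms of the powers \<open>u\<^sup>n\<close> are bounded
  below, so in an algebra the norm of \<open>u\<close> cannot be arbitrarily small.  If \<open>a < d / p\<close> small norms are
  attained by bumps moving to the singular point; if the smoothness is too low, by averages of
  bumps concentrating at a regular point.
\<close>

section \<open>Smooth functions of one variable\<close>

text \<open>Weak derivatives are defined by applying partial derivatives to test functions in one
  fixed coordinate order; interchanging them for arbitrary smooth functions would need the symmetry
  theorem. The proof avoids it: from weak derivatives to lines only tensor products are used as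
  tests, and conversely a multi-index is built by raising coordinates in nondecreasing order, so
  that the new derivative is the one applied first. Lines also replace approximation: no density of
  smooth functions is used, neither for the product rule nor for the embeddings. In the Whitney step
  one of the two local energies is replaced by the whole energy at the price of the volume of the
  cube, the other stays local and is integrated over \<open>y\<close>. This volume is the
  \<open>d\<close> in the exponent \<open>a p - d\<close>. At the critical index
  \<open>m = d / p\<close> one shrinking bump does not suffice, since its energy of top order is
  scale invariant. Averaging \<open>n\<close> bumps at separated scales gains \<open>n\<close> to
  the power \<open>1 - p\<close>, which tends to 0 only for \<open>p > 1\<close>; hence the critical
  index is admissible only for \<open>p = 1\<close>.\<close>

coinductive csmooth :: "(real \<Rightarrow> real) \<Rightarrow> bool" where
  csmoothI: "(\<And>x. (f has_real_derivative g x) (at x)) \<Longrightarrow> csmooth g \<Longrightarrow> csmooth f"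

lemma csmooth_deriv:
  assumes "csmooth f"
  shows "(f has_real_derivative deriv f x) (at x)" "csmooth (deriv f)"
proof -
  obtain g where g: "\<And>x. (f has_real_derivative g x) (at x)" "csmooth g"
    using assms by (meson csmooth.cases)
  then have "deriv f = g" by (auto intro: DERIV_imp_deriv)
  then show "(f has_real_derivative deriv f x) (at x)" "csmooth (deriv f)"
    using g by auto
qed

lemma csmooth_funpow_deriv: "csmooth f \<Longrightarrow> csmooth ((deriv ^^ n) f)"
  by (induction n) (auto intro: csmooth_deriv)

lemma csmooth_isCont: "csmooth f \<Longrightarrow> isCont f x"
  using csmooth_deriv(1) DERIV_isCont by blast

lemma csmooth_const: "csmooth (\<lambda>x. c)"
proof (coinduction arbitrary: c)
  case csmooth
  show ?case by (rule exI[of _ "\<lambda>x. c"], rule exI[of _ "\<lambda>x. 0"]) auto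
qed

lemma csmooth_add: "csmooth f \<Longrightarrow> csmooth g \<Longrightarrow> csmooth (\<lambda>x. f x + g x)"
proof (coinduction arbitrary: f g)
  case csmooth
  show ?case
    by (intro exI[of _ "\<lambda>x. f x + g x"] exI[of _ "\<lambda>x. deriv f x + deriv g x"])
       (use csmooth in \<open>auto intro!: derivative_intros csmooth_deriv\<close>)
qed

lemma csmooth_affine: "csmooth f \<Longrightarrow> csmooth (\<lambda>x. c * f (a * x + b))"
proof (coinduction arbitrary: f c)
  case csmooth
  have "((\<lambda>x. c * f (a * x + b)) has_real_derivative (c * a) * deriv f (a * x + b)) (at x)" for x
  proof -
    have "((\<lambda>x. a * x + b) has_real_derivative a) (at x)"
      by (auto intro!: derivative_eq_intros)
    from DERIV_cmult[OF DERIV_chain2[OF csmooth_deriv(1)[OF csmooth] this], of c] show ?thesis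
      by (simp add: mult_ac)
  qed
  then show ?case
    by (intro exI[of _ "\<lambda>x. c * f (a * x + b)"] exI[of _ "\<lambda>x. (c * a) * deriv f (a * x + b)"])
       (use csmooth in \<open>auto intro!: csmooth_deriv(2)\<close>)
qed

lemma csmooth_mult:
  assumes "csmooth f" "csmooth g"
  shows "csmooth (\<lambda>x. f x * g x)"
proof -
  \<comment> \<open>finite sums of products of smooth functions are closed under differentiation\<close>
  have "csmooth h" if "\<exists>L. (\<forall>(a, b) \<in> set L. csmooth a \<and> csmooth b) \<and> h = (\<lambda>x. \<Sum>(a, b)\<leftarrow>L. a x * b x)"
    for h :: "real \<Rightarrow> real"
    using that
  proof (coinduction arbitrary: h)
    case csmooth
    then obtain L where L: "\<forall>(a, b) \<in> set L. csmooth a \<and> csmooth b" "h = (\<lambda>x. \<Sum>(a, b)\<leftarrow>L. a x * b x)"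
      by blast
    define L' where "L' = concat (map (\<lambda>(a, b). [(deriv a, b), (a, deriv b)]) L)"
    have "((\<lambda>x. \<Sum>(a, b)\<leftarrow>L. a x * b x) has_real_derivative (\<Sum>(a, b)\<leftarrow>L'. a x * b x)) (at x)" for x
      using L(1) unfolding L'_def
    proof (induction L)
      case (Cons p L)
      obtain a b where p: "p = (a, b)" by (cases p)
      have ab: "(a has_real_derivative deriv a x) (at x)" "(b has_real_derivative deriv b x) (at x)"
        using Cons.prems by (auto simp: p intro: csmooth_deriv)
      show ?case
        using Cons DERIV_add[OF DERIV_mult[OF ab] Cons.IH] by (simp add: p mult_ac add_ac)
    qed auto
    moreover have "\<forall>(a, b) \<in> set L'. csmooth a \<and> csmooth b"
      using L(1) by (fastforce simp: L'_def intro: csmooth_deriv)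
    ultimately show ?case using L(2)
      by (intro exI[of _ h] exI[of _ "\<lambda>x. \<Sum>(a, b)\<leftarrow>L'. a x * b x"]) blast
  qed
  moreover have "\<exists>L. (\<forall>(a, b) \<in> set L. csmooth a \<and> csmooth b) \<and> (\<lambda>x. f x * g x) = (\<lambda>x. \<Sum>(a, b)\<leftarrow>L. a x * b x)"
    using assms by (intro exI[of _ "[(f, g)]"]) auto
  ultimately show ?thesis by blast
qed

section \<open>Bump and plateau functions of one variable\<close>

definition flat_exp :: "real \<Rightarrow> real \<Rightarrow> real" where
  "flat_exp c s = (if s > 0 then exp (- c / s) else 0)"

lemma poly_exp_limit:
  fixes P :: "real poly"
  assumes "c > 0"
  shows "((\<lambda>y. poly P y * exp (- c * y)) \<longlongrightarrow> 0) at_top"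
proof -
  have 1: "((\<lambda>y. y ^ k * exp (- c * y)) \<longlongrightarrow> 0) at_top" for k
  proof -
    have "((\<lambda>y. (1 / c) ^ k * ((c * y) ^ k / exp (c * y))) \<longlongrightarrow> (1 / c) ^ k * 0) at_top"
      using assms
      by (intro tendsto_intros filterlim_compose[OF tendsto_power_div_exp_0]
          filterlim_tendsto_pos_mult_at_top[OF tendsto_const] filterlim_ident) auto
    then show ?thesis
      using assms by (simp add: field_simps exp_minus power_mult_distrib)
  qed
  have "((\<lambda>y. \<Sum>i\<le>degree P. coeff P i * (y ^ i * exp (- c * y))) \<longlongrightarrow> (\<Sum>i\<le>degree P. coeff P i * 0)) at_top"
    by (intro tendsto_intros 1)
  then show ?thesis
    by (simp add: poly_altdef sum_distrib_right mult.assoc)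
qed

text \<open>A product of a polynomial in \<open>1/s\<close> with the flat exponential differentiates
  to one of the same kind, so this whole class is the coinduction invariant; the flat exponential
  alone would not be one.\<close>

lemma csmooth_poly_flat_exp:
  assumes c: "c > 0"
  shows "csmooth (\<lambda>s. poly P (1 / s) * flat_exp c s)"
proof (coinduction arbitrary: P)
  case csmooth
  \<comment> \<open>The derivative of \<open>1/s\<close> is \<open>-(1/s)^2\<close>: this gives the
    factor \<open>X^2\<close> and the minus sign at \<open>pderiv P\<close>, while the exponential
    contributes \<open>c P\<close>.\<close>
  define Q where "Q = (smult c P - pderiv P) * [:0, 0, 1:]"
  have "((\<lambda>s. poly P (1 / s) * flat_exp c s) has_real_derivative poly Q (1 / s) * flat_exp c s) (at s)" for s
  proof -
    consider "s > 0" | "s < 0" | "s = 0" by linarith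
    then show ?thesis
    proof cases
      case 1
      have "((\<lambda>s. poly P (1 / s) * exp (- c / s)) has_real_derivative
           (poly (pderiv P) (1 / s) * (- 1 / s\<^sup>2)) * exp (- c / s) + (exp (- c / s) * (c / s\<^sup>2)) * poly P (1 / s)) (at s)"
        using 1 by (intro DERIV_mult DERIV_chain2[OF poly_DERIV] DERIV_chain2[OF DERIV_exp])
          (auto intro!: derivative_eq_intros simp: power2_eq_square)
      also have "(poly (pderiv P) (1 / s) * (- 1 / s\<^sup>2)) * exp (- c / s) + (exp (- c / s) * (c / s\<^sup>2)) * poly P (1 / s)
           = poly Q (1 / s) * flat_exp c s"
        using 1 by (simp add: Q_def flat_exp_def field_simps power2_eq_square)
      finally show ?thesis
        by (rule DERIV_cong_ev[THEN iffD1, rotated -1])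
           (use 1 eventually_nhds_in_open[of "{0<..}" s] in \<open>auto simp: flat_exp_def elim!: eventually_mono\<close>)
    next
      case 2
      have "((\<lambda>s. 0) has_real_derivative poly Q (1 / s) * flat_exp c s) (at s)"
        using 2 by (auto simp: flat_exp_def)
      then show ?thesis
        by (rule DERIV_cong_ev[THEN iffD1, rotated -1])
           (use 2 eventually_nhds_in_open[of "{..<0}" s] in \<open>auto simp: flat_exp_def elim!: eventually_mono\<close>)
    next
      case 3
      \<comment> \<open>The difference quotient at 0 divides by \<open>h\<close>, that is, it
        multiplies the polynomial in \<open>1/h\<close> by its variable; hence
        \<open>pCons 0 P\<close>.\<close>
      have "((\<lambda>h. poly (pCons 0 P) (1 / h) * exp (- c * (1 / h))) \<longlongrightarrow> 0) (at_right 0)"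
        by (rule filterlim_compose[OF poly_exp_limit[OF c, of "pCons 0 P"]])
           (use filterlim_inverse_at_top_right in \<open>simp add: inverse_eq_divide\<close>)
      then have r: "((\<lambda>h. (poly P (1 / h) * flat_exp c h) / h) \<longlongrightarrow> 0) (at_right 0)"
        by (rule Lim_transform_eventually)
           (auto simp: flat_exp_def eventually_at_filter)
      have l: "((\<lambda>h. (poly P (1 / h) * flat_exp c h) / h) \<longlongrightarrow> 0) (at_left 0)"
        by (rule Lim_transform_eventually[OF tendsto_const]) (auto simp: flat_exp_def eventually_at_filter)
      have "((\<lambda>h. (poly P (1 / h) * flat_exp c h) / h) \<longlongrightarrow> 0) (at 0)"
        using l r by (simp add: filterlim_split_at)
      then show ?thesis unfolding 3 DERIV_def by (simp add: flat_exp_def)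
    qed
  qed
  then show ?case
    by (intro exI[of _ "\<lambda>s. poly P (1 / s) * flat_exp c s"] exI[of _ "\<lambda>s. poly Q (1 / s) * flat_exp c s"]) auto
qed

lemma csmooth_flat_exp: "c > 0 \<Longrightarrow> csmooth (flat_exp c)"
  using csmooth_poly_flat_exp[of c 1] by simp

text \<open>The parameter \<open>c\<close> regulates only the steepness: the bump is positive
  exactly between \<open>a\<close> and \<open>b\<close> for every \<open>c > 0\<close>, and as
  \<open>c\<close> tends to 0 it tends to the indicator of the open interval.\<close>

definition bump1 :: "real \<Rightarrow> real \<Rightarrow> real \<Rightarrow> real \<Rightarrow> real" where
  "bump1 c a b s = flat_exp c (s - a) * flat_exp c (b - s)"

lemma csmooth_bump1: "c > 0 \<Longrightarrow> csmooth (bump1 c a b)"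
  using csmooth_mult[OF csmooth_affine[OF csmooth_flat_exp, of c 1 1 "-a"] csmooth_affine[OF csmooth_flat_exp, of c 1 "-1" b]]
  unfolding bump1_def[abs_def] by simp

lemma bump1_nonneg: "0 \<le> bump1 c a b s"
  by (auto simp: bump1_def flat_exp_def)

lemma bump1_le_1: "0 < c \<Longrightarrow> bump1 c a b s \<le> 1"
  unfolding bump1_def flat_exp_def by (auto intro!: mult_le_one divide_nonneg_nonneg)

lemma bump1_pos_iff: "0 < bump1 c a b s \<longleftrightarrow> a < s \<and> s < b"
  by (auto simp: bump1_def flat_exp_def)

lemma bump1_eq_0_iff: "bump1 c a b s = 0 \<longleftrightarrow> \<not> (a < s \<and> s < b)"
  by (auto simp: bump1_def flat_exp_def)

lemma bump1_tendsto: "(\<lambda>n. bump1 (1 / real (Suc n)) a b s) \<longlonglongrightarrow> indicator {a<..<b} s"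
proof (cases "a < s \<and> s < b")
  case True
  have "(\<lambda>n. exp (- (1 / real (Suc n)) / (s - a)) * exp (- (1 / real (Suc n)) / (b - s))) \<longlonglongrightarrow>
      exp (- 0 / (s - a)) * exp (- 0 / (b - s))"
    using True by (intro tendsto_intros LIMSEQ_Suc lim_1_over_n) auto
  then show ?thesis using True by (simp add: bump1_def flat_exp_def)
qed (auto simp: bump1_def flat_exp_def)

text \<open>A normalised primitive of a bump on \<open>(1/2, 1)\<close> is a smooth step
  \<open>S\<close> that is 0 up to 1/2 and 1 from 1 on. At most one of \<open>S s\<close> and
  \<open>S (-s)\<close> differs from 0, so subtracting both from 1 gives the even plateau without
  composing with the absolute value.\<close>

lemma plateau_exists:
  obtains \<eta> where "csmooth \<eta>" "\<And>s. 0 \<le> \<eta> s" "\<And>s. \<eta> s \<le> 1"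
    "\<And>s. \<bar>s\<bar> \<le> 1 / 2 \<Longrightarrow> \<eta> s = 1" "\<And>s. 1 \<le> \<bar>s\<bar> \<Longrightarrow> \<eta> s = 0"
proof -
  define b where "b = bump1 1 (1/2) 1"
  have cb: "csmooth b" by (simp add: b_def csmooth_bump1)
  obtain B where B: "\<And>x. (B has_real_derivative b x) (at x)"
    using einterval_antiderivative[of "-\<infinity>" "\<infinity>" b] csmooth_isCont[OF cb]
    by (auto simp: has_real_derivative_iff_has_vector_derivative)
  have cB: "csmooth B" using B cb by (rule csmoothI)
  have mono: "B x \<le> B y" if "x \<le> y" for x y
    using that by (rule DERIV_nonneg_imp_nondecreasing) (use B bump1_nonneg[of 1 "1/2" 1] b_def in blast)
  have const: "B x = B y" if "x \<le> y" "y \<le> 1/2 \<or> 1 \<le> x" for x y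
  proof (cases "x < y")
    case True
    have "\<exists>l z. x < z \<and> z < y \<and> DERIV B z :> l \<and> B y - B x = (y - x) * l"
      using True by (intro MVT) (use B in \<open>auto intro: DERIV_continuous_on DERIV_subset simp: real_differentiable_def\<close>)
    then obtain l z where z: "x < z" "z < y" "DERIV B z :> l" "B y - B x = (y - x) * l"
      by blast
    have "l = b z" using z(3) B DERIV_unique by blast
    also have "b z = 0" using z that by (auto simp: b_def bump1_eq_0_iff)
    finally show ?thesis using z by simp
  qed (use that in auto)
  have pos: "B (1/2) < B 1"
  proof -
    have 1: "\<exists>y. DERIV B x :> y \<and> 0 < y" if "1/2 < x" "x < 1" for x
      using B[of x] that bump1_pos_iff[of 1 "1/2" 1 x] unfolding b_def by blast
    have 2: "continuous_on {1/2..1} B"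
      using csmooth_isCont[OF cB] by (simp add: continuous_at_imp_continuous_on)
    show ?thesis
      using DERIV_pos_imp_increasing_open[of "1/2" 1 B, OF _ 1 2] by simp
  qed
  define I where "I = B 1 - B (1/2)"
  \<comment> \<open>The trivial factors and summands here and in \<open>\<eta>\<close> give the
    terms the shape of \<open>csmooth_affine\<close>.\<close>
  define S where "S = (\<lambda>s. (1 / I) * B (1 * s + 0) + - B (1/2) / I)"
  have cS: "csmooth S"
    unfolding S_def by (intro csmooth_add csmooth_affine csmooth_const cB)
  have S_eq: "S s = (B s - B (1/2)) / I" for s by (simp add: S_def diff_divide_distrib)
  have I: "I > 0" using pos by (simp add: I_def)
  define \<eta> where "\<eta> = (\<lambda>s. 1 + (-1 * S (1 * s + 0) + -1 * S (-1 * s + 0)))"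
  have "csmooth \<eta>"
    unfolding \<eta>_def by (intro csmooth_add csmooth_affine csmooth_const cS)
  moreover have \<eta>_eq: "\<eta> s = 1 - S \<bar>s\<bar>" for s
    using const[of "-\<bar>s\<bar>" "1/2"] by (cases "s \<ge> 0") (auto simp: \<eta>_def S_eq minus_divide_left)
  moreover have "S \<bar>s\<bar> \<le> 1" for s
  proof (cases "\<bar>s\<bar> \<le> 1")
    case True then show ?thesis using mono[OF True] I by (simp add: S_eq I_def)
  next
    case False then show ?thesis using const[of 1 "\<bar>s\<bar>"] I by (simp add: S_eq I_def)
  qed
  moreover have "0 \<le> S \<bar>s\<bar>" for s
    using mono[of "1/2" "\<bar>s\<bar>"] const[of "\<bar>s\<bar>" "1/2"] I by (cases "\<bar>s\<bar> \<le> 1/2") (auto simp: S_eq)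
  moreover have "S \<bar>s\<bar> = 0" if "\<bar>s\<bar> \<le> 1/2" for s
    using const[of "\<bar>s\<bar>" "1/2"] that by (auto simp: S_eq)
  moreover have "S \<bar>s\<bar> = 1" if "1 \<le> \<bar>s\<bar>" for s
    using const[of 1 "\<bar>s\<bar>"] that I by (auto simp: S_eq I_def)
  ultimately show ?thesis by (intro that[of \<eta>]) auto
qed

section \<open>Test functions that are tensor products\<close>

text \<open>Carrying the orders of differentiation in the definition closes the class under partial
  derivatives, which merely increment \<open>\<alpha>\<close>; that they commute becomes an identity
  between multi-indices.\<close>

definition tensor :: "('d::finite \<Rightarrow> real \<Rightarrow> real) \<Rightarrow> ('d \<Rightarrow> nat) \<Rightarrow> real ^ 'd \<Rightarrow> real" where
  "tensor \<eta> \<alpha> x = (\<Prod>j\<in>UNIV. (deriv ^^ \<alpha> j) (\<eta> j) (x $ j))"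

lemma tensor_line_deriv:
  assumes "\<And>j. csmooth (\<eta> j)"
  shows "((\<lambda>t. tensor \<eta> \<alpha> (x + t *\<^sub>R axis i 1)) has_real_derivative
     tensor \<eta> (\<alpha>(i := Suc (\<alpha> i))) (x + t *\<^sub>R axis i 1)) (at t)"
proof -
  define R where "R = (\<Prod>j\<in>UNIV - {i}. (deriv ^^ \<alpha> j) (\<eta> j) (x $ j))"
  have 1: "tensor \<eta> \<beta> (x + s *\<^sub>R axis i 1) = (deriv ^^ \<beta> i) (\<eta> i) (x $ i + s) * R"
    if "\<And>j. j \<noteq> i \<Longrightarrow> \<beta> j = \<alpha> j" for \<beta> s
    unfolding tensor_def R_def
    by (subst prod.remove[of _ i]) (auto simp: axis_def that intro!: prod.cong)
  have "((\<lambda>t. (deriv ^^ \<alpha> i) (\<eta> i) (x $ i + t)) has_real_derivative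
      deriv ((deriv ^^ \<alpha> i) (\<eta> i)) (x $ i + t)) (at t)"
    using DERIV_chain2[OF csmooth_deriv(1)[OF csmooth_funpow_deriv[OF assms]] DERIV_add[OF DERIV_const DERIV_ident]]
    by simp
  then show ?thesis
    by (simp add: 1 DERIV_cmult_right)
qed

lemma partial_deriv_tensor:
  assumes "\<And>j. csmooth (\<eta> j)"
  shows "partial_deriv i (tensor \<eta> \<alpha>) = tensor \<eta> (\<alpha>(i := Suc (\<alpha> i)))"
proof
  fix x
  show "partial_deriv i (tensor \<eta> \<alpha>) x = tensor \<eta> (\<alpha>(i := Suc (\<alpha> i))) x"
    unfolding partial_deriv_def
    using DERIV_imp_deriv[OF tensor_line_deriv[where t = 0 and i = i and \<alpha> = \<alpha> and x = x and \<eta> = \<eta>, OF assms]]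
    by simp
qed

lemma tensor_differentiable:
  assumes "\<And>j. csmooth (\<eta> j)"
  shows "tensor \<eta> \<alpha> differentiable_on UNIV"
proof -
  have "(\<lambda>x. \<Prod>j\<in>S. (deriv ^^ \<alpha> j) (\<eta> j) (x $ j)) differentiable at x" for S and x :: "real ^ 'a"
  proof (induction S rule: infinite_finite_induct)
    case (insert i S)
    have "(deriv ^^ \<alpha> i) (\<eta> i) differentiable at (x $ i)"
      using csmooth_deriv(1)[OF csmooth_funpow_deriv[OF assms]] real_differentiable_def by blast
    then have "(\<lambda>x. (deriv ^^ \<alpha> i) (\<eta> i) (x $ i)) differentiable at x"
      using differentiable_compose[OF _ bounded_linear_imp_differentiable[OF bounded_linear_vec_nth[of i]]]
      by blast
    then show ?case using insert by simp
  qed auto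
  then show ?thesis
    unfolding tensor_def[abs_def] by (simp add: differentiable_on_def)
qed

lemma foldr_partial_deriv_tensor:
  assumes "\<And>j. csmooth (\<eta> j)"
  shows "\<exists>\<beta>. foldr partial_deriv js (tensor \<eta> \<alpha>) = tensor \<eta> \<beta>"
  by (induction js) (auto simp: partial_deriv_tensor[OF assms])

lemma smooth_tensor:
  assumes "\<And>j. csmooth (\<eta> j)"
  shows "smooth (tensor \<eta> \<alpha>)"
  unfolding smooth_def
proof
  fix js
  obtain \<beta> where "foldr partial_deriv js (tensor \<eta> \<alpha>) = tensor \<eta> \<beta>"
    using foldr_partial_deriv_tensor[of \<eta> js \<alpha>, OF assms] by blast
  then show "foldr partial_deriv js (tensor \<eta> \<alpha>) differentiable_on UNIV"
    by (simp add: tensor_differentiable[OF assms])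
qed

lemma partial_deriv_funpow_tensor:
  assumes "\<And>j. csmooth (\<eta> j)"
  shows "(partial_deriv i ^^ n) (tensor \<eta> \<beta>) = tensor \<eta> (\<beta>(i := \<beta> i + n))"
  by (induction n) (auto simp: partial_deriv_tensor[OF assms] fun_upd_def intro!: arg_cong[of _ _ "tensor \<eta>"])

lemma classical_deriv_tensor:
  assumes "\<And>j. csmooth (\<eta> j)"
  shows "classical_deriv \<alpha> (tensor \<eta> \<beta>) = tensor \<eta> (\<lambda>j. \<beta> j + \<alpha> j)"
proof -
  have "foldr (\<lambda>i. partial_deriv i ^^ \<alpha> i) xs (tensor \<eta> \<beta>) = tensor \<eta> (\<lambda>j. if j \<in> set xs then \<beta> j + \<alpha> j else \<beta> j)"
    if "distinct xs" for xs
    using that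
  proof (induction xs)
    case (Cons i xs)
    have "(\<lambda>j. if j \<in> set xs then \<beta> j + \<alpha> j else \<beta> j)(i := (if i \<in> set xs then \<beta> i + \<alpha> i else \<beta> i) + \<alpha> i)
      = (\<lambda>j. if j \<in> set (i # xs) then \<beta> j + \<alpha> j else \<beta> j)"
      using Cons.prems by auto
    then show ?case
      using Cons by (simp add: partial_deriv_funpow_tensor[OF assms])
  qed auto
  from this[of "sorted_list_of_set UNIV"] show ?thesis
    by (simp add: classical_deriv_def)
qed

text \<open>The class of test functions on boxes is translation invariant and rich enough to separate
  locally integrable functions, and its partial derivatives visibly commute.\<close>

definition box_test :: "(real ^ 'd::finite) set \<Rightarrow> (real ^ 'd \<Rightarrow> real) \<Rightarrow> bool" where
  "box_test \<Omega> \<phi> \<longleftrightarrow> (\<exists>\<eta> a b. (\<forall>j. csmooth (\<eta> j)) \<and> cbox a b \<subseteq> \<Omega> \<and>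
     (\<forall>j s. s \<notin> {a $ j..b $ j} \<longrightarrow> \<eta> j s = 0) \<and> \<phi> = tensor \<eta> (\<lambda>_. 0))"

lemma box_test_imp_test_functions:
  assumes "box_test \<Omega> \<phi>"
  shows "\<phi> \<in> test_functions \<Omega>"
proof -
  obtain \<eta> a b where \<eta>: "\<And>j. csmooth (\<eta> j)" "cbox a b \<subseteq> \<Omega>" "\<And>j s. s \<notin> {a $ j..b $ j} \<Longrightarrow> \<eta> j s = 0"
    "\<phi> = tensor \<eta> (\<lambda>_. 0)"
    using assms unfolding box_test_def by metis
  have "{x. \<phi> x \<noteq> 0} \<subseteq> cbox a b"
    using \<eta>(3) by (auto simp: \<eta>(4) tensor_def mem_box_cart) (meson atLeastAtMost_iff)+
  then have cl: "closure {x. \<phi> x \<noteq> 0} \<subseteq> cbox a b"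
    by (intro closure_minimal closed_cbox)
  then have "compact (closure {x. \<phi> x \<noteq> 0})"
    by (meson bounded_cbox bounded_subset closed_closure compact_eq_bounded_closed)
  then show ?thesis
    using \<eta> cl by (auto simp: test_functions_def smooth_tensor)
qed

lemma box_test_translate:
  assumes "box_test \<Omega> \<phi>" "(+) v ` \<Omega> \<subseteq> \<Omega>'"
  shows "box_test \<Omega>' (\<lambda>x. \<phi> (x - v))"
proof -
  obtain \<eta> a b where \<eta>: "\<And>j. csmooth (\<eta> j)" "cbox a b \<subseteq> \<Omega>" "\<And>j s. s \<notin> {a $ j..b $ j} \<Longrightarrow> \<eta> j s = 0"
    "\<phi> = tensor \<eta> (\<lambda>_. 0)"
    using assms unfolding box_test_def by metis
  have "csmooth (\<lambda>s. \<eta> j (s - v $ j))" for j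
    using csmooth_affine[OF \<eta>(1)[of j], of 1 1 "- v $ j"] by simp
  moreover have "cbox (v + a) (v + b) \<subseteq> \<Omega>'"
    using \<eta>(2) assms(2) unfolding cbox_translation by blast
  moreover have "\<eta> j (s - v $ j) = 0" if "s \<notin> {(v + a) $ j..(v + b) $ j}" for j s
    using that by (intro \<eta>(3)) auto
  ultimately show ?thesis
    unfolding box_test_def
    by (intro exI[of _ "\<lambda>j s. \<eta> j (s - v $ j)"] exI[of _ "v + a"] exI[of _ "v + b"])
       (auto simp: \<eta>(4) tensor_def)
qed

text \<open>On the left the additional derivative acts innermost, on the right in its sorted place.
  For a tensor product both only add to the same multi-index, whatever \<open>i\<close> is.\<close>

lemma box_test_classical_deriv:
  fixes \<phi> :: "real ^ 'd::{finite,linorder} \<Rightarrow> real"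
  assumes "box_test \<Omega> \<phi>"
  shows "classical_deriv \<alpha> (partial_deriv i \<phi>) = classical_deriv (\<alpha>(i := Suc (\<alpha> i))) \<phi>"
proof -
  obtain \<eta> where \<eta>: "\<And>j. csmooth (\<eta> j)" "\<phi> = tensor \<eta> (\<lambda>_. 0)"
    using assms unfolding box_test_def by metis
  show ?thesis
    by (auto simp: \<eta> partial_deriv_tensor classical_deriv_tensor intro!: arg_cong[of _ _ "tensor \<eta>"])
qed

section \<open>The fundamental lemma of the calculus of variations\<close>

definition loc_int :: "(real ^ 'd::finite) set \<Rightarrow> (real ^ 'd \<Rightarrow> 'b::euclidean_space) \<Rightarrow> bool" where
  "loc_int \<Omega> w \<longleftrightarrow> w \<in> borel_measurable borel \<and> (\<forall>K. compact K \<and> K \<subseteq> \<Omega> \<longrightarrow> set_integrable lborel K w)"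

text \<open>Tensor products of \<open>bump1\<close> with parameter \<open>1 / (n + 1)\<close>
  converge to the indicator of the box and are dominated by that of the closed box, on which
  \<open>w\<close> is integrable.\<close>

lemma box_integral_0:
  fixes w :: "real ^ 'd::finite \<Rightarrow> 'b::euclidean_space"
  assumes w: "loc_int \<Omega> w" and \<Omega>: "cbox a b \<subseteq> \<Omega>"
    and 0: "\<And>\<phi>. box_test \<Omega> \<phi> \<Longrightarrow> (LINT x|lborel. \<phi> x *\<^sub>R w x) = 0"
  shows "(LINT x:box a b|lborel. w x) = 0"
proof -
  have [measurable]: "w \<in> borel_measurable borel" using w by (simp add: loc_int_def)
  define \<phi> where "\<phi> n = tensor (\<lambda>j. bump1 (1 / real (Suc n)) (a $ j) (b $ j)) (\<lambda>_. 0)" for n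
  have bt: "box_test \<Omega> (\<phi> n)" for n
    unfolding box_test_def \<phi>_def
    by (rule exI[of _ "\<lambda>j. bump1 (1 / real (Suc n)) (a $ j) (b $ j)"], rule exI[of _ a], rule exI[of _ b])
       (use \<Omega> in \<open>auto simp: csmooth_bump1 bump1_eq_0_iff\<close>)
  have [measurable]: "\<phi> n \<in> borel_measurable borel" for n
    using smooth_tensor[of "\<lambda>j. bump1 (1 / real (Suc n)) (a $ j) (b $ j)" "\<lambda>_. 0"]
    by (intro borel_measurable_continuous_onI differentiable_imp_continuous_on)
       (auto simp: \<phi>_def csmooth_bump1 tensor_differentiable)
  have lim: "(\<lambda>n. \<phi> n x) \<longlonglongrightarrow> indicator (box a b) x" for x
  proof -
    have "(\<lambda>n. \<phi> n x) \<longlonglongrightarrow> (\<Prod>j\<in>UNIV. indicator {a $ j<..<b $ j} (x $ j))"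
      unfolding \<phi>_def tensor_def by (auto simp del: of_nat_Suc intro!: tendsto_prod bump1_tendsto)
    also have "(\<Prod>j\<in>UNIV. indicator {a $ j<..<b $ j} (x $ j)) = (indicator (box a b) x :: real)"
      by (auto simp: indicator_def mem_box_cart)
    finally show ?thesis .
  qed
  have le: "norm (\<phi> n x *\<^sub>R w x) \<le> indicator (cbox a b) x * norm (w x)" for n x
  proof (cases "x \<in> cbox a b")
    case True
    have "\<bar>\<phi> n x\<bar> \<le> 1"
      unfolding \<phi>_def tensor_def by (auto simp: abs_prod bump1_nonneg bump1_le_1 intro!: prod_le_1)
    then show ?thesis using True by (simp add: mult_left_le_one_le)
  next
    case False
    then obtain j where "\<not> (a $ j \<le> x $ j \<and> x $ j \<le> b $ j)"
      by (auto simp: mem_box_cart)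
    then have "bump1 (1 / real (Suc n)) (a $ j) (b $ j) (x $ j) = 0"
      by (auto simp: bump1_eq_0_iff)
    then have "\<phi> n x = 0"
      unfolding \<phi>_def tensor_def by (intro prod_zero) auto
    then show ?thesis by simp
  qed
  have "(\<lambda>n. LINT x|lborel. \<phi> n x *\<^sub>R w x) \<longlonglongrightarrow> (LINT x|lborel. indicator (box a b) x *\<^sub>R w x)"
  proof (rule integral_dominated_convergence[where w = "\<lambda>x. indicator (cbox a b) x * norm (w x)"])
    have "set_integrable lborel (cbox a b) w" using w \<Omega> by (auto simp: loc_int_def)
    then have "set_integrable lborel (cbox a b) (\<lambda>x. norm (w x))" by (rule set_integrable_norm)
    then show "integrable lborel (\<lambda>x. indicator (cbox a b) x * norm (w x))"
      by (simp add: set_integrable_def)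
  qed (use le lim in \<open>auto intro!: tendsto_intros\<close>)
  then show ?thesis
    using 0[OF bt] by (simp add: set_lebesgue_integral_def LIMSEQ_const_iff)
qed

text \<open>An open set is a union of countably many closed boxes with rational corners, so only
  countably many null sets are collected.\<close>

lemma AE_open_cboxI:
  fixes \<Omega> :: "'a::euclidean_space set"
  assumes "open \<Omega>" and box: "\<And>a b. cbox a b \<subseteq> \<Omega> \<Longrightarrow> AE x in lborel. x \<in> cbox a b \<longrightarrow> P x"
  shows "AE x in lborel. x \<in> \<Omega> \<longrightarrow> P x"
proof -
  define I where "I = {f \<in> Basis \<rightarrow>\<^sub>E \<rat> \<times> \<rat>. cbox (\<Sum>i\<in>Basis. fst (f i) *\<^sub>R i :: 'a) (\<Sum>i\<in>Basis. snd (f i) *\<^sub>R i) \<subseteq> \<Omega>}"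
  have "countable I"
    unfolding I_def by (intro countable_Collect countable_PiE) (auto intro!: countable_SIGMA countable_rat)
  then have "AE x in lborel. \<forall>f\<in>I. x \<in> cbox (\<Sum>i\<in>Basis. fst (f i) *\<^sub>R i) (\<Sum>i\<in>Basis. snd (f i) *\<^sub>R i) \<longrightarrow> P x"
    by (subst AE_ball_countable) (auto simp: I_def intro!: box)
  moreover have "\<Omega> \<subseteq> (\<Union>f\<in>I. cbox (\<Sum>i\<in>Basis. fst (f i) *\<^sub>R i) (\<Sum>i\<in>Basis. snd (f i) *\<^sub>R i))"
    unfolding I_def by (rule equalityD1[OF open_UNION_cbox[OF \<open>open \<Omega>\<close>]])
  ultimately show ?thesis
    by (auto elim!: eventually_mono)
qed

text \<open>Boxes are an intersection-stable generator of the Borel sets, so vanishing integrals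
  over boxes extend to all Borel sets, and a density whose integrals all vanish is 0 almost
  everywhere. Cutting \<open>w\<close> off at one closed box makes it a density integrable over the
  whole space.\<close>

lemma fundamental_lemma:
  fixes w :: "real ^ 'd::finite \<Rightarrow> 'b::euclidean_space"
  assumes \<Omega>: "open \<Omega>" and w: "loc_int \<Omega> w"
    and 0: "\<And>\<phi>. box_test \<Omega> \<phi> \<Longrightarrow> (LINT x|lborel. \<phi> x *\<^sub>R w x) = 0"
  shows "AE x in lborel. x \<in> \<Omega> \<longrightarrow> w x = 0"
proof -
  have [measurable]: "w \<in> borel_measurable borel" using w by (simp add: loc_int_def)
  have box: "AE x in lborel. x \<in> cbox c d \<longrightarrow> w x = 0" if cd: "cbox c d \<subseteq> \<Omega>" for c d
  proof -
    define f where "f x = indicator (cbox c d) x *\<^sub>R w x" for x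
    have f: "integrable lborel f"
      using w cd unfolding loc_int_def f_def[abs_def] set_integrable_def by auto
    have [measurable]: "f \<in> borel_measurable borel" unfolding f_def by measurable
    have AE: "AE x in lborel. x \<notin> cbox c d - box c d"
      using AE_not_in[OF null_sets_cbox_Diff_box] .
    have basic: "(LINT x:box a b|lborel. f x) = 0" for a b
    proof -
      have "(LINT x:box a b|lborel. f x) = (LINT x:(box a b \<inter> box c d)|lborel. w x)"
        unfolding set_lebesgue_integral_def f_def
        by (intro integral_cong_AE) (use AE box_subset_cbox[of c d] in \<open>auto elim!: eventually_mono simp: indicator_def\<close>)
      also have "\<dots> = 0"
        unfolding box_Int_box
        by (rule box_integral_0[OF w _ 0]) (use cd in \<open>auto simp: Int_interval[symmetric]\<close>)
      finally show ?thesis .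
    qed
    \<comment> \<open>The complement step of the induction below needs a vanishing integral over the
      whole space; it reduces to the box because the boundary is a null set.\<close>
    have UNIV: "(LINT x|lborel. f x) = 0"
    proof -
      have "(LINT x|lborel. f x) = (LINT x:box c d|lborel. f x)"
        unfolding set_lebesgue_integral_def f_def
        by (intro integral_cong_AE) (use AE box_subset_cbox[of c d] in \<open>auto elim!: eventually_mono simp: indicator_def\<close>)
      then show ?thesis by (simp add: basic)
    qed
    have "AE x in lborel. f x = 0"
    proof (rule sigma_finite_measure.density_zero[OF sigma_finite_lborel f])
      fix A :: "(real ^ 'd) set" assume "A \<in> sets lborel"
      then have A: "A \<in> sigma_sets UNIV (range (\<lambda>(a, b). box a b))"
        by (simp add: borel_eq_box)
      have gs: "sigma_sets UNIV (range (\<lambda>(a, b). box a b)) = sets (borel :: (real ^ 'd) measure)"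
        by (simp add: borel_eq_box)
      have si: "set_integrable lborel B f" if "B \<in> sets borel" for B
        using f that by (simp add: set_integrable_def integrable_mult_indicator)
      have "Int_stable (range (\<lambda>(a, b). box a b :: (real ^ 'd) set))"
        by (auto simp: Int_stable_def box_Int_box)
      moreover have "range (\<lambda>(a, b). box a b :: (real ^ 'd) set) \<subseteq> Pow UNIV" by simp
      ultimately show "(LINT x:A|lborel. f x) = 0" using A
      proof (induction rule: sigma_sets_induct_disjoint)
        case (compl A)
        have "(LINT x:UNIV - A|lborel. f x) = (LINT x|lborel. f x) - (LINT x:A|lborel. f x)"
          unfolding set_lebesgue_integral_def
        proof (subst Bochner_Integration.integral_diff[symmetric])
          show "integrable lborel (\<lambda>x. indicat_real A x *\<^sub>R f x)"
            using si[of A] compl(1) by (simp add: gs set_integrable_def)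
        qed (use f in \<open>auto simp: indicator_def intro!: Bochner_Integration.integral_cong\<close>)
        then show ?case using compl UNIV by simp
      next
        case (union A)
        have "(LINT x:(\<Union>i. A i)|lborel. f x) = (\<Sum>i. LINT x:A i|lborel. f x)"
          using union(1,2) by (intro lebesgue_integral_countable_add) (auto simp: gs disjoint_family_on_def intro!: si sets.countable_UN)
        then show ?case using union by simp
      qed (use basic in \<open>auto simp: set_lebesgue_integral_def\<close>)
    qed
    then show ?thesis by eventually_elim (auto simp: f_def)
  qed
  show ?thesis by (rule AE_open_cboxI[OF \<Omega> box])
qed

section \<open>Absolute continuity on lines\<close>

lemma borel_measurable_shift [measurable (raw)]:
  fixes v :: "'a::euclidean_space"
  shows "f \<in> borel_measurable borel \<Longrightarrow> (\<lambda>x. f (x + v)) \<in> borel_measurable borel"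
  by (rule measurable_compose[of "\<lambda>x. x + v"]) auto

lemma lborel_distr_shift: "distr lborel borel (\<lambda>x. x + v) = (lborel :: 'a::euclidean_space measure)"
  using lborel_distr_plus[of v] by (simp add: add.commute[of _ v])

lemma integrable_shift_iff:
  fixes h :: "'a::euclidean_space \<Rightarrow> 'b::euclidean_space"
  assumes [measurable]: "h \<in> borel_measurable borel"
  shows "integrable lborel (\<lambda>x. h (x + v)) \<longleftrightarrow> integrable lborel h"
  using integrable_distr_eq[of "\<lambda>x. x + v" lborel borel h] by (simp add: lborel_distr_shift)

lemma integral_shift:
  fixes h :: "'a::euclidean_space \<Rightarrow> 'b::euclidean_space"
  assumes [measurable]: "h \<in> borel_measurable borel"
  shows "(LINT x|lborel. h (x + v)) = (LINT x|lborel. h x)"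
  using integral_distr[of "\<lambda>x. x + v" lborel borel h] by (simp add: lborel_distr_shift)

lemma nn_integral_shift:
  fixes h :: "'a::euclidean_space \<Rightarrow> ennreal"
  assumes [measurable]: "h \<in> borel_measurable borel"
  shows "(\<integral>\<^sup>+x. h (x + v) \<partial>lborel) = (\<integral>\<^sup>+x. h x \<partial>lborel)"
  using nn_integral_distr[of "\<lambda>x. x + v" lborel borel h] by (simp add: lborel_distr_shift)

lemma AE_shift:
  fixes v :: "'a::euclidean_space"
  assumes "AE x in lborel. P x"
  shows "AE x in lborel. P (x + v)"
proof -
  obtain N where N': "\<And>x. x \<in> space lborel - N \<Longrightarrow> P x" "N \<in> null_sets lborel"
    using AE_E3[OF assms] by blast
  then have N: "N \<in> sets borel" "emeasure lborel N = 0" by auto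
  have "(\<lambda>x. x + v) -` N \<inter> space lborel \<in> null_sets lborel"
  proof -
    have "emeasure lborel ((\<lambda>x. x + v) -` N \<inter> space lborel) = emeasure (distr lborel borel (\<lambda>x. x + v)) N"
      using N by (subst emeasure_distr) auto
    then show ?thesis using N by (auto simp: lborel_distr_shift null_sets_def intro: measurable_sets_borel[of _ borel])
  qed
  then have "AE x in lborel. x \<notin> (\<lambda>x. x + v) -` N \<inter> space lborel"
    by (rule AE_not_in)
  then show ?thesis by eventually_elim (use N' in auto)
qed

section \<open>Test functions: derivatives along coordinate lines, supports and bounds\<close>

lemma smooth_partial_deriv: "smooth \<phi> \<Longrightarrow> smooth (partial_deriv i \<phi>)"
  unfolding smooth_def
proof
  fix js assume "\<forall>is. foldr partial_deriv is \<phi> differentiable_on UNIV"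
  then have "foldr partial_deriv (js @ [i]) \<phi> differentiable_on UNIV" by blast
  then show "foldr partial_deriv js (partial_deriv i \<phi>) differentiable_on UNIV" by simp
qed

lemma smooth_differentiable: "smooth \<phi> \<Longrightarrow> \<phi> differentiable at x"
  unfolding smooth_def by (drule spec[of _ "[]"]) (simp add: differentiable_on_def)

lemma smooth_continuous: "smooth \<phi> \<Longrightarrow> continuous_on S \<phi>"
  using smooth_differentiable differentiable_imp_continuous_within continuous_at_imp_continuous_on by blast

lemma smooth_line_deriv:
  assumes "smooth \<phi>"
  shows "((\<lambda>t. \<phi> (x + t *\<^sub>R axis i 1)) has_real_derivative partial_deriv i \<phi> (x + t *\<^sub>R axis i 1)) (at t)"
proof -
  have d: "(\<lambda>s. \<phi> (y + s *\<^sub>R axis i 1)) differentiable (at 0)" for y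
    by (rule differentiable_compose[OF smooth_differentiable[OF assms]]) simp
  have "((\<lambda>s. \<phi> ((x + t *\<^sub>R axis i 1) + s *\<^sub>R axis i 1)) has_real_derivative partial_deriv i \<phi> (x + t *\<^sub>R axis i 1)) (at 0)"
    unfolding partial_deriv_def using d[of "x + t *\<^sub>R axis i 1"]
    by (simp add: DERIV_deriv_iff_real_differentiable)
  then have "((\<lambda>s. \<phi> (x + (s + t) *\<^sub>R axis i 1)) has_real_derivative partial_deriv i \<phi> (x + t *\<^sub>R axis i 1)) (at 0)"
    by (simp add: algebra_simps)
  then show ?thesis
    using DERIV_shift[of "\<lambda>s. \<phi> (x + s *\<^sub>R axis i 1)" _ 0 t] by simp
qed

lemma test_functionsD:
  assumes "\<phi> \<in> test_functions \<Omega>"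
  shows "smooth \<phi>" "compact (closure {x. \<phi> x \<noteq> 0})" "closure {x. \<phi> x \<noteq> 0} \<subseteq> \<Omega>"
    "\<And>x. x \<notin> closure {x. \<phi> x \<noteq> 0} \<Longrightarrow> \<phi> x = 0"
  using assms closure_subset[of "{x. \<phi> x \<noteq> 0}"] by (auto simp: test_functions_def)

lemma test_function_measurable [measurable_dest]:
  "\<phi> \<in> test_functions \<Omega> \<Longrightarrow> \<phi> \<in> borel_measurable borel"
  by (intro borel_measurable_continuous_onI smooth_continuous test_functionsD)

lemma test_function_bounded:
  assumes "\<phi> \<in> test_functions \<Omega>"
  obtains B where "B > 0" "\<And>x. \<bar>\<phi> x\<bar> \<le> B"
proof -
  have "compact (\<phi> ` closure {x. \<phi> x \<noteq> 0})"
    using test_functionsD[OF assms] by (intro compact_continuous_image smooth_continuous)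
  then obtain B where B: "B > 0" "\<And>y. y \<in> \<phi> ` closure {x. \<phi> x \<noteq> 0} \<Longrightarrow> norm y \<le> B"
    using compact_imp_bounded bounded_pos by metis
  have "\<bar>\<phi> x\<bar> \<le> B" for x
    using B(2)[of "\<phi> x"] B(1) test_functionsD(4)[OF assms, of x] by (cases "x \<in> closure {x. \<phi> x \<noteq> 0}") auto
  then show ?thesis using B that by blast
qed

lemma partial_deriv_outside_support:
  assumes "smooth \<phi>" "x \<notin> closure {x. \<phi> x \<noteq> 0}"
  shows "partial_deriv i \<phi> x = 0"
proof -
  have "open (- closure {x. \<phi> x \<noteq> 0})" by auto
  moreover have "((\<lambda>t::real. x + t *\<^sub>R axis i 1) \<longlongrightarrow> x + 0 *\<^sub>R axis i 1) (nhds 0)"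
    by (intro tendsto_intros filterlim_ident)
  ultimately have "eventually (\<lambda>t. x + t *\<^sub>R axis i 1 \<in> - closure {x. \<phi> x \<noteq> 0}) (nhds (0::real))"
    using assms(2) by (intro topological_tendstoD) auto
  then have "eventually (\<lambda>t. 0 = \<phi> (x + t *\<^sub>R axis i 1)) (nhds (0::real))"
    by eventually_elim (use closure_subset[of "{x. \<phi> x \<noteq> 0}"] in auto)
  then have "((\<lambda>t. \<phi> (x + t *\<^sub>R axis i 1)) has_real_derivative 0) (at 0)"
    using DERIV_cong_ev[OF refl, of "\<lambda>t. 0" "\<lambda>t. \<phi> (x + t *\<^sub>R axis i 1)" 0 0 0] by auto
  then show ?thesis
    using smooth_line_deriv[OF assms(1), of x i 0] DERIV_unique by force
qed

lemma test_functions_partial_deriv: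
  assumes "\<phi> \<in> test_functions \<Omega>"
  shows "partial_deriv i \<phi> \<in> test_functions \<Omega>"
proof -
  have sub: "closure {x. partial_deriv i \<phi> x \<noteq> 0} \<subseteq> closure {x. \<phi> x \<noteq> 0}"
    using partial_deriv_outside_support[OF test_functionsD(1)[OF assms]]
    by (intro closure_minimal) auto
  then have "closure {x. \<phi> x \<noteq> 0} \<inter> closure {x. partial_deriv i \<phi> x \<noteq> 0} = closure {x. partial_deriv i \<phi> x \<noteq> 0}"
    by blast
  then have "compact (closure {x. partial_deriv i \<phi> x \<noteq> 0})"
    using compact_Int_closed[OF test_functionsD(2)[OF assms] closed_closure] by metis
  then show ?thesis
    using smooth_partial_deriv[OF test_functionsD(1)[OF assms]] subset_trans[OF sub test_functionsD(3)[OF assms]]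
    unfolding test_functions_def by blast
qed

lemma loc_intD: "loc_int \<Omega> w \<Longrightarrow> compact K \<Longrightarrow> K \<subseteq> \<Omega> \<Longrightarrow> set_integrable lborel K w"
  and loc_int_measurable [measurable_dest]: "loc_int \<Omega> w \<Longrightarrow> w \<in> borel_measurable borel"
  by (auto simp: loc_int_def)

lemma bounded_compact_support_integrable:
  fixes w :: "real ^ 'd::finite \<Rightarrow> 'b::euclidean_space"
  assumes w: "loc_int \<Omega> w" and K: "compact K" "K \<subseteq> \<Omega>"
    and [measurable]: "\<psi> \<in> borel_measurable borel"
    and \<psi>: "\<And>x. \<bar>\<psi> x\<bar> \<le> B" "\<And>x. x \<notin> K \<Longrightarrow> \<psi> x = 0"
  shows "integrable lborel (\<lambda>x. \<psi> x *\<^sub>R w x)"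
proof (rule Bochner_Integration.integrable_bound)
  show "integrable lborel (\<lambda>x. B *\<^sub>R (indicator K x *\<^sub>R w x))"
    using loc_intD[OF w K] unfolding set_integrable_def by (rule integrable_scaleR_right)
  show "(\<lambda>x. \<psi> x *\<^sub>R w x) \<in> borel_measurable lborel"
    using loc_int_measurable[OF w] by simp
  have "norm (\<psi> x *\<^sub>R w x) \<le> norm (B *\<^sub>R indicat_real K x *\<^sub>R w x)" for x
    using \<psi>[of x] by (auto simp: indicator_def intro!: mult_right_mono)
  then show "AE x in lborel. norm (\<psi> x *\<^sub>R w x) \<le> norm (B *\<^sub>R indicat_real K x *\<^sub>R w x)" by simp
qed

lemma test_function_integrable:
  fixes w :: "real ^ 'd::finite \<Rightarrow> 'b::euclidean_space"
  assumes "\<phi> \<in> test_functions \<Omega>" "loc_int \<Omega> w"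
  shows "integrable lborel (\<lambda>x. \<phi> x *\<^sub>R w x)"
proof -
  obtain B where "B > 0" "\<And>x. \<bar>\<phi> x\<bar> \<le> B" using test_function_bounded[OF assms(1)] by blast
  then show ?thesis
    using bounded_compact_support_integrable[OF assms(2) test_functionsD(2,3)[OF assms(1)]
        test_function_measurable[OF assms(1)] _ test_functionsD(4)[OF assms(1)]] by blast
qed

text \<open>The exceptional null set may depend on \<open>t\<close>, so no representative that is
  continuous along lines has to be chosen.\<close>

definition ac_on_lines ::
    "(real ^ 'd::finite) set \<Rightarrow> 'd \<Rightarrow> (real ^ 'd \<Rightarrow> 'b::euclidean_space) \<Rightarrow> (real ^ 'd \<Rightarrow> 'b) \<Rightarrow> bool" where
  "ac_on_lines \<Omega> i f g \<longleftrightarrow>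
     (\<forall>t\<ge>0. AE x in lborel. (\<forall>s\<in>{0..t}. x + s *\<^sub>R axis i 1 \<in> \<Omega>) \<longrightarrow>
        f (x + t *\<^sub>R axis i 1) - f x = (LINT s:{0..t}|lborel. g (x + s *\<^sub>R axis i 1)))"

definition sweep :: "'d \<Rightarrow> real \<Rightarrow> (real ^ 'd::finite) set \<Rightarrow> (real ^ 'd) set" where
  "sweep i t K = (\<lambda>(x, s). x + s *\<^sub>R axis i 1) ` (K \<times> {0..t})"

lemma compact_sweep: "compact K \<Longrightarrow> compact (sweep i t K)"
  unfolding sweep_def
  by (intro compact_continuous_image compact_Times) (auto simp: split_beta intro!: continuous_intros)

lemma sweepI: "x \<in> K \<Longrightarrow> s \<in> {0..t} \<Longrightarrow> x + s *\<^sub>R axis i 1 \<in> sweep i t K"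
  by (force simp: sweep_def)

text \<open>The complement is the sum of the closed set \<open>-\<Omega>\<close> and a compact
  segment, hence closed.\<close>

lemma open_line_kernel:
  fixes \<Omega> :: "(real ^ 'd::finite) set"
  assumes "open \<Omega>"
  shows "open {x. \<forall>s\<in>{0..t}. x + s *\<^sub>R axis i 1 \<in> \<Omega>}"
proof -
  have "closed (\<Union>x\<in>-\<Omega>. \<Union>y\<in>(\<lambda>s. - s *\<^sub>R axis i 1) ` {0..t}. {x + y})"
    using closed_compact_sums[of "-\<Omega>" "(\<lambda>s. - s *\<^sub>R axis i 1) ` {0..t}"] assms
    by (simp add: compact_continuous_image continuous_intros)
  also have "(\<Union>x\<in>-\<Omega>. \<Union>y\<in>(\<lambda>s. - s *\<^sub>R axis i 1) ` {0..t}. {x + y}) = - {x. \<forall>s\<in>{0..t}. x + s *\<^sub>R axis i 1 \<in> \<Omega>}"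
    (is "?L = ?R")
  proof (rule set_eqI)
    fix x :: "real ^ 'd"
    have "x \<in> ?L \<longleftrightarrow> (\<exists>s\<in>{0..t}. \<exists>y. y \<notin> \<Omega> \<and> x = y - s *\<^sub>R axis i 1)" by auto
    also have "\<dots> \<longleftrightarrow> (\<exists>s\<in>{0..t}. x + s *\<^sub>R axis i 1 \<notin> \<Omega>)" by (auto simp: eq_diff_eq)
    finally show "x \<in> ?L \<longleftrightarrow> x \<in> ?R" by auto
  qed
  finally show ?thesis by (simp add: closed_def)
qed

text \<open>Tonelli with \<open>x\<close> innermost: for fixed \<open>s\<close> the inner integral
  is a translate, bounded by the integral of the norm of \<open>g\<close> over the compact sweep,
  which does not depend on \<open>s\<close>.\<close>

lemma integrable_pair_sweep:
  fixes g :: "real ^ 'd::finite \<Rightarrow> 'b::euclidean_space"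
  assumes g: "loc_int \<Omega> g" and K: "compact K" "sweep i t K \<subseteq> \<Omega>"
  shows "integrable (lborel \<Otimes>\<^sub>M lborel)
    (\<lambda>(x, s). indicator K x *\<^sub>R indicator {0..t} s *\<^sub>R g (x + s *\<^sub>R axis i 1))"
proof (rule integrableI_bounded)
  have [measurable]: "g \<in> borel_measurable borel" "K \<in> sets borel" "sweep i t K \<in> sets borel"
    using g K compact_sweep[OF K(1)] by (auto simp: loc_int_def borel_compact)
  show "(\<lambda>(x, s). indicator K x *\<^sub>R indicator {0..t} s *\<^sub>R g (x + s *\<^sub>R axis i 1)) \<in> borel_measurable (lborel \<Otimes>\<^sub>M lborel)"
    by measurable
  define C where "C = (\<integral>\<^sup>+y. ennreal (norm (indicat_real (sweep i t K) y *\<^sub>R g y)) \<partial>lborel)"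
  have C: "C < \<infinity>"
    using loc_intD[OF g compact_sweep[OF K(1)] K(2)] unfolding C_def set_integrable_def integrable_iff_bounded by simp
  have "(\<integral>\<^sup>+ p. ennreal (norm (case p of (x, s) \<Rightarrow> indicat_real K x *\<^sub>R indicat_real {0..t} s *\<^sub>R g (x + s *\<^sub>R axis i 1))) \<partial>(lborel \<Otimes>\<^sub>M lborel))
     = (\<integral>\<^sup>+ s. \<integral>\<^sup>+ x. ennreal (norm (indicat_real K x *\<^sub>R indicat_real {0..t} s *\<^sub>R g (x + s *\<^sub>R axis i 1))) \<partial>lborel \<partial>lborel)"
    by (subst lborel_pair.nn_integral_snd[symmetric]) simp_all
  also have "\<dots> \<le> (\<integral>\<^sup>+ s. C * indicator {0..t} s \<partial>lborel)"
  proof (rule nn_integral_mono)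
    fix s
    show "(\<integral>\<^sup>+ x. ennreal (norm (indicat_real K x *\<^sub>R indicat_real {0..t} s *\<^sub>R g (x + s *\<^sub>R axis i 1))) \<partial>lborel) \<le> C * indicator {0..t} s"
    proof (cases "s \<in> {0..t}")
      case True
      have "(\<integral>\<^sup>+ x. ennreal (norm (indicat_real K x *\<^sub>R indicat_real {0..t} s *\<^sub>R g (x + s *\<^sub>R axis i 1))) \<partial>lborel)
        \<le> (\<integral>\<^sup>+ x. ennreal (norm (indicat_real (sweep i t K) (x + s *\<^sub>R axis i 1) *\<^sub>R g (x + s *\<^sub>R axis i 1))) \<partial>lborel)"
        using True by (intro nn_integral_mono ennreal_leI) (auto simp: indicator_def sweepI)
      also have "\<dots> = C"
        unfolding C_def by (rule nn_integral_shift) measurable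
      finally show ?thesis using True by simp
    qed simp
  qed
  also have "\<dots> = C * emeasure lborel {0..t}" by (simp add: nn_integral_cmult)
  also have "\<dots> < \<infinity>" using C by (simp add: emeasure_lborel_Icc_eq ennreal_mult_less_top)
  finally show "(\<integral>\<^sup>+ p. ennreal (norm (case p of (x, s) \<Rightarrow> indicat_real K x *\<^sub>R indicat_real {0..t} s *\<^sub>R g (x + s *\<^sub>R axis i 1))) \<partial>(lborel \<Otimes>\<^sub>M lborel)) < \<infinity>" .
qed

lemma integrable_pair_product:
  fixes a :: "'x::euclidean_space \<Rightarrow> 'b::euclidean_space" and b :: "'y::euclidean_space \<Rightarrow> real"
  assumes a: "integrable lborel a" and b: "integrable lborel b"
  shows "integrable (lborel \<Otimes>\<^sub>M lborel) (\<lambda>(x, y). b y *\<^sub>R a x)"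
proof (rule integrableI_bounded)
  have [measurable]: "a \<in> borel_measurable borel" "b \<in> borel_measurable borel"
    using a b borel_measurable_integrable by force+
  show "(\<lambda>(x, y). b y *\<^sub>R a x) \<in> borel_measurable (lborel \<Otimes>\<^sub>M lborel)" by measurable
  have "(\<integral>\<^sup>+ p. ennreal (norm (case p of (x, y) \<Rightarrow> b y *\<^sub>R a x)) \<partial>(lborel \<Otimes>\<^sub>M lborel))
    = (\<integral>\<^sup>+ x. ennreal (norm (a x)) * (\<integral>\<^sup>+ y. ennreal (norm (b y)) \<partial>lborel) \<partial>lborel)"
    by (subst lborel.nn_integral_fst[symmetric])
       (simp_all add: nn_integral_cmult[symmetric] ennreal_mult mult_ac)
  also have "\<dots> < \<infinity>"
    using a b by (simp add: nn_integral_multc integrable_iff_bounded ennreal_mult_less_top)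
  finally show "(\<integral>\<^sup>+ p. ennreal (norm (case p of (x, y) \<Rightarrow> b y *\<^sub>R a x)) \<partial>(lborel \<Otimes>\<^sub>M lborel)) < \<infinity>" .
qed

lemma AE_line_integrable:
  fixes g :: "real ^ 'd::finite \<Rightarrow> 'b::euclidean_space"
  assumes \<Omega>: "open \<Omega>" and g: "loc_int \<Omega> g"
  shows "AE x in lborel. (\<forall>s\<in>{0..t}. x + s *\<^sub>R axis i 1 \<in> \<Omega>) \<longrightarrow>
     set_integrable lborel {0..t} (\<lambda>s. g (x + s *\<^sub>R axis i 1))"
proof -
  have "AE x in lborel. x \<in> {x. \<forall>s\<in>{0..t}. x + s *\<^sub>R axis i 1 \<in> \<Omega>} \<longrightarrow>
     set_integrable lborel {0..t} (\<lambda>s. g (x + s *\<^sub>R axis i 1))"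
  proof (rule AE_open_cboxI[OF open_line_kernel[OF \<Omega>]])
    fix a b assume "cbox a b \<subseteq> {x. \<forall>s\<in>{0..t}. x + s *\<^sub>R axis i 1 \<in> \<Omega>}"
    then have "sweep i t (cbox a b) \<subseteq> \<Omega>" by (auto simp: sweep_def)
    from lborel_pair.AE_integrable_fst'[OF integrable_pair_sweep[OF g compact_cbox this]]
    show "AE x in lborel. x \<in> cbox a b \<longrightarrow> set_integrable lborel {0..t} (\<lambda>s. g (x + s *\<^sub>R axis i 1))"
      by eventually_elim (auto simp: set_integrable_def)
  qed
  then show ?thesis by simp
qed

lemma smooth_line_FTC:
  assumes "smooth \<phi>" "0 \<le> t"
  shows "(LINT s:{0..t}|lborel. partial_deriv i \<phi> (x - s *\<^sub>R axis i 1)) = \<phi> x - \<phi> (x - t *\<^sub>R axis i 1)"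
proof -
  have "((\<lambda>s. - \<phi> (x - s *\<^sub>R axis i 1)) has_real_derivative partial_deriv i \<phi> (x - s *\<^sub>R axis i 1)) (at s)" for s
  proof -
    have "((\<lambda>s. - s) has_real_derivative - 1) (at s)" by (auto intro!: derivative_eq_intros)
    from DERIV_minus[OF DERIV_chain2[OF smooth_line_deriv[OF assms(1), of x i "- s"] this]] show ?thesis by simp
  qed
  moreover have "isCont (\<lambda>s. partial_deriv i \<phi> (x - s *\<^sub>R axis i 1)) s" for s
    using smooth_continuous[OF smooth_partial_deriv[OF assms(1)], of UNIV i]
    by (intro continuous_at_compose[of _ "\<lambda>s. x - s *\<^sub>R axis i 1" "partial_deriv i \<phi>", unfolded o_def] continuous_intros)
       (auto simp: continuous_on_eq_continuous_at)
  ultimately show ?thesis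
    using integral_FTC_Icc_real[of 0 t "\<lambda>s. - \<phi> (x - s *\<^sub>R axis i 1)" "\<lambda>s. partial_deriv i \<phi> (x - s *\<^sub>R axis i 1)"] assms(2)
    by (simp add: set_lebesgue_integral_def mult.commute)
qed

lemma integrable_shift_compact:
  fixes f :: "real ^ 'd::finite \<Rightarrow> 'b::euclidean_space"
  assumes f: "loc_int \<Omega> f" and \<phi>: "\<phi> \<in> test_functions UNIV"
    and s: "\<And>x. x \<in> closure {x. \<phi> x \<noteq> 0} \<Longrightarrow> x + v \<in> \<Omega>"
  shows "integrable lborel (\<lambda>x. \<phi> x *\<^sub>R f (x + v))" "integrable lborel (\<lambda>x. \<phi> (x - v) *\<^sub>R f x)"
    "(LINT x|lborel. \<phi> x *\<^sub>R f (x + v)) = (LINT x|lborel. \<phi> (x - v) *\<^sub>R f x)"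
proof -
  note [measurable] = loc_int_measurable[OF f] test_function_measurable[OF \<phi>]
  have [measurable]: "(\<lambda>x. \<phi> (x - v)) \<in> borel_measurable borel"
    using borel_measurable_shift[of \<phi> "- v"] by simp
  obtain B where B: "B > 0" "\<And>x. \<bar>\<phi> x\<bar> \<le> B" using test_function_bounded[OF \<phi>] by blast
  let ?K = "(+) v ` closure {x. \<phi> x \<noteq> 0}"
  show 2: "integrable lborel (\<lambda>x. \<phi> (x - v) *\<^sub>R f x)"
  proof (rule bounded_compact_support_integrable[OF f, of ?K _ B])
    show "compact ?K" using test_functionsD(2)[OF \<phi>] by (rule compact_translation)
    show "?K \<subseteq> \<Omega>" using s by (auto simp: add.commute)
    show "\<phi> (x - v) = 0" if "x \<notin> ?K" for x
    proof (rule test_functionsD(4)[OF \<phi>])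
      show "x - v \<notin> closure {x. \<phi> x \<noteq> 0}" using that by (metis add.commute diff_add_cancel image_eqI)
    qed
  qed (use B in auto)
  have eq: "(\<lambda>x. \<phi> x *\<^sub>R f (x + v)) = (\<lambda>x. (\<lambda>x. \<phi> (x - v) *\<^sub>R f x) (x + v))" by simp
  show "integrable lborel (\<lambda>x. \<phi> x *\<^sub>R f (x + v))"
    using 2 unfolding eq by (subst integrable_shift_iff) auto
  show "(LINT x|lborel. \<phi> x *\<^sub>R f (x + v)) = (LINT x|lborel. \<phi> (x - v) *\<^sub>R f x)"
    unfolding eq by (subst integral_shift) auto
qed

lemma test_functions_mono: "\<Omega> \<subseteq> \<Omega>' \<Longrightarrow> \<phi> \<in> test_functions \<Omega> \<Longrightarrow> \<phi> \<in> test_functions \<Omega>'"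
  by (auto simp: test_functions_def)

text \<open>Both directions between weak derivatives and absolute continuity on lines rest on the following
  two ways of writing \<open>\<integral> \<phi>(x) (f(x + t e) - f(x)) dx\<close>.\<close>

lemma test_difference_left:
  fixes f :: "real ^ 'd::finite \<Rightarrow> 'b::euclidean_space"
  assumes f: "loc_int \<Omega> f" and \<phi>: "\<phi> \<in> test_functions \<Omega>" and t: "0 \<le> t"
    and K: "\<And>x s. x \<in> closure {x. \<phi> x \<noteq> 0} \<Longrightarrow> s \<in> {0..t} \<Longrightarrow> x + s *\<^sub>R axis i 1 \<in> \<Omega>"
  shows "(LINT x|lborel. \<phi> x *\<^sub>R f (x + t *\<^sub>R axis i 1)) - (LINT x|lborel. \<phi> x *\<^sub>R f x) =
    - (LINT s:{0..t}|lborel. LINT x|lborel. partial_deriv i \<phi> (x - s *\<^sub>R axis i 1) *\<^sub>R f x)"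
proof -
  let ?S = "closure {x. \<phi> x \<noteq> 0}"
  have \<phi>U: "\<phi> \<in> test_functions UNIV" using \<phi> by (rule test_functions_mono[rotated]) simp
  note sm = test_functionsD(1)[OF \<phi>]
  note cS = test_functionsD(2)[OF \<phi>]
  have sw: "sweep i t ?S \<subseteq> \<Omega>" using K by (auto simp: sweep_def)
  note [measurable] = loc_int_measurable[OF f] test_function_measurable[OF \<phi>]
    test_function_measurable[OF test_functions_partial_deriv[OF \<phi>, of i]]
    borel_compact[OF compact_sweep[OF cS, of i t]]
  obtain B where B: "B > 0" "\<And>x. \<bar>partial_deriv i \<phi> x\<bar> \<le> B"
    using test_function_bounded[OF test_functions_partial_deriv[OF \<phi>]] by blast
  have int: "integrable (lborel \<Otimes>\<^sub>M lborel)
      (\<lambda>(x, s). indicator {0..t} s *\<^sub>R partial_deriv i \<phi> (x - s *\<^sub>R axis i 1) *\<^sub>R f x)"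
  proof (rule Bochner_Integration.integrable_bound)
    show "integrable (lborel \<Otimes>\<^sub>M lborel) (\<lambda>(x, s). (B * indicat_real {0..t} s) *\<^sub>R (indicat_real (sweep i t ?S) x *\<^sub>R f x))"
      using loc_intD[OF f compact_sweep[OF cS] sw]
      by (intro integrable_pair_product)
         (auto simp: set_integrable_def integrable_indicator_iff emeasure_lborel_Icc_eq intro!: integrable_mult_right)
    have "norm (indicat_real {0..t} s *\<^sub>R partial_deriv i \<phi> (x - s *\<^sub>R axis i 1) *\<^sub>R f x) \<le>
        norm ((B * indicat_real {0..t} s) *\<^sub>R (indicat_real (sweep i t ?S) x *\<^sub>R f x))" for x s
    proof (cases "s \<in> {0..t} \<and> x - s *\<^sub>R axis i 1 \<in> ?S")
      case True
      then have "x \<in> sweep i t ?S" using sweepI[of "x - s *\<^sub>R axis i 1" ?S s t i] by simp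
      then show ?thesis using True B by (auto intro!: mult_right_mono)
    next
      case False
      then show ?thesis using partial_deriv_outside_support[OF sm] by (auto simp: indicator_def)
    qed
    then show "AE p in lborel \<Otimes>\<^sub>M lborel. norm (case p of (x, s) \<Rightarrow> indicator {0..t} s *\<^sub>R partial_deriv i \<phi> (x - s *\<^sub>R axis i 1) *\<^sub>R f x)
      \<le> norm (case p of (x, s) \<Rightarrow> (B * indicat_real {0..t} s) *\<^sub>R (indicat_real (sweep i t ?S) x *\<^sub>R f x))"
      by auto
  qed measurable
  \<comment> \<open>Fubini lets the integral over \<open>s\<close> act on the smooth factor, where
    the fundamental theorem gives an increment of \<open>\<phi>\<close>; a translation then moves
    the shift from \<open>\<phi>\<close> to \<open>f\<close>.\<close>
  have "(LINT s:{0..t}|lborel. LINT x|lborel. partial_deriv i \<phi> (x - s *\<^sub>R axis i 1) *\<^sub>R f x)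
     = (LINT s|lborel. LINT x|lborel. indicator {0..t} s *\<^sub>R partial_deriv i \<phi> (x - s *\<^sub>R axis i 1) *\<^sub>R f x)"
    unfolding set_lebesgue_integral_def by (simp add: integral_scaleR_right del: scaleR_scaleR)
  also have "\<dots> = (LINT x|lborel. LINT s|lborel. indicator {0..t} s *\<^sub>R partial_deriv i \<phi> (x - s *\<^sub>R axis i 1) *\<^sub>R f x)"
    by (rule lborel_pair.Fubini_integral[OF int])
  also have "\<dots> = (LINT x|lborel. (LINT s:{0..t}|lborel. partial_deriv i \<phi> (x - s *\<^sub>R axis i 1)) *\<^sub>R f x)"
  proof (rule Bochner_Integration.integral_cong[OF refl])
    fix x
    have "set_integrable lborel {0..t} (\<lambda>s. partial_deriv i \<phi> (x - s *\<^sub>R axis i 1))"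
      by (intro borel_integrable_atLeastAtMost' continuous_on_compose2[OF smooth_continuous[OF smooth_partial_deriv[OF sm], of UNIV]]
          continuous_intros) auto
    then show "(LINT s|lborel. indicator {0..t} s *\<^sub>R partial_deriv i \<phi> (x - s *\<^sub>R axis i 1) *\<^sub>R f x) =
        (LINT s:{0..t}|lborel. partial_deriv i \<phi> (x - s *\<^sub>R axis i 1)) *\<^sub>R f x"
      unfolding set_lebesgue_integral_def set_integrable_def
      by (subst integral_scaleR_left[symmetric]) simp_all
  qed
  also have "\<dots> = (LINT x|lborel. \<phi> x *\<^sub>R f x - \<phi> (x - t *\<^sub>R axis i 1) *\<^sub>R f x)"
    by (simp add: smooth_line_FTC[OF sm t] scaleR_diff_left)
  also have "\<dots> = (LINT x|lborel. \<phi> x *\<^sub>R f x) - (LINT x|lborel. \<phi> (x - t *\<^sub>R axis i 1) *\<^sub>R f x)"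
    using integrable_shift_compact(2)[OF f \<phi>U, of "t *\<^sub>R axis i 1"] K t test_function_integrable[OF \<phi> f]
    by (intro Bochner_Integration.integral_diff) auto
  also have "(LINT x|lborel. \<phi> (x - t *\<^sub>R axis i 1) *\<^sub>R f x) = (LINT x|lborel. \<phi> x *\<^sub>R f (x + t *\<^sub>R axis i 1))"
    using integrable_shift_compact(3)[OF f \<phi>U, of "t *\<^sub>R axis i 1"] K t by auto
  finally show ?thesis by simp
qed

lemma test_difference_right:
  fixes g :: "real ^ 'd::finite \<Rightarrow> 'b::euclidean_space"
  assumes g: "loc_int \<Omega> g" and \<phi>: "\<phi> \<in> test_functions \<Omega>" and t: "0 \<le> t"
    and K: "\<And>x s. x \<in> closure {x. \<phi> x \<noteq> 0} \<Longrightarrow> s \<in> {0..t} \<Longrightarrow> x + s *\<^sub>R axis i 1 \<in> \<Omega>"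
  shows "integrable lborel (\<lambda>x. \<phi> x *\<^sub>R (LINT s:{0..t}|lborel. g (x + s *\<^sub>R axis i 1)))" (is ?A)
    "(LINT x|lborel. \<phi> x *\<^sub>R (LINT s:{0..t}|lborel. g (x + s *\<^sub>R axis i 1))) =
      (LINT s:{0..t}|lborel. LINT x|lborel. \<phi> (x - s *\<^sub>R axis i 1) *\<^sub>R g x)" (is ?B)
proof -
  let ?S = "closure {x. \<phi> x \<noteq> 0}"
  have \<phi>U: "\<phi> \<in> test_functions UNIV" using \<phi> by (rule test_functions_mono[rotated]) simp
  note cS = test_functionsD(2)[OF \<phi>]
  have sw: "sweep i t ?S \<subseteq> \<Omega>" using K by (auto simp: sweep_def)
  note [measurable] = loc_int_measurable[OF g] test_function_measurable[OF \<phi>] borel_compact[OF cS]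
  obtain B where B: "B > 0" "\<And>x. \<bar>\<phi> x\<bar> \<le> B" using test_function_bounded[OF \<phi>] by blast
  have int: "integrable (lborel \<Otimes>\<^sub>M lborel)
      (\<lambda>(x, s). \<phi> x *\<^sub>R indicator {0..t} s *\<^sub>R g (x + s *\<^sub>R axis i 1))"
  proof (rule Bochner_Integration.integrable_bound)
    show "integrable (lborel \<Otimes>\<^sub>M lborel)
      (\<lambda>p. B *\<^sub>R (case p of (x, s) \<Rightarrow> indicator ?S x *\<^sub>R indicator {0..t} s *\<^sub>R g (x + s *\<^sub>R axis i 1)))"
      by (intro integrable_scaleR_right integrable_pair_sweep[OF g cS sw])
    have "norm (\<phi> x *\<^sub>R indicat_real {0..t} s *\<^sub>R g (x + s *\<^sub>R axis i 1)) \<le>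
        norm (B *\<^sub>R (indicat_real ?S x *\<^sub>R indicat_real {0..t} s *\<^sub>R g (x + s *\<^sub>R axis i 1)))" for x s
      using B test_functionsD(4)[OF \<phi>, of x]
      by (cases "x \<in> ?S"; cases "s \<in> {0..t}") (auto intro!: mult_right_mono mult_nonneg_nonneg)
    then show "AE p in lborel \<Otimes>\<^sub>M lborel. norm (case p of (x, s) \<Rightarrow> \<phi> x *\<^sub>R indicator {0..t} s *\<^sub>R g (x + s *\<^sub>R axis i 1))
      \<le> norm (B *\<^sub>R (case p of (x, s) \<Rightarrow> indicat_real ?S x *\<^sub>R indicat_real {0..t} s *\<^sub>R g (x + s *\<^sub>R axis i 1)))"
      by (auto simp del: scaleR_scaleR norm_scaleR)
  qed measurable
  have eq: "\<phi> x *\<^sub>R (LINT s:{0..t}|lborel. g (x + s *\<^sub>R axis i 1)) = (LINT s|lborel. \<phi> x *\<^sub>R indicator {0..t} s *\<^sub>R g (x + s *\<^sub>R axis i 1))" for x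
    unfolding set_lebesgue_integral_def by (simp only: integral_scaleR_right)
  show ?A
    unfolding eq using lborel_pair.integrable_fst[OF int] by simp
  have "(LINT x|lborel. \<phi> x *\<^sub>R (LINT s:{0..t}|lborel. g (x + s *\<^sub>R axis i 1))) =
     (LINT s|lborel. LINT x|lborel. \<phi> x *\<^sub>R indicator {0..t} s *\<^sub>R g (x + s *\<^sub>R axis i 1))"
    unfolding eq by (rule lborel_pair.Fubini_integral[OF int, symmetric])
  also have "\<dots> = (LINT s:{0..t}|lborel. LINT x|lborel. \<phi> (x - s *\<^sub>R axis i 1) *\<^sub>R g x)"
    unfolding set_lebesgue_integral_def
  proof (rule Bochner_Integration.integral_cong[OF refl])
    fix s
    show "(LINT x|lborel. \<phi> x *\<^sub>R indicator {0..t} s *\<^sub>R g (x + s *\<^sub>R axis i 1)) =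
       indicat_real {0..t} s *\<^sub>R (LINT x|lborel. \<phi> (x - s *\<^sub>R axis i 1) *\<^sub>R g x)"
      using integrable_shift_compact(3)[OF g \<phi>U, of "s *\<^sub>R axis i 1"] K
      by (cases "s \<in> {0..t}") auto
  qed
  finally show ?B .
qed


lemma partial_deriv_shift: "partial_deriv i (\<lambda>x. \<phi> (x - v)) x = partial_deriv i \<phi> (x - v)"
  by (simp add: partial_deriv_def algebra_simps)

lemma borel_measurable_line_integral:
  fixes g :: "real ^ 'd::finite \<Rightarrow> 'b::euclidean_space"
  assumes [measurable]: "g \<in> borel_measurable borel"
  shows "(\<lambda>x. LINT s:{0..t}|lborel. g (x + s *\<^sub>R axis i 1)) \<in> borel_measurable borel"
proof -
  have "(\<lambda>x. LINT s:{0..t}|lborel. g (x + s *\<^sub>R axis i 1)) \<in> borel_measurable lborel"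
    unfolding set_lebesgue_integral_def by measurable
  then show ?thesis by simp
qed

text \<open>For fixed \<open>t\<close> let \<open>w\<close> be the defect of the claimed identity.
  On the points whose whole segment lies in \<open>\<Omega>\<close> it is tested with a box test
  \<open>\<phi>\<close>: the two difference formulas express the result by translates of
  \<open>\<phi>\<close>, each of which is again a box test in \<open>\<Omega>\<close>, so the weak
  identity cancels the terms.\<close>

lemma weak_imp_ac_on_lines:
  fixes f g :: "real ^ 'd::finite \<Rightarrow> 'b::euclidean_space"
  assumes \<Omega>: "open \<Omega>" and f: "loc_int \<Omega> f" and g: "loc_int \<Omega> g"
    and weak: "\<And>\<phi>. box_test \<Omega> \<phi> \<Longrightarrow>
      (LINT x|lborel. partial_deriv i \<phi> x *\<^sub>R f x) = - (LINT x|lborel. \<phi> x *\<^sub>R g x)"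
  shows "ac_on_lines \<Omega> i f g"
  unfolding ac_on_lines_def
proof (intro allI impI)
  fix t :: real assume t: "0 \<le> t"
  let ?e = "axis i 1 :: real ^ 'd"
  let ?O = "{x. \<forall>s\<in>{0..t}. x + s *\<^sub>R ?e \<in> \<Omega>}"
  define G where "G x = (LINT s:{0..t}|lborel. g (x + s *\<^sub>R ?e))" for x
  define w where "w x = f (x + t *\<^sub>R ?e) - f x - G x" for x
  note [measurable] = loc_int_measurable[OF f] loc_int_measurable[OF g]
  have [measurable]: "G \<in> borel_measurable borel"
    unfolding G_def by (rule borel_measurable_line_integral) measurable
  have O: "?O \<subseteq> \<Omega>" using t by (auto dest!: bspec[of _ _ 0])
  have "set_integrable lborel K w" if K: "compact K" "K \<subseteq> ?O" for K
  proof -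
    have [measurable]: "K \<in> sets borel" using K(1) by (rule borel_compact)
    let ?K = "(+) (t *\<^sub>R ?e) ` K"
    have cK: "compact ?K" using K(1) by (rule compact_translation)
    have [measurable]: "?K \<in> sets borel" using cK by (rule borel_compact)
    have "integrable lborel (\<lambda>x. indicator ?K x *\<^sub>R f x)"
      using loc_intD[OF f cK] K(2) t by (force simp: set_integrable_def add.commute)
    then have "integrable lborel (\<lambda>x. (\<lambda>x. indicator ?K x *\<^sub>R f x) (x + t *\<^sub>R ?e))"
      by (subst integrable_shift_iff) auto
    moreover have "indicator ?K (x + t *\<^sub>R ?e) = (indicator K x :: real)" for x
      by (auto simp: indicator_def add.commute)
    ultimately have 1: "integrable lborel (\<lambda>x. indicator K x *\<^sub>R f (x + t *\<^sub>R ?e))" by simp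
    have 2: "integrable lborel (\<lambda>x. indicator K x *\<^sub>R f x)"
      using loc_intD[OF f K(1)] K(2) O by (auto simp: set_integrable_def)
    have "sweep i t K \<subseteq> \<Omega>" using K(2) by (auto simp: sweep_def)
    from lborel_pair.integrable_fst[OF integrable_pair_sweep[OF g K(1) this]]
    have 3: "integrable lborel (\<lambda>x. indicator K x *\<^sub>R G x)"
      by (simp only: G_def set_lebesgue_integral_def prod.case integral_scaleR_right)
    show ?thesis
      unfolding set_integrable_def w_def using Bochner_Integration.integrable_diff[OF Bochner_Integration.integrable_diff[OF 1 2] 3]
      by (simp add: scaleR_diff_right)
  qed
  then have w: "loc_int ?O w"
    unfolding loc_int_def by (simp add: w_def[abs_def])
  have 0: "(LINT x|lborel. \<phi> x *\<^sub>R w x) = 0" if bt: "box_test ?O \<phi>" for \<phi>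
  proof -
    have \<phi>O: "\<phi> \<in> test_functions ?O" using box_test_imp_test_functions[OF bt] .
    have \<phi>: "\<phi> \<in> test_functions \<Omega>" using test_functions_mono[OF O \<phi>O] .
    have \<phi>U: "\<phi> \<in> test_functions UNIV" using \<phi> by (rule test_functions_mono[rotated]) simp
    have K: "x + s *\<^sub>R ?e \<in> \<Omega>" if "x \<in> closure {x. \<phi> x \<noteq> 0}" "s \<in> {0..t}" for x s
      using test_functionsD(3)[OF \<phi>O] that by blast
    have s: "(LINT x|lborel. partial_deriv i \<phi> (x - s *\<^sub>R ?e) *\<^sub>R f x) = - (LINT x|lborel. \<phi> (x - s *\<^sub>R ?e) *\<^sub>R g x)"
      if "s \<in> {0..t}" for s
    proof -
      have "box_test \<Omega> (\<lambda>x. \<phi> (x - s *\<^sub>R ?e))"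
        using that by (intro box_test_translate[OF bt]) (auto simp: add.commute)
      from weak[OF this] show ?thesis by (simp add: partial_deriv_shift)
    qed
    have "(LINT x|lborel. \<phi> x *\<^sub>R w x) = (LINT x|lborel. \<phi> x *\<^sub>R f (x + t *\<^sub>R ?e)) - (LINT x|lborel. \<phi> x *\<^sub>R f x)
       - (LINT x|lborel. \<phi> x *\<^sub>R G x)"
      unfolding w_def scaleR_diff_right
      using integrable_shift_compact(1)[OF f \<phi>U, of "t *\<^sub>R ?e"] K t test_function_integrable[OF \<phi> f]
        test_difference_right(1)[OF g \<phi> t K]
      by (subst Bochner_Integration.integral_diff Bochner_Integration.integrable_diff; (simp add: G_def)?)+
    also have "\<dots> = - (LINT s:{0..t}|lborel. LINT x|lborel. partial_deriv i \<phi> (x - s *\<^sub>R ?e) *\<^sub>R f x) -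
       (LINT s:{0..t}|lborel. LINT x|lborel. \<phi> (x - s *\<^sub>R ?e) *\<^sub>R g x)"
      unfolding G_def
      by (intro arg_cong2[of _ _ _ _ "(-)"] test_difference_left[OF f \<phi> t] test_difference_right(2)[OF g \<phi> t] K)
    also have "(LINT s:{0..t}|lborel. LINT x|lborel. partial_deriv i \<phi> (x - s *\<^sub>R ?e) *\<^sub>R f x) =
       (LINT s:{0..t}|lborel. - (LINT x|lborel. \<phi> (x - s *\<^sub>R ?e) *\<^sub>R g x))"
      using s by (intro set_lebesgue_integral_cong) auto
    also have "- (LINT s:{0..t}|lborel. - (LINT x|lborel. \<phi> (x - s *\<^sub>R ?e) *\<^sub>R g x)) -
       (LINT s:{0..t}|lborel. LINT x|lborel. \<phi> (x - s *\<^sub>R ?e) *\<^sub>R g x) = 0"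
      by (simp add: set_lebesgue_integral_def)
    finally show ?thesis .
  qed
  show "AE x in lborel. (\<forall>s\<in>{0..t}. x + s *\<^sub>R ?e \<in> \<Omega>) \<longrightarrow>
      f (x + t *\<^sub>R ?e) - f x = (LINT s:{0..t}|lborel. g (x + s *\<^sub>R ?e))"
    using fundamental_lemma[OF open_line_kernel[OF \<Omega>] w 0]
    by (simp add: w_def G_def)
qed

text \<open>Continuity in the shift is what later permits an identity for means over small shifts to
  be evaluated at shift 0.\<close>

lemma continuous_on_test_translate:
  fixes f :: "real ^ 'd::finite \<Rightarrow> 'b::euclidean_space"
  assumes f: "loc_int \<Omega> f" and \<phi>: "\<phi> \<in> test_functions \<Omega>"
    and K: "\<And>x s. x \<in> closure {x. \<phi> x \<noteq> 0} \<Longrightarrow> s \<in> {0..t} \<Longrightarrow> x + s *\<^sub>R axis i 1 \<in> \<Omega>"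
  shows "continuous_on {0..t} (\<lambda>s. LINT x|lborel. \<phi> (x - s *\<^sub>R axis i 1) *\<^sub>R f x)"
proof (rule continuous_on_sequentiallyI)
  let ?S = "closure {x. \<phi> x \<noteq> 0}"
  fix u :: "nat \<Rightarrow> real" and a assume u: "\<forall>n. u n \<in> {0..t}" "a \<in> {0..t}" "u \<longlonglongrightarrow> a"
  note cS = test_functionsD(2)[OF \<phi>]
  note [measurable] = loc_int_measurable[OF f] test_function_measurable[OF \<phi>]
    borel_compact[OF compact_sweep[OF cS, of i t]]
  have sw: "sweep i t ?S \<subseteq> \<Omega>" using K by (auto simp: sweep_def)
  obtain B where B: "B > 0" "\<And>x. \<bar>\<phi> x\<bar> \<le> B" using test_function_bounded[OF \<phi>] by blast
  show "(\<lambda>n. LINT x|lborel. \<phi> (x - u n *\<^sub>R axis i 1) *\<^sub>R f x) \<longlonglongrightarrow> (LINT x|lborel. \<phi> (x - a *\<^sub>R axis i 1) *\<^sub>R f x)"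
  proof (rule integral_dominated_convergence[where w = "\<lambda>x. B * norm (indicat_real (sweep i t ?S) x *\<^sub>R f x)"])
    show "integrable lborel (\<lambda>x. B * norm (indicat_real (sweep i t ?S) x *\<^sub>R f x))"
      using loc_intD[OF f compact_sweep[OF cS] sw] unfolding set_integrable_def
      by (intro integrable_mult_right integrable_norm)
    show "AE x in lborel. (\<lambda>n. \<phi> (x - u n *\<^sub>R axis i 1) *\<^sub>R f x) \<longlonglongrightarrow> \<phi> (x - a *\<^sub>R axis i 1) *\<^sub>R f x"
    proof (rule AE_I2)
      fix x
      have "(\<lambda>n. \<phi> (x - u n *\<^sub>R axis i 1)) \<longlonglongrightarrow> \<phi> (x - a *\<^sub>R axis i 1)"
        using u(3) by (intro continuous_on_tendsto_compose[OF smooth_continuous[OF test_functionsD(1)[OF \<phi>], of UNIV]] tendsto_intros) auto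
      then show "(\<lambda>n. \<phi> (x - u n *\<^sub>R axis i 1) *\<^sub>R f x) \<longlonglongrightarrow> \<phi> (x - a *\<^sub>R axis i 1) *\<^sub>R f x"
        by (intro tendsto_intros)
    qed
    show "AE x in lborel. norm (\<phi> (x - u n *\<^sub>R axis i 1) *\<^sub>R f x) \<le> B * norm (indicat_real (sweep i t ?S) x *\<^sub>R f x)" for n
    proof (rule AE_I2)
      fix x
      show "norm (\<phi> (x - u n *\<^sub>R axis i 1) *\<^sub>R f x) \<le> B * norm (indicat_real (sweep i t ?S) x *\<^sub>R f x)"
      proof (cases "x - u n *\<^sub>R axis i 1 \<in> ?S")
        case True
        then have "x \<in> sweep i t ?S" using sweepI[OF True, of "u n" t i] u(1) by simp
        then show ?thesis using B by (auto intro!: mult_right_mono)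
      next
        case False
        then show ?thesis using test_functionsD(4)[OF \<phi> False] B(1) by simp
      qed
    qed
  qed (measurable; simp)+
qed

lemma continuous_integral_0_imp_0:
  fixes c :: "real \<Rightarrow> 'b::euclidean_space"
  assumes "\<delta> > 0" and c: "continuous_on {0..\<delta>} c"
    and 0: "\<And>t. t \<in> {0..\<delta>} \<Longrightarrow> (LINT s:{0..t}|lborel. c s) = 0"
  shows "c 0 = 0"
proof -
  have "integral {0..t} c = 0" if "t \<in> {0..\<delta>}" for t
  proof -
    have "set_integrable lborel {0..t} c"
      using c that by (intro borel_integrable_atLeastAtMost') (auto intro: continuous_on_subset)
    then show ?thesis using set_borel_integral_eq_integral(2)[of "{0..t}" c] 0[OF that] by simp
  qed
  then have "((\<lambda>u. integral {0..u} c) has_vector_derivative 0) (at 0 within {0..\<delta>})"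
    using \<open>\<delta> > 0\<close> by (intro has_vector_derivative_transform[OF _ _ has_vector_derivative_const]) auto
  moreover have "((\<lambda>u. integral {0..u} c) has_vector_derivative c 0) (at 0 within {0..\<delta>})"
    using assms by (intro integral_has_vector_derivative) auto
  moreover have "at 0 within {0..\<delta>} \<noteq> bot"
    using \<open>\<delta> > 0\<close> by (simp add: trivial_limit_within islimpt_Icc)
  ultimately show ?thesis by (metis vector_derivative_unique_within)
qed

text \<open>Increments of \<open>f\<close> give the weak identity only in the mean over all shifts
  of \<open>\<phi>\<close> by \<open>s\<close> in \<open>[0, t]\<close>. As this holds for every
  small \<open>t\<close> and the defect \<open>c s\<close> is continuous in \<open>s\<close>, the
  defect vanishes at shift 0.\<close>

lemma ac_on_lines_imp_weak:
  fixes f g :: "real ^ 'd::finite \<Rightarrow> 'b::euclidean_space"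
  assumes \<Omega>: "open \<Omega>" and f: "loc_int \<Omega> f" and g: "loc_int \<Omega> g"
    and ac: "ac_on_lines \<Omega> i f g" and \<phi>: "\<phi> \<in> test_functions \<Omega>"
  shows "(LINT x|lborel. partial_deriv i \<phi> x *\<^sub>R f x) = - (LINT x|lborel. \<phi> x *\<^sub>R g x)"
proof -
  let ?S = "closure {x. \<phi> x \<noteq> 0}"
  let ?e = "axis i 1 :: real ^ 'd"
  have \<phi>U: "\<phi> \<in> test_functions UNIV" using \<phi> by (rule test_functions_mono[rotated]) simp
  obtain \<epsilon> where \<epsilon>: "\<epsilon> > 0" "(\<Union>x\<in>?S. ball x \<epsilon>) \<subseteq> \<Omega>"
    using compact_subset_open_imp_ball_epsilon_subset[OF test_functionsD(2)[OF \<phi>] \<Omega> test_functionsD(3)[OF \<phi>]] by blast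
  define \<delta> where "\<delta> = \<epsilon> / 2"
  have \<delta>: "\<delta> > 0" using \<epsilon> by (simp add: \<delta>_def)
  have K: "x + s *\<^sub>R ?e \<in> \<Omega>" if "x \<in> ?S" "s \<in> {0..\<delta>}" for x s
  proof -
    have "x + s *\<^sub>R ?e \<in> ball x \<epsilon>" using that \<epsilon>(1) by (auto simp: dist_norm \<delta>_def)
    then show ?thesis using that(1) \<epsilon>(2) by blast
  qed
  define c where "c s = (LINT x|lborel. partial_deriv i \<phi> (x - s *\<^sub>R ?e) *\<^sub>R f x) + (LINT x|lborel. \<phi> (x - s *\<^sub>R ?e) *\<^sub>R g x)" for s
  have supp: "closure {x. partial_deriv i \<phi> x \<noteq> 0} \<subseteq> ?S"
    using partial_deriv_outside_support[OF test_functionsD(1)[OF \<phi>]] by (intro closure_minimal) auto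
  have c1: "continuous_on {0..\<delta>} (\<lambda>s. LINT x|lborel. partial_deriv i \<phi> (x - s *\<^sub>R ?e) *\<^sub>R f x)"
    using supp K by (intro continuous_on_test_translate[OF f test_functions_partial_deriv[OF \<phi>]]) auto
  have c2: "continuous_on {0..\<delta>} (\<lambda>s. LINT x|lborel. \<phi> (x - s *\<^sub>R ?e) *\<^sub>R g x)"
    by (rule continuous_on_test_translate[OF g \<phi> K])
  have "(LINT s:{0..t}|lborel. c s) = 0" if t: "t \<in> {0..\<delta>}" for t
  proof -
    have t0: "0 \<le> t" and Kt: "\<And>x s. x \<in> ?S \<Longrightarrow> s \<in> {0..t} \<Longrightarrow> x + s *\<^sub>R ?e \<in> \<Omega>" using t K by auto
    have int: "set_integrable lborel {0..t} (\<lambda>s. LINT x|lborel. partial_deriv i \<phi> (x - s *\<^sub>R ?e) *\<^sub>R f x)"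
      "set_integrable lborel {0..t} (\<lambda>s. LINT x|lborel. \<phi> (x - s *\<^sub>R ?e) *\<^sub>R g x)"
      using c1 c2 t by (auto intro!: borel_integrable_atLeastAtMost' elim!: continuous_on_subset)
    have i1: "integrable lborel (\<lambda>x. \<phi> x *\<^sub>R f (x + t *\<^sub>R ?e))"
      using Kt t0 by (intro integrable_shift_compact(1)[OF f \<phi>U]) auto
    have "(LINT x|lborel. \<phi> x *\<^sub>R (LINT s:{0..t}|lborel. g (x + s *\<^sub>R ?e))) = (LINT x|lborel. \<phi> x *\<^sub>R f (x + t *\<^sub>R ?e) - \<phi> x *\<^sub>R f x)"
    proof (rule integral_cong_AE)
      have "AE x in lborel. (\<forall>s\<in>{0..t}. x + s *\<^sub>R ?e \<in> \<Omega>) \<longrightarrow>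
        f (x + t *\<^sub>R ?e) - f x = (LINT s:{0..t}|lborel. g (x + s *\<^sub>R ?e))"
        using ac t0 by (simp add: ac_on_lines_def)
      then show "AE x in lborel. \<phi> x *\<^sub>R (LINT s:{0..t}|lborel. g (x + s *\<^sub>R ?e)) = \<phi> x *\<^sub>R f (x + t *\<^sub>R ?e) - \<phi> x *\<^sub>R f x"
      proof eventually_elim
        case (elim x)
        show ?case
          using elim Kt[of x] test_functionsD(4)[OF \<phi>, of x]
          by (cases "x \<in> ?S") (auto simp: scaleR_diff_right[symmetric])
      qed
    qed (use test_difference_right(1)[OF g \<phi> t0 Kt] i1 test_function_integrable[OF \<phi> f] in \<open>auto intro: borel_measurable_integrable Bochner_Integration.integrable_diff\<close>)
    also have "\<dots> = (LINT x|lborel. \<phi> x *\<^sub>R f (x + t *\<^sub>R ?e)) - (LINT x|lborel. \<phi> x *\<^sub>R f x)"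
      using i1 test_function_integrable[OF \<phi> f] by (rule Bochner_Integration.integral_diff)
    also have "\<dots> = - (LINT s:{0..t}|lborel. LINT x|lborel. partial_deriv i \<phi> (x - s *\<^sub>R ?e) *\<^sub>R f x)"
      by (rule test_difference_left[OF f \<phi> t0]) (rule Kt)
    also have "(LINT x|lborel. \<phi> x *\<^sub>R (LINT s:{0..t}|lborel. g (x + s *\<^sub>R ?e))) =
      (LINT s:{0..t}|lborel. LINT x|lborel. \<phi> (x - s *\<^sub>R ?e) *\<^sub>R g x)"
      by (rule test_difference_right(2)[OF g \<phi> t0]) (rule Kt)
    finally show ?thesis
      unfolding c_def set_integral_add(2)[OF int] by simp
  qed
  then have "c 0 = 0"
    using continuous_on_add[OF c1 c2] \<delta> by (intro continuous_integral_0_imp_0[of \<delta> c]) (auto simp: c_def[abs_def])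
  then show ?thesis by (simp add: c_def eq_neg_iff_add_eq_0)
qed

section \<open>Weak derivatives of higher order and families of derivatives\<close>

definition bweak ::
    "(real ^ 'd::{finite,linorder}) set \<Rightarrow> ('d \<Rightarrow> nat) \<Rightarrow>
     (real ^ 'd::{finite,linorder} \<Rightarrow> 'b::euclidean_space) \<Rightarrow> (real ^ 'd::{finite,linorder} \<Rightarrow> 'b) \<Rightarrow> bool" where
  "bweak \<Omega> \<alpha> u v \<longleftrightarrow> loc_int \<Omega> u \<and> loc_int \<Omega> v \<and>
     (\<forall>\<phi> \<in> test_functions \<Omega>. (LINT x|lborel. classical_deriv \<alpha> \<phi> x *\<^sub>R u x) =
        (-1) ^ mindex_order \<alpha> *\<^sub>R (LINT x|lborel. \<phi> x *\<^sub>R v x))"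

lemma test_functions_classical_deriv:
  fixes \<phi> :: "real ^ 'd::{finite,linorder} \<Rightarrow> real"
  assumes "\<phi> \<in> test_functions \<Omega>"
  shows "classical_deriv \<alpha> \<phi> \<in> test_functions \<Omega>"
proof -
  have 1: "(partial_deriv i ^^ n) \<psi> \<in> test_functions \<Omega>" if "\<psi> \<in> test_functions \<Omega>" for i n \<psi>
    by (induction n) (auto intro: that test_functions_partial_deriv)
  have "foldr (\<lambda>i. partial_deriv i ^^ \<alpha> i) xs \<phi> \<in> test_functions \<Omega>" for xs
    by (induction xs) (auto intro: assms 1)
  then show ?thesis by (simp add: classical_deriv_def)
qed

lemma classical_deriv_0: "classical_deriv (\<lambda>_. 0) \<phi> = \<phi>"
proof -
  have "foldr (\<lambda>i. partial_deriv i ^^ 0) xs \<phi> = \<phi>" for xs :: "'a list"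
    by (induction xs) auto
  then show ?thesis by (simp add: classical_deriv_def)
qed

text \<open>\<open>foldr\<close> applies the derivative in the last coordinate of the sorted list
  first. If no coordinate beyond \<open>i\<close> occurs in \<open>\<alpha>\<close>, the additional
  derivative in direction \<open>i\<close> is therefore the innermost one, for every function and
  without any interchange.\<close>

lemma classical_deriv_max_index:
  fixes \<phi> :: "real ^ 'd::{finite,linorder} \<Rightarrow> real"
  assumes "\<And>j. i < j \<Longrightarrow> \<alpha> j = 0"
  shows "classical_deriv (\<alpha>(i := Suc (\<alpha> i))) \<phi> = classical_deriv \<alpha> (partial_deriv i \<phi>)"
proof -
  obtain xs ys where xy: "sorted_list_of_set (UNIV :: 'd set) = xs @ i # ys"
    using split_list[of i "sorted_list_of_set UNIV"] by auto
  have "sorted (xs @ i # ys)" "distinct (xs @ i # ys)"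
    unfolding xy[symmetric] by auto
  then have ys: "\<forall>j\<in>set ys. i < j" and xs: "i \<notin> set xs"
    by (auto simp: sorted_append order.strict_iff_order)
  have id: "foldr (\<lambda>i. partial_deriv i ^^ \<beta> i) zs \<psi> = \<psi>" if "\<forall>j\<in>set zs. \<beta> j = 0" for zs \<psi> and \<beta> :: "'d \<Rightarrow> nat"
    using that by (induction zs) auto
  have cong: "foldr (\<lambda>j. partial_deriv j ^^ (\<alpha>(i := Suc (\<alpha> i))) j) xs \<psi> = foldr (\<lambda>j. partial_deriv j ^^ \<alpha> j) xs \<psi>" for \<psi>
    using xs by (intro foldr_cong) auto
  have id1: "foldr (\<lambda>j. partial_deriv j ^^ (\<alpha>(i := Suc (\<alpha> i))) j) ys \<psi> = \<psi>"
    and id2: "foldr (\<lambda>j. partial_deriv j ^^ \<alpha> j) ys \<psi> = \<psi>" for \<psi>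
    using ys assms by (auto intro!: id)
  show ?thesis
    unfolding classical_deriv_def xy foldr_append foldr.simps o_apply id1 id2 cong
    by (simp add: funpow_swap1)
qed

lemma mindex_order_upd: "mindex_order (\<alpha>(i := Suc (\<alpha> i))) = Suc (mindex_order \<alpha>)"
  unfolding mindex_order_def by (simp add: sum.remove[of UNIV i])

lemma mindex_order_0: "mindex_order (\<lambda>_. 0) = 0"
  by (simp add: mindex_order_def)

text \<open>Every multi-index is reached by raising its largest occurring coordinate last, which is
  the order that \<open>classical_deriv_max_index\<close> requires.\<close>

lemma mindex_induct [case_names zero upd]:
  fixes P :: "('d::{finite,linorder} \<Rightarrow> nat) \<Rightarrow> bool"
  assumes "P (\<lambda>_. 0)"
    and step: "\<And>\<alpha> i. (\<And>j. i < j \<Longrightarrow> \<alpha> j = 0) \<Longrightarrow> P \<alpha> \<Longrightarrow> P (\<alpha>(i := Suc (\<alpha> i)))"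
  shows "P \<alpha>"
proof (induction "mindex_order \<alpha>" arbitrary: \<alpha>)
  case 0
  then have "\<alpha> = (\<lambda>_. 0)" by (auto simp: mindex_order_def)
  then show ?case using assms by simp
next
  case (Suc n)
  have ne: "{j. \<alpha> j \<noteq> 0} \<noteq> {}"
  proof
    assume "{j. \<alpha> j \<noteq> 0} = {}"
    then show False using Suc(2) by (simp add: mindex_order_def)
  qed
  define i where "i = Max {j. \<alpha> j \<noteq> 0}"
  have i: "\<alpha> i \<noteq> 0" using Max_in[of "{j. \<alpha> j \<noteq> 0}"] ne by (auto simp: i_def)
  have max: "\<alpha> j = 0" if "i < j" for j
    using Max_ge[of "{j. \<alpha> j \<noteq> 0}" j] that unfolding i_def by fastforce
  define \<beta> where "\<beta> = \<alpha>(i := \<alpha> i - 1)"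
  have \<alpha>: "\<alpha> = \<beta>(i := Suc (\<beta> i))" using i by (auto simp: \<beta>_def)
  have "n = mindex_order \<beta>" using Suc(2) mindex_order_upd[of \<beta> i] \<alpha> by simp
  then have "P \<beta>" by (rule Suc(1))
  moreover have "\<beta> j = 0" if "i < j" for j using max[OF that] that by (simp add: \<beta>_def)
  ultimately show ?case by (subst \<alpha>) (rule step)
qed

lemma bweak_unique:
  assumes \<Omega>: "open \<Omega>" and "bweak \<Omega> \<alpha> u v" "bweak \<Omega> \<alpha> u v'"
  shows "AE x in lborel. x \<in> \<Omega> \<longrightarrow> v x = v' x"
proof -
  have v: "loc_int \<Omega> v" "loc_int \<Omega> v'" using assms by (auto simp: bweak_def)
  have "loc_int \<Omega> (\<lambda>x. v x - v' x)"
    using v by (auto simp: loc_int_def intro!: set_integral_diff)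
  moreover have "(LINT x|lborel. \<phi> x *\<^sub>R (v x - v' x)) = 0" if "box_test \<Omega> \<phi>" for \<phi>
  proof -
    have \<phi>: "\<phi> \<in> test_functions \<Omega>" using box_test_imp_test_functions[OF that] .
    have "(-1) ^ mindex_order \<alpha> *\<^sub>R (LINT x|lborel. \<phi> x *\<^sub>R v x) = (-1) ^ mindex_order \<alpha> *\<^sub>R (LINT x|lborel. \<phi> x *\<^sub>R v' x)"
      using assms \<phi> by (auto simp: bweak_def)
    then have "(LINT x|lborel. \<phi> x *\<^sub>R v x) = (LINT x|lborel. \<phi> x *\<^sub>R v' x)" by simp
    then show ?thesis
      using test_function_integrable[OF \<phi> v(1)] test_function_integrable[OF \<phi> v(2)]
      by (simp add: scaleR_diff_right)
  qed
  ultimately have "AE x in lborel. x \<in> \<Omega> \<longrightarrow> v x - v' x = 0"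
    by (rule fundamental_lemma[OF \<Omega>])
  then show ?thesis by simp
qed

lemma bweak_zero: "loc_int \<Omega> u \<Longrightarrow> bweak \<Omega> (\<lambda>_. 0) u u"
  by (simp add: bweak_def classical_deriv_0 mindex_order_0)

lemma bweak_imp_ac_on_lines:
  assumes \<Omega>: "open \<Omega>" and w: "bweak \<Omega> \<alpha> u w" and z: "bweak \<Omega> (\<alpha>(i := Suc (\<alpha> i))) u z"
  shows "ac_on_lines \<Omega> i w z"
proof (rule weak_imp_ac_on_lines[OF \<Omega>])
  fix \<phi> assume bt: "box_test \<Omega> \<phi>"
  note \<phi> = box_test_imp_test_functions[OF bt]
  have "(-1) ^ mindex_order \<alpha> *\<^sub>R (LINT x|lborel. partial_deriv i \<phi> x *\<^sub>R w x) =
     (LINT x|lborel. classical_deriv \<alpha> (partial_deriv i \<phi>) x *\<^sub>R u x)"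
    using w test_functions_partial_deriv[OF \<phi>, of i] by (auto simp: bweak_def)
  also have "\<dots> = (-1) ^ Suc (mindex_order \<alpha>) *\<^sub>R (LINT x|lborel. \<phi> x *\<^sub>R z x)"
    using z \<phi> unfolding box_test_classical_deriv[OF bt] bweak_def mindex_order_upd by blast
  also have "\<dots> = (-1) ^ mindex_order \<alpha> *\<^sub>R (- (LINT x|lborel. \<phi> x *\<^sub>R z x))" by simp
  finally show "(LINT x|lborel. partial_deriv i \<phi> x *\<^sub>R w x) = - (LINT x|lborel. \<phi> x *\<^sub>R z x)"
    by (simp del: scaleR_minus_right)
qed (use w z in \<open>auto simp: bweak_def\<close>)

text \<open>The conclusion concerns all test functions, not only tensor products; hence
  \<open>i\<close> may not precede a coordinate that already occurs in
  \<open>\<alpha>\<close>.\<close>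

lemma bweak_step:
  assumes \<Omega>: "open \<Omega>" and w: "bweak \<Omega> \<alpha> u w" and z: "loc_int \<Omega> z"
    and ac: "ac_on_lines \<Omega> i w z" and i: "\<And>j. i < j \<Longrightarrow> \<alpha> j = 0"
  shows "bweak \<Omega> (\<alpha>(i := Suc (\<alpha> i))) u z"
proof -
  have "(LINT x|lborel. classical_deriv (\<alpha>(i := Suc (\<alpha> i))) \<phi> x *\<^sub>R u x) =
      (-1) ^ mindex_order (\<alpha>(i := Suc (\<alpha> i))) *\<^sub>R (LINT x|lborel. \<phi> x *\<^sub>R z x)"
    if \<phi>: "\<phi> \<in> test_functions \<Omega>" for \<phi>
  proof -
    have lw: "loc_int \<Omega> w" using w by (simp add: bweak_def)
    have cd: "classical_deriv (\<alpha>(i := Suc (\<alpha> i))) \<phi> = classical_deriv \<alpha> (partial_deriv i \<phi>)"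
      by (rule classical_deriv_max_index) (rule i)
    have "(LINT x|lborel. classical_deriv (\<alpha>(i := Suc (\<alpha> i))) \<phi> x *\<^sub>R u x) =
      (-1) ^ mindex_order \<alpha> *\<^sub>R (LINT x|lborel. partial_deriv i \<phi> x *\<^sub>R w x)"
      using w test_functions_partial_deriv[OF \<phi>, of i]
      unfolding cd bweak_def by blast
    also have "(LINT x|lborel. partial_deriv i \<phi> x *\<^sub>R w x) = - (LINT x|lborel. \<phi> x *\<^sub>R z x)"
      by (rule ac_on_lines_imp_weak[OF \<Omega> lw z ac \<phi>])
    finally show ?thesis by (simp add: mindex_order_upd del: fun_upd_apply)
  qed
  then show ?thesis using w z by (simp add: bweak_def)
qed

text \<open>Compatibility is demanded in every direction, so a family records all routes to the same
  multi-index at once. Members of order above \<open>m\<close> are unconstrained.\<close>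

definition ac_family ::
    "(real ^ 'd::{finite,linorder}) set \<Rightarrow> nat \<Rightarrow> (('d \<Rightarrow> nat) \<Rightarrow> real ^ 'd::{finite,linorder} \<Rightarrow> 'b::euclidean_space) \<Rightarrow> bool" where
  "ac_family \<Omega> m U \<longleftrightarrow> (\<forall>\<alpha>. mindex_order \<alpha> \<le> m \<longrightarrow> loc_int \<Omega> (U \<alpha>)) \<and>
     (\<forall>\<alpha> i. mindex_order \<alpha> < m \<longrightarrow> ac_on_lines \<Omega> i (U \<alpha>) (U (\<alpha>(i := Suc (\<alpha> i)))))"

lemma ac_family_bweak:
  assumes \<Omega>: "open \<Omega>" and U: "ac_family \<Omega> m U" and \<alpha>: "mindex_order \<alpha> \<le> m"
  shows "bweak \<Omega> \<alpha> (U (\<lambda>_. 0)) (U \<alpha>)"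
  using \<alpha>
proof (induction \<alpha> rule: mindex_induct)
  case zero
  then show ?case using U by (intro bweak_zero) (auto simp: ac_family_def)
next
  case (upd \<alpha> i)
  then show ?case
    using U unfolding mindex_order_upd ac_family_def
    by (intro bweak_step[OF \<Omega>, of \<alpha> _ "U \<alpha>"]) (simp_all add: mindex_order_upd del: fun_upd_apply)
qed

section \<open>Passage from Lebesgue measurable functions to Borel representatives\<close>

lemma lebesgue_borel_version:
  fixes v :: "'a::euclidean_space \<Rightarrow> 'b::euclidean_space"
  assumes "v \<in> borel_measurable lebesgue"
  obtains w where "w \<in> borel_measurable borel" "AE x in lborel. v x = w x"
proof -
  have "\<exists>g. g \<in> borel_measurable lborel \<and> (AE x in lborel. v x \<bullet> b = g x)" for b
    using completion_ex_borel_measurable_real[of "\<lambda>x. v x \<bullet> b" lborel] assms by auto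
  then obtain g where g: "\<And>b. g b \<in> borel_measurable lborel" "\<And>b. AE x in lborel. v x \<bullet> b = g b x"
    by metis
  have "AE x in lborel. \<forall>b\<in>Basis. v x \<bullet> b = g b x"
    by (subst AE_ball_countable) (auto simp: g(2) countable_finite)
  then have "AE x in lborel. v x = (\<Sum>b\<in>Basis. g b x *\<^sub>R b)"
    by eventually_elim (metis (no_types, lifting) euclidean_representation sum.cong)
  moreover have "(\<lambda>x. \<Sum>b\<in>Basis. g b x *\<^sub>R b) \<in> borel_measurable borel"
    using g(1) by auto
  ultimately show ?thesis using that by blast
qed

lemma set_integrable_lebesgue_iff:
  fixes v w :: "'a::euclidean_space \<Rightarrow> 'b::euclidean_space"
  assumes v: "v \<in> borel_measurable (lebesgue_on \<Omega>)" and \<Omega>: "\<Omega> \<in> sets borel"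
    and w[measurable]: "w \<in> borel_measurable borel" and eq: "AE x in lborel. x \<in> \<Omega> \<longrightarrow> v x = w x"
    and K: "K \<subseteq> \<Omega>" and [measurable]: "K \<in> sets borel"
  shows "set_integrable lebesgue K v \<longleftrightarrow> set_integrable lborel K w"
proof -
  have v': "(\<lambda>x. if x \<in> \<Omega> then v x else 0) \<in> borel_measurable lebesgue"
    using v \<Omega> by (subst borel_measurable_if) auto
  have [measurable]: "K \<in> sets lebesgue" by simp
  have "(\<lambda>x. indicator K x *\<^sub>R (if x \<in> \<Omega> then v x else 0)) \<in> borel_measurable lebesgue"
    using v' by measurable
  also have "(\<lambda>x. indicator K x *\<^sub>R (if x \<in> \<Omega> then v x else 0)) = (\<lambda>x. indicator K x *\<^sub>R v x)"
    by (rule ext) (use K in \<open>auto simp: indicator_def\<close>)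
  finally have m: "(\<lambda>x. indicator K x *\<^sub>R v x) \<in> borel_measurable lebesgue" .
  have "AE x in lebesgue. indicator K x *\<^sub>R v x = indicator K x *\<^sub>R w x"
    using AE_completion[OF eq] by eventually_elim (use K in \<open>auto simp: indicator_def\<close>)
  then have "set_integrable lebesgue K v \<longleftrightarrow> integrable lebesgue (\<lambda>x. indicat_real K x *\<^sub>R w x)"
    unfolding set_integrable_def using m by (intro integrable_cong_AE) (auto intro: measurable_completion)
  also have "\<dots> \<longleftrightarrow> set_integrable lborel K w"
    unfolding set_integrable_def by (rule integrable_completion) measurable
  finally show ?thesis .
qed

text \<open>Total Borel functions are preferred because translations, dilations and Fubini on
  products of \<open>lborel\<close> then preserve measurability; the change on a null set does not
  affect integrals against test functions.\<close>

lemma loc_int_borel_version: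
  fixes v :: "real ^ 'd::finite \<Rightarrow> 'b::euclidean_space"
  assumes \<Omega>: "open \<Omega>" and v: "locally_integrable_on v \<Omega>"
  obtains w where "loc_int \<Omega> w" "AE x in lborel. x \<in> \<Omega> \<longrightarrow> v x = w x"
proof -
  have vm: "v \<in> borel_measurable (lebesgue_on \<Omega>)" using v by (simp add: locally_integrable_on_def)
  have "(\<lambda>x. if x \<in> \<Omega> then v x else 0) \<in> borel_measurable lebesgue"
    using vm \<Omega> by (subst borel_measurable_if) auto
  then obtain w where w: "w \<in> borel_measurable borel" "AE x in lborel. (if x \<in> \<Omega> then v x else 0) = w x"
    by (rule lebesgue_borel_version)
  have eq: "AE x in lborel. x \<in> \<Omega> \<longrightarrow> v x = w x" using w(2) by eventually_elim auto
  have "loc_int \<Omega> w"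
    unfolding loc_int_def
    using v set_integrable_lebesgue_iff[OF vm _ w(1) eq] \<Omega> w(1)
    by (auto simp: locally_integrable_on_def borel_compact)
  then show ?thesis using eq that by blast
qed

lemma test_integral_lebesgue:
  fixes v w :: "real ^ 'd::finite \<Rightarrow> 'b::euclidean_space"
  assumes \<Omega>: "open \<Omega>" and \<phi>: "\<phi> \<in> test_functions \<Omega>"
    and v: "v \<in> borel_measurable (lebesgue_on \<Omega>)" and w: "w \<in> borel_measurable borel"
    and eq: "AE x in lborel. x \<in> \<Omega> \<longrightarrow> v x = w x"
  shows "(LINT x:\<Omega>|lebesgue. \<phi> x *\<^sub>R v x) = (LINT x|lborel. \<phi> x *\<^sub>R w x)"
proof -
  note [measurable] = test_function_measurable[OF \<phi>] w
  have v': "(\<lambda>x. if x \<in> \<Omega> then v x else 0) \<in> borel_measurable lebesgue"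
    using v \<Omega> by (subst borel_measurable_if) auto
  have "\<phi> \<in> borel_measurable lebesgue" using test_function_measurable[OF \<phi>] by (intro measurable_completion) simp
  then have "(\<lambda>x. \<phi> x *\<^sub>R (if x \<in> \<Omega> then v x else 0)) \<in> borel_measurable lebesgue"
    using v' by measurable
  moreover have e: "indicator \<Omega> x *\<^sub>R \<phi> x *\<^sub>R v x = \<phi> x *\<^sub>R (if x \<in> \<Omega> then v x else 0)" for x by simp
  moreover have "(\<lambda>x. \<phi> x *\<^sub>R w x) \<in> borel_measurable lborel" by measurable
  moreover have "AE x in lebesgue. indicator \<Omega> x *\<^sub>R \<phi> x *\<^sub>R v x = \<phi> x *\<^sub>R w x"
    using AE_completion[OF eq]
  proof eventually_elim
    case (elim x)
    show ?case
    proof (cases "x \<in> \<Omega>")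
      case False
      then have "x \<notin> closure {x. \<phi> x \<noteq> 0}" using test_functionsD(3)[OF \<phi>] by blast
      then have "\<phi> x = 0" by (rule test_functionsD(4)[OF \<phi>])
      then show ?thesis by simp
    qed (use elim in simp)
  qed
  ultimately have "(LINT x:\<Omega>|lebesgue. \<phi> x *\<^sub>R v x) = (LINT x|lebesgue. \<phi> x *\<^sub>R w x)"
    unfolding set_lebesgue_integral_def e by (intro integral_cong_AE) (auto intro: measurable_completion)
  also have "\<dots> = (LINT x|lborel. \<phi> x *\<^sub>R w x)"
    by (rule integral_completion) measurable
  finally show ?thesis .
qed

lemma is_weak_deriv_iff_bweak:
  fixes u v u' v' :: "real ^ 'd::{finite,linorder} \<Rightarrow> 'b::euclidean_space"
  assumes \<Omega>: "open \<Omega>"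
    and m: "u \<in> borel_measurable (lebesgue_on \<Omega>)" "v \<in> borel_measurable (lebesgue_on \<Omega>)"
      "u' \<in> borel_measurable borel" "v' \<in> borel_measurable borel"
    and eq: "AE x in lborel. x \<in> \<Omega> \<longrightarrow> u x = u' x" "AE x in lborel. x \<in> \<Omega> \<longrightarrow> v x = v' x"
  shows "is_weak_deriv \<Omega> \<alpha> u v \<longleftrightarrow> bweak \<Omega> \<alpha> u' v'"
proof -
  have b: "\<Omega> \<in> sets borel" using \<Omega> by simp
  have "locally_integrable_on u \<Omega> \<longleftrightarrow> loc_int \<Omega> u'"
    using set_integrable_lebesgue_iff[OF m(1) b m(3) eq(1)] m
    by (auto simp: locally_integrable_on_def loc_int_def borel_compact)
  moreover have "locally_integrable_on v \<Omega> \<longleftrightarrow> loc_int \<Omega> v'"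
    using set_integrable_lebesgue_iff[OF m(2) b m(4) eq(2)] m
    by (auto simp: locally_integrable_on_def loc_int_def borel_compact)
  moreover have "(LINT x:\<Omega>|lebesgue. classical_deriv \<alpha> \<phi> x *\<^sub>R u x) = (LINT x|lborel. classical_deriv \<alpha> \<phi> x *\<^sub>R u' x)"
    "(LINT x:\<Omega>|lebesgue. \<phi> x *\<^sub>R v x) = (LINT x|lborel. \<phi> x *\<^sub>R v' x)" if "\<phi> \<in> test_functions \<Omega>" for \<phi>
    using that test_functions_classical_deriv[OF that] by (intro test_integral_lebesgue[OF \<Omega>] m eq; simp)+
  ultimately show ?thesis unfolding is_weak_deriv_def bweak_def by auto
qed

lemma weak_derivs_imp_ac_family:
  fixes u :: "real ^ 'd::{finite,linorder} \<Rightarrow> 'b::euclidean_space"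
  assumes \<Omega>: "open \<Omega>" and u: "\<And>\<alpha>. mindex_order \<alpha> \<le> m \<Longrightarrow> \<exists>v. is_weak_deriv \<Omega> \<alpha> u v"
  obtains U where "ac_family \<Omega> m U" "AE x in lborel. x \<in> \<Omega> \<longrightarrow> u x = U (\<lambda>_. 0) x"
proof -
  have "locally_integrable_on u \<Omega>"
    using u[of "\<lambda>_. 0"] by (auto simp: is_weak_deriv_def mindex_order_0)
  then have um: "u \<in> borel_measurable (lebesgue_on \<Omega>)" by (simp add: locally_integrable_on_def)
  obtain u' where u': "loc_int \<Omega> u'" "AE x in lborel. x \<in> \<Omega> \<longrightarrow> u x = u' x"
    using loc_int_borel_version[OF \<Omega> \<open>locally_integrable_on u \<Omega>\<close>] by blast
  have "\<exists>w. bweak \<Omega> \<alpha> u' w" if \<alpha>: "mindex_order \<alpha> \<le> m" for \<alpha>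
  proof -
    obtain v where v: "is_weak_deriv \<Omega> \<alpha> u v" using u[OF \<alpha>] by blast
    then have lv: "locally_integrable_on v \<Omega>" by (simp add: is_weak_deriv_def)
    then obtain w where w: "loc_int \<Omega> w" "AE x in lborel. x \<in> \<Omega> \<longrightarrow> v x = w x"
      using loc_int_borel_version[OF \<Omega>] by blast
    then show ?thesis
      using v is_weak_deriv_iff_bweak[OF \<Omega> um _ loc_int_measurable[OF u'(1)] loc_int_measurable[OF w(1)] u'(2) w(2)] lv
      by (auto simp: locally_integrable_on_def)
  qed
  then obtain W where W: "\<And>\<alpha>. mindex_order \<alpha> \<le> m \<Longrightarrow> bweak \<Omega> \<alpha> u' (W \<alpha>)" by metis
  \<comment> \<open>A weak derivative of order 0 agrees with \<open>u'\<close> only almost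
    everywhere; overwriting index 0 makes the family start with \<open>u'\<close> itself.\<close>
  define U where "U = W((\<lambda>_. 0) := u')"
  have U: "bweak \<Omega> \<alpha> u' (U \<alpha>)" if "mindex_order \<alpha> \<le> m" for \<alpha>
    using W[OF that] bweak_zero[OF u'(1)] by (simp add: U_def)
  have "ac_family \<Omega> m U"
    unfolding ac_family_def
  proof (intro conjI allI impI)
    fix \<alpha> :: "'d \<Rightarrow> nat" assume "mindex_order \<alpha> \<le> m"
    then show "loc_int \<Omega> (U \<alpha>)" using U by (simp add: bweak_def)
  next
    fix \<alpha> :: "'d \<Rightarrow> nat" and i assume "mindex_order \<alpha> < m"
    then show "ac_on_lines \<Omega> i (U \<alpha>) (U (\<alpha>(i := Suc (\<alpha> i))))"
      by (intro bweak_imp_ac_on_lines[OF \<Omega> U U]) (simp_all add: mindex_order_upd)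
  qed
  then show ?thesis using u'(2) that by (simp add: U_def)
qed

text \<open>By uniqueness the function selected by choice in \<open>weak_deriv\<close> agrees almost
  everywhere with the member of the family; this is what makes the energy computable from any
  family.\<close>

lemma ac_family_imp_weak_derivs:
  fixes u :: "real ^ 'd::{finite,linorder} \<Rightarrow> 'b::euclidean_space"
  assumes \<Omega>: "open \<Omega>" and um: "u \<in> borel_measurable (lebesgue_on \<Omega>)"
    and U: "ac_family \<Omega> m U" and eq: "AE x in lborel. x \<in> \<Omega> \<longrightarrow> u x = U (\<lambda>_. 0) x"
    and \<alpha>: "mindex_order \<alpha> \<le> m"
  shows "is_weak_deriv \<Omega> \<alpha> u (U \<alpha>)" "AE x in lborel. x \<in> \<Omega> \<longrightarrow> weak_deriv \<Omega> \<alpha> u x = U \<alpha> x"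
proof -
  have b: "bweak \<Omega> \<alpha> (U (\<lambda>_. 0)) (U \<alpha>)" by (rule ac_family_bweak[OF \<Omega> U \<alpha>])
  then have m: "U (\<lambda>_. 0) \<in> borel_measurable borel" "U \<alpha> \<in> borel_measurable borel"
    by (auto simp: bweak_def loc_int_def)
  have "U \<alpha> \<in> borel_measurable (lebesgue_on \<Omega>)"
    using m(2) by (intro measurable_restrict_space1 measurable_completion) simp
  then show 1: "is_weak_deriv \<Omega> \<alpha> u (U \<alpha>)"
    using is_weak_deriv_iff_bweak[OF \<Omega> um _ m eq, of "U \<alpha>"] b by simp
  have wd: "is_weak_deriv \<Omega> \<alpha> u (weak_deriv \<Omega> \<alpha> u)"
    unfolding weak_deriv_def by (rule someI[of "is_weak_deriv \<Omega> \<alpha> u", OF 1])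
  then have lv: "locally_integrable_on (weak_deriv \<Omega> \<alpha> u) \<Omega>" by (simp add: is_weak_deriv_def)
  then obtain w where w: "loc_int \<Omega> w" "AE x in lborel. x \<in> \<Omega> \<longrightarrow> weak_deriv \<Omega> \<alpha> u x = w x"
    using loc_int_borel_version[OF \<Omega>] by blast
  have "bweak \<Omega> \<alpha> (U (\<lambda>_. 0)) w"
    using wd is_weak_deriv_iff_bweak[OF \<Omega> um _ m(1) loc_int_measurable[OF w(1)] eq w(2)] lv
    by (auto simp: locally_integrable_on_def)
  from bweak_unique[OF \<Omega> this b] w(2)
  show "AE x in lborel. x \<in> \<Omega> \<longrightarrow> weak_deriv \<Omega> \<alpha> u x = U \<alpha> x" by eventually_elim auto
qed

section \<open>The weight and the energy of a family of derivatives\<close>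

lemma finite_mindex_le: "finite {\<alpha> :: 'd::finite \<Rightarrow> nat. mindex_order \<alpha> \<le> m}"
proof (rule finite_subset)
  show "{\<alpha> :: 'd \<Rightarrow> nat. mindex_order \<alpha> \<le> m} \<subseteq> PiE UNIV (\<lambda>_. {..m})"
  proof
    fix \<alpha> :: "'d \<Rightarrow> nat" assume "\<alpha> \<in> {\<alpha>. mindex_order \<alpha> \<le> m}"
    then have "\<alpha> i \<le> m" for i
      using member_le_sum[of i UNIV \<alpha>] by (simp add: mindex_order_def)
    then show "\<alpha> \<in> PiE UNIV (\<lambda>_. {..m})" by (intro PiE_I) auto
  qed
  show "finite (PiE (UNIV :: 'd set) (\<lambda>_. {..m}))" by (intro finite_PiE) auto
qed

lemma rho_continuous: "continuous_on UNIV (rho l)"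
  unfolding rho_def[abs_def] by (intro continuous_intros)

lemma rho_measurable [measurable]: "rho l \<in> borel_measurable borel"
  by (intro borel_measurable_continuous_onI rho_continuous)

lemma rho_pos_iff: "0 < rho l x \<longleftrightarrow> x \<in> - singular_set l"
proof -
  have fin: "finite (leading_coords (CARD('a) - l) :: 'a set)" by simp
  have "0 < (\<Sum>i\<in>leading_coords (CARD('a) - l). \<bar>x $ i\<bar>\<^sup>2) \<longleftrightarrow> \<not> (\<forall>i\<in>leading_coords (CARD('a) - l). x $ i = 0)"
    using sum_nonneg_eq_0_iff[OF fin, of "\<lambda>i. \<bar>x $ i\<bar>\<^sup>2"] sum_nonneg[of "leading_coords (CARD('a) - l)" "\<lambda>i. \<bar>x $ i\<bar>\<^sup>2"]
    by (auto simp: less_le)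
  then show ?thesis by (simp add: rho_def singular_set_def)
qed

lemma open_regular_set: "open (- singular_set l)"
proof -
  have "- singular_set l = rho l -` {0<..}" using rho_pos_iff[of l] by auto
  then show ?thesis using open_vimage[OF open_greaterThan rho_continuous] by metis
qed

definition family_energy ::
    "nat \<Rightarrow> real \<Rightarrow> real \<Rightarrow> nat \<Rightarrow> (('d::{finite,linorder} \<Rightarrow> nat) \<Rightarrow> real ^ 'd::{finite,linorder} \<Rightarrow> 'b::euclidean_space) \<Rightarrow> ennreal" where
  "family_energy m a p l U = (\<Sum>\<alpha> | mindex_order \<alpha> \<le> m. \<integral>\<^sup>+ x \<in> - singular_set l.
     ennreal ((rho l x powr (real (mindex_order \<alpha>) - a) * norm (U \<alpha> x)) powr p) \<partial>lborel)"

lemma kondratiev_energy_eq: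
  fixes u :: "real ^ 'd::{finite,linorder} \<Rightarrow> 'b::euclidean_space"
  assumes "u \<in> borel_measurable (lebesgue_on (- singular_set l))"
    and U: "ac_family (- singular_set l) m U" and eq: "AE x in lborel. x \<in> - singular_set l \<longrightarrow> u x = U (\<lambda>_. 0) x"
  shows "kondratiev_energy m a p l u = family_energy m a p l U"
  unfolding kondratiev_energy_def family_energy_def nn_integral_completion
proof (rule sum.cong[OF refl], rule nn_integral_cong_AE)
  fix \<alpha> :: "'d \<Rightarrow> nat" assume "\<alpha> \<in> {\<alpha>. mindex_order \<alpha> \<le> m}"
  then have "AE x in lborel. x \<in> - singular_set l \<longrightarrow> weak_deriv (- singular_set l) \<alpha> u x = U \<alpha> x"
    using ac_family_imp_weak_derivs(2)[OF open_regular_set assms] by simp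
  then show "AE x in lborel. ennreal (norm (rho l x powr (real (mindex_order \<alpha>) - a) *\<^sub>R weak_deriv (- singular_set l) \<alpha> u x) powr p) * indicator (- singular_set l) x =
      ennreal ((rho l x powr (real (mindex_order \<alpha>) - a) * norm (U \<alpha> x)) powr p) * indicator (- singular_set l) x"
    by eventually_elim (auto simp: indicator_def)
qed

lemma kondratiev_spaceE:
  fixes u :: "real ^ 'd::{finite,linorder} \<Rightarrow> 'b::euclidean_space"
  assumes "u \<in> kondratiev_space m a p l"
  obtains U where "ac_family (- singular_set l) m U" "AE x in lborel. x \<in> - singular_set l \<longrightarrow> u x = U (\<lambda>_. 0) x"
    "u \<in> borel_measurable (lebesgue_on (- singular_set l))"
    "kondratiev_energy m a p l u = family_energy m a p l U" "family_energy m a p l U < \<infinity>"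
proof -
  have u: "u \<in> borel_measurable (lebesgue_on (- singular_set l))" "kondratiev_energy m a p l u < \<infinity>"
    and ex: "\<And>\<alpha>. mindex_order \<alpha> \<le> m \<Longrightarrow> \<exists>v. is_weak_deriv (- singular_set l) \<alpha> u v"
    using assms by (auto simp: kondratiev_space_def)
  obtain U where U: "ac_family (- singular_set l) m U" "AE x in lborel. x \<in> - singular_set l \<longrightarrow> u x = U (\<lambda>_. 0) x"
    using weak_derivs_imp_ac_family[OF open_regular_set ex] by blast
  show ?thesis using that[OF U u(1) kondratiev_energy_eq[OF u(1) U]] u(2) kondratiev_energy_eq[OF u(1) U] by metis
qed

lemma kondratiev_spaceI:
  fixes u :: "real ^ 'd::{finite,linorder} \<Rightarrow> 'b::euclidean_space"
  assumes "u \<in> borel_measurable (lebesgue_on (- singular_set l))"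
    and "ac_family (- singular_set l) m U" "AE x in lborel. x \<in> - singular_set l \<longrightarrow> u x = U (\<lambda>_. 0) x"
    and "family_energy m a p l U < \<infinity>"
  shows "u \<in> kondratiev_space m a p l"
  unfolding kondratiev_space_def
  using assms(1,4) ac_family_imp_weak_derivs(1)[OF open_regular_set assms(1-3)] kondratiev_energy_eq[OF assms(1-3)] by auto

section \<open>The Leibniz rule\<close>

lemma integrable_pair_mult:
  fixes a b :: "real \<Rightarrow> 'b::{real_normed_field,euclidean_space}"
  assumes a: "integrable lborel a" and b: "integrable lborel b"
  shows "integrable (lborel \<Otimes>\<^sub>M lborel) (\<lambda>(x, y). a x * b y)"
proof (rule integrableI_bounded)
  have [measurable]: "a \<in> borel_measurable borel" "b \<in> borel_measurable borel"
    using a b borel_measurable_integrable by force+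
  show "(\<lambda>(x, y). a x * b y) \<in> borel_measurable (lborel \<Otimes>\<^sub>M lborel)" by measurable
  have "(\<integral>\<^sup>+ p. ennreal (norm (case p of (x, y) \<Rightarrow> a x * b y)) \<partial>(lborel \<Otimes>\<^sub>M lborel))
    = (\<integral>\<^sup>+ x. ennreal (norm (a x)) * (\<integral>\<^sup>+ y. ennreal (norm (b y)) \<partial>lborel) \<partial>lborel)"
    by (subst lborel.nn_integral_fst[symmetric])
       (simp_all add: nn_integral_cmult[symmetric] ennreal_mult norm_mult)
  also have "\<dots> < \<infinity>"
    using a b by (simp add: nn_integral_multc integrable_iff_bounded ennreal_mult_less_top)
  finally show "(\<integral>\<^sup>+ p. ennreal (norm (case p of (x, y) \<Rightarrow> a x * b y)) \<partial>(lborel \<Otimes>\<^sub>M lborel)) < \<infinity>" .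
qed

text \<open>Integration by parts for primitives of integrable functions, by splitting the square
  \<open>[0, t]\<^sup>2\<close> along the diagonal.\<close>

lemma integral_primitive_mult:
  fixes a b :: "real \<Rightarrow> 'b::{real_normed_field,euclidean_space}"
  assumes a: "integrable lborel a" and b: "integrable lborel b"
  defines "A \<equiv> \<lambda>s. LINT r|lborel. indicator {..s} r *\<^sub>R a r" and "B \<equiv> \<lambda>s. LINT r|lborel. indicator {..s} r *\<^sub>R b r"
  shows "integrable lborel (\<lambda>s. a s * B s)" "integrable lborel (\<lambda>s. A s * b s)"
    "(LINT s|lborel. a s * B s) + (LINT s|lborel. A s * b s) = (LINT s|lborel. a s) * (LINT s|lborel. b s)"
proof -
  have [measurable]: "a \<in> borel_measurable borel" "b \<in> borel_measurable borel"
    using a b borel_measurable_integrable by force+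
  note ab = integrable_pair_mult[OF a b]
  have i1: "integrable (lborel \<Otimes>\<^sub>M lborel) (\<lambda>(s, r). indicator {..s} r *\<^sub>R (a s * b r))"
    by (rule Bochner_Integration.integrable_bound[OF ab])
       (auto simp: indicator_def split_beta measurable_split_conv)
  have i2: "integrable (lborel \<Otimes>\<^sub>M lborel) (\<lambda>(s, r). indicator {..r} s *\<^sub>R (a s * b r))"
    by (rule Bochner_Integration.integrable_bound[OF ab])
       (auto simp: indicator_def split_beta measurable_split_conv)
  have e1: "(LINT r|lborel. indicator {..s} r *\<^sub>R (a s * b r)) = a s * B s" for s
    unfolding B_def by (simp add: mult_scaleR_right[symmetric] del: mult_scaleR_right)
  have e2: "(LINT s|lborel. indicator {..r} s *\<^sub>R (a s * b r)) = A r * b r" for r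
    unfolding A_def by (simp add: mult_scaleR_left[symmetric] del: mult_scaleR_left)
  show "integrable lborel (\<lambda>s. a s * B s)"
    using lborel_pair.integrable_fst[OF i1] by (simp add: e1)
  show "integrable lborel (\<lambda>s. A s * b s)"
    using lborel_pair.integrable_snd[OF i2] by (simp add: e2)
  have "(LINT s|lborel. a s * B s) + (LINT r|lborel. A r * b r) =
     (LINT s|lborel. LINT r|lborel. indicator {..s} r *\<^sub>R (a s * b r)) + (LINT s|lborel. LINT r|lborel. indicator {..r} s *\<^sub>R (a s * b r))"
    by (simp only: e1 e2 lborel_pair.Fubini_integral[OF i2, symmetric])
  also have "\<dots> = (LINT s|lborel. (LINT r|lborel. indicator {..s} r *\<^sub>R (a s * b r)) + (LINT r|lborel. indicator {..r} s *\<^sub>R (a s * b r)))"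
    using lborel_pair.integrable_fst[OF i1] lborel_pair.integrable_fst[OF i2]
    by (simp add: Bochner_Integration.integral_add)
  also have "\<dots> = (LINT s|lborel. LINT r|lborel. a s * b r)"
  proof (rule Bochner_Integration.integral_cong[OF refl])
    fix s
    have bi: "integrable lborel (\<lambda>r. indicator X r *\<^sub>R (a s * b r))" if "X \<in> sets borel" for X
      using that b by (intro integrable_mult_indicator) auto
    have "(LINT r|lborel. indicator {..s} r *\<^sub>R (a s * b r)) + (LINT r|lborel. indicator {..r} s *\<^sub>R (a s * b r)) =
       (LINT r|lborel. indicator {..s} r *\<^sub>R (a s * b r)) + (LINT r|lborel. indicator {s..} r *\<^sub>R (a s * b r))"
      by (intro arg_cong2[of _ _ _ _ "(+)"] Bochner_Integration.integral_cong) (auto simp: indicator_def)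
    also have "\<dots> = (LINT r|lborel. indicator {..s} r *\<^sub>R (a s * b r) + indicator {s..} r *\<^sub>R (a s * b r))"
      by (intro Bochner_Integration.integral_add[symmetric] bi) auto
    also have "\<dots> = (LINT r|lborel. a s * b r)"
      by (intro integral_cong_AE)
         (auto intro!: eventually_mono[OF AE_lborel_singleton[of s]] simp: indicator_def)
    finally show "(LINT r|lborel. indicator {..s} r *\<^sub>R (a s * b r)) + (LINT r|lborel. indicator {..r} s *\<^sub>R (a s * b r)) = (LINT r|lborel. a s * b r)" .
  qed
  finally show "(LINT s|lborel. a s * B s) + (LINT s|lborel. A s * b s) = (LINT s|lborel. a s) * (LINT s|lborel. b s)"
    by simp
qed

text \<open>\<open>F\<close> and \<open>H\<close> are known to be primitives at almost every
  interior point and at the end point \<open>t\<close>. That suffices: interior values occur only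
  under the integral, and the boundary terms use only 0 and \<open>t\<close>.\<close>

lemma ac_product_rule_1d:
  fixes F G H K :: "real \<Rightarrow> 'b::{real_normed_field,euclidean_space}"
  assumes t: "0 \<le> t" and G: "set_integrable lborel {0..t} G" and K: "set_integrable lborel {0..t} K"
    and [measurable]: "F \<in> borel_measurable borel" "G \<in> borel_measurable borel" "H \<in> borel_measurable borel" "K \<in> borel_measurable borel"
    and F: "AE s in lborel. s \<in> {0..t} \<longrightarrow> F s - F 0 = (LINT r:{0..s}|lborel. G r)" "F t - F 0 = (LINT r:{0..t}|lborel. G r)"
    and H: "AE s in lborel. s \<in> {0..t} \<longrightarrow> H s - H 0 = (LINT r:{0..s}|lborel. K r)" "H t - H 0 = (LINT r:{0..t}|lborel. K r)"
  shows "F t * H t - F 0 * H 0 = (LINT s:{0..t}|lborel. G s * H s + F s * K s)"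
proof -
  define a where "a s = indicator {0..t} s *\<^sub>R G s" for s
  define b where "b s = indicator {0..t} s *\<^sub>R K s" for s
  define A where "A s = (LINT r|lborel. indicator {..s} r *\<^sub>R a r)" for s
  define B where "B s = (LINT r|lborel. indicator {..s} r *\<^sub>R b r)" for s
  have ia: "integrable lborel a" and ib: "integrable lborel b"
    using G K by (auto simp: a_def[abs_def] b_def[abs_def] set_integrable_def)
  note prim = integral_primitive_mult[OF ia ib, folded A_def B_def]
  have A: "A s = (LINT r:{0..s}|lborel. G r)" and B: "B s = (LINT r:{0..s}|lborel. K r)" if "s \<in> {0..t}" for s
    unfolding A_def B_def a_def b_def set_lebesgue_integral_def
    using that by (auto intro!: Bochner_Integration.integral_cong simp: indicator_def)
  have [measurable]: "a \<in> borel_measurable borel" "b \<in> borel_measurable borel"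
    unfolding a_def[abs_def] b_def[abs_def] by measurable
  have [measurable]: "A \<in> borel_measurable borel" "B \<in> borel_measurable borel"
  proof -
    have "(\<lambda>s. LINT r|lborel. indicator {..s} r *\<^sub>R a r) \<in> borel_measurable lborel"
      "(\<lambda>s. LINT r|lborel. indicator {..s} r *\<^sub>R b r) \<in> borel_measurable lborel"
      unfolding indicator_def atMost_iff by measurable
    then show "A \<in> borel_measurable borel" "B \<in> borel_measurable borel" by (simp_all add: A_def[abs_def] B_def[abs_def])
  qed
  have "(LINT s:{0..t}|lborel. G s * H s + F s * K s) = (LINT s|lborel. a s * H 0 + a s * B s + (F 0 * b s + A s * b s))"
    unfolding set_lebesgue_integral_def
  proof (rule integral_cong_AE)
    show "AE s in lborel. indicator {0..t} s *\<^sub>R (G s * H s + F s * K s) = a s * H 0 + a s * B s + (F 0 * b s + A s * b s)"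
      using F(1) H(1)
    proof eventually_elim
      case (elim s)
      show ?case
      proof (cases "s \<in> {0..t}")
        case True
        then have "F s = F 0 + A s" "H s = H 0 + B s" using elim A[OF True] B[OF True] by (auto simp: algebra_simps)
        then show ?thesis using True by (simp add: a_def b_def algebra_simps)
      qed (simp add: a_def b_def)
    qed
  qed measurable
  also have "\<dots> = (LINT s|lborel. a s * H 0 + a s * B s) + (LINT s|lborel. F 0 * b s + A s * b s)"
    using ia ib prim by (intro Bochner_Integration.integral_add Bochner_Integration.integrable_add integrable_mult_left integrable_mult_right) auto
  also have "(LINT s|lborel. a s * H 0 + a s * B s) = (LINT s|lborel. a s) * H 0 + (LINT s|lborel. a s * B s)"
    using ia prim by (subst Bochner_Integration.integral_add) auto
  also have "(LINT s|lborel. F 0 * b s + A s * b s) = F 0 * (LINT s|lborel. b s) + (LINT s|lborel. A s * b s)"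
    using ib prim by (subst Bochner_Integration.integral_add) auto
  also have "(LINT s|lborel. a s) = F t - F 0" using F(2) by (simp add: a_def set_lebesgue_integral_def)
  also have "(LINT s|lborel. b s) = H t - H 0" using H(2) by (simp add: b_def set_lebesgue_integral_def)
  finally show ?thesis
    using prim(3) F(2) H(2) by (simp add: a_def[abs_def] b_def[abs_def] set_lebesgue_integral_def algebra_simps)
qed

lemma ac_on_linesD:
  "ac_on_lines \<Omega> i f g \<Longrightarrow> 0 \<le> t \<Longrightarrow> AE x in lborel. (\<forall>s\<in>{0..t}. x + s *\<^sub>R axis i 1 \<in> \<Omega>) \<longrightarrow>
     f (x + t *\<^sub>R axis i 1) - f x = (LINT s:{0..t}|lborel. g (x + s *\<^sub>R axis i 1))"
  by (simp add: ac_on_lines_def)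

text \<open>For every \<open>s\<close> the identity holds at almost every \<open>x\<close>; Fubini
  turns this into almost every \<open>s\<close> for almost every \<open>x\<close>, which is all that
  integration along a line can see.\<close>

lemma ac_on_lines_AE_AE:
  fixes f g :: "real ^ 'd::finite \<Rightarrow> 'b::euclidean_space"
  assumes \<Omega>: "open \<Omega>" and f: "loc_int \<Omega> f" and g: "loc_int \<Omega> g" and ac: "ac_on_lines \<Omega> i f g"
  shows "AE x in lborel. (\<forall>s\<in>{0..t}. x + s *\<^sub>R axis i 1 \<in> \<Omega>) \<longrightarrow>
    (AE s in lborel. s \<in> {0..t} \<longrightarrow> f (x + s *\<^sub>R axis i 1) - f x = (LINT r:{0..s}|lborel. g (x + r *\<^sub>R axis i 1)))"
proof -
  let ?e = "axis i 1 :: real ^ 'd"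
  let ?O = "{x. \<forall>s\<in>{0..t}. x + s *\<^sub>R ?e \<in> \<Omega>}"
  note [measurable] = loc_int_measurable[OF f] loc_int_measurable[OF g]
  have [measurable]: "?O \<in> sets borel" using open_line_kernel[OF \<Omega>] by simp
  have [measurable]: "(\<lambda>p. LINT r|lborel. indicator {0..snd p} r *\<^sub>R g (fst p + r *\<^sub>R ?e)) \<in> borel_measurable (lborel \<Otimes>\<^sub>M lborel)"
    unfolding indicator_def atLeastAtMost_iff by measurable
  have "AE x in lborel. AE s in lborel. x \<in> ?O \<longrightarrow> s \<in> {0..t} \<longrightarrow> f (x + s *\<^sub>R ?e) - f x = (LINT r|lborel. indicator {0..s} r *\<^sub>R g (x + r *\<^sub>R ?e))"
  proof (subst lborel_pair.AE_commute)
    show "AE s in lborel. AE x in lborel. x \<in> ?O \<longrightarrow> s \<in> {0..t} \<longrightarrow> f (x + s *\<^sub>R ?e) - f x = (LINT r|lborel. indicator {0..s} r *\<^sub>R g (x + r *\<^sub>R ?e))"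
    proof (rule AE_I2)
      fix s
      show "AE x in lborel. x \<in> ?O \<longrightarrow> s \<in> {0..t} \<longrightarrow> f (x + s *\<^sub>R ?e) - f x = (LINT r|lborel. indicator {0..s} r *\<^sub>R g (x + r *\<^sub>R ?e))"
      proof (cases "s \<in> {0..t}")
        case True
        then show ?thesis
          using ac_on_linesD[OF ac, of s] unfolding set_lebesgue_integral_def by (auto elim!: eventually_mono)
      next
        case False
        then show ?thesis by (intro AE_I2) auto
      qed
    qed
  qed measurable
  then show ?thesis by eventually_elim (auto simp: set_lebesgue_integral_def)
qed

lemma ac_on_lines_mult:
  fixes f g h k :: "real ^ 'd::finite \<Rightarrow> 'b::{real_normed_field,euclidean_space}"
  assumes \<Omega>: "open \<Omega>" and f: "loc_int \<Omega> f" and g: "loc_int \<Omega> g" and h: "loc_int \<Omega> h" and k: "loc_int \<Omega> k"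
    and fg: "ac_on_lines \<Omega> i f g" and hk: "ac_on_lines \<Omega> i h k"
  shows "ac_on_lines \<Omega> i (\<lambda>x. f x * h x) (\<lambda>x. g x * h x + f x * k x)"
  unfolding ac_on_lines_def
proof (intro allI impI)
  fix t :: real assume t: "0 \<le> t"
  let ?e = "axis i 1 :: real ^ 'd"
  note [measurable] = loc_int_measurable[OF f] loc_int_measurable[OF g] loc_int_measurable[OF h] loc_int_measurable[OF k]
  show "AE x in lborel. (\<forall>s\<in>{0..t}. x + s *\<^sub>R ?e \<in> \<Omega>) \<longrightarrow>
       f (x + t *\<^sub>R ?e) * h (x + t *\<^sub>R ?e) - f x * h x =
       (LINT s:{0..t}|lborel. g (x + s *\<^sub>R ?e) * h (x + s *\<^sub>R ?e) + f (x + s *\<^sub>R ?e) * k (x + s *\<^sub>R ?e))"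
    using ac_on_linesD[OF fg t] ac_on_linesD[OF hk t] ac_on_lines_AE_AE[OF \<Omega> f g fg, of t] ac_on_lines_AE_AE[OF \<Omega> h k hk, of t]
      AE_line_integrable[OF \<Omega> g, of t i] AE_line_integrable[OF \<Omega> k, of t i]
  proof eventually_elim
    case (elim x)
    show ?case
    proof
      assume seg: "\<forall>s\<in>{0..t}. x + s *\<^sub>R ?e \<in> \<Omega>"
      show "f (x + t *\<^sub>R ?e) * h (x + t *\<^sub>R ?e) - f x * h x =
        (LINT s:{0..t}|lborel. g (x + s *\<^sub>R ?e) * h (x + s *\<^sub>R ?e) + f (x + s *\<^sub>R ?e) * k (x + s *\<^sub>R ?e))"
        using ac_product_rule_1d[OF t, of "\<lambda>s. g (x + s *\<^sub>R ?e)" "\<lambda>s. k (x + s *\<^sub>R ?e)" "\<lambda>s. f (x + s *\<^sub>R ?e)" "\<lambda>s. h (x + s *\<^sub>R ?e)"]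
          elim seg by simp
    qed
  qed
qed

lemma ac_on_lines_add:
  fixes f g h k :: "real ^ 'd::finite \<Rightarrow> 'b::euclidean_space"
  assumes \<Omega>: "open \<Omega>" and g: "loc_int \<Omega> g" and k: "loc_int \<Omega> k"
    and fg: "ac_on_lines \<Omega> i f g" and hk: "ac_on_lines \<Omega> i h k"
  shows "ac_on_lines \<Omega> i (\<lambda>x. f x + h x) (\<lambda>x. g x + k x)"
  unfolding ac_on_lines_def
proof (intro allI impI)
  fix t :: real assume t: "0 \<le> t"
  show "AE x in lborel. (\<forall>s\<in>{0..t}. x + s *\<^sub>R axis i 1 \<in> \<Omega>) \<longrightarrow>
       f (x + t *\<^sub>R axis i 1) + h (x + t *\<^sub>R axis i 1) - (f x + h x) =
       (LINT s:{0..t}|lborel. g (x + s *\<^sub>R axis i 1) + k (x + s *\<^sub>R axis i 1))"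
    using ac_on_linesD[OF fg t] ac_on_linesD[OF hk t] AE_line_integrable[OF \<Omega> g, of t i] AE_line_integrable[OF \<Omega> k, of t i]
  proof eventually_elim
    case (elim x)
    show ?case
    proof
      assume "\<forall>s\<in>{0..t}. x + s *\<^sub>R axis i 1 \<in> \<Omega>"
      with elim show "f (x + t *\<^sub>R axis i 1) + h (x + t *\<^sub>R axis i 1) - (f x + h x) =
       (LINT s:{0..t}|lborel. g (x + s *\<^sub>R axis i 1) + k (x + s *\<^sub>R axis i 1))"
        by (simp add: set_integral_add(2) algebra_simps)
    qed
  qed
qed

lemma loc_int_add: "loc_int \<Omega> f \<Longrightarrow> loc_int \<Omega> g \<Longrightarrow> loc_int \<Omega> (\<lambda>x. f x + g x)"
  by (auto simp: loc_int_def intro: set_integral_add)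

lemma loc_int_zero: "loc_int \<Omega> (\<lambda>x. 0)"
  by (auto simp: loc_int_def set_integrable_def)

lemma ac_on_lines_zero: "ac_on_lines \<Omega> i (\<lambda>x. 0) (\<lambda>x. 0)"
  by (simp add: ac_on_lines_def set_lebesgue_integral_def)

text \<open>Multiplicities are encoded by repetition in the list, so no binomial coefficients
  appear.\<close>

definition product_sum ::
  "(('d \<Rightarrow> nat) \<Rightarrow> real ^ 'd::finite \<Rightarrow> 'b::real_normed_field) \<Rightarrow> (('d \<Rightarrow> nat) \<Rightarrow> real ^ 'd::finite \<Rightarrow> 'b) \<Rightarrow>
   (('d \<Rightarrow> nat) \<times> ('d \<Rightarrow> nat)) list \<Rightarrow> real ^ 'd::finite \<Rightarrow> 'b" where
  "product_sum U V L x = (\<Sum>(\<beta>, \<gamma>)\<leftarrow>L. U \<beta> x * V \<gamma> x)"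

text \<open>Each differentiation replaces every pair by the two pairs in which one entry is raised,
  so order \<open>k\<close> produces \<open>2^k\<close> entries. Building \<open>\<alpha>\<close>
  along \<open>mindex_induct\<close> makes \<open>bweak_step\<close> applicable. Local integrability
  of the products is a hypothesis, supplied later by the weighted estimates.\<close>

lemma leibniz_bweak:
  fixes U V :: "('d::{finite,linorder} \<Rightarrow> nat) \<Rightarrow> real ^ 'd::{finite,linorder} \<Rightarrow> 'b::{real_normed_field,euclidean_space}"
  assumes \<Omega>: "open \<Omega>" and U: "ac_family \<Omega> m U" and V: "ac_family \<Omega> m V"
    and UV: "\<And>\<beta> \<gamma>. mindex_order \<beta> + mindex_order \<gamma> \<le> m \<Longrightarrow> loc_int \<Omega> (\<lambda>x. U \<beta> x * V \<gamma> x)"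
    and \<alpha>: "mindex_order \<alpha> \<le> m"
  shows "\<exists>L. length L \<le> 2 ^ m \<and> (\<forall>(\<beta>, \<gamma>)\<in>set L. mindex_order \<beta> + mindex_order \<gamma> = mindex_order \<alpha>) \<and>
    bweak \<Omega> \<alpha> (\<lambda>x. U (\<lambda>_. 0) x * V (\<lambda>_. 0) x) (product_sum U V L)"
proof -
  have "\<exists>L. length L = 2 ^ mindex_order \<alpha> \<and> (\<forall>(\<beta>, \<gamma>)\<in>set L. mindex_order \<beta> + mindex_order \<gamma> = mindex_order \<alpha>) \<and>
    bweak \<Omega> \<alpha> (\<lambda>x. U (\<lambda>_. 0) x * V (\<lambda>_. 0) x) (product_sum U V L)"
    using \<alpha>
  proof (induction \<alpha> rule: mindex_induct)
    case zero
    have "product_sum U V [((\<lambda>_. 0), (\<lambda>_. 0))] = (\<lambda>x. U (\<lambda>_. 0) x * V (\<lambda>_. 0) x)"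
      by (auto simp: product_sum_def)
    moreover have "loc_int \<Omega> (\<lambda>x. U (\<lambda>_. 0) x * V (\<lambda>_. 0) x)"
      by (rule UV) (simp add: mindex_order_0)
    ultimately show ?case
      by (intro exI[of _ "[((\<lambda>_. 0), (\<lambda>_. 0))]"]) (auto simp: mindex_order_0 bweak_zero)
  next
    case (upd \<alpha> i)
    then have \<alpha>m: "mindex_order \<alpha> < m" by (simp add: mindex_order_upd del: fun_upd_apply)
    then obtain L where L: "length L = 2 ^ mindex_order \<alpha>" "\<forall>(\<beta>, \<gamma>)\<in>set L. mindex_order \<beta> + mindex_order \<gamma> = mindex_order \<alpha>"
      "bweak \<Omega> \<alpha> (\<lambda>x. U (\<lambda>_. 0) x * V (\<lambda>_. 0) x) (product_sum U V L)"
      using upd.IH by auto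
    define L' where "L' M = concat (map (\<lambda>(\<beta>, \<gamma>). [(\<beta>(i := Suc (\<beta> i)), \<gamma>), (\<beta>, \<gamma>(i := Suc (\<gamma> i)))]) M)"
      for M :: "(('d \<Rightarrow> nat) \<times> ('d \<Rightarrow> nat)) list"
    have len: "length (L' M) = 2 * length M" for M
      by (induction M) (auto simp: L'_def)
    have "ac_on_lines \<Omega> i (product_sum U V M) (product_sum U V (L' M)) \<and> loc_int \<Omega> (product_sum U V (L' M))"
      if "\<forall>(\<beta>, \<gamma>)\<in>set M. mindex_order \<beta> + mindex_order \<gamma> = mindex_order \<alpha>" for M
      using that
    proof (induction M)
      case Nil
      then show ?case by (simp add: product_sum_def[abs_def] L'_def ac_on_lines_zero loc_int_zero)
    next
      case (Cons p M)
      obtain \<beta> \<gamma> where p: "p = (\<beta>, \<gamma>)" by (cases p)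
      have bg: "mindex_order \<beta> + mindex_order \<gamma> = mindex_order \<alpha>" using Cons.prems p by auto
      let ?\<beta> = "\<beta>(i := Suc (\<beta> i))" and ?\<gamma> = "\<gamma>(i := Suc (\<gamma> i))"
      have l: "loc_int \<Omega> (U \<beta>)" "loc_int \<Omega> (V \<gamma>)" "loc_int \<Omega> (U ?\<beta>)" "loc_int \<Omega> (V ?\<gamma>)"
        "ac_on_lines \<Omega> i (U \<beta>) (U ?\<beta>)" "ac_on_lines \<Omega> i (V \<gamma>) (V ?\<gamma>)"
        using U V \<alpha>m bg unfolding ac_family_def by (auto simp: mindex_order_upd simp del: fun_upd_apply)
      have ac: "ac_on_lines \<Omega> i (\<lambda>x. U \<beta> x * V \<gamma> x) (\<lambda>x. U ?\<beta> x * V \<gamma> x + U \<beta> x * V ?\<gamma> x)"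
        by (rule ac_on_lines_mult[OF \<Omega> l(1,3,2,4,5,6)])
      have li: "loc_int \<Omega> (\<lambda>x. U ?\<beta> x * V \<gamma> x + U \<beta> x * V ?\<gamma> x)"
        using bg \<alpha>m by (intro loc_int_add UV) (auto simp: mindex_order_upd simp del: fun_upd_apply)
      have IH: "ac_on_lines \<Omega> i (product_sum U V M) (product_sum U V (L' M))" "loc_int \<Omega> (product_sum U V (L' M))"
        using Cons by auto
      have e1: "product_sum U V (p # M) = (\<lambda>x. U \<beta> x * V \<gamma> x + product_sum U V M x)"
        by (auto simp: product_sum_def p)
      have e2: "product_sum U V (L' (p # M)) = (\<lambda>x. (U ?\<beta> x * V \<gamma> x + U \<beta> x * V ?\<gamma> x) + product_sum U V (L' M) x)"
        by (auto simp: product_sum_def p L'_def)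
      show ?case unfolding e1 e2
        using ac_on_lines_add[OF \<Omega> li IH(2) ac IH(1)] loc_int_add[OF li IH(2)] by blast
    qed
    from this[OF L(2)] have "ac_on_lines \<Omega> i (product_sum U V L) (product_sum U V (L' L))" "loc_int \<Omega> (product_sum U V (L' L))" by auto
    then have "bweak \<Omega> (\<alpha>(i := Suc (\<alpha> i))) (\<lambda>x. U (\<lambda>_. 0) x * V (\<lambda>_. 0) x) (product_sum U V (L' L))"
      by (intro bweak_step[OF \<Omega> L(3)] upd.hyps) auto
    moreover have "\<forall>(\<beta>, \<gamma>)\<in>set (L' L). mindex_order \<beta> + mindex_order \<gamma> = mindex_order (\<alpha>(i := Suc (\<alpha> i)))"
      using L(2) by (auto simp: L'_def mindex_order_upd simp del: fun_upd_apply)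
    moreover have "length (L' L) = 2 ^ mindex_order (\<alpha>(i := Suc (\<alpha> i)))"
      using L(1) by (simp add: len mindex_order_upd del: fun_upd_apply)
    ultimately show ?case by (intro exI[of _ "L' L"] conjI)
  qed
  then obtain L where L: "length L = 2 ^ mindex_order \<alpha>" "\<forall>(\<beta>, \<gamma>)\<in>set L. mindex_order \<beta> + mindex_order \<gamma> = mindex_order \<alpha>"
    "bweak \<Omega> \<alpha> (\<lambda>x. U (\<lambda>_. 0) x * V (\<lambda>_. 0) x) (product_sum U V L)" by (elim exE conjE)
  have "length L \<le> 2 ^ m" unfolding L(1) using \<alpha> by (intro power_increasing) auto
  then show ?thesis using L by (intro exI[of _ L] conjI)
qed

text \<open>The lists depend on how a multi-index was built, so the list for
  \<open>\<alpha>(i := Suc (\<alpha> i))\<close> need not be the formal derivative of the one for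
  \<open>\<alpha>\<close>. Both represent weak derivatives of the same product, and that alone
  yields absolute continuity in every direction.\<close>

lemma leibniz_family:
  fixes U V :: "('d::{finite,linorder} \<Rightarrow> nat) \<Rightarrow> real ^ 'd::{finite,linorder} \<Rightarrow> 'b::{real_normed_field,euclidean_space}"
  assumes \<Omega>: "open \<Omega>" and U: "ac_family \<Omega> m U" and V: "ac_family \<Omega> m V"
    and UV: "\<And>\<beta> \<gamma>. mindex_order \<beta> + mindex_order \<gamma> \<le> m \<Longrightarrow> loc_int \<Omega> (\<lambda>x. U \<beta> x * V \<gamma> x)"
  obtains Z L where "ac_family \<Omega> m Z" "Z (\<lambda>_. 0) = (\<lambda>x. U (\<lambda>_. 0) x * V (\<lambda>_. 0) x)"
    "\<And>\<alpha>. mindex_order \<alpha> \<le> m \<Longrightarrow> length (L \<alpha>) \<le> 2 ^ m"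
    "\<And>\<alpha> \<beta> \<gamma>. mindex_order \<alpha> \<le> m \<Longrightarrow> (\<beta>, \<gamma>) \<in> set (L \<alpha>) \<Longrightarrow> mindex_order \<beta> + mindex_order \<gamma> = mindex_order \<alpha>"
    "\<And>\<alpha> x. mindex_order \<alpha> \<le> m \<Longrightarrow> Z \<alpha> x = product_sum U V (L \<alpha>) x"
proof -
  have "\<forall>\<alpha>. \<exists>L. mindex_order \<alpha> \<le> m \<longrightarrow> length L \<le> 2 ^ m \<and> (\<forall>(\<beta>, \<gamma>)\<in>set L. mindex_order \<beta> + mindex_order \<gamma> = mindex_order \<alpha>) \<and>
    bweak \<Omega> \<alpha> (\<lambda>x. U (\<lambda>_. 0) x * V (\<lambda>_. 0) x) (product_sum U V L)"
    using leibniz_bweak[OF \<Omega> U V UV] by simp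
  then obtain L0 where L0: "\<And>\<alpha>. mindex_order \<alpha> \<le> m \<Longrightarrow> length (L0 \<alpha>) \<le> 2 ^ m \<and>
     (\<forall>(\<beta>, \<gamma>)\<in>set (L0 \<alpha>). mindex_order \<beta> + mindex_order \<gamma> = mindex_order \<alpha>) \<and>
    bweak \<Omega> \<alpha> (\<lambda>x. U (\<lambda>_. 0) x * V (\<lambda>_. 0) x) (product_sum U V (L0 \<alpha>))"
    unfolding choice_iff by (elim exE) blast
  \<comment> \<open>The list obtained for index 0 represents the product only almost everywhere; it
    is replaced by the single pair that represents it at every point.\<close>
  define L where "L = L0((\<lambda>_. 0) := [((\<lambda>_. 0), (\<lambda>_. 0))])"
  define Z where "Z \<alpha> = product_sum U V (L \<alpha>)" for \<alpha>
  have Z0: "Z (\<lambda>_. 0) = (\<lambda>x. U (\<lambda>_. 0) x * V (\<lambda>_. 0) x)"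
    by (auto simp: Z_def L_def product_sum_def)
  have l0: "loc_int \<Omega> (\<lambda>x. U (\<lambda>_. 0) x * V (\<lambda>_. 0) x)"
    by (rule UV) (simp add: mindex_order_0)
  have Zb: "bweak \<Omega> \<alpha> (\<lambda>x. U (\<lambda>_. 0) x * V (\<lambda>_. 0) x) (Z \<alpha>)" if "mindex_order \<alpha> \<le> m" for \<alpha>
    using L0[OF that] bweak_zero[OF l0] Z0 by (cases "\<alpha> = (\<lambda>_. 0)") (simp_all add: Z_def L_def)
  have "ac_family \<Omega> m Z"
    unfolding ac_family_def
  proof (intro conjI allI impI)
    fix \<alpha> :: "'d \<Rightarrow> nat" assume "mindex_order \<alpha> \<le> m"
    then show "loc_int \<Omega> (Z \<alpha>)" using Zb by (simp add: bweak_def)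
  next
    fix \<alpha> :: "'d \<Rightarrow> nat" and i assume "mindex_order \<alpha> < m"
    then show "ac_on_lines \<Omega> i (Z \<alpha>) (Z (\<alpha>(i := Suc (\<alpha> i))))"
      by (intro bweak_imp_ac_on_lines[OF \<Omega> Zb Zb]) (simp_all add: mindex_order_upd)
  qed
  then show ?thesis
  proof (rule that[of Z L, OF _ Z0])
    show "length (L \<alpha>) \<le> 2 ^ m" if "mindex_order \<alpha> \<le> m" for \<alpha>
      using L0[OF that] by (simp add: L_def)
    show "mindex_order \<beta> + mindex_order \<gamma> = mindex_order \<alpha>" if "mindex_order \<alpha> \<le> m" "(\<beta>, \<gamma>) \<in> set (L \<alpha>)" for \<alpha> \<beta> \<gamma>
      using L0[OF that(1)] that(2) by (auto simp: L_def mindex_order_0 split: if_splits)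
  qed (simp add: Z_def)
qed

section \<open>Potential estimates on cubes\<close>

text \<open>The tangent inequality of the convex function \<open>v powr q\<close> at
  \<open>y\<close>, read off from Young's inequality with exponents \<open>q\<close> and
  \<open>q / (q - 1)\<close>.\<close>

lemma tangent_powr:
  fixes y v q :: real
  assumes "1 \<le> q" "0 \<le> y" "0 \<le> v"
  shows "q * (y powr (q - 1) * v) \<le> v powr q + (q - 1) * y powr q"
proof (cases "q = 1")
  case False
  then have q: "q > 1" using assms by simp
  have "v * y powr (q - 1) \<le> v powr q / q + (y powr (q - 1)) powr (q / (q - 1)) / (q / (q - 1))"
    using q assms by (intro Youngs_inequality) (auto simp: field_simps)
  also have "(y powr (q - 1)) powr (q / (q - 1)) = y powr q"
    using q by (simp add: powr_powr)
  finally show ?thesis using q by (simp add: field_simps)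
qed (use assms in auto)

text \<open>Integrate the tangent inequality at \<open>y\<close>. Total mass at most 1 is enough,
  because the constant term \<open>(q - 1) * y powr q\<close> is nonnegative and stands on the
  larger side.\<close>

lemma Jensen_powr:
  fixes F :: "'a \<Rightarrow> real"
  assumes M: "emeasure M (space M) \<le> 1" and q: "1 \<le> q" and y: "0 \<le> y"
    and [measurable]: "F \<in> borel_measurable M" and F: "\<And>x. 0 \<le> F x"
    and le: "ennreal y \<le> (\<integral>\<^sup>+x. ennreal (F x) \<partial>M)"
  shows "ennreal (y powr q) \<le> (\<integral>\<^sup>+x. ennreal (F x powr q) \<partial>M)"
proof (cases "y = 0")
  case False
  then have y0: "y > 0" using y by simp
  have "ennreal (q * y powr (q - 1)) * ennreal y \<le> ennreal (q * y powr (q - 1)) * (\<integral>\<^sup>+x. ennreal (F x) \<partial>M)"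
    by (intro mult_left_mono le) auto
  also have "\<dots> = (\<integral>\<^sup>+x. ennreal (q * (y powr (q - 1) * F x)) \<partial>M)"
    using q F by (subst nn_integral_cmult[symmetric]) (auto simp: ennreal_mult[symmetric] mult.assoc)
  also have "\<dots> \<le> (\<integral>\<^sup>+x. ennreal (F x powr q) + ennreal ((q - 1) * y powr q) \<partial>M)"
    using tangent_powr[OF q y F] q by (intro nn_integral_mono) (auto simp: ennreal_plus[symmetric] simp del: ennreal_plus intro!: ennreal_leI)
  also have "\<dots> = (\<integral>\<^sup>+x. ennreal (F x powr q) \<partial>M) + ennreal ((q - 1) * y powr q) * emeasure M (space M)"
    by (subst nn_integral_add) auto
  also have "\<dots> \<le> (\<integral>\<^sup>+x. ennreal (F x powr q) \<partial>M) + ennreal ((q - 1) * y powr q) * 1"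
    using M by (intro add_left_mono mult_left_mono) auto
  also have "ennreal (q * y powr (q - 1)) * ennreal y = ennreal (y powr q) + ennreal ((q - 1) * y powr q)"
  proof -
    have "y powr (q - 1) * y = y powr q" using y0 by (simp add: powr_diff)
    then have "q * y powr (q - 1) * y = y powr q + (q - 1) * y powr q" by (simp add: algebra_simps)
    then show ?thesis using q y by (simp add: ennreal_mult[symmetric] ennreal_plus[symmetric] del: ennreal_plus)
  qed
  finally show ?thesis by (simp add: add.commute[of _ "ennreal ((q - 1) * y powr q)"])
qed simp

section \<open>Dilations, and translation estimates from derivatives along lines\<close>

lemma nn_integral_scale:
  fixes F :: "real ^ 'd::finite \<Rightarrow> ennreal"
  assumes [measurable]: "F \<in> borel_measurable borel" and r: "r > 0"
  shows "(\<integral>\<^sup>+x. F x \<partial>lborel) = ennreal (r ^ CARD('d)) * (\<integral>\<^sup>+x. F (y + r *\<^sub>R x) \<partial>lborel)"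
  using r by (subst lborel_affine[of r y]) (simp_all add: nn_integral_density nn_integral_distr nn_integral_cmult)

lemma AE_scale:
  fixes y :: "real ^ 'd::finite"
  assumes P: "AE x in lborel. P x" and r: "r > 0"
  shows "AE x in lborel. P (y + r *\<^sub>R x)"
proof -
  obtain N where N: "\<And>x. x \<in> space lborel - N \<Longrightarrow> P x" "N \<in> null_sets lborel"
    using AE_E3[OF P] by blast
  then have [measurable]: "N \<in> sets borel" and N0: "emeasure lborel N = 0" by auto
  have "0 = (\<integral>\<^sup>+x. indicator N x \<partial>lborel)" using N0 by simp
  also have "\<dots> = ennreal (r ^ CARD('d)) * (\<integral>\<^sup>+x. indicator N (y + r *\<^sub>R x) \<partial>lborel)"
    by (rule nn_integral_scale[OF _ r]) measurable
  finally have "(\<integral>\<^sup>+x. indicator N (y + r *\<^sub>R x) \<partial>lborel) = 0" using r by auto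
  then have "AE x in lborel. indicator N (y + r *\<^sub>R x) = (0::ennreal)"
    by (subst (asm) nn_integral_0_iff_AE) auto
  then show ?thesis by eventually_elim (use N in \<open>auto simp: indicator_def split: if_splits\<close>)
qed

lemma loc_int_scale:
  fixes f :: "real ^ 'd::finite \<Rightarrow> 'b::euclidean_space"
  assumes f: "loc_int \<Omega> f" and r: "r > 0"
  shows "loc_int {z. y + r *\<^sub>R z \<in> \<Omega>} (\<lambda>z. c *\<^sub>R f (y + r *\<^sub>R z))"
  unfolding loc_int_def
proof (intro conjI allI impI)
  note [measurable] = loc_int_measurable[OF f]
  show "(\<lambda>z. c *\<^sub>R f (y + r *\<^sub>R z)) \<in> borel_measurable borel" by measurable
  fix K assume K: "compact K \<and> K \<subseteq> {z. y + r *\<^sub>R z \<in> \<Omega>}"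
  define K' where "K' = (\<lambda>z. y + r *\<^sub>R z) ` K"
  have cK: "compact K'" unfolding K'_def using K by (intro compact_continuous_image continuous_intros) auto
  have K'\<Omega>: "K' \<subseteq> \<Omega>" using K by (auto simp: K'_def)
  have [measurable]: "K \<in> sets borel" "K' \<in> sets borel" using K cK by (auto intro: borel_compact)
  have ind: "indicator K' (y + r *\<^sub>R z) = (indicator K z :: real)" for z
    using r by (auto simp: indicator_def K'_def)
  have "integrable lborel (\<lambda>x. indicator K' x *\<^sub>R f x)"
    using loc_intD[OF f cK K'\<Omega>] by (simp add: set_integrable_def)
  then have "ennreal (r ^ CARD('d)) * (\<integral>\<^sup>+z. ennreal (norm (indicat_real K' (y + r *\<^sub>R z) *\<^sub>R f (y + r *\<^sub>R z))) \<partial>lborel) < \<infinity>"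
    unfolding integrable_iff_bounded by (subst nn_integral_scale[symmetric, OF _ r]) auto
  then have "(\<integral>\<^sup>+z. ennreal (norm (indicat_real K z *\<^sub>R f (y + r *\<^sub>R z))) \<partial>lborel) < \<infinity>"
    using r unfolding ind by (auto simp: ennreal_mult_less_top)
  then have "integrable lborel (\<lambda>z. indicat_real K z *\<^sub>R f (y + r *\<^sub>R z))"
    unfolding integrable_iff_bounded by auto
  from integrable_scaleR_right[OF this, of c]
  show "set_integrable lborel K (\<lambda>z. c *\<^sub>R f (y + r *\<^sub>R z))"
    unfolding set_integrable_def by (simp add: mult.commute)
qed

lemma ac_on_lines_scale:
  fixes f g :: "real ^ 'd::finite \<Rightarrow> 'b::euclidean_space"
  assumes ac: "ac_on_lines \<Omega> i f g" and r: "r > 0"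
  shows "ac_on_lines {z. y + r *\<^sub>R z \<in> \<Omega>} i (\<lambda>z. c *\<^sub>R f (y + r *\<^sub>R z)) (\<lambda>z. (c * r) *\<^sub>R g (y + r *\<^sub>R z))"
  unfolding ac_on_lines_def
proof (intro allI impI)
  fix t :: real assume t: "0 \<le> t"
  have rt: "0 \<le> r * t" using r t by simp
  show "AE x in lborel. (\<forall>s\<in>{0..t}. x + s *\<^sub>R axis i 1 \<in> {z. y + r *\<^sub>R z \<in> \<Omega>}) \<longrightarrow>
      c *\<^sub>R f (y + r *\<^sub>R (x + t *\<^sub>R axis i 1)) - c *\<^sub>R f (y + r *\<^sub>R x) =
      (LINT s:{0..t}|lborel. (c * r) *\<^sub>R g (y + r *\<^sub>R (x + s *\<^sub>R axis i 1)))"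
    using AE_scale[OF ac_on_linesD[OF ac rt] r, of y]
  proof eventually_elim
    case (elim x)
    show ?case
    proof
      assume seg: "\<forall>s\<in>{0..t}. x + s *\<^sub>R axis i 1 \<in> {z. y + r *\<^sub>R z \<in> \<Omega>}"
      have "y + r *\<^sub>R x + s *\<^sub>R axis i 1 \<in> \<Omega>" if "s \<in> {0..r * t}" for s
      proof -
        have "s / r \<in> {0..t}" using that r by (auto simp: field_simps)
        from seg[rule_format, OF this] show ?thesis using r by (simp add: algebra_simps)
      qed
      then have "f (y + r *\<^sub>R x + (r * t) *\<^sub>R axis i 1) - f (y + r *\<^sub>R x) = (LINT s:{0..r * t}|lborel. g (y + r *\<^sub>R x + s *\<^sub>R axis i 1))"
        using elim by auto
      also have "\<dots> = \<bar>r\<bar> *\<^sub>R (LINT s|lborel. indicat_real {0..r * t} (0 + r * s) *\<^sub>R g (y + r *\<^sub>R x + (0 + r * s) *\<^sub>R axis i 1))"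
        unfolding set_lebesgue_integral_def using r by (intro lborel_integral_real_affine) auto
      also have "\<dots> = r *\<^sub>R (LINT s:{0..t}|lborel. g (y + r *\<^sub>R (x + s *\<^sub>R axis i 1)))"
        unfolding set_lebesgue_integral_def using r
        by (auto intro!: Bochner_Integration.integral_cong simp: indicator_def algebra_simps zero_le_mult_iff)
      finally have *: "f (y + r *\<^sub>R (x + t *\<^sub>R axis i 1)) - f (y + r *\<^sub>R x) = r *\<^sub>R (LINT s:{0..t}|lborel. g (y + r *\<^sub>R (x + s *\<^sub>R axis i 1)))"
        by (simp add: algebra_simps)
      show "c *\<^sub>R f (y + r *\<^sub>R (x + t *\<^sub>R axis i 1)) - c *\<^sub>R f (y + r *\<^sub>R x) =
        (LINT s:{0..t}|lborel. (c * r) *\<^sub>R g (y + r *\<^sub>R (x + s *\<^sub>R axis i 1)))"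
        unfolding scaleR_diff_right[symmetric] * by (simp add: set_lebesgue_integral_def)
    qed
  qed
qed

lemma norm_integral_le_nn_integral:
  fixes f :: "'a \<Rightarrow> 'b::euclidean_space"
  shows "ennreal (norm (LINT x|M. f x)) \<le> (\<integral>\<^sup>+x. ennreal (norm (f x)) \<partial>M)"
  by (cases "integrable M f") (auto simp: integral_norm_bound_ennreal not_integrable_integral_eq)

text \<open>Increments are line integrals of \<open>g\<close>; by Tonelli each of the translates by
  \<open>s\<close> in \<open>[0, t]\<close> contributes at most the integral over the box, whence
  the factor \<open>t\<close>. Segments between two points of a box stay in the box.\<close>

lemma translation_bound_axis:
  fixes f g :: "real ^ 'd::finite \<Rightarrow> 'b::euclidean_space"
  assumes [measurable]: "f \<in> borel_measurable borel" "g \<in> borel_measurable borel"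
    and ac: "ac_on_lines \<Omega> i f g" and Q: "cbox a b \<subseteq> \<Omega>" and t: "0 \<le> t"
  shows "(\<integral>\<^sup>+x. ennreal (norm (f (x + t *\<^sub>R axis i 1) - f x)) * indicator (cbox a b) x * indicator (cbox a b) (x + t *\<^sub>R axis i 1) \<partial>lborel)
    \<le> ennreal t * (\<integral>\<^sup>+x. ennreal (norm (g x)) * indicator (cbox a b) x \<partial>lborel)"
proof -
  let ?Q = "cbox a b" and ?e = "axis i 1 :: real ^ 'd"
  let ?I = "\<integral>\<^sup>+x. ennreal (norm (g x)) * indicator (cbox a b) x \<partial>lborel"
  have "(\<integral>\<^sup>+x. ennreal (norm (f (x + t *\<^sub>R ?e) - f x)) * indicator ?Q x * indicator ?Q (x + t *\<^sub>R ?e) \<partial>lborel)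
    \<le> (\<integral>\<^sup>+x. \<integral>\<^sup>+s. indicator {0..t} s * (ennreal (norm (g (x + s *\<^sub>R ?e))) * indicator ?Q (x + s *\<^sub>R ?e)) \<partial>lborel \<partial>lborel)"
  proof (rule nn_integral_mono_AE, use ac_on_linesD[OF ac t] in eventually_elim)
    case (elim x)
    show ?case
    proof (cases "x \<in> ?Q \<and> x + t *\<^sub>R ?e \<in> ?Q")
      case True
      have inQ: "x + s *\<^sub>R ?e \<in> ?Q" if "s \<in> {0..t}" for s
        unfolding mem_box_cart
      proof
        fix j
        have "a $ j \<le> x $ j" "(x + t *\<^sub>R ?e) $ j \<le> b $ j" "x $ j \<le> b $ j" using True by (auto simp: mem_box_cart)
        then show "a $ j \<le> (x + s *\<^sub>R ?e) $ j \<and> (x + s *\<^sub>R ?e) $ j \<le> b $ j"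
          using that by (cases "j = i") (auto simp: axis_def)
      qed
      then have "f (x + t *\<^sub>R ?e) - f x = (LINT s:{0..t}|lborel. g (x + s *\<^sub>R ?e))"
        using elim Q by blast
      also have "ennreal (norm \<dots>) \<le> (\<integral>\<^sup>+s. ennreal (norm (indicator {0..t} s *\<^sub>R g (x + s *\<^sub>R ?e))) \<partial>lborel)"
        unfolding set_lebesgue_integral_def by (rule norm_integral_le_nn_integral)
      also have "\<dots> = (\<integral>\<^sup>+s. indicator {0..t} s * (ennreal (norm (g (x + s *\<^sub>R ?e))) * indicator ?Q (x + s *\<^sub>R ?e)) \<partial>lborel)"
        using inQ by (intro nn_integral_cong) (auto simp: indicator_def)
      finally show ?thesis using True by simp
    next
      case False
      then have "indicator ?Q x = (0::ennreal) \<or> indicator ?Q (x + t *\<^sub>R ?e) = (0::ennreal)" by auto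
      then show ?thesis by (elim disjE) (simp_all only: mult_zero_left mult_zero_right zero_le)
    qed
  qed
  also have "\<dots> = (\<integral>\<^sup>+s. \<integral>\<^sup>+x. indicator {0..t} s * (ennreal (norm (g (x + s *\<^sub>R ?e))) * indicator ?Q (x + s *\<^sub>R ?e)) \<partial>lborel \<partial>lborel)"
    by (rule lborel_pair.Fubini') measurable
  also have "\<dots> = (\<integral>\<^sup>+s. indicator {0..t} s * ?I \<partial>lborel)"
  proof (rule nn_integral_cong)
    fix s
    have "(\<integral>\<^sup>+x. ennreal (norm (g (x + s *\<^sub>R ?e))) * indicator ?Q (x + s *\<^sub>R ?e) \<partial>lborel) = ?I"
      by (rule nn_integral_shift) measurable
    then show "(\<integral>\<^sup>+x. indicator {0..t} s * (ennreal (norm (g (x + s *\<^sub>R ?e))) * indicator ?Q (x + s *\<^sub>R ?e)) \<partial>lborel) = indicator {0..t} s * ?I"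
      by (simp add: nn_integral_cmult)
  qed
  also have "\<dots> = ennreal t * ?I" using t by (simp add: nn_integral_multc)
  finally show ?thesis .
qed

text \<open>Serves two purposes: moving by a vector one coordinate at a time, and distributing the
  coordinates of a vector over two factors.\<close>

definition coord_proj :: "'d set \<Rightarrow> real ^ 'd::finite \<Rightarrow> real ^ 'd" where
  "coord_proj S h = (\<chi> i. if i \<in> S then h $ i else 0)"

lemma coord_proj_nth [simp]: "coord_proj S h $ i = (if i \<in> S then h $ i else 0)"
  by (simp add: coord_proj_def)

lemma coord_proj_empty [simp]: "coord_proj {} h = 0"
  and coord_proj_UNIV [simp]: "coord_proj UNIV h = h"
  by (auto simp: vec_eq_iff)

lemma coord_proj_insert: "i \<notin> S \<Longrightarrow> coord_proj (insert i S) h = coord_proj S h + h $ i *\<^sub>R axis i 1"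
  by (auto simp: vec_eq_iff axis_def)

lemma coord_proj_measurable [measurable]: "coord_proj S \<in> borel_measurable borel"
proof (rule borel_measurable_continuous_onI)
  have "continuous_on UNIV (\<lambda>h. coord_proj S h $ i)" for i
    by (cases "i \<in> S") (auto intro!: continuous_intros)
  then show "continuous_on UNIV (coord_proj S)"
    unfolding coord_proj_def[abs_def] by (intro continuous_on_vec_lambda) simp
qed

text \<open>The translation is performed coordinate by coordinate. Since all coordinates of
  \<open>h\<close> are nonnegative, the intermediate points lie between \<open>x\<close> and
  \<open>x + h\<close> in every coordinate and so never leave the box.\<close>

lemma translation_bound:
  fixes f :: "real ^ 'd::finite \<Rightarrow> 'b::euclidean_space"
  assumes [measurable]: "f \<in> borel_measurable borel" "\<And>i. g i \<in> borel_measurable borel"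
    and ac: "\<And>i. ac_on_lines \<Omega> i f (g i)" and Q: "cbox a b \<subseteq> \<Omega>" and h: "\<And>i. 0 \<le> h $ i"
  shows "(\<integral>\<^sup>+x. ennreal (norm (f (x + h) - f x)) * indicator (cbox a b) x * indicator (cbox a b) (x + h) \<partial>lborel)
    \<le> (\<Sum>i\<in>UNIV. ennreal (h $ i) * (\<integral>\<^sup>+x. ennreal (norm (g i x)) * indicator (cbox a b) x \<partial>lborel))"
proof -
  let ?Q = "cbox a b" and ?P = "\<lambda>S. coord_proj S h"
  have "(\<integral>\<^sup>+x. ennreal (norm (f (x + ?P S) - f x)) * indicator ?Q x * indicator ?Q (x + ?P S) \<partial>lborel)
    \<le> (\<Sum>i\<in>S. ennreal (h $ i) * (\<integral>\<^sup>+x. ennreal (norm (g i x)) * indicator ?Q x \<partial>lborel))" for S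
  proof (induction S rule: infinite_finite_induct)
    case (insert i S)
    let ?v = "h $ i *\<^sub>R axis i 1 :: real ^ 'd"
    have P: "?P (insert i S) = ?P S + ?v" using insert by (simp add: coord_proj_insert)
    let ?A = "\<lambda>y. ennreal (norm (f (y + ?v) - f y)) * indicator ?Q y * indicator ?Q (y + ?v)"
    let ?B = "\<lambda>x. ennreal (norm (f (x + ?P S) - f x)) * indicator ?Q x * indicator ?Q (x + ?P S)"
    have "ennreal (norm (f (x + ?P (insert i S)) - f x)) * indicator ?Q x * indicator ?Q (x + ?P (insert i S))
       \<le> ?A (x + ?P S) + ?B x" for x
    proof (cases "x \<in> ?Q \<and> x + ?P (insert i S) \<in> ?Q")
      case True
      have "x $ j \<le> (x + ?P S) $ j" "(x + ?P S) $ j \<le> (x + ?P (insert i S)) $ j" for j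
        using h[of j] by auto
      moreover have "a $ j \<le> x $ j" "(x + ?P (insert i S)) $ j \<le> b $ j" for j
        using True by (auto simp: mem_box_cart)
      ultimately have "x + ?P S \<in> ?Q"
        unfolding mem_box_cart by (meson order_trans)
      moreover have "norm (f (x + ?P (insert i S)) - f x) \<le> norm (f (x + ?P S + ?v) - f (x + ?P S)) + norm (f (x + ?P S) - f x)"
        using norm_triangle_ineq[of "f (x + ?P S + ?v) - f (x + ?P S)" "f (x + ?P S) - f x"]
        unfolding P add.assoc by simp
      ultimately show ?thesis
        using True unfolding P add.assoc[symmetric]
        by (simp add: ennreal_plus[symmetric] ennreal_leI del: ennreal_plus)
    next
      case False
      then have "indicator ?Q x = (0::ennreal) \<or> indicator ?Q (x + ?P (insert i S)) = (0::ennreal)" by auto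
      then show ?thesis by (elim disjE) (simp_all only: mult_zero_left mult_zero_right zero_le)
    qed
    then have "(\<integral>\<^sup>+x. ennreal (norm (f (x + ?P (insert i S)) - f x)) * indicator ?Q x * indicator ?Q (x + ?P (insert i S)) \<partial>lborel)
      \<le> (\<integral>\<^sup>+x. ?A (x + ?P S) + ?B x \<partial>lborel)" by (rule nn_integral_mono)
    also have "\<dots> = (\<integral>\<^sup>+x. ?A (x + ?P S) \<partial>lborel) + (\<integral>\<^sup>+x. ?B x \<partial>lborel)"
      by (rule nn_integral_add) measurable
    also have "(\<integral>\<^sup>+x. ?A (x + ?P S) \<partial>lborel) = (\<integral>\<^sup>+x. ?A x \<partial>lborel)"
      by (rule nn_integral_shift) measurable
    also have "\<dots> \<le> ennreal (h $ i) * (\<integral>\<^sup>+x. ennreal (norm (g i x)) * indicator ?Q x \<partial>lborel)"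
      by (rule translation_bound_axis[OF _ _ ac Q h]) measurable
    finally have "(\<integral>\<^sup>+x. ennreal (norm (f (x + ?P (insert i S)) - f x)) * indicator ?Q x * indicator ?Q (x + ?P (insert i S)) \<partial>lborel)
      \<le> ennreal (h $ i) * (\<integral>\<^sup>+x. ennreal (norm (g i x)) * indicator ?Q x \<partial>lborel) + (\<integral>\<^sup>+x. ?B x \<partial>lborel)"
      by (simp add: add_right_mono)
    from order_trans[OF this add_left_mono[OF insert.IH]] show ?case using insert.hyps by simp
  qed auto
  from this[of UNIV] show ?thesis by simp
qed

section \<open>Oscillation on cubes and the pointwise bound by a potential\<close>

definition dcube :: "real \<Rightarrow> real \<Rightarrow> (real ^ 'd::finite) set" where
  "dcube a b = cbox (\<chi> i. a) (\<chi> i. b)"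

lemma mem_dcube: "x \<in> dcube a b \<longleftrightarrow> (\<forall>i. a \<le> x $ i \<and> x $ i \<le> b)"
  by (simp add: dcube_def mem_box_cart)

lemma dcube_mono: "a' \<le> a \<Longrightarrow> b \<le> b' \<Longrightarrow> dcube a b \<subseteq> dcube a' b'"
  unfolding subset_iff mem_dcube by (meson order_trans)

lemma dcube_measurable [measurable]: "dcube a b \<in> sets borel"
  by (simp add: dcube_def)

lemma compact_dcube: "compact (dcube a b)"
  by (simp add: dcube_def)

lemma emeasure_dcube:
  assumes "a \<le> b"
  shows "emeasure lborel (dcube a b :: (real ^ 'd::finite) set) = ennreal ((b - a) ^ CARD('d))"
proof -
  have ne: "cbox (\<chi> i. a) (\<chi> i. b) \<noteq> ({} :: (real ^ 'd) set)"
    using assms by (auto simp: mem_box_cart set_eq_iff intro!: exI[of _ "\<chi> i. a"])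
  show ?thesis
    unfolding dcube_def using content_cbox_cart[OF ne]
    by (simp add: emeasure_eq_ennreal_measure emeasure_lborel_cbox_finite[unfolded infinity_ennreal_def] less_imp_neq)
qed

text \<open>With \<open>h = z - w\<close> this becomes an integral over translations. The two cubes
  are placed so that every coordinate of \<open>h\<close> lies in \<open>[0, 1]\<close>; hence
  \<open>translation_bound\<close> applies with coefficients at most 1, and such \<open>h\<close>
  fill a set of measure at most 1.\<close>

lemma poincare_unit:
  fixes f :: "real ^ 'd::finite \<Rightarrow> 'b::euclidean_space"
  assumes [measurable]: "f \<in> borel_measurable borel" "\<And>i. g i \<in> borel_measurable borel"
    and ac: "\<And>i. ac_on_lines \<Omega> i f (g i)" and Q: "dcube 0 1 \<subseteq> \<Omega>"
  shows "(\<integral>\<^sup>+z. \<integral>\<^sup>+w. ennreal (norm (f z - f w)) * indicator (dcube (1/2) 1) z * indicator (dcube (1/4) (1/2)) w \<partial>lborel \<partial>lborel)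
    \<le> (\<Sum>i\<in>UNIV. \<integral>\<^sup>+x. ennreal (norm (g i x)) * indicator (dcube 0 1) x \<partial>lborel)"
proof -
  let ?Q = "dcube 0 1 :: (real ^ 'd) set" and ?D = "dcube (1/2) 1 :: (real ^ 'd) set" and ?E = "dcube (1/4) (1/2) :: (real ^ 'd) set"
  let ?S = "\<Sum>i\<in>UNIV. \<integral>\<^sup>+x. ennreal (norm (g i x)) * indicator ?Q x \<partial>lborel"
  have "(\<integral>\<^sup>+z. \<integral>\<^sup>+w. ennreal (norm (f z - f w)) * indicator ?D z * indicator ?E w \<partial>lborel \<partial>lborel)
     = (\<integral>\<^sup>+w. \<integral>\<^sup>+z. ennreal (norm (f z - f w)) * indicator ?D z * indicator ?E w \<partial>lborel \<partial>lborel)"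
    by (rule lborel_pair.Fubini') measurable
  also have "\<dots> = (\<integral>\<^sup>+w. \<integral>\<^sup>+h. ennreal (norm (f (h + w) - f w)) * indicator ?D (h + w) * indicator ?E w \<partial>lborel \<partial>lborel)"
    by (intro nn_integral_cong nn_integral_shift[symmetric]) measurable
  also have "\<dots> = (\<integral>\<^sup>+h. \<integral>\<^sup>+w. ennreal (norm (f (h + w) - f w)) * indicator ?D (h + w) * indicator ?E w \<partial>lborel \<partial>lborel)"
    by (rule lborel_pair.Fubini') measurable
  also have "\<dots> \<le> (\<integral>\<^sup>+h. ?S * indicator ?Q h \<partial>lborel)"
  proof (rule nn_integral_mono)
    fix h :: "real ^ 'd"
    show "(\<integral>\<^sup>+w. ennreal (norm (f (h + w) - f w)) * indicator ?D (h + w) * indicator ?E w \<partial>lborel) \<le> ?S * indicator ?Q h"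
    proof (cases "h \<in> ?Q")
      case True
      have "(\<integral>\<^sup>+w. ennreal (norm (f (h + w) - f w)) * indicator ?D (h + w) * indicator ?E w \<partial>lborel)
        \<le> (\<integral>\<^sup>+w. ennreal (norm (f (w + h) - f w)) * indicator ?Q w * indicator ?Q (w + h) \<partial>lborel)"
      proof (intro nn_integral_mono)
        fix w :: "real ^ 'd"
        have "?D \<subseteq> ?Q" "?E \<subseteq> ?Q"
          by (rule dcube_mono; simp)+
        then have "indicator ?D (h + w) \<le> (indicator ?Q (w + h) :: ennreal)" "indicator ?E w \<le> (indicator ?Q w :: ennreal)"
          by (auto simp: indicator_def add.commute)
        then show "ennreal (norm (f (h + w) - f w)) * indicator ?D (h + w) * indicator ?E w \<le> ennreal (norm (f (w + h) - f w)) * indicator ?Q w * indicator ?Q (w + h)"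
          unfolding add.commute[of h w] mult.assoc by (subst (2) mult.commute) (intro mult_left_mono mult_mono; simp)
      qed
      also have "\<dots> \<le> (\<Sum>i\<in>UNIV. ennreal (h $ i) * (\<integral>\<^sup>+x. ennreal (norm (g i x)) * indicator ?Q x \<partial>lborel))"
        unfolding dcube_def
        by (rule translation_bound[OF _ _ ac]) (use Q True in \<open>auto simp: dcube_def[symmetric] mem_dcube\<close>)
      also have "\<dots> \<le> ?S"
      proof (rule sum_mono)
        fix i
        have "ennreal (h $ i) \<le> 1" using True by (auto simp: mem_dcube intro: ennreal_leI[of _ 1, simplified])
        from mult_right_mono[OF this] show "ennreal (h $ i) * (\<integral>\<^sup>+x. ennreal (norm (g i x)) * indicator ?Q x \<partial>lborel)
          \<le> (\<integral>\<^sup>+x. ennreal (norm (g i x)) * indicator ?Q x \<partial>lborel)" by fastforce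
      qed
      finally show ?thesis using True by simp
    next
      case False
      have z0: "indicator ?D (h + w) * indicator ?E w = (0::ennreal)" for w
      proof (rule ccontr)
        assume "indicator ?D (h + w) * indicator ?E w \<noteq> (0::ennreal)"
        then have "h + w \<in> ?D" "w \<in> ?E" by (auto simp: indicator_def split: if_splits)
        then have "1/2 \<le> h $ i + w $ i" "h $ i + w $ i \<le> 1" "1/4 \<le> w $ i" "w $ i \<le> 1/2" for i
          unfolding mem_dcube by auto
        note hw = this
        have "0 \<le> h $ i" "h $ i \<le> 1" for i
          using hw[of i] by linarith+
        then show False using False by (simp add: mem_dcube)
      qed
      show ?thesis by (simp only: mult.assoc z0 mult_zero_right) simp
    qed
  qed
  also have "\<dots> = ?S" by (simp add: nn_integral_cmult emeasure_dcube)
  finally show ?thesis .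
qed

lemma poincare_scaled:
  fixes f :: "real ^ 'd::finite \<Rightarrow> 'b::euclidean_space"
  assumes [measurable]: "f \<in> borel_measurable borel" "\<And>i. g i \<in> borel_measurable borel"
    and ac: "\<And>i. ac_on_lines \<Omega> i f (g i)" and \<sigma>: "\<sigma> > 0" and Q: "\<And>z. z \<in> dcube 0 1 \<Longrightarrow> x + \<sigma> *\<^sub>R z \<in> \<Omega>"
  shows "(\<integral>\<^sup>+z. \<integral>\<^sup>+w. ennreal (norm (f (x + \<sigma> *\<^sub>R z) - f (x + \<sigma> *\<^sub>R w))) * indicator (dcube (1/2) 1) z * indicator (dcube (1/4) (1/2)) w \<partial>lborel \<partial>lborel)
    \<le> ennreal \<sigma> * (\<Sum>i\<in>UNIV. \<integral>\<^sup>+z. ennreal (norm (g i (x + \<sigma> *\<^sub>R z))) * indicator (dcube 0 1) z \<partial>lborel)"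
proof -
  have "(\<integral>\<^sup>+z. \<integral>\<^sup>+w. ennreal (norm (1 *\<^sub>R f (x + \<sigma> *\<^sub>R z) - 1 *\<^sub>R f (x + \<sigma> *\<^sub>R w))) * indicator (dcube (1/2) 1) z * indicator (dcube (1/4) (1/2)) w \<partial>lborel \<partial>lborel)
    \<le> (\<Sum>i\<in>UNIV. \<integral>\<^sup>+z. ennreal (norm ((1 * \<sigma>) *\<^sub>R g i (x + \<sigma> *\<^sub>R z))) * indicator (dcube 0 1) z \<partial>lborel)"
    by (rule poincare_unit[OF _ _ ac_on_lines_scale[OF ac \<sigma>]]) (use Q in auto)
  also have "\<dots> = ennreal \<sigma> * (\<Sum>i\<in>UNIV. \<integral>\<^sup>+z. ennreal (norm (g i (x + \<sigma> *\<^sub>R z))) * indicator (dcube 0 1) z \<partial>lborel)"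
    using \<sigma> by (simp add: ennreal_mult sum_distrib_left nn_integral_cmult[symmetric] mult.assoc)
  finally show ?thesis by simp
qed

lemma ennreal_finite_sum_tendsto_0:
  fixes M :: "nat \<Rightarrow> ennreal"
  assumes "(\<Sum>k. M k) < \<infinity>"
  shows "M \<longlonglongrightarrow> 0"
proof -
  have fin: "M k < \<infinity>" for k
    using assms ennreal_suminf_lessD by blast
  then have e: "M k = ennreal (enn2real (M k))" for k by simp
  have "summable (\<lambda>k. enn2real (M k))"
    by (rule summable_suminf_not_top) (use assms e in auto)
  then have "(\<lambda>k. ennreal (enn2real (M k))) \<longlonglongrightarrow> ennreal 0"
    by (intro tendsto_ennrealI summable_LIMSEQ_zero)
  then show ?thesis using e by simp
qed

text \<open>The function value is reached from the averages over the cubes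
  \<open>x + 2\<^sup>-\<^sup>k [1/2, 1]\<^sup>d\<close>; all coordinate differences between consecutive cubes are nonnegative.\<close>

lemma pointwise_potential_bound:
  fixes f :: "real ^ 'd::finite \<Rightarrow> 'b::euclidean_space"
  assumes f: "loc_int \<Omega> f" and g: "\<And>i. loc_int \<Omega> (g i)"
    and ac: "\<And>i. ac_on_lines \<Omega> i f (g i)" and s: "0 \<le> s" and Q: "dcube 0 (s + 1) \<subseteq> \<Omega>"
  shows "AE x in lborel. x \<in> dcube 0 s \<longrightarrow> ennreal (norm (f x)) \<le> ennreal (2 ^ CARD('d) * (4 ^ CARD('d) + 1)) *
    (\<Sum>k. ennreal ((1/2) ^ k) * (\<integral>\<^sup>+z. ennreal (norm (f (x + (1/2) ^ k *\<^sub>R z)) + (\<Sum>i\<in>UNIV. norm (g i (x + (1/2) ^ k *\<^sub>R z)))) * indicator (dcube 0 1) z \<partial>lborel))"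
proof -
  let ?n = "CARD('d)"
  let ?Q = "dcube 0 s :: (real ^ 'd) set" and ?D = "dcube (1/2) 1 :: (real ^ 'd) set" and ?E = "dcube (1/4) (1/2) :: (real ^ 'd) set"
  note [measurable] = loc_int_measurable[OF f] loc_int_measurable[OF g]
  define \<sigma> :: "nat \<Rightarrow> real" where "\<sigma> k = (1/2) ^ k" for k
  have \<sigma>: "0 < \<sigma> k" "\<sigma> k \<le> 1" for k by (auto simp: \<sigma>_def power_le_one)
  \<comment> \<open>\<open>M\<close> measures the oscillation about the value \<open>f x\<close> at
    scale \<open>2^-k\<close>, \<open>P\<close> compares the cube of that scale with the next
    smaller one, and \<open>A\<close> is the integral in the summand of the potential.\<close>
  define M where "M k x = (\<integral>\<^sup>+z. ennreal (norm (f (x + \<sigma> k *\<^sub>R z) - f x)) * indicator ?D z \<partial>lborel)" for k x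
  define P where "P k x = (\<integral>\<^sup>+z. \<integral>\<^sup>+w. ennreal (norm (f (x + \<sigma> k *\<^sub>R z) - f (x + \<sigma> k *\<^sub>R w))) * indicator ?D z * indicator ?E w \<partial>lborel \<partial>lborel)" for k x
  define A where "A k x = (\<integral>\<^sup>+z. ennreal (norm (f (x + \<sigma> k *\<^sub>R z)) + (\<Sum>i\<in>UNIV. norm (g i (x + \<sigma> k *\<^sub>R z)))) * indicator (dcube 0 1) z \<partial>lborel)" for k x
  have inQ: "x + \<sigma> k *\<^sub>R z \<in> dcube 0 (s + 1)" if "x \<in> ?Q" "z \<in> dcube 0 1" for x z k
    unfolding mem_dcube
  proof
    fix i
    have "\<sigma> k * z $ i \<le> 1 * 1" using \<sigma>[of k] that by (intro mult_mono) (auto simp: mem_dcube)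
    moreover have "0 \<le> \<sigma> k * z $ i" using \<sigma>[of k] that by (auto simp: mem_dcube)
    moreover have "0 \<le> x $ i" "x $ i \<le> s" using that by (auto simp: mem_dcube)
    ultimately show "0 \<le> (x + \<sigma> k *\<^sub>R z) $ i \<and> (x + \<sigma> k *\<^sub>R z) $ i \<le> s + 1" by auto
  qed
  have emD: "emeasure lborel ?D = ennreal ((1/2) ^ ?n)" and emE: "emeasure lborel ?E = ennreal ((1/4) ^ ?n)"
    by (simp_all add: emeasure_dcube)
  have DQ: "?D \<subseteq> dcube 0 1" by (rule dcube_mono) auto

  have PA: "P k x \<le> ennreal (\<sigma> k) * A k x" if "x \<in> ?Q" for k x
  proof -
    have "P k x \<le> ennreal (\<sigma> k) * (\<Sum>i\<in>UNIV. \<integral>\<^sup>+z. ennreal (norm (g i (x + \<sigma> k *\<^sub>R z))) * indicator (dcube 0 1) z \<partial>lborel)"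
      unfolding P_def using inQ[OF that] Q by (intro poincare_scaled[OF _ _ ac] \<sigma>) auto
    also have "(\<Sum>i\<in>UNIV. \<integral>\<^sup>+z. ennreal (norm (g i (x + \<sigma> k *\<^sub>R z))) * indicator (dcube 0 1) z \<partial>lborel) =
       (\<integral>\<^sup>+z. (\<Sum>i\<in>UNIV. ennreal (norm (g i (x + \<sigma> k *\<^sub>R z))) * indicator (dcube 0 1) z) \<partial>lborel)"
      by (rule nn_integral_sum[symmetric]) measurable
    also have "\<dots> \<le> A k x"
      unfolding A_def sum_distrib_right[symmetric]
      by (intro nn_integral_mono mult_right_mono) (auto intro!: ennreal_leI)
    finally show ?thesis by (simp add: mult_left_mono)
  qed

  \<comment> \<open>The cube \<open>?E\<close> at scale \<open>\<sigma> k\<close> is the cube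
    \<open>?D\<close> at scale \<open>\<sigma> (Suc k)\<close>. The factor \<open>4^d\<close> is the
    reciprocal of the volume of \<open>?E\<close>; it cancels in the last term against the volume of
    \<open>?D\<close> and the Jacobian, so that the oscillations telescope with coefficient
    1.\<close>
  have step: "M k x \<le> ennreal (4 ^ ?n) * P k x + M (Suc k) x" for k x
  proof -
    let ?a = "\<lambda>z. ennreal (norm (f (x + \<sigma> k *\<^sub>R z) - f x))"
    have "M k x * ennreal ((1/4) ^ ?n) = (\<integral>\<^sup>+z. \<integral>\<^sup>+w. ?a z * indicator ?D z * indicator ?E w \<partial>lborel \<partial>lborel)"
      unfolding M_def emE[symmetric] by (simp add: nn_integral_cmult nn_integral_multc)
    also have "\<dots> \<le> (\<integral>\<^sup>+z. \<integral>\<^sup>+w. ennreal (norm (f (x + \<sigma> k *\<^sub>R z) - f (x + \<sigma> k *\<^sub>R w))) * indicator ?D z * indicator ?E w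
        + indicator ?D z * (?a w * indicator ?E w) \<partial>lborel \<partial>lborel)"
    proof (intro nn_integral_mono)
      fix z w :: "real ^ 'd"
      have "norm (f (x + \<sigma> k *\<^sub>R z) - f x) \<le> norm (f (x + \<sigma> k *\<^sub>R z) - f (x + \<sigma> k *\<^sub>R w)) + norm (f (x + \<sigma> k *\<^sub>R w) - f x)"
        using norm_triangle_ineq[of "f (x + \<sigma> k *\<^sub>R z) - f (x + \<sigma> k *\<^sub>R w)" "f (x + \<sigma> k *\<^sub>R w) - f x"] by simp
      then have "?a z \<le> ennreal (norm (f (x + \<sigma> k *\<^sub>R z) - f (x + \<sigma> k *\<^sub>R w))) + ?a w"
        by (simp add: ennreal_plus[symmetric] ennreal_leI del: ennreal_plus)
      then have "?a z * (indicator ?D z * indicator ?E w) \<le> (ennreal (norm (f (x + \<sigma> k *\<^sub>R z) - f (x + \<sigma> k *\<^sub>R w))) + ?a w) * (indicator ?D z * indicator ?E w)"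
        by (rule mult_right_mono) simp
      then show "?a z * indicator ?D z * indicator ?E w \<le> ennreal (norm (f (x + \<sigma> k *\<^sub>R z) - f (x + \<sigma> k *\<^sub>R w))) * indicator ?D z * indicator ?E w
        + indicator ?D z * (?a w * indicator ?E w)"
        by (simp add: distrib_left distrib_right mult_ac)
    qed
    also have "\<dots> = (\<integral>\<^sup>+z. (\<integral>\<^sup>+w. ennreal (norm (f (x + \<sigma> k *\<^sub>R z) - f (x + \<sigma> k *\<^sub>R w))) * indicator ?D z * indicator ?E w \<partial>lborel)
        + indicator ?D z * (\<integral>\<^sup>+w. ?a w * indicator ?E w \<partial>lborel) \<partial>lborel)"
      by (intro nn_integral_cong) (simp add: nn_integral_add nn_integral_cmult)
    also have "\<dots> = P k x + emeasure lborel ?D * (\<integral>\<^sup>+w. ?a w * indicator ?E w \<partial>lborel)"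
      unfolding P_def by (subst nn_integral_add) (simp_all add: nn_integral_multc)
    also have "(\<integral>\<^sup>+w. ?a w * indicator ?E w \<partial>lborel) = ennreal ((1/2) ^ ?n) * (\<integral>\<^sup>+w. ?a (0 + (1/2) *\<^sub>R w) * indicator ?E (0 + (1/2) *\<^sub>R w) \<partial>lborel)"
      by (rule nn_integral_scale) auto
    also have "(\<integral>\<^sup>+w. ?a (0 + (1/2) *\<^sub>R w) * indicator ?E (0 + (1/2) *\<^sub>R w) \<partial>lborel) = M (Suc k) x"
      unfolding M_def \<sigma>_def by (intro nn_integral_cong) (auto simp: indicator_def mem_dcube)
    finally have "ennreal (4 ^ ?n) * (M k x * ennreal ((1/4) ^ ?n)) \<le> ennreal (4 ^ ?n) * (P k x + ennreal ((1/2) ^ ?n) * (ennreal ((1/2) ^ ?n) * M (Suc k) x))"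
      unfolding emD by (rule mult_left_mono) simp
    moreover have "ennreal (4 ^ ?n) * ennreal ((1/4) ^ ?n) = 1" "ennreal (4 ^ ?n) * (ennreal ((1/2) ^ ?n) * ennreal ((1/2) ^ ?n)) = 1"
      by (simp_all add: ennreal_mult[symmetric] power_mult_distrib[symmetric])
    ultimately show ?thesis
      by (simp add: distrib_left mult.assoc[symmetric] mult.commute[of "M k x"] mult.left_commute)
  qed

  \<comment> \<open>Replaces the Lebesgue differentiation theorem: the integrals of
    \<open>M k\<close> decay geometrically, so for almost every \<open>x\<close> the series of
    \<open>M k x\<close> converges and its terms tend to 0.\<close>
  have fin: "(\<integral>\<^sup>+x. (\<Sum>k. M k x * indicator ?Q x) \<partial>lborel) < \<infinity>"
  proof -
    define I where "I = (\<Sum>i\<in>UNIV. \<integral>\<^sup>+x. ennreal (norm (g i x)) * indicator (dcube 0 (s + 1)) x \<partial>lborel)"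
    have "(\<integral>\<^sup>+x. ennreal (norm (g i x)) * indicator (dcube 0 (s + 1)) x \<partial>lborel) < \<infinity>" for i
    proof -
      have "integrable lborel (\<lambda>x. indicator (dcube 0 (s + 1)) x *\<^sub>R g i x)"
        using loc_intD[OF g compact_dcube Q] by (simp add: set_integrable_def)
      then show ?thesis
        by (auto simp: integrable_iff_bounded ennreal_mult ennreal_indicator mult.commute)
    qed
    then have I: "I < \<infinity>" by (simp add: I_def)
    have "(\<integral>\<^sup>+x. M k x * indicator ?Q x \<partial>lborel) \<le> ennreal (\<sigma> k) * I" for k
    proof -
      have "(\<integral>\<^sup>+x. M k x * indicator ?Q x \<partial>lborel) = (\<integral>\<^sup>+x. \<integral>\<^sup>+z. ennreal (norm (f (x + \<sigma> k *\<^sub>R z) - f x)) * indicator ?D z * indicator ?Q x \<partial>lborel \<partial>lborel)"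
        unfolding M_def by (simp add: nn_integral_multc)
      also have "\<dots> = (\<integral>\<^sup>+z. \<integral>\<^sup>+x. ennreal (norm (f (x + \<sigma> k *\<^sub>R z) - f x)) * indicator ?D z * indicator ?Q x \<partial>lborel \<partial>lborel)"
        by (rule lborel_pair.Fubini') measurable
      also have "\<dots> \<le> (\<integral>\<^sup>+z. (ennreal (\<sigma> k) * I) * indicator (dcube 0 1 :: (real ^ 'd) set) z \<partial>lborel)"
      proof (rule nn_integral_mono)
        fix z :: "real ^ 'd"
        show "(\<integral>\<^sup>+x. ennreal (norm (f (x + \<sigma> k *\<^sub>R z) - f x)) * indicator ?D z * indicator ?Q x \<partial>lborel) \<le> (ennreal (\<sigma> k) * I) * indicator (dcube 0 1) z"
        proof (cases "z \<in> ?D")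
          case True
          then have z: "z \<in> dcube 0 1" using DQ by blast
          have Qs: "x \<in> dcube 0 (s + 1)" if "x \<in> ?Q" for x
            using that unfolding mem_dcube by (auto intro: order_trans)
          have "(\<integral>\<^sup>+x. ennreal (norm (f (x + \<sigma> k *\<^sub>R z) - f x)) * indicator ?D z * indicator ?Q x \<partial>lborel)
            \<le> (\<integral>\<^sup>+x. ennreal (norm (f (x + \<sigma> k *\<^sub>R z) - f x)) * indicator (dcube 0 (s + 1)) x * indicator (dcube 0 (s + 1)) (x + \<sigma> k *\<^sub>R z) \<partial>lborel)"
            using True inQ[OF _ z] Qs by (intro nn_integral_mono) (auto simp: indicator_def)
          also have "\<dots> \<le> (\<Sum>i\<in>UNIV. ennreal ((\<sigma> k *\<^sub>R z) $ i) * (\<integral>\<^sup>+x. ennreal (norm (g i x)) * indicator (dcube 0 (s + 1)) x \<partial>lborel))"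
            unfolding dcube_def
            by (rule translation_bound[OF _ _ ac]) (use Q z \<sigma>(1)[of k] in \<open>auto simp: dcube_def[symmetric] mem_dcube\<close>)
          also have "\<dots> \<le> (\<Sum>i\<in>UNIV. ennreal (\<sigma> k) * (\<integral>\<^sup>+x. ennreal (norm (g i x)) * indicator (dcube 0 (s + 1)) x \<partial>lborel))"
            using z \<sigma>(1)[of k] by (intro sum_mono mult_right_mono ennreal_leI) (auto simp: mem_dcube mult_le_cancel_left1)
          also have "\<dots> = ennreal (\<sigma> k) * I" by (simp add: I_def sum_distrib_left)
          finally show ?thesis using z by simp
        qed simp
      qed
      also have "\<dots> = ennreal (\<sigma> k) * I" by (simp add: nn_integral_cmult emeasure_dcube)
      finally show ?thesis .
    qed
    then have "(\<Sum>k. \<integral>\<^sup>+x. M k x * indicator ?Q x \<partial>lborel) \<le> (\<Sum>k. ennreal (\<sigma> k) * I)"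
      by (intro suminf_le) auto
    also have "\<dots> = (\<Sum>k. ennreal (\<sigma> k)) * I" by simp
    also have "(\<Sum>k. ennreal (\<sigma> k)) = ennreal (\<Sum>k. \<sigma> k)"
      unfolding \<sigma>_def by (intro suminf_ennreal2) (auto intro: summable_geometric)
    also have "ennreal (\<Sum>k. \<sigma> k) * I < \<infinity>" using I by (simp add: ennreal_mult_less_top)
    finally have "(\<Sum>k. \<integral>\<^sup>+x. M k x * indicator ?Q x \<partial>lborel) < \<infinity>" .
    moreover have "(\<integral>\<^sup>+x. (\<Sum>k. M k x * indicator ?Q x) \<partial>lborel) = (\<Sum>k. \<integral>\<^sup>+x. M k x * indicator ?Q x \<partial>lborel)"
      unfolding M_def by (rule nn_integral_suminf) measurable
    ultimately show ?thesis by simp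
  qed
  have "AE x in lborel. (\<Sum>k. M k x * indicator ?Q x) \<noteq> \<infinity>"
    by (rule nn_integral_PInf_AE) (use fin in \<open>auto simp: M_def\<close>)
  then show ?thesis
  proof eventually_elim
    case (elim x)
    show ?case
    proof
      assume x: "x \<in> ?Q"
      define S where "S = (\<Sum>k. ennreal (\<sigma> k) * A k x)"
      have lim: "(\<lambda>k. M k x) \<longlonglongrightarrow> 0"
        using elim x by (intro ennreal_finite_sum_tendsto_0) (auto simp: less_top)
      have tele: "M 0 x \<le> ennreal (4 ^ ?n) * (\<Sum>k<K. ennreal (\<sigma> k) * A k x) + M K x" for K
      proof (induction K)
        case (Suc K)
        have "M K x \<le> ennreal (4 ^ ?n) * (ennreal (\<sigma> K) * A K x) + M (Suc K) x"
          using order_trans[OF step[of K x] add_right_mono[OF mult_left_mono[OF PA[OF x]]]] by simp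
        from order_trans[OF Suc add_left_mono[OF this]] show ?case by (simp add: distrib_left add_ac)
      qed simp
      have partial: "(\<Sum>k<K. ennreal (\<sigma> k) * A k x) \<le> S" for K
        unfolding S_def by (rule sum_le_suminf) auto
      have bd: "M 0 x \<le> ennreal (4 ^ ?n) * S + M K x" for K
        by (rule order_trans[OF tele add_right_mono[OF mult_left_mono[OF partial]]]) simp
      have "(\<lambda>K. ennreal (4 ^ ?n) * S + M K x) \<longlonglongrightarrow> ennreal (4 ^ ?n) * S + 0"
        by (intro tendsto_intros lim)
      from LIMSEQ_le_const[OF this] bd have M0: "M 0 x \<le> ennreal (4 ^ ?n) * S" by simp
      have A0: "A 0 x \<le> S"
        unfolding S_def using sum_le_suminf[of "\<lambda>k. ennreal (\<sigma> k) * A k x" "{0}"] by (simp add: \<sigma>_def)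
      \<comment> \<open>Averaging over the first cube, of volume \<open>2^-d\<close>: telescoping
        bounds the oscillation by \<open>4^d\<close> times the series, and the mean value is at most
        its first term. Hence the constant \<open>2^d * (4^d + 1)\<close>.\<close>
      have "ennreal (norm (f x)) * ennreal ((1/2) ^ ?n) = (\<integral>\<^sup>+z. ennreal (norm (f x)) * indicator ?D z \<partial>lborel)"
        by (simp add: nn_integral_cmult emD)
      also have "\<dots> \<le> (\<integral>\<^sup>+z. ennreal (norm (f (x + \<sigma> 0 *\<^sub>R z) - f x)) * indicator ?D z + ennreal (norm (f (x + \<sigma> 0 *\<^sub>R z))) * indicator ?D z \<partial>lborel)"
      proof (intro nn_integral_mono)
        fix z :: "real ^ 'd"
        have "norm (f x) \<le> norm (f (x + \<sigma> 0 *\<^sub>R z) - f x) + norm (f (x + \<sigma> 0 *\<^sub>R z))"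
          using norm_triangle_ineq4[of "f (x + \<sigma> 0 *\<^sub>R z)" "f (x + \<sigma> 0 *\<^sub>R z) - f x"] by (simp add: add.commute)
        then have "ennreal (norm (f x)) \<le> ennreal (norm (f (x + \<sigma> 0 *\<^sub>R z) - f x)) + ennreal (norm (f (x + \<sigma> 0 *\<^sub>R z)))"
          by (simp add: ennreal_plus[symmetric] ennreal_leI del: ennreal_plus)
        from mult_right_mono[OF this, of "indicator ?D z"]
        show "ennreal (norm (f x)) * indicator ?D z \<le> ennreal (norm (f (x + \<sigma> 0 *\<^sub>R z) - f x)) * indicator ?D z + ennreal (norm (f (x + \<sigma> 0 *\<^sub>R z))) * indicator ?D z"
          by (simp add: distrib_right)
      qed
      also have "\<dots> = M 0 x + (\<integral>\<^sup>+z. ennreal (norm (f (x + \<sigma> 0 *\<^sub>R z))) * indicator ?D z \<partial>lborel)"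
        unfolding M_def by (rule nn_integral_add) measurable
      also have "(\<integral>\<^sup>+z. ennreal (norm (f (x + \<sigma> 0 *\<^sub>R z))) * indicator ?D z \<partial>lborel) \<le> A 0 x"
        unfolding A_def using DQ by (intro nn_integral_mono mult_mono ennreal_leI) (auto simp: indicator_def intro!: sum_nonneg)
      finally have "ennreal (norm (f x)) * ennreal ((1/2) ^ ?n) \<le> M 0 x + A 0 x" by (simp add: add_left_mono)
      also have "\<dots> \<le> ennreal (4 ^ ?n) * S + S" using M0 A0 by (rule add_mono)
      also have "\<dots> = ennreal (4 ^ ?n + 1) * S" by (simp add: distrib_right)
      finally have "ennreal (2 ^ ?n) * (ennreal (norm (f x)) * ennreal ((1/2) ^ ?n)) \<le> ennreal (2 ^ ?n) * (ennreal (4 ^ ?n + 1) * S)"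
        by (rule mult_left_mono) simp
      moreover have "ennreal (2 ^ ?n) * ennreal ((1/2) ^ ?n) = 1"
        by (simp add: ennreal_mult[symmetric] power_mult_distrib[symmetric])
      ultimately have "ennreal (norm (f x)) \<le> ennreal (2 ^ ?n) * (ennreal (4 ^ ?n + 1) * S)"
        by (simp add: mult.left_commute)
      also have "\<dots> = ennreal (2 ^ ?n * (4 ^ ?n + 1)) * S"
        by (simp add: ennreal_mult mult.assoc del: ennreal_plus)
      finally show "ennreal (norm (f x)) \<le> ennreal (2 ^ ?n * (4 ^ ?n + 1)) *
        (\<Sum>k. ennreal ((1/2) ^ k) * (\<integral>\<^sup>+z. ennreal (norm (f (x + (1/2) ^ k *\<^sub>R z)) + (\<Sum>i\<in>UNIV. norm (g i (x + (1/2) ^ k *\<^sub>R z)))) * indicator (dcube 0 1) z \<partial>lborel))"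
        by (simp add: S_def A_def \<sigma>_def)
    qed
  qed
qed

section \<open>Lebesgue and uniform norms of the potential\<close>

lemma le_one_plus_powr:
  fixes v q :: real
  assumes "0 \<le> v" "1 \<le> q"
  shows "v \<le> 1 + v powr q"
proof (cases "v \<le> 1")
  case True
  have "0 \<le> v powr q" by simp
  then show ?thesis using True by linarith
next
  case False
  then have "v powr 1 \<le> v powr q" using assms by (intro powr_mono) auto
  then show ?thesis using False by simp
qed

text \<open>Jensen's inequality on the unit cube bounds the power of the average; dilating the cube
  of side \<open>2^-k\<close> to unit size costs \<open>2^(d k)\<close>, which is the growth that
  the potential estimates have to beat.\<close>

lemma cube_average_powr:
  fixes F :: "real ^ 'd::finite \<Rightarrow> real"
  assumes [measurable]: "F \<in> borel_measurable borel" and F: "\<And>x. 0 \<le> F x" and q: "1 \<le> q"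
    and K: "(\<integral>\<^sup>+x. ennreal (F x powr q) * indicator (dcube 0 (s + 1)) x \<partial>lborel) \<le> ennreal K" "0 \<le> K"
    and x: "x \<in> dcube 0 s"
  obtains a where "0 \<le> a" "(\<integral>\<^sup>+z. ennreal (F (x + (1/2) ^ k *\<^sub>R z)) * indicator (dcube 0 1) z \<partial>lborel) = ennreal a"
    "ennreal (a powr q) \<le> (\<integral>\<^sup>+z. ennreal (F (x + (1/2) ^ k *\<^sub>R z) powr q) * indicator (dcube 0 1) z \<partial>lborel)"
    "a powr q \<le> (2 ^ CARD('d)) ^ k * K"
proof -
  let ?\<sigma> = "(1/2) ^ k :: real" and ?Q = "dcube 0 1 :: (real ^ 'd) set"
  have \<sigma>: "0 < ?\<sigma>" "?\<sigma> \<le> 1" by (auto simp: power_le_one)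
  define H where "H y = ennreal (F y powr q) * indicator (dcube 0 (s + 1)) y" for y
  have [measurable]: "H \<in> borel_measurable borel" unfolding H_def by measurable
  let ?A = "\<integral>\<^sup>+z. ennreal (F (x + ?\<sigma> *\<^sub>R z)) * indicator ?Q z \<partial>lborel"
  let ?B = "\<integral>\<^sup>+z. ennreal (F (x + ?\<sigma> *\<^sub>R z) powr q) * indicator ?Q z \<partial>lborel"
  have inQ: "x + ?\<sigma> *\<^sub>R z \<in> dcube 0 (s + 1)" if "z \<in> ?Q" for z
    unfolding mem_dcube
  proof
    fix i
    have "?\<sigma> * z $ i \<le> 1 * 1" using \<sigma> that by (intro mult_mono) (auto simp: mem_dcube)
    moreover have "0 \<le> ?\<sigma> * z $ i" using \<sigma> that by (auto simp: mem_dcube)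
    moreover have "0 \<le> x $ i" "x $ i \<le> s" using x by (auto simp: mem_dcube)
    ultimately show "0 \<le> (x + ?\<sigma> *\<^sub>R z) $ i \<and> (x + ?\<sigma> *\<^sub>R z) $ i \<le> s + 1" by auto
  qed
  have "?B \<le> (\<integral>\<^sup>+z. H (x + ?\<sigma> *\<^sub>R z) \<partial>lborel)"
    unfolding H_def using inQ by (intro nn_integral_mono) (auto simp: indicator_def)
  also have "\<dots> = ennreal ((2 ^ CARD('d)) ^ k) * (ennreal (?\<sigma> ^ CARD('d)) * (\<integral>\<^sup>+z. H (x + ?\<sigma> *\<^sub>R z) \<partial>lborel))"
  proof -
    have "(2 ^ CARD('d)) ^ k * ?\<sigma> ^ CARD('d) = (1::real)"
      by (simp add: power_mult[symmetric] mult.commute[of k] power_mult_distrib[symmetric])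
    then show ?thesis by (simp add: mult.assoc[symmetric] ennreal_mult[symmetric])
  qed
  also have "ennreal (?\<sigma> ^ CARD('d)) * (\<integral>\<^sup>+z. H (x + ?\<sigma> *\<^sub>R z) \<partial>lborel) = (\<integral>\<^sup>+x. H x \<partial>lborel)"
    by (rule nn_integral_scale[symmetric]) (use \<sigma> in auto)
  also have "ennreal ((2 ^ CARD('d)) ^ k) * (\<integral>\<^sup>+x. H x \<partial>lborel) \<le> ennreal ((2 ^ CARD('d)) ^ k) * ennreal K"
    unfolding H_def by (intro mult_left_mono K) auto
  finally have B: "?B \<le> ennreal ((2 ^ CARD('d)) ^ k * K)" using K(2) by (simp add: ennreal_mult)
  have em: "(\<integral>\<^sup>+z. indicator ?Q z \<partial>lborel) = 1" by (simp add: emeasure_dcube)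
  \<comment> \<open>Jensen is applied to a real number, so the average must first be shown finite;
    the inequality \<open>v \<le> 1 + v powr q\<close> and the finite integral \<open>?B\<close> do
    this.\<close>
  have "?A \<le> (\<integral>\<^sup>+z. indicator ?Q z + ennreal (F (x + ?\<sigma> *\<^sub>R z) powr q) * indicator ?Q z \<partial>lborel)"
  proof (rule nn_integral_mono)
    fix z
    have "ennreal (F (x + ?\<sigma> *\<^sub>R z)) \<le> 1 + ennreal (F (x + ?\<sigma> *\<^sub>R z) powr q)"
      using le_one_plus_powr[OF F q, of "x + ?\<sigma> *\<^sub>R z"]
      by (metis ennreal_1 ennreal_leI ennreal_plus powr_ge_zero zero_le_one)
    from mult_right_mono[OF this, of "indicator ?Q z"]
    show "ennreal (F (x + ?\<sigma> *\<^sub>R z)) * indicator ?Q z \<le> indicator ?Q z + ennreal (F (x + ?\<sigma> *\<^sub>R z) powr q) * indicator ?Q z"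
      by (simp add: distrib_right)
  qed
  also have "\<dots> = 1 + ?B" by (subst nn_integral_add) (simp_all add: em del: nn_integral_indicator)
  also have "\<dots> < \<infinity>" using B by (auto simp: less_top[symmetric] top_unique)
  finally have Afin: "?A < \<infinity>" .
  define a where "a = enn2real ?A"
  have A: "?A = ennreal a" using Afin by (simp add: a_def)
  have a0: "0 \<le> a" by (simp add: a_def)
  define M where "M = density lborel (indicator ?Q)"
  have "ennreal (a powr q) \<le> (\<integral>\<^sup>+z. ennreal (F (x + ?\<sigma> *\<^sub>R z) powr q) \<partial>M)"
  proof (rule Jensen_powr[OF _ q a0])
    show "emeasure M (space M) \<le> 1"
      by (simp add: M_def emeasure_density emeasure_dcube)
    show "ennreal a \<le> (\<integral>\<^sup>+z. ennreal (F (x + ?\<sigma> *\<^sub>R z)) \<partial>M)"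
      unfolding A[symmetric] M_def by (subst nn_integral_density) (simp_all add: mult.commute)
    show "(\<lambda>z. F (x + ?\<sigma> *\<^sub>R z)) \<in> borel_measurable M" by (simp add: M_def)
  qed (rule F)
  also have "\<dots> = ?B" unfolding M_def by (subst nn_integral_density) (simp_all add: mult.commute)
  finally have aB: "ennreal (a powr q) \<le> ?B" .
  have "a powr q \<le> (2 ^ CARD('d)) ^ k * K"
    using order_trans[OF aB B] K(2) by (simp add: ennreal_le_iff)
  then show ?thesis using that[OF a0 A aB] by blast
qed

text \<open>The average at scale \<open>2^-k\<close> is at most \<open>K powr (1/q)\<close> times
  \<open>2 powr (d k / q)\<close>, so the terms form a geometric series of ratio
  \<open>2 powr (d / q - 1)\<close>, which converges because \<open>q > d\<close>.\<close>

lemma potential_sup_bound: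
  fixes F f :: "real ^ 'd::finite \<Rightarrow> real"
  assumes Fm: "F \<in> borel_measurable borel" and F: "\<And>x. 0 \<le> F x" and q: "real CARD('d) < q" and C: "0 \<le> C"
    and K: "(\<integral>\<^sup>+x. ennreal (F x powr q) * indicator (dcube 0 (s + 1)) x \<partial>lborel) \<le> ennreal K" "0 \<le> K"
    and x: "x \<in> dcube 0 s"
    and f: "0 \<le> f x" "ennreal (f x) \<le> ennreal C * (\<Sum>k. ennreal ((1/2) ^ k) * (\<integral>\<^sup>+z. ennreal (F (x + (1/2) ^ k *\<^sub>R z)) * indicator (dcube 0 1) z \<partial>lborel))"
  shows "f x \<le> C * (K powr (1 / q) / (1 - 2 powr (real CARD('d) / q - 1)))"
proof -
  let ?n = "CARD('d)"
  have "1 \<le> ?n" by (simp add: Suc_leI)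
  then have q1: "1 \<le> q" using q by linarith
  define r where "r = 2 powr (real ?n / q - 1)"
  have "real ?n / q - 1 < 0" using q q1 by simp
  then have r: "0 < r" "r < 1" by (auto simp: r_def powr_less_one)
  have 1: "ennreal ((1/2) ^ k) * (\<integral>\<^sup>+z. ennreal (F (x + (1/2) ^ k *\<^sub>R z)) * indicator (dcube 0 1) z \<partial>lborel) \<le> ennreal (K powr (1 / q) * r ^ k)" for k
  proof -
    obtain a where a: "0 \<le> a" "(\<integral>\<^sup>+z. ennreal (F (x + (1/2) ^ k *\<^sub>R z)) * indicator (dcube 0 1) z \<partial>lborel) = ennreal a"
      "ennreal (a powr q) \<le> (\<integral>\<^sup>+z. ennreal (F (x + (1/2) ^ k *\<^sub>R z) powr q) * indicator (dcube 0 1) z \<partial>lborel)"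
      "a powr q \<le> (2 ^ ?n) ^ k * K"
      by (rule cube_average_powr[OF Fm F q1 K x, of k])
    have "a = (a powr q) powr (1 / q)" using q1 a(1) by (simp add: powr_powr)
    also have "\<dots> \<le> ((2 ^ ?n) ^ k * K) powr (1 / q)" using a(4) q1 by (intro powr_mono2) auto
    also have "\<dots> = ((2 ^ ?n) ^ k) powr (1 / q) * K powr (1 / q)" using K(2) by (simp add: powr_mult)
    also have "((2 ^ ?n) ^ k) powr (1 / q) = 2 powr (real ?n * real k / q)"
      by (simp add: power_mult[symmetric] powr_realpow[symmetric] powr_powr)
    finally have "(1/2) ^ k * a \<le> (1/2) ^ k * (2 powr (real ?n * real k / q) * K powr (1 / q))"
      by (intro mult_left_mono) auto
    also have "(1/2) ^ k * (2 powr (real ?n * real k / q) * K powr (1 / q)) = K powr (1 / q) * r ^ k"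
    proof -
      have "r ^ k = r powr (real k)" using r by (simp add: powr_realpow)
      also have "\<dots> = 2 powr ((real ?n / q - 1) * real k)" unfolding r_def by (simp only: powr_powr)
      also have "\<dots> = 2 powr (real ?n * real k / q) * 2 powr (- real k)" by (simp add: powr_add[symmetric] algebra_simps)
      also have "2 powr (- real k) = (1/2) ^ k" by (simp add: powr_minus powr_realpow power_one_over inverse_eq_divide)
      finally show ?thesis by simp
    qed
    finally show ?thesis unfolding a(2) using a(1) by (simp add: ennreal_mult[symmetric] ennreal_leI)
  qed
  have "ennreal (f x) \<le> ennreal C * (\<Sum>k. ennreal (K powr (1 / q) * r ^ k))"
    using f(2) by (rule order_trans) (intro mult_left_mono suminf_le 1; simp)
  also have "(\<Sum>k. ennreal (K powr (1 / q) * r ^ k)) = ennreal (\<Sum>k. K powr (1 / q) * r ^ k)"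
    using r by (intro suminf_ennreal2 summable_mult summable_geometric) auto
  also have "(\<Sum>k. K powr (1 / q) * r ^ k) = K powr (1 / q) / (1 - r)"
    using r by (subst suminf_mult) (auto simp: suminf_geometric summable_geometric)
  finally show ?thesis
    using C r by (simp add: ennreal_mult[symmetric] ennreal_le_iff r_def[symmetric])
qed

text \<open>The factor \<open>2^-k\<close> is split: probability weights \<open>w k\<close> of ratio
  \<open>2 powr -\<delta>\<close> permit Jensen's inequality in \<open>k\<close> with exponent
  \<open>q'\<close>, and the remaining decay pays for the growth of the averages. The number
  \<open>\<delta>\<close> is what is left of one derivative after raising the integrability from
  \<open>q\<close> to \<open>q'\<close>.\<close>

lemma potential_integral_bound:
  fixes F f :: "real ^ 'd::finite \<Rightarrow> real"
  assumes [measurable]: "F \<in> borel_measurable borel" "f \<in> borel_measurable borel" and F: "\<And>x. 0 \<le> F x"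
    and q: "1 \<le> q" "q \<le> q'" and \<delta>: "\<delta> = 1 - real CARD('d) * (1 / q - 1 / q')" "0 < \<delta>" and C: "0 \<le> C"
    and K: "(\<integral>\<^sup>+x. ennreal (F x powr q) * indicator (dcube 0 (s + 1)) x \<partial>lborel) \<le> ennreal K" "0 \<le> K" and f0: "\<And>x. 0 \<le> f x"
    and f: "AE x in lborel. x \<in> dcube 0 s \<longrightarrow> ennreal (f x) \<le>
      ennreal C * (\<Sum>k. ennreal ((1/2) ^ k) * (\<integral>\<^sup>+z. ennreal (F (x + (1/2) ^ k *\<^sub>R z)) * indicator (dcube 0 1) z \<partial>lborel))"
  shows "(\<integral>\<^sup>+x. ennreal (f x powr q') * indicator (dcube 0 s) x \<partial>lborel)
    \<le> ennreal (C powr q' * (1 - 2 powr - \<delta>) powr (- q') * K powr (q' / q - 1) * K)"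
proof -
  let ?n = "CARD('d)" and ?Q = "dcube 0 1 :: (real ^ 'd) set" and ?S = "dcube 0 s :: (real ^ 'd) set"
  have q'1: "1 \<le> q'" using q by simp
  define Z where "Z = 1 - 2 powr - \<delta>"
  have th: "0 < 2 powr - \<delta>" "2 powr - \<delta> < 1" using \<delta>(2) by (auto intro: powr_less_one)
  then have Z: "0 < Z" by (simp add: Z_def)
  define w where "w k = Z * (2 powr - \<delta>) ^ k" for k :: nat
  have w: "0 < w k" for k using Z th by (simp add: w_def)
  have sw: "(\<Sum>k. ennreal (w k)) = 1"
  proof -
    have "(\<Sum>k. ennreal (w k)) = ennreal (\<Sum>k. w k)"
      unfolding w_def using th Z by (intro suminf_ennreal2 summable_mult summable_geometric) auto
    also have "(\<Sum>k. w k) = Z * (1 / (1 - 2 powr - \<delta>))"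
      unfolding w_def using th by (subst suminf_mult) (auto simp: suminf_geometric summable_geometric)
    also have "\<dots> = 1" using Z \<delta>(2) by (simp add: Z_def)
    finally show ?thesis by simp
  qed
  define A where "A k x = (\<integral>\<^sup>+z. ennreal (F (x + (1/2) ^ k *\<^sub>R z)) * indicator ?Q z \<partial>lborel)" for k x
  define a where "a k x = enn2real (A k x)" for k x
  have [measurable]: "a k \<in> borel_measurable borel" for k
    unfolding a_def[abs_def] A_def by measurable
  have a: "A k x = ennreal (a k x)" "0 \<le> a k x" "a k x powr q \<le> (2 ^ ?n) ^ k * K"
    "ennreal (a k x powr q) \<le> (\<integral>\<^sup>+z. ennreal (F (x + (1/2) ^ k *\<^sub>R z) powr q) * indicator ?Q z \<partial>lborel)" if xS: "x \<in> ?S" for k x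
  proof -
    obtain b where b: "0 \<le> b" "A k x = ennreal b"
      "ennreal (b powr q) \<le> (\<integral>\<^sup>+z. ennreal (F (x + (1/2) ^ k *\<^sub>R z) powr q) * indicator (dcube 0 1) z \<partial>lborel)"
      "b powr q \<le> (2 ^ ?n) ^ k * K"
      unfolding A_def by (rule cube_average_powr[OF assms(1) F q(1) K xS, of k])
    have "a k x = b" using b by (simp add: a_def)
    then show "A k x = ennreal (a k x)" "0 \<le> a k x" "a k x powr q \<le> (2 ^ ?n) ^ k * K"
      "ennreal (a k x powr q) \<le> (\<integral>\<^sup>+z. ennreal (F (x + (1/2) ^ k *\<^sub>R z) powr q) * indicator ?Q z \<partial>lborel)" using b by auto
  qed
  have int_a: "(\<integral>\<^sup>+x. ennreal (a k x powr q) * indicator ?S x \<partial>lborel) \<le> ennreal K" for k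
  proof -
    have inQ: "x + (1/2) ^ k *\<^sub>R z \<in> dcube 0 (s + 1)" if "x \<in> ?S" "z \<in> ?Q" for x z
      unfolding mem_dcube
    proof
      fix i
      have "(1/2) ^ k * z $ i \<le> 1 * 1" using that by (intro mult_mono) (auto simp: mem_dcube power_le_one)
      moreover have "0 \<le> (1/2) ^ k * z $ i" using that by (auto simp: mem_dcube)
      moreover have "0 \<le> x $ i" "x $ i \<le> s" using that by (auto simp: mem_dcube)
      ultimately show "0 \<le> (x + (1/2) ^ k *\<^sub>R z) $ i \<and> (x + (1/2) ^ k *\<^sub>R z) $ i \<le> s + 1" by auto
    qed
    define H where "H y = ennreal (F y powr q) * indicator (dcube 0 (s + 1)) y" for y
    have [measurable]: "H \<in> borel_measurable borel" unfolding H_def by measurable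
    have "(\<integral>\<^sup>+x. ennreal (a k x powr q) * indicator ?S x \<partial>lborel) \<le>
      (\<integral>\<^sup>+x. \<integral>\<^sup>+z. ennreal (F (x + (1/2) ^ k *\<^sub>R z) powr q) * indicator ?Q z * indicator ?S x \<partial>lborel \<partial>lborel)"
    proof (rule nn_integral_mono)
      fix x
      show "ennreal (a k x powr q) * indicator ?S x \<le> (\<integral>\<^sup>+z. ennreal (F (x + (1/2) ^ k *\<^sub>R z) powr q) * indicator ?Q z * indicator ?S x \<partial>lborel)"
        by (cases "x \<in> ?S") (simp_all add: a(4))
    qed
    also have "\<dots> = (\<integral>\<^sup>+z. \<integral>\<^sup>+x. ennreal (F (x + (1/2) ^ k *\<^sub>R z) powr q) * indicator ?Q z * indicator ?S x \<partial>lborel \<partial>lborel)"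
      by (rule lborel_pair.Fubini') measurable
    also have "\<dots> \<le> (\<integral>\<^sup>+z. ennreal K * indicator ?Q z \<partial>lborel)"
    proof (rule nn_integral_mono)
      fix z
      show "(\<integral>\<^sup>+x. ennreal (F (x + (1/2) ^ k *\<^sub>R z) powr q) * indicator ?Q z * indicator ?S x \<partial>lborel) \<le> ennreal K * indicator ?Q z"
      proof (cases "z \<in> ?Q")
        case True
        have "(\<integral>\<^sup>+x. ennreal (F (x + (1/2) ^ k *\<^sub>R z) powr q) * indicator ?Q z * indicator ?S x \<partial>lborel) \<le> (\<integral>\<^sup>+x. H (x + (1/2) ^ k *\<^sub>R z) \<partial>lborel)"
          unfolding H_def using inQ True by (intro nn_integral_mono) (auto simp: indicator_def)
        also have "\<dots> = (\<integral>\<^sup>+x. H x \<partial>lborel)" by (rule nn_integral_shift) measurable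
        also have "\<dots> \<le> ennreal K" unfolding H_def by (rule K)
        finally show ?thesis using True by simp
      qed simp
    qed
    also have "\<dots> = ennreal K" by (simp add: nn_integral_cmult emeasure_dcube)
    finally show ?thesis .
  qed
  define c where "c k = C * (1/2) ^ k / w k" for k :: nat
  have c: "0 \<le> c k" for k using C w[of k] by (simp add: c_def)
  define M where "M = density (count_space UNIV) (\<lambda>k. ennreal (w k))"
  have Mint: "(\<integral>\<^sup>+k. G k \<partial>M) = (\<Sum>k. ennreal (w k) * G k)" for G :: "nat \<Rightarrow> ennreal"
    unfolding M_def by (subst nn_integral_density) (simp_all add: nn_integral_count_space_nat)
  define R where "R = C powr q' * Z powr (- q') * K powr (q' / q - 1)"
  have R0: "0 \<le> R" by (simp add: R_def)
  have point: "ennreal (f x powr q') \<le> (\<Sum>k. ennreal (w k * R) * ennreal (a k x powr q))"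
    if x: "x \<in> ?S" and le: "ennreal (f x) \<le> ennreal C * (\<Sum>k. ennreal ((1/2) ^ k) * A k x)" for x
  proof -
    have "ennreal (f x) \<le> (\<Sum>k. ennreal C * (ennreal ((1/2) ^ k) * A k x))" using le by simp
    also have "\<dots> = (\<Sum>k. ennreal (w k) * ennreal (c k * a k x))"
    proof (rule suminf_cong)
      fix k
      have "C * ((1/2) ^ k * a k x) = w k * (c k * a k x)" using w[of k] by (simp add: c_def)
      then show "ennreal C * (ennreal ((1/2) ^ k) * A k x) = ennreal (w k) * ennreal (c k * a k x)"
        unfolding a(1)[OF x] using C w[of k] c[of k] a(2)[OF x, of k] by (simp add: ennreal_mult[symmetric])
    qed
    finally have "ennreal (f x) \<le> (\<integral>\<^sup>+k. ennreal (c k * a k x) \<partial>M)" by (simp add: Mint)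
    moreover have "emeasure M (space M) \<le> 1"
      using Mint[of "\<lambda>_. 1"] sw by (simp add: M_def)
    ultimately have "ennreal (f x powr q') \<le> (\<integral>\<^sup>+k. ennreal ((c k * a k x) powr q') \<partial>M)"
      using c a(2)[OF x] q'1 f0 by (intro Jensen_powr) (auto simp: M_def)
    also have "\<dots> = (\<Sum>k. ennreal (w k) * ennreal ((c k * a k x) powr q'))" by (rule Mint)
    also have "\<dots> \<le> (\<Sum>k. ennreal (w k * R) * ennreal (a k x powr q))"
    proof (rule suminf_le)
      fix k
      let ?b = "a k x"
      have b0: "0 \<le> ?b" using a(2)[OF x] .
      \<comment> \<open>Only the surplus power is estimated pointwise; one factor
        \<open>?b powr q\<close> is kept, because its integral is bounded by \<open>K\<close> at
        every scale.\<close>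
      have "?b powr q' = (?b powr q) powr (q' / q - 1) * ?b powr q"
        using q by (simp add: powr_powr powr_add[symmetric] algebra_simps)
      also have "\<dots> \<le> ((2 ^ ?n) ^ k * K) powr (q' / q - 1) * ?b powr q"
        using q a(3)[OF x] by (intro mult_right_mono powr_mono2) (auto simp: field_simps)
      also have "((2 ^ ?n) ^ k * K) powr (q' / q - 1) = ((2 ^ ?n) ^ k) powr (q' / q - 1) * K powr (q' / q - 1)"
        using K(2) by (simp add: powr_mult)
      finally have bq: "?b powr q' \<le> ((2 ^ ?n) ^ k) powr (q' / q - 1) * K powr (q' / q - 1) * ?b powr q" .
      have t1: "((2 ^ ?n) ^ k) powr (q' / q - 1) = 2 powr (real ?n * real k * (q' / q - 1))"
        by (simp add: power_mult[symmetric] powr_realpow[symmetric] powr_powr)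
      have t2: "c k powr q' = C powr q' * Z powr (- q') * 2 powr ((\<delta> - 1) * real k * q')"
      proof -
        have "c k = C * (1 / Z) * (2 powr ((\<delta> - 1) * real k))"
        proof -
          have "(2 powr - \<delta>) ^ k = (2 powr - \<delta>) powr (real k)" by (simp add: powr_realpow)
          then have "(2 powr - \<delta>) ^ k = 2 powr (- \<delta> * real k)" by (simp only: powr_powr)
          moreover have "(1/2) ^ k = 2 powr (- real k)" by (simp add: powr_minus powr_realpow power_one_over inverse_eq_divide)
          ultimately have "c k = C * (1 / Z) * (2 powr (- real k) / 2 powr (- \<delta> * real k))"
            unfolding c_def w_def by simp
          also have "2 powr (- real k) / 2 powr (- \<delta> * real k) = 2 powr ((\<delta> - 1) * real k)"
            unfolding powr_diff[symmetric] by (simp add: algebra_simps)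
          finally show ?thesis .
        qed
        then have "c k powr q' = C powr q' * (1 / Z) powr q' * (2 powr ((\<delta> - 1) * real k)) powr q'"
          using C Z by (simp add: powr_mult powr_divide)
        then show ?thesis using Z by (simp add: powr_powr powr_minus powr_divide inverse_eq_divide)
      qed
      \<comment> \<open>The powers of 2 cancel exactly; this equation is what determines
        \<open>\<delta>\<close>.\<close>
      have t3: "2 powr ((\<delta> - 1) * real k * q') * 2 powr (real ?n * real k * (q' / q - 1)) = 1"
      proof -
        have "(\<delta> - 1) * q' = - (real ?n * (q' / q - 1))"
          unfolding \<delta>(1) using q q'1 by (simp add: field_simps)
        then have "(\<delta> - 1) * real k * q' + real ?n * real k * (q' / q - 1) = 0"
          by (metis add.left_inverse mult.assoc mult.commute mult_minus_left)
        then show ?thesis by (simp add: powr_add[symmetric])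
      qed
      have "(c k * ?b) powr q' = c k powr q' * ?b powr q'" using c b0 by (simp add: powr_mult)
      also have "\<dots> \<le> c k powr q' * (((2 ^ ?n) ^ k) powr (q' / q - 1) * K powr (q' / q - 1) * ?b powr q)"
        by (rule mult_left_mono[OF bq]) simp
      also have "\<dots> = R * (2 powr ((\<delta> - 1) * real k * q') * 2 powr (real ?n * real k * (q' / q - 1))) * ?b powr q"
        unfolding t1 t2 R_def by (simp add: mult_ac)
      also have "\<dots> = R * ?b powr q" unfolding t3 by simp
      finally have "w k * (c k * ?b) powr q' \<le> w k * R * ?b powr q" using w[of k] by (simp add: mult.assoc)
      then show "ennreal (w k) * ennreal ((c k * ?b) powr q') \<le> ennreal (w k * R) * ennreal (?b powr q)"
        using w[of k] R0 by (simp add: ennreal_mult[symmetric] ennreal_leI)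
    qed auto
    finally show ?thesis .
  qed
  have "(\<integral>\<^sup>+x. ennreal (f x powr q') * indicator ?S x \<partial>lborel) \<le> (\<integral>\<^sup>+x. (\<Sum>k. ennreal (w k * R) * (ennreal (a k x powr q) * indicator ?S x)) \<partial>lborel)"
  proof (rule nn_integral_mono_AE, use f in eventually_elim)
    case (elim x)
    show ?case
      using elim point[of x] by (cases "x \<in> ?S") (simp_all add: A_def)
  qed
  also have "\<dots> = (\<Sum>k. ennreal (w k * R) * (\<integral>\<^sup>+x. ennreal (a k x powr q) * indicator ?S x \<partial>lborel))"
    by (simp add: nn_integral_suminf nn_integral_cmult)
  also have "\<dots> \<le> (\<Sum>k. ennreal (w k) * ennreal (R * K))"
  proof (rule suminf_le)
    fix k
    have "ennreal (w k * R) * (\<integral>\<^sup>+x. ennreal (a k x powr q) * indicator ?S x \<partial>lborel) \<le> ennreal (w k * R) * ennreal K"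
      by (intro mult_left_mono int_a) simp
    also have "\<dots> = ennreal (w k) * ennreal (R * K)"
      using w[of k] R0 K(2) by (simp add: ennreal_mult mult_ac)
    finally show "ennreal (w k * R) * (\<integral>\<^sup>+x. ennreal (a k x powr q) * indicator ?S x \<partial>lborel) \<le> ennreal (w k) * ennreal (R * K)" .
  qed auto
  also have "\<dots> = ennreal (R * K)" by (simp add: sw)
  finally show ?thesis by (simp add: R_def Z_def)
qed

section \<open>Products on a cube: the subcritical case\<close>

definition jet_sum :: "(('d \<Rightarrow> nat) \<Rightarrow> real ^ 'd::finite \<Rightarrow> 'b::real_normed_vector) \<Rightarrow> nat \<Rightarrow> real ^ 'd::finite \<Rightarrow> real" where
  "jet_sum U j x = (\<Sum>\<alpha> | mindex_order \<alpha> \<le> j. norm (U \<alpha> x))"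

lemma jet_sum_nonneg: "0 \<le> jet_sum U j x"
  by (simp add: jet_sum_def sum_nonneg)

lemma norm_le_jet_sum: "mindex_order \<alpha> \<le> j \<Longrightarrow> norm (U \<alpha> x) \<le> jet_sum U j x"
  unfolding jet_sum_def by (rule member_le_sum) (auto simp: finite_mindex_le)

lemma jet_sum_mono: "i \<le> j \<Longrightarrow> jet_sum U i x \<le> jet_sum U j x"
  unfolding jet_sum_def by (rule sum_mono2) (auto simp: finite_mindex_le)

lemma ac_familyD:
  assumes "ac_family \<Omega> m U"
  shows "mindex_order \<alpha> \<le> m \<Longrightarrow> loc_int \<Omega> (U \<alpha>)"
    "mindex_order \<alpha> < m \<Longrightarrow> ac_on_lines \<Omega> i (U \<alpha>) (U (\<alpha>(i := Suc (\<alpha> i))))"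
    "mindex_order \<alpha> \<le> m \<Longrightarrow> U \<alpha> \<in> borel_measurable borel"
  using assms unfolding ac_family_def loc_int_def by blast+

lemma jet_sum_measurable:
  assumes "ac_family \<Omega> m U" "j \<le> m"
  shows "jet_sum U j \<in> borel_measurable borel"
  unfolding jet_sum_def[abs_def]
  by (intro borel_measurable_sum borel_measurable_norm) (use ac_familyD(3)[OF assms(1)] assms(2) in auto)

text \<open>The number of multi-indices times the constant of
  \<open>pointwise_potential_bound\<close>; the factor \<open>d + 1\<close> counts a function and
  its \<open>d\<close> first derivatives, each bounded by the next jet.\<close>

definition jet_const :: "'d::finite itself \<Rightarrow> nat \<Rightarrow> real" where
  "jet_const _ j = real (card {\<alpha> :: 'd \<Rightarrow> nat. mindex_order \<alpha> \<le> j}) * (2 ^ CARD('d) * (4 ^ CARD('d) + 1) * (real CARD('d) + 1))"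

lemma jet_sum_potential_bound:
  fixes U :: "('d::{finite,linorder} \<Rightarrow> nat) \<Rightarrow> real ^ 'd::{finite,linorder} \<Rightarrow> 'b::euclidean_space"
  assumes U: "ac_family \<Omega> m U" and j: "j < m" and s: "0 \<le> s" and Q: "dcube 0 (s + 1) \<subseteq> \<Omega>"
  shows "AE x in lborel. x \<in> dcube 0 s \<longrightarrow> ennreal (jet_sum U j x) \<le> ennreal (jet_const TYPE('d) j) *
    (\<Sum>k. ennreal ((1/2) ^ k) * (\<integral>\<^sup>+z. ennreal (jet_sum U (Suc j) (x + (1/2) ^ k *\<^sub>R z)) * indicator (dcube 0 1) z \<partial>lborel))"
proof -
  let ?A = "{\<alpha> :: 'd \<Rightarrow> nat. mindex_order \<alpha> \<le> j}" and ?n = "CARD('d)"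
  let ?c = "2 ^ ?n * (4 ^ ?n + 1) :: real"
  define T where "T x = (\<Sum>k. ennreal ((1/2) ^ k) * (\<integral>\<^sup>+z. ennreal (jet_sum U (Suc j) (x + (1/2) ^ k *\<^sub>R z)) * indicator (dcube 0 1) z \<partial>lborel))" for x
  have [measurable]: "jet_sum U (Suc j) \<in> borel_measurable borel" using j by (intro jet_sum_measurable[OF U]) auto
  have "AE x in lborel. x \<in> dcube 0 s \<longrightarrow> ennreal (norm (U \<alpha> x)) \<le> ennreal (?c * (real ?n + 1)) * T x" if \<alpha>: "\<alpha> \<in> ?A" for \<alpha>
  proof -
    have ord: "mindex_order \<alpha> \<le> m" "mindex_order \<alpha> < m" "mindex_order (\<alpha>(i := Suc (\<alpha> i))) \<le> Suc j" for i
      using \<alpha> j by (auto simp: mindex_order_upd simp del: fun_upd_apply)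
    have "loc_int \<Omega> (U (\<alpha>(i := Suc (\<alpha> i))))" for i
      using ord(3)[of i] j by (intro ac_familyD(1)[OF U]) auto
    from pointwise_potential_bound[OF ac_familyD(1)[OF U ord(1)] this ac_familyD(2)[OF U ord(2)] s Q]
    show ?thesis
    proof eventually_elim
      case (elim x)
      have le: "norm (U \<alpha> y) + (\<Sum>i\<in>UNIV. norm (U (\<alpha>(i := Suc (\<alpha> i))) y)) \<le> (real ?n + 1) * jet_sum U (Suc j) y" for y
      proof -
        have "norm (U \<alpha> y) \<le> jet_sum U (Suc j) y" using \<alpha> by (intro norm_le_jet_sum) auto
        moreover have "(\<Sum>i\<in>UNIV. norm (U (\<alpha>(i := Suc (\<alpha> i))) y)) \<le> (\<Sum>i\<in>(UNIV :: 'd set). jet_sum U (Suc j) y)"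
          by (intro sum_mono norm_le_jet_sum ord(3))
        ultimately show ?thesis by (simp add: algebra_simps)
      qed
      have "(\<Sum>k. ennreal ((1/2) ^ k) * (\<integral>\<^sup>+z. ennreal (norm (U \<alpha> (x + (1/2) ^ k *\<^sub>R z)) + (\<Sum>i\<in>UNIV. norm (U (\<alpha>(i := Suc (\<alpha> i))) (x + (1/2) ^ k *\<^sub>R z)))) * indicator (dcube 0 1) z \<partial>lborel))
        \<le> (\<Sum>k. ennreal (real ?n + 1) * (ennreal ((1/2) ^ k) * (\<integral>\<^sup>+z. ennreal (jet_sum U (Suc j) (x + (1/2) ^ k *\<^sub>R z)) * indicator (dcube 0 1) z \<partial>lborel)))"
      proof (rule suminf_le)
        fix k
        have "(\<integral>\<^sup>+z. ennreal (norm (U \<alpha> (x + (1/2) ^ k *\<^sub>R z)) + (\<Sum>i\<in>UNIV. norm (U (\<alpha>(i := Suc (\<alpha> i))) (x + (1/2) ^ k *\<^sub>R z)))) * indicator (dcube 0 1) z \<partial>lborel)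
          \<le> (\<integral>\<^sup>+z. ennreal (real ?n + 1) * (ennreal (jet_sum U (Suc j) (x + (1/2) ^ k *\<^sub>R z)) * indicator (dcube 0 1) z) \<partial>lborel)"
          unfolding mult.assoc[symmetric]
          using le by (intro nn_integral_mono mult_right_mono) (auto simp: ennreal_mult[symmetric] jet_sum_nonneg simp del: ennreal_plus intro!: ennreal_leI)
        also have "\<dots> = ennreal (real ?n + 1) * (\<integral>\<^sup>+z. ennreal (jet_sum U (Suc j) (x + (1/2) ^ k *\<^sub>R z)) * indicator (dcube 0 1) z \<partial>lborel)"
          by (rule nn_integral_cmult) measurable
        finally show "ennreal ((1/2) ^ k) * (\<integral>\<^sup>+z. ennreal (norm (U \<alpha> (x + (1/2) ^ k *\<^sub>R z)) + (\<Sum>i\<in>UNIV. norm (U (\<alpha>(i := Suc (\<alpha> i))) (x + (1/2) ^ k *\<^sub>R z)))) * indicator (dcube 0 1) z \<partial>lborel)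
          \<le> ennreal (real ?n + 1) * (ennreal ((1/2) ^ k) * (\<integral>\<^sup>+z. ennreal (jet_sum U (Suc j) (x + (1/2) ^ k *\<^sub>R z)) * indicator (dcube 0 1) z \<partial>lborel))"
          unfolding mult.left_commute[of "ennreal (real ?n + 1)"] by (rule mult_left_mono) simp
      qed auto
      also have "\<dots> = ennreal (real ?n + 1) * T x" unfolding T_def by (rule ennreal_suminf_cmult)
      finally have "ennreal ?c * (\<Sum>k. ennreal ((1/2) ^ k) * (\<integral>\<^sup>+z. ennreal (norm (U \<alpha> (x + (1/2) ^ k *\<^sub>R z)) + (\<Sum>i\<in>UNIV. norm (U (\<alpha>(i := Suc (\<alpha> i))) (x + (1/2) ^ k *\<^sub>R z)))) * indicator (dcube 0 1) z \<partial>lborel))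
        \<le> ennreal ?c * (ennreal (real ?n + 1) * T x)" by (rule mult_left_mono) simp
      also have "\<dots> = ennreal (?c * (real ?n + 1)) * T x"
        by (simp add: ennreal_mult mult.assoc del: ennreal_plus)
      finally show ?case using elim by (auto intro: order_trans)
    qed
  qed
  then have "AE x in lborel. \<forall>\<alpha>\<in>?A. x \<in> dcube 0 s \<longrightarrow> ennreal (norm (U \<alpha> x)) \<le> ennreal (?c * (real ?n + 1)) * T x"
    by (subst AE_ball_countable) (auto simp: finite_mindex_le countable_finite)
  then show ?thesis
  proof eventually_elim
    case (elim x)
    show ?case
    proof
      assume x: "x \<in> dcube 0 s"
      have "ennreal (jet_sum U j x) = (\<Sum>\<alpha>\<in>?A. ennreal (norm (U \<alpha> x)))"
        unfolding jet_sum_def by (rule sum_ennreal[symmetric]) simp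
      also have "\<dots> \<le> (\<Sum>\<alpha>\<in>?A. ennreal (?c * (real ?n + 1)) * T x)"
        using elim x by (intro sum_mono) auto
      also have "\<dots> = ennreal (jet_const TYPE('d) j) * T x"
        by (simp add: jet_const_def ennreal_mult mult.assoc ennreal_of_nat_eq_real_of_nat del: ennreal_plus)
      finally show "ennreal (jet_sum U j x) \<le> ennreal (jet_const TYPE('d) j) *
        (\<Sum>k. ennreal ((1/2) ^ k) * (\<integral>\<^sup>+z. ennreal (jet_sum U (Suc j) (x + (1/2) ^ k *\<^sub>R z)) * indicator (dcube 0 1) z \<partial>lborel))"
        by (simp add: T_def)
    qed
  qed
qed

text \<open>The side \<open>m + 1\<close> leaves a margin of 1 for each of the \<open>m\<close>
  embedding steps, since the potential looks one unit ahead in every coordinate; the unit cube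
  remains at the end.\<close>

definition jet_energy ::
  "real \<Rightarrow> nat \<Rightarrow> (('d \<Rightarrow> nat) \<Rightarrow> real ^ 'd::finite \<Rightarrow> 'b::real_normed_vector) \<Rightarrow> ennreal" where
  "jet_energy p m U = (\<integral>\<^sup>+x. ennreal (jet_sum U m x powr p) * indicator (dcube 0 (real m + 1)) x \<partial>lborel)"

text \<open>The Lebesgue exponents \<open>m p / j\<close>, for \<open>j = m, \<dots>, 1, 0\<close>, have reciprocals in arithmetic
  progression with gap \<open>1 / (m p) < 1 / d\<close>, so every step is a subcritical Sobolev embedding.\<close>

lemma sobolev_chain:
  assumes p: "1 \<le> p" and mp: "real CARD('d) < real m * p" and j: "1 \<le> j" "j \<le> m"
  shows "\<exists>B\<ge>0. \<forall>\<Omega> (U :: ('d::{finite,linorder} \<Rightarrow> nat) \<Rightarrow> real ^ 'd::{finite,linorder} \<Rightarrow> 'b::euclidean_space).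
    ac_family \<Omega> m U \<longrightarrow> dcube 0 (real m + 1) \<subseteq> \<Omega> \<longrightarrow> jet_energy p m U \<le> 1 \<longrightarrow>
    (\<integral>\<^sup>+x. ennreal (jet_sum U j x powr (real m * p / real j)) * indicator (dcube 0 (real j + 1)) x \<partial>lborel) \<le> ennreal B"
  using j(2)
proof (induction j rule: inc_induct)
  case base
  show ?case using j by (intro exI[of _ 1]) (auto simp: jet_energy_def)
next
  case (step i)
  let ?q = "real m * p / real (Suc i)" and ?q' = "real m * p / real i"
  from step.IH obtain K where K: "0 \<le> K" "\<forall>\<Omega> (U :: ('d::{finite,linorder} \<Rightarrow> nat) \<Rightarrow> real ^ 'd::{finite,linorder} \<Rightarrow> 'b::euclidean_space).
    ac_family \<Omega> m U \<longrightarrow> dcube 0 (real m + 1) \<subseteq> \<Omega> \<longrightarrow> jet_energy p m U \<le> 1 \<longrightarrow>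
    (\<integral>\<^sup>+x. ennreal (jet_sum U (Suc i) x powr ?q) * indicator (dcube 0 (real (Suc i) + 1)) x \<partial>lborel) \<le> ennreal K" by blast
  define \<delta> where "\<delta> = 1 - real CARD('d) * (1 / ?q - 1 / ?q')"
  have i: "1 \<le> i" "i < m" using step.hyps j by auto
  have m0: "0 < real m * p" using i p by simp
  have \<delta>: "0 < \<delta>"
  proof -
    have "1 / ?q - 1 / ?q' = 1 / (real m * p)" using i m0 by (simp add: field_simps add_divide_distrib)
    then show ?thesis using mp m0 by (simp add: \<delta>_def field_simps)
  qed
  have q: "1 \<le> ?q" "?q \<le> ?q'"
  proof -
    have "1 * real (Suc i) \<le> p * real m" using p i by (intro mult_mono) auto
    then show "1 \<le> ?q" by (simp add: field_simps)
    show "?q \<le> ?q'" using i m0 by (intro divide_left_mono) auto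
  qed
  define B where "B = jet_const TYPE('d) i powr ?q' * (1 - 2 powr - \<delta>) powr (- ?q') * K powr (?q' / ?q - 1) * K"
  show ?case
  proof (intro exI[of _ B] conjI allI impI)
    show "0 \<le> B" using K(1) by (simp add: B_def)
    fix \<Omega> and U :: "('d::{finite,linorder} \<Rightarrow> nat) \<Rightarrow> real ^ 'd::{finite,linorder} \<Rightarrow> 'b::euclidean_space"
    assume U: "ac_family \<Omega> m U" and Q: "dcube 0 (real m + 1) \<subseteq> \<Omega>" and E: "jet_energy p m U \<le> 1"
    have KU: "(\<integral>\<^sup>+x. ennreal (jet_sum U (Suc i) x powr ?q) * indicator (dcube 0 (real i + 1 + 1)) x \<partial>lborel) \<le> ennreal K"
      using K(2)[rule_format, OF U Q E] by (simp add: add_ac)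
    have "dcube 0 (real i + 1 + 1) \<subseteq> (dcube 0 (real m + 1) :: (real ^ 'd::{finite,linorder}) set)" using i by (intro dcube_mono) auto
    then have Q': "dcube 0 (real i + 1 + 1) \<subseteq> \<Omega>" using Q by blast
    show "(\<integral>\<^sup>+x. ennreal (jet_sum U i x powr ?q') * indicator (dcube 0 (real i + 1)) x \<partial>lborel) \<le> ennreal B"
      unfolding B_def
      by (rule potential_integral_bound[OF jet_sum_measurable[OF U] jet_sum_measurable[OF U] jet_sum_nonneg q \<delta>_def \<delta> _ KU K(1) jet_sum_nonneg])
         (use i jet_sum_potential_bound[OF U i(2) _ Q'] in \<open>auto simp: jet_const_def\<close>)
  qed
qed

text \<open>The last link of the chain: the first jet is integrable to the power
  \<open>m p > d\<close>, so its potential is bounded.\<close>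

lemma sobolev_chain_sup:
  assumes p: "1 \<le> p" and mp: "real CARD('d) < real m * p" and m: "1 \<le> m"
  shows "\<exists>B\<ge>0. \<forall>\<Omega> (U :: ('d::{finite,linorder} \<Rightarrow> nat) \<Rightarrow> real ^ 'd::{finite,linorder} \<Rightarrow> 'b::euclidean_space).
    ac_family \<Omega> m U \<longrightarrow> dcube 0 (real m + 1) \<subseteq> \<Omega> \<longrightarrow> jet_energy p m U \<le> 1 \<longrightarrow>
    (AE x in lborel. x \<in> dcube 0 1 \<longrightarrow> jet_sum U 0 x \<le> B)"
proof -
  obtain K where K: "0 \<le> K" "\<forall>\<Omega> (U :: ('d::{finite,linorder} \<Rightarrow> nat) \<Rightarrow> real ^ 'd::{finite,linorder} \<Rightarrow> 'b::euclidean_space).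
    ac_family \<Omega> m U \<longrightarrow> dcube 0 (real m + 1) \<subseteq> \<Omega> \<longrightarrow> jet_energy p m U \<le> 1 \<longrightarrow>
    (\<integral>\<^sup>+x. ennreal (jet_sum U 1 x powr (real m * p / real 1)) * indicator (dcube 0 (real 1 + 1)) x \<partial>lborel) \<le> ennreal K"
    using sobolev_chain[OF p mp order_refl m, where 'b = 'b] by blast
  define B where "B = jet_const TYPE('d) 0 * (K powr (1 / (real m * p)) / (1 - 2 powr (real CARD('d) / (real m * p) - 1)))"
  have mp0: "0 < real m * p" using p m by simp
  have c: "0 \<le> jet_const TYPE('d) 0" by (simp add: jet_const_def)
  show ?thesis
  proof (intro exI[of _ B] conjI allI impI)
    have "2 powr (real CARD('d) / (real m * p) - 1) < 1"
      using mp mp0 by (intro powr_less_one) (auto simp: field_simps)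
    then show "0 \<le> B" using c by (simp add: B_def)
    fix \<Omega> and U :: "('d::{finite,linorder} \<Rightarrow> nat) \<Rightarrow> real ^ 'd::{finite,linorder} \<Rightarrow> 'b::euclidean_space"
    assume U: "ac_family \<Omega> m U" and Q: "dcube 0 (real m + 1) \<subseteq> \<Omega>" and E: "jet_energy p m U \<le> 1"
    have KU: "(\<integral>\<^sup>+x. ennreal (jet_sum U 1 x powr (real m * p)) * indicator (dcube 0 (1 + 1)) x \<partial>lborel) \<le> ennreal K"
      using K(2)[rule_format, OF U Q E] by simp
    have "dcube 0 (1 + 1) \<subseteq> (dcube 0 (real m + 1) :: (real ^ 'd::{finite,linorder}) set)" using m by (intro dcube_mono) auto
    then have Q': "dcube 0 (1 + 1) \<subseteq> \<Omega>" using Q by blast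
    have m0: "0 < m" using m by simp
    have J: "jet_sum U 1 \<in> borel_measurable borel" by (rule jet_sum_measurable[OF U m])
    have "AE x in lborel. x \<in> dcube 0 1 \<longrightarrow> ennreal (jet_sum U 0 x) \<le> ennreal (jet_const TYPE('d) 0) *
      (\<Sum>k. ennreal ((1/2) ^ k) * (\<integral>\<^sup>+z. ennreal (jet_sum U (Suc 0) (x + (1/2) ^ k *\<^sub>R z)) * indicator (dcube 0 1) z \<partial>lborel))"
      by (rule jet_sum_potential_bound[OF U m0 _ Q']) simp
    then show "AE x in lborel. x \<in> dcube 0 1 \<longrightarrow> jet_sum U 0 x \<le> B"
    proof eventually_elim
      case (elim x)
      show ?case unfolding B_def
        using elim by (intro impI potential_sup_bound[OF J jet_sum_nonneg mp c KU K(1)]) (auto simp: jet_sum_nonneg)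
    qed
  qed
qed

section \<open>Products of derivatives, first with normalised energies\<close>

lemma nn_integral_norm_product_sup:
  fixes f g :: "real ^ 'd::finite \<Rightarrow> 'b::real_normed_vector"
  assumes B: "0 \<le> B" "AE x in lborel. x \<in> Q \<longrightarrow> norm (f x) \<le> B" and p: "1 \<le> p"
    and G: "\<And>x. norm (g x) \<le> G x" "Q \<subseteq> Q'" and E: "(\<integral>\<^sup>+x. ennreal (G x powr p) * indicator Q' x \<partial>lborel) \<le> 1"
    and [measurable]: "G \<in> borel_measurable borel" "Q' \<in> sets borel"
  shows "(\<integral>\<^sup>+x. ennreal ((norm (f x) * norm (g x)) powr p) * indicator Q x \<partial>lborel) \<le> ennreal (B powr p)"
proof -
  have "(\<integral>\<^sup>+x. ennreal ((norm (f x) * norm (g x)) powr p) * indicator Q x \<partial>lborel)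
    \<le> (\<integral>\<^sup>+x. ennreal (B powr p) * (ennreal (G x powr p) * indicator Q' x) \<partial>lborel)"
  proof (rule nn_integral_mono_AE, use B(2) in eventually_elim)
    case (elim x)
    show ?case
    proof (cases "x \<in> Q")
      case True
      then have "norm (f x) * norm (g x) \<le> B * G x" using elim G(1)[of x] B(1) by (intro mult_mono) auto
      then have "(norm (f x) * norm (g x)) powr p \<le> (B * G x) powr p" using p by (intro powr_mono2) auto
      also have "\<dots> = B powr p * G x powr p" using B(1) order_trans[OF norm_ge_zero G(1)] by (simp add: powr_mult)
      finally show ?thesis using True G(2) by (auto simp: ennreal_mult[symmetric] ennreal_leI)
    qed simp
  qed
  also have "\<dots> = ennreal (B powr p) * (\<integral>\<^sup>+x. ennreal (G x powr p) * indicator Q' x \<partial>lborel)"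
    by (rule nn_integral_cmult) measurable
  also have "\<dots> \<le> ennreal (B powr p) * 1" by (rule mult_left_mono[OF E]) simp
  finally show ?thesis by simp
qed

text \<open>Young's exponents degenerate when one factor carries no derivative; that factor is then
  bounded uniformly instead. Young turns the product into a sum and so destroys homogeneity, which
  is why both energies are normalised here.\<close>

lemma local_product_normalized:
  assumes p: "1 \<le> p" and mp: "real CARD('d) < real m * p" and m: "1 \<le> m"
    and bc: "mindex_order \<beta> + mindex_order \<gamma> \<le> m"
  shows "\<exists>B\<ge>0. \<forall>\<Omega> (U :: ('d::{finite,linorder} \<Rightarrow> nat) \<Rightarrow> real ^ 'd::{finite,linorder} \<Rightarrow> 'b::euclidean_space) (V :: ('d::{finite,linorder} \<Rightarrow> nat) \<Rightarrow> real ^ 'd::{finite,linorder} \<Rightarrow> 'b::euclidean_space).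
    ac_family \<Omega> m U \<longrightarrow> ac_family \<Omega> m V \<longrightarrow> dcube 0 (real m + 1) \<subseteq> \<Omega> \<longrightarrow> jet_energy p m U \<le> 1 \<longrightarrow> jet_energy p m V \<le> 1 \<longrightarrow>
    (\<integral>\<^sup>+x. ennreal ((norm (U \<beta> x) * norm (V \<gamma> x)) powr p) * indicator (dcube 0 1) x \<partial>lborel) \<le> ennreal B"
proof -
  let ?b = "mindex_order \<beta>" and ?c = "mindex_order \<gamma>"
  have sub: "dcube 0 1 \<subseteq> (dcube 0 (real m + 1) :: (real ^ 'd::{finite,linorder}) set)" by (intro dcube_mono) auto
  obtain B0 where B0: "0 \<le> B0" "\<And>\<Omega> (U :: ('d::{finite,linorder} \<Rightarrow> nat) \<Rightarrow> real ^ 'd::{finite,linorder} \<Rightarrow> 'b::euclidean_space).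
    ac_family \<Omega> m U \<Longrightarrow> dcube 0 (real m + 1) \<subseteq> \<Omega> \<Longrightarrow> jet_energy p m U \<le> 1 \<Longrightarrow>
    AE x in lborel. x \<in> dcube 0 1 \<longrightarrow> jet_sum U 0 x \<le> B0"
    using sobolev_chain_sup[OF p mp m, where 'b = 'b] by blast
  have one: "(\<integral>\<^sup>+x. ennreal ((norm (U \<beta>' x) * norm (V \<gamma>' x)) powr p) * indicator (dcube 0 1) x \<partial>lborel) \<le> ennreal (B0 powr p)"
    if b: "mindex_order \<beta>' = 0" "mindex_order \<gamma>' \<le> m" and U: "ac_family \<Omega> m U" and V: "ac_family \<Omega> m V" and Q: "dcube 0 (real m + 1) \<subseteq> \<Omega>"
      and E: "jet_energy p m U \<le> 1" "jet_energy p m V \<le> 1"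
    for \<Omega> and U V :: "('d::{finite,linorder} \<Rightarrow> nat) \<Rightarrow> real ^ 'd::{finite,linorder} \<Rightarrow> 'b::euclidean_space" and \<beta>' \<gamma>'
  proof (rule nn_integral_norm_product_sup[OF B0(1) _ p norm_le_jet_sum[OF b(2)] sub E(2)[unfolded jet_energy_def]])
    show "AE x in lborel. x \<in> dcube 0 1 \<longrightarrow> norm (U \<beta>' x) \<le> B0"
      using B0(2)[OF U Q E(1)]
    proof eventually_elim
      case (elim x)
      then show ?case using norm_le_jet_sum[of \<beta>' 0 U x] b(1) by auto
    qed
  qed (auto intro: jet_sum_measurable[OF V])
  consider "?b = 0" | "?c = 0" | "1 \<le> ?b" "1 \<le> ?c" by linarith
  then show ?thesis
  proof cases
    case 1
    then show ?thesis using one[OF 1] bc by (intro exI[of _ "B0 powr p"]) auto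
  next
    case 2
    show ?thesis
    proof (intro exI[of _ "B0 powr p"] conjI allI impI)
      fix \<Omega> and U V :: "('d::{finite,linorder} \<Rightarrow> nat) \<Rightarrow> real ^ 'd::{finite,linorder} \<Rightarrow> 'b::euclidean_space"
      assume "ac_family \<Omega> m U" "ac_family \<Omega> m V" "dcube 0 (real m + 1) \<subseteq> \<Omega>" "jet_energy p m U \<le> 1" "jet_energy p m V \<le> 1"
      then show "(\<integral>\<^sup>+x. ennreal ((norm (U \<beta> x) * norm (V \<gamma> x)) powr p) * indicator (dcube 0 1) x \<partial>lborel) \<le> ennreal (B0 powr p)"
        using one[OF 2, of \<beta> \<Omega> V U] bc by (subst mult.commute[of "norm (U \<beta> _)"]) simp
    qed simp
  next
    case 3
    \<comment> \<open>The order of \<open>\<gamma>\<close> is at most \<open>?e\<close>. Using the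
      jet of order \<open>?e\<close> for the second factor makes the exponents conjugate:
      \<open>?b / m + ?e / m = 1\<close>.\<close>
    let ?e = "m - ?b"
    have e: "1 \<le> ?e" "?e \<le> m" "?b \<le> m" "?c \<le> ?e" using 3 bc by auto
    have er: "real ?e = real m - real ?b" using e by simp
    obtain B1 where B1: "0 \<le> B1" "\<And>\<Omega> (U :: ('d::{finite,linorder} \<Rightarrow> nat) \<Rightarrow> real ^ 'd::{finite,linorder} \<Rightarrow> 'b::euclidean_space).
      ac_family \<Omega> m U \<Longrightarrow> dcube 0 (real m + 1) \<subseteq> \<Omega> \<Longrightarrow> jet_energy p m U \<le> 1 \<Longrightarrow>
      (\<integral>\<^sup>+x. ennreal (jet_sum U ?b x powr (real m * p / real ?b)) * indicator (dcube 0 (real ?b + 1)) x \<partial>lborel) \<le> ennreal B1"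
      using sobolev_chain[OF p mp 3(1) e(3), where 'b = 'b] by blast
    obtain B2 where B2: "0 \<le> B2" "\<And>\<Omega> (U :: ('d::{finite,linorder} \<Rightarrow> nat) \<Rightarrow> real ^ 'd::{finite,linorder} \<Rightarrow> 'b::euclidean_space).
      ac_family \<Omega> m U \<Longrightarrow> dcube 0 (real m + 1) \<subseteq> \<Omega> \<Longrightarrow> jet_energy p m U \<le> 1 \<Longrightarrow>
      (\<integral>\<^sup>+x. ennreal (jet_sum U ?e x powr (real m * p / real ?e)) * indicator (dcube 0 (real ?e + 1)) x \<partial>lborel) \<le> ennreal B2"
      using sobolev_chain[OF p mp e(1,2), where 'b = 'b] by blast
    show ?thesis
    proof (intro exI[of _ "B1 + B2"] conjI allI impI)
      show "0 \<le> B1 + B2" using B1 B2 by simp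
      fix \<Omega> and U V :: "('d::{finite,linorder} \<Rightarrow> nat) \<Rightarrow> real ^ 'd::{finite,linorder} \<Rightarrow> 'b::euclidean_space"
      assume U: "ac_family \<Omega> m U" and V: "ac_family \<Omega> m V" and Q: "dcube 0 (real m + 1) \<subseteq> \<Omega>"
        and E: "jet_energy p m U \<le> 1" "jet_energy p m V \<le> 1"
      note [measurable] = jet_sum_measurable[OF U e(3)] jet_sum_measurable[OF V e(2)]
      let ?F = "\<lambda>x. ennreal (jet_sum U ?b x powr (real m * p / real ?b)) * indicator (dcube 0 (real ?b + 1)) x"
      let ?G = "\<lambda>x. ennreal (jet_sum V ?e x powr (real m * p / real ?e)) * indicator (dcube 0 (real ?e + 1)) x"
      have sub': "dcube 0 1 \<subseteq> (dcube 0 (real ?b + 1) :: (real ^ 'd::{finite,linorder}) set)" "dcube 0 1 \<subseteq> (dcube 0 (real ?e + 1) :: (real ^ 'd::{finite,linorder}) set)"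
        by (intro dcube_mono; simp)+
      have "(\<integral>\<^sup>+x. ennreal ((norm (U \<beta> x) * norm (V \<gamma> x)) powr p) * indicator (dcube 0 1) x \<partial>lborel) \<le> (\<integral>\<^sup>+x. ?F x + ?G x \<partial>lborel)"
      proof (rule nn_integral_mono)
        fix x
        show "ennreal ((norm (U \<beta> x) * norm (V \<gamma> x)) powr p) * indicator (dcube 0 1) x \<le> ?F x + ?G x"
        proof (cases "x \<in> dcube 0 1")
          case True
          let ?u = "jet_sum U ?b x" and ?v = "jet_sum V ?e x"
          have uv: "0 \<le> ?u" "0 \<le> ?v" by (auto simp: jet_sum_nonneg)
          have "(norm (U \<beta> x) * norm (V \<gamma> x)) powr p \<le> (?u * ?v) powr p"
            using p e(4) by (intro powr_mono2 mult_mono norm_le_jet_sum) (auto simp: jet_sum_nonneg)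
          also have "\<dots> = ?u powr p * ?v powr p" using uv by (simp add: powr_mult)
          also have "\<dots> \<le> (?u powr p) powr (real m / real ?b) / (real m / real ?b) + (?v powr p) powr (real m / real ?e) / (real m / real ?e)"
            using 3 e er by (intro Youngs_inequality) (auto simp: field_simps)
          also have "\<dots> \<le> (?u powr p) powr (real m / real ?b) + (?v powr p) powr (real m / real ?e)"
          proof -
            have "1 \<le> real m / real ?b" "1 \<le> real m / real ?e" using 3 e by (auto simp: field_simps)
            moreover have "a / r \<le> a" if "1 \<le> r" "0 \<le> a" for a r :: real
              using divide_left_mono[of 1 r a] that by simp
            ultimately show ?thesis
              by (meson add_mono powr_ge_zero)
          qed
          also have "\<dots> = ?u powr (real m * p / real ?b) + ?v powr (real m * p / real ?e)"
            by (simp add: powr_powr mult.commute)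
          finally have le: "(norm (U \<beta> x) * norm (V \<gamma> x)) powr p \<le> ?u powr (real m * p / real ?b) + ?v powr (real m * p / real ?e)" .
          have "x \<in> dcube 0 (real ?b + 1)" "x \<in> dcube 0 (real ?e + 1)" using True sub' by blast+
          then show ?thesis using ennreal_leI[OF le] True by simp
        qed simp
      qed
      also have "\<dots> = (\<integral>\<^sup>+x. ?F x \<partial>lborel) + (\<integral>\<^sup>+x. ?G x \<partial>lborel)" by (rule nn_integral_add) measurable
      also have "\<dots> \<le> ennreal B1 + ennreal B2" by (intro add_mono B1(2)[OF U Q E(1)] B2(2)[OF V Q E(2)])
      also have "\<dots> = ennreal (B1 + B2)" using B1 B2 by simp
      finally show "(\<integral>\<^sup>+x. ennreal ((norm (U \<beta> x) * norm (V \<gamma> x)) powr p) * indicator (dcube 0 1) x \<partial>lborel) \<le> ennreal (B1 + B2)" .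
    qed
  qed
qed

lemma ac_family_scaleR:
  assumes U: "ac_family \<Omega> m U"
  shows "ac_family \<Omega> m (\<lambda>\<alpha> x. c *\<^sub>R U \<alpha> x)"
  unfolding ac_family_def
proof (intro conjI allI impI)
  fix \<alpha> :: "'a \<Rightarrow> nat" assume "mindex_order \<alpha> \<le> m"
  then show "loc_int \<Omega> (\<lambda>x. c *\<^sub>R U \<alpha> x)"
    using loc_int_scale[OF ac_familyD(1)[OF U], of \<alpha> 1 0 c] by simp
next
  fix \<alpha> :: "'a \<Rightarrow> nat" and i assume "mindex_order \<alpha> < m"
  then show "ac_on_lines \<Omega> i (\<lambda>x. c *\<^sub>R U \<alpha> x) (\<lambda>x. c *\<^sub>R U (\<alpha>(i := Suc (\<alpha> i))) x)"
    using ac_on_lines_scale[OF ac_familyD(2)[OF U], of \<alpha> 1 0 i c] by simp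
qed

lemma jet_energy_scaleR:
  assumes U: "ac_family \<Omega> m U"
  shows "jet_energy p m (\<lambda>\<alpha> x. c *\<^sub>R U \<alpha> x) = ennreal (\<bar>c\<bar> powr p) * jet_energy p m U"
proof -
  note [measurable] = jet_sum_measurable[OF U order_refl]
  have "jet_sum (\<lambda>\<alpha> x. c *\<^sub>R U \<alpha> x) m x powr p = \<bar>c\<bar> powr p * jet_sum U m x powr p" for x
    using jet_sum_nonneg[of U m x] by (simp add: jet_sum_def sum_distrib_left[symmetric] powr_mult)
  then show ?thesis
    unfolding jet_energy_def by (subst nn_integral_cmult[symmetric]) (auto simp: ennreal_mult mult.assoc)
qed

text \<open>Multiplying each factor by a suitable constant restores homogeneity. A vanishing energy
  cannot be normalised, so the constants are taken from positive upper bounds \<open>A\<close> and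
  \<open>D\<close>, which are lowered to the energies in the limit.\<close>

lemma local_product_homogeneous:
  fixes U V :: "('d::{finite,linorder} \<Rightarrow> nat) \<Rightarrow> real ^ 'd::{finite,linorder} \<Rightarrow> 'b::euclidean_space"
  assumes p: "1 \<le> p" and B: "0 \<le> B" and bc: "mindex_order \<beta> \<le> m" "mindex_order \<gamma> \<le> m"
    and norm: "\<And>\<Omega> (U :: ('d::{finite,linorder} \<Rightarrow> nat) \<Rightarrow> real ^ 'd::{finite,linorder} \<Rightarrow> 'b) (V :: ('d::{finite,linorder} \<Rightarrow> nat) \<Rightarrow> real ^ 'd::{finite,linorder} \<Rightarrow> 'b).
      ac_family \<Omega> m U \<Longrightarrow> ac_family \<Omega> m V \<Longrightarrow> dcube 0 (real m + 1) \<subseteq> \<Omega> \<Longrightarrow> jet_energy p m U \<le> 1 \<Longrightarrow> jet_energy p m V \<le> 1 \<Longrightarrow>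
      (\<integral>\<^sup>+x. ennreal ((norm (U \<beta> x) * norm (V \<gamma> x)) powr p) * indicator (dcube 0 1) x \<partial>lborel) \<le> ennreal B"
    and U: "ac_family \<Omega> m U" and V: "ac_family \<Omega> m V" and Q: "dcube 0 (real m + 1) \<subseteq> \<Omega>"
    and fin: "jet_energy p m U < \<infinity>" "jet_energy p m V < \<infinity>"
  shows "(\<integral>\<^sup>+x. ennreal ((norm (U \<beta> x) * norm (V \<gamma> x)) powr p) * indicator (dcube 0 1) x \<partial>lborel)
    \<le> ennreal B * jet_energy p m U * jet_energy p m V"
proof -
  let ?L = "\<integral>\<^sup>+x. ennreal ((norm (U \<beta> x) * norm (V \<gamma> x)) powr p) * indicator (dcube 0 1) x \<partial>lborel"
  note [measurable] = ac_familyD(3)[OF U bc(1)] ac_familyD(3)[OF V bc(2)]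
  obtain X where X: "0 \<le> X" "jet_energy p m U = ennreal X" using fin(1) by (cases "jet_energy p m U") auto
  obtain Y where Y: "0 \<le> Y" "jet_energy p m V = ennreal Y" using fin(2) by (cases "jet_energy p m V") auto
  have *: "?L \<le> ennreal (B * (A * D))" if A: "X \<le> A" "0 < A" and D: "Y \<le> D" "0 < D" for A D
  proof -
    define c where "c = (1 / A) powr (1 / p)"
    define d where "d = (1 / D) powr (1 / p)"
    have cd: "0 < c" "0 < d" "c powr p = 1 / A" "d powr p = 1 / D"
      using A D p by (auto simp: c_def d_def powr_powr)
    have "ennreal (\<bar>c\<bar> powr p) * ennreal X = ennreal (X / A)" "ennreal (\<bar>d\<bar> powr p) * ennreal Y = ennreal (Y / D)"
      using cd A D X(1) Y(1) by (simp_all add: ennreal_mult[symmetric])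
    moreover have "ennreal (X / A) \<le> ennreal 1" "ennreal (Y / D) \<le> ennreal 1"
      using A D by (auto intro!: ennreal_leI simp: field_simps)
    ultimately have "jet_energy p m (\<lambda>\<alpha> x. c *\<^sub>R U \<alpha> x) \<le> 1" "jet_energy p m (\<lambda>\<alpha> x. d *\<^sub>R V \<alpha> x) \<le> 1"
      unfolding jet_energy_scaleR[OF U] jet_energy_scaleR[OF V] X(2) Y(2) by simp_all
    from norm[OF ac_family_scaleR[OF U, of c] ac_family_scaleR[OF V, of d] Q this]
    have "(\<integral>\<^sup>+x. ennreal ((norm (c *\<^sub>R U \<beta> x) * norm (d *\<^sub>R V \<gamma> x)) powr p) * indicator (dcube 0 1) x \<partial>lborel) \<le> ennreal B" .
    also have "(\<integral>\<^sup>+x. ennreal ((norm (c *\<^sub>R U \<beta> x) * norm (d *\<^sub>R V \<gamma> x)) powr p) * indicator (dcube 0 1) x \<partial>lborel) =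
      (\<integral>\<^sup>+x. ennreal (1 / (A * D)) * (ennreal ((norm (U \<beta> x) * norm (V \<gamma> x)) powr p) * indicator (dcube 0 1) x) \<partial>lborel)"
    proof (rule nn_integral_cong)
      fix x
      have "norm (c *\<^sub>R U \<beta> x) * norm (d *\<^sub>R V \<gamma> x) = c * d * (norm (U \<beta> x) * norm (V \<gamma> x))"
        using cd by (simp add: mult_ac)
      then have "(norm (c *\<^sub>R U \<beta> x) * norm (d *\<^sub>R V \<gamma> x)) powr p = c powr p * d powr p * (norm (U \<beta> x) * norm (V \<gamma> x)) powr p"
        using cd by (simp add: powr_mult)
      then have "(norm (c *\<^sub>R U \<beta> x) * norm (d *\<^sub>R V \<gamma> x)) powr p = 1 / (A * D) * (norm (U \<beta> x) * norm (V \<gamma> x)) powr p"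
        by (simp add: cd)
      then show "ennreal ((norm (c *\<^sub>R U \<beta> x) * norm (d *\<^sub>R V \<gamma> x)) powr p) * indicator (dcube 0 1) x =
        ennreal (1 / (A * D)) * (ennreal ((norm (U \<beta> x) * norm (V \<gamma> x)) powr p) * indicator (dcube 0 1) x)"
        using A D by (simp only:) (simp add: ennreal_mult[symmetric] mult.assoc[symmetric])
    qed
    also have "\<dots> = ennreal (1 / (A * D)) * ?L" by (rule nn_integral_cmult) measurable
    finally have "ennreal (A * D) * (ennreal (1 / (A * D)) * ?L) \<le> ennreal (A * D) * ennreal B" by (rule mult_left_mono) simp
    then have "(ennreal (A * D) * ennreal (1 / (A * D))) * ?L \<le> ennreal (A * D) * ennreal B"
      by (simp only: mult.assoc)
    moreover have "ennreal (A * D) * ennreal (1 / (A * D)) = 1"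
    proof -
      have "0 \<le> A * D" "0 \<le> 1 / (A * D)" using A D by auto
      then show ?thesis using A D by (simp only: ennreal_mult[symmetric]) simp
    qed
    moreover have "ennreal (A * D) * ennreal B = ennreal (B * (A * D))"
      using A D B by (simp only: ennreal_mult mult_nonneg_nonneg less_imp_le mult.commute)
    ultimately show ?thesis by (simp only: mult_1_left)
  qed
  have l: "(\<lambda>n. 1 / real (Suc n)) \<longlonglongrightarrow> 0" by (rule LIMSEQ_Suc[OF lim_1_over_n])
  have lim: "(\<lambda>n. ennreal (B * ((X + 1 / real (Suc n)) * (Y + 1 / real (Suc n))))) \<longlonglongrightarrow> ennreal (B * ((X + 0) * (Y + 0)))"
    by (intro tendsto_ennrealI tendsto_mult tendsto_add tendsto_const l)
  have le: "?L \<le> ennreal (B * ((X + 1 / real (Suc n)) * (Y + 1 / real (Suc n))))" for n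
    using X Y by (intro *) (auto intro: add_nonneg_pos)
  have "?L \<le> ennreal (B * ((X + 0) * (Y + 0)))"
    by (rule LIMSEQ_le_const[OF lim]) (use le in blast)
  then show ?thesis using X Y B by (simp add: ennreal_mult mult.assoc)
qed

section \<open>Products on a cube: the case p = 1\<close>

text \<open>Replacing coordinate \<open>i\<close> of a uniformly distributed point of the cube by an
  independent uniform number does not change its distribution.\<close>

lemma resample_coordinate:
  fixes \<Psi> :: "real ^ 'd::finite \<Rightarrow> ennreal"
  assumes [measurable]: "\<Psi> \<in> borel_measurable borel"
  shows "(\<integral>\<^sup>+h. \<integral>\<^sup>+\<tau>. \<Psi> (h + (\<tau> - h $ i) *\<^sub>R axis i 1) * indicator {0..1} \<tau> * indicator (dcube 0 1) h \<partial>lborel \<partial>lborel)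
    = (\<integral>\<^sup>+h. \<Psi> h * indicator (dcube 0 1) h \<partial>lborel)"
proof -
  let ?Q = "dcube 0 1 :: (real ^ 'd) set" and ?e = "axis i 1 :: real ^ 'd"
  have nth [measurable]: "(\<lambda>h :: real ^ 'd. h $ i) \<in> borel_measurable borel"
    by (intro borel_measurable_continuous_onI continuous_intros)
  have "(\<integral>\<^sup>+h. \<integral>\<^sup>+\<tau>. \<Psi> (h + (\<tau> - h $ i) *\<^sub>R ?e) * indicator {0..1} \<tau> * indicator ?Q h \<partial>lborel \<partial>lborel)
    = (\<integral>\<^sup>+h. \<integral>\<^sup>+\<tau>. \<Psi> (h + \<tau> *\<^sub>R ?e) * indicator {0..1} (\<tau> + h $ i) * indicator ?Q h \<partial>lborel \<partial>lborel)"
  proof (rule nn_integral_cong)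
    fix h :: "real ^ 'd"
    have "(\<integral>\<^sup>+\<tau>. (\<lambda>\<tau>. \<Psi> (h + (\<tau> - h $ i) *\<^sub>R ?e) * indicator {0..1} \<tau> * indicator ?Q h) (\<tau> + h $ i) \<partial>lborel)
      = (\<integral>\<^sup>+\<tau>. \<Psi> (h + (\<tau> - h $ i) *\<^sub>R ?e) * indicator {0..1} \<tau> * indicator ?Q h \<partial>lborel)"
      by (rule nn_integral_shift) measurable
    then show "(\<integral>\<^sup>+\<tau>. \<Psi> (h + (\<tau> - h $ i) *\<^sub>R ?e) * indicator {0..1} \<tau> * indicator ?Q h \<partial>lborel)
      = (\<integral>\<^sup>+\<tau>. \<Psi> (h + \<tau> *\<^sub>R ?e) * indicator {0..1} (\<tau> + h $ i) * indicator ?Q h \<partial>lborel)" by simp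
  qed
  also have "\<dots> = (\<integral>\<^sup>+\<tau>. \<integral>\<^sup>+h. \<Psi> (h + \<tau> *\<^sub>R ?e) * indicator {0..1} (\<tau> + h $ i) * indicator ?Q h \<partial>lborel \<partial>lborel)"
    by (rule lborel_pair.Fubini') measurable
  also have "\<dots> = (\<integral>\<^sup>+\<tau>. \<integral>\<^sup>+h. \<Psi> h * indicator ?Q h * indicator {0..1} (h $ i - \<tau>) \<partial>lborel \<partial>lborel)"
  proof (rule nn_integral_cong)
    fix \<tau>
    let ?G = "\<lambda>h. \<Psi> h * indicator ?Q h * indicator {0..1} (h $ i - \<tau>)"
    have "indicator {0..1} (\<tau> + h $ i) * indicator ?Q h = (indicator ?Q (h + \<tau> *\<^sub>R ?e) * indicator {0..1} (h $ i) :: ennreal)" for h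
    proof -
      have "(\<tau> + h $ i \<in> {0..1} \<and> h \<in> ?Q) \<longleftrightarrow> (h + \<tau> *\<^sub>R ?e \<in> ?Q \<and> h $ i \<in> {0..1})"
        unfolding mem_dcube by (auto simp: axis_def split: if_splits)
      then show ?thesis by (auto simp: indicator_def)
    qed
    then have "(\<integral>\<^sup>+h. \<Psi> (h + \<tau> *\<^sub>R ?e) * indicator {0..1} (\<tau> + h $ i) * indicator ?Q h \<partial>lborel) = (\<integral>\<^sup>+h. ?G (h + \<tau> *\<^sub>R ?e) \<partial>lborel)"
      by (simp add: mult.assoc)
    also have "\<dots> = (\<integral>\<^sup>+h. ?G h \<partial>lborel)"
      by (rule nn_integral_shift) measurable
    finally show "(\<integral>\<^sup>+h. \<Psi> (h + \<tau> *\<^sub>R ?e) * indicator {0..1} (\<tau> + h $ i) * indicator ?Q h \<partial>lborel) = (\<integral>\<^sup>+h. ?G h \<partial>lborel)" .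
  qed
  also have "\<dots> = (\<integral>\<^sup>+h. \<integral>\<^sup>+\<tau>. \<Psi> h * indicator ?Q h * indicator {0..1} (h $ i - \<tau>) \<partial>lborel \<partial>lborel)"
    by (rule lborel_pair.Fubini'[symmetric]) measurable
  also have "\<dots> = (\<integral>\<^sup>+h. \<Psi> h * indicator ?Q h \<partial>lborel)"
  proof (rule nn_integral_cong)
    fix h :: "real ^ 'd"
    have "(\<integral>\<^sup>+\<tau>. indicator {0..1} (h $ i - \<tau>) \<partial>lborel) = (\<integral>\<^sup>+\<tau>. indicator {h $ i - 1..h $ i} \<tau> \<partial>lborel)"
      by (intro nn_integral_cong) (auto simp: indicator_def)
    also have "\<dots> = 1" by simp
    finally show "(\<integral>\<^sup>+\<tau>. \<Psi> h * indicator ?Q h * indicator {0..1} (h $ i - \<tau>) \<partial>lborel) = \<Psi> h * indicator ?Q h"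
      by (subst nn_integral_cmult) simp_all
  qed
  finally show ?thesis .
qed

text \<open>\<open>f x\<close> differs from \<open>f (x + t e)\<close> by at most the integral of
  the norm of \<open>g\<close> over the unit segment; averaging over \<open>t\<close> in
  \<open>[0, 1]\<close> gives the claim.\<close>

lemma line_average_bound:
  fixes f g :: "real ^ 'd::finite \<Rightarrow> 'b::euclidean_space"
  assumes \<Omega>: "open \<Omega>" and f: "loc_int \<Omega> f" and g: "loc_int \<Omega> g" and ac: "ac_on_lines \<Omega> i f g"
  shows "AE x in lborel. (\<forall>s\<in>{0..1}. x + s *\<^sub>R axis i 1 \<in> \<Omega>) \<longrightarrow>
    ennreal (norm (f x)) \<le> (\<integral>\<^sup>+t. ennreal (norm (f (x + t *\<^sub>R axis i 1)) + norm (g (x + t *\<^sub>R axis i 1))) * indicator {0..1} t \<partial>lborel)"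
  using ac_on_lines_AE_AE[OF \<Omega> f g ac, of 1]
proof eventually_elim
  case (elim x)
  let ?e = "axis i 1 :: real ^ 'd"
  note [measurable] = loc_int_measurable[OF f] loc_int_measurable[OF g]
  show ?case
  proof
    assume "\<forall>s\<in>{0..1}. x + s *\<^sub>R ?e \<in> \<Omega>"
    with elim have ae: "AE s in lborel. s \<in> {0..1} \<longrightarrow> f (x + s *\<^sub>R ?e) - f x = (LINT r:{0..s}|lborel. g (x + r *\<^sub>R ?e))" by blast
    let ?I = "\<integral>\<^sup>+r. ennreal (norm (g (x + r *\<^sub>R ?e))) * indicator {0..1} r \<partial>lborel"
    have "ennreal (norm (f x)) = (\<integral>\<^sup>+(t::real). ennreal (norm (f x)) * indicator {0..1} t \<partial>lborel)"
      by (simp add: nn_integral_cmult)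
    also have "\<dots> \<le> (\<integral>\<^sup>+t. ennreal (norm (f (x + t *\<^sub>R ?e))) * indicator {0..1} t + ?I * indicator {0..1} t \<partial>lborel)"
    proof (rule nn_integral_mono_AE, use ae in eventually_elim)
      case (elim t)
      show ?case
      proof (cases "t \<in> {0..1}")
        case True
        have "ennreal (norm (f x)) \<le> ennreal (norm (f (x + t *\<^sub>R ?e)) + norm (f (x + t *\<^sub>R ?e) - f x))"
          using norm_triangle_ineq4[of "f (x + t *\<^sub>R ?e)" "f (x + t *\<^sub>R ?e) - f x"] by (intro ennreal_leI) simp
        also have "\<dots> = ennreal (norm (f (x + t *\<^sub>R ?e))) + ennreal (norm (LINT r:{0..t}|lborel. g (x + r *\<^sub>R ?e)))"
          using elim True by simp
        also have "ennreal (norm (LINT r:{0..t}|lborel. g (x + r *\<^sub>R ?e))) \<le> (\<integral>\<^sup>+r. ennreal (norm (indicator {0..t} r *\<^sub>R g (x + r *\<^sub>R ?e))) \<partial>lborel)"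
          unfolding set_lebesgue_integral_def by (rule norm_integral_le_nn_integral)
        also have "\<dots> \<le> ?I" using True by (intro nn_integral_mono) (auto simp: indicator_def)
        finally show ?thesis using True by (simp add: add_left_mono)
      qed simp
    qed
    also have "\<dots> = (\<integral>\<^sup>+t. ennreal (norm (f (x + t *\<^sub>R ?e))) * indicator {0..1} t \<partial>lborel) + ?I"
      by (subst nn_integral_add) (simp_all add: nn_integral_cmult)
    also have "\<dots> = (\<integral>\<^sup>+t. ennreal (norm (f (x + t *\<^sub>R ?e)) + norm (g (x + t *\<^sub>R ?e))) * indicator {0..1} t \<partial>lborel)"
      by (subst nn_integral_add[symmetric]) (auto intro!: nn_integral_cong simp: distrib_right)
    finally show "ennreal (norm (f x)) \<le> (\<integral>\<^sup>+t. ennreal (norm (f (x + t *\<^sub>R ?e)) + norm (g (x + t *\<^sub>R ?e))) * indicator {0..1} t \<partial>lborel)" .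
  qed
qed

text \<open>The factor 2 accounts for a function and its one directional derivative in
  \<open>line_average_bound\<close>, the cardinality for the summands of the jet.\<close>

definition line_const :: "'d::finite itself \<Rightarrow> nat \<Rightarrow> real" where
  "line_const _ m = 2 * real (card {\<alpha> :: 'd \<Rightarrow> nat. mindex_order \<alpha> \<le> m})"

lemma jet_sum_line_bound:
  fixes U :: "('d::{finite,linorder} \<Rightarrow> nat) \<Rightarrow> real ^ 'd::{finite,linorder} \<Rightarrow> 'b::euclidean_space"
  assumes \<Omega>: "open \<Omega>" and U: "ac_family \<Omega> m U" and j: "j < m"
  shows "AE x in lborel. (\<forall>s\<in>{0..1}. x + s *\<^sub>R axis i 1 \<in> \<Omega>) \<longrightarrow> ennreal (jet_sum U j x) \<le>
    ennreal (line_const TYPE('d) m) * (\<integral>\<^sup>+t. ennreal (jet_sum U (Suc j) (x + t *\<^sub>R axis i 1)) * indicator {0..1} t \<partial>lborel)"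
proof -
  let ?A = "{\<alpha> :: 'd \<Rightarrow> nat. mindex_order \<alpha> \<le> j}" and ?e = "axis i 1 :: real ^ 'd::{finite,linorder}"
  have [measurable]: "jet_sum U (Suc j) \<in> borel_measurable borel" using j by (intro jet_sum_measurable[OF U]) auto
  define T where "T x = (\<integral>\<^sup>+t. ennreal (jet_sum U (Suc j) (x + t *\<^sub>R ?e)) * indicator {0..1} t \<partial>lborel)" for x
  have "AE x in lborel. (\<forall>s\<in>{0..1}. x + s *\<^sub>R ?e \<in> \<Omega>) \<longrightarrow> ennreal (norm (U \<alpha> x)) \<le> ennreal 2 * T x" if \<alpha>: "\<alpha> \<in> ?A" for \<alpha>
  proof -
    have ord: "mindex_order \<alpha> \<le> m" "mindex_order \<alpha> < m" "mindex_order (\<alpha>(i := Suc (\<alpha> i))) \<le> Suc j" "mindex_order (\<alpha>(i := Suc (\<alpha> i))) \<le> m"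
      using \<alpha> j by (auto simp: mindex_order_upd simp del: fun_upd_apply)
    show ?thesis
      using line_average_bound[OF \<Omega> ac_familyD(1)[OF U ord(1)] ac_familyD(1)[OF U ord(4)] ac_familyD(2)[OF U ord(2)]]
    proof eventually_elim
      case (elim x)
      have "(\<integral>\<^sup>+t. ennreal (norm (U \<alpha> (x + t *\<^sub>R ?e)) + norm (U (\<alpha>(i := Suc (\<alpha> i))) (x + t *\<^sub>R ?e))) * indicator {0..1} t \<partial>lborel)
        \<le> (\<integral>\<^sup>+t. ennreal 2 * (ennreal (jet_sum U (Suc j) (x + t *\<^sub>R ?e)) * indicator {0..1} t) \<partial>lborel)"
      proof (rule nn_integral_mono)
        fix t
        have "norm (U \<alpha> (x + t *\<^sub>R ?e)) + norm (U (\<alpha>(i := Suc (\<alpha> i))) (x + t *\<^sub>R ?e)) \<le> 2 * jet_sum U (Suc j) (x + t *\<^sub>R ?e)"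
          using norm_le_jet_sum[of \<alpha> "Suc j" U "x + t *\<^sub>R ?e"] norm_le_jet_sum[OF ord(3), of U "x + t *\<^sub>R ?e"] \<alpha> by simp
        then have "ennreal (norm (U \<alpha> (x + t *\<^sub>R ?e)) + norm (U (\<alpha>(i := Suc (\<alpha> i))) (x + t *\<^sub>R ?e))) \<le> ennreal 2 * ennreal (jet_sum U (Suc j) (x + t *\<^sub>R ?e))"
          by (subst ennreal_mult[symmetric]) (auto simp: jet_sum_nonneg simp del: ennreal_plus intro!: ennreal_leI)
        from mult_right_mono[OF this, of "indicator {0..1} t"]
        show "ennreal (norm (U \<alpha> (x + t *\<^sub>R ?e)) + norm (U (\<alpha>(i := Suc (\<alpha> i))) (x + t *\<^sub>R ?e))) * indicator {0..1} t
          \<le> ennreal 2 * (ennreal (jet_sum U (Suc j) (x + t *\<^sub>R ?e)) * indicator {0..1} t)" by (simp only: mult.assoc) simp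
      qed
      also have "\<dots> = ennreal 2 * T x" unfolding T_def by (rule nn_integral_cmult) measurable
      finally show ?case using elim by (auto intro: order_trans)
    qed
  qed
  then have "AE x in lborel. \<forall>\<alpha>\<in>?A. (\<forall>s\<in>{0..1}. x + s *\<^sub>R ?e \<in> \<Omega>) \<longrightarrow> ennreal (norm (U \<alpha> x)) \<le> ennreal 2 * T x"
    by (subst AE_ball_countable) (auto simp: finite_mindex_le countable_finite)
  then show ?thesis
  proof eventually_elim
    case (elim x)
    show ?case
    proof
      assume x: "\<forall>s\<in>{0..1}. x + s *\<^sub>R ?e \<in> \<Omega>"
      have "ennreal (jet_sum U j x) = (\<Sum>\<alpha>\<in>?A. ennreal (norm (U \<alpha> x)))"
        unfolding jet_sum_def by (rule sum_ennreal[symmetric]) simp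
      also have "\<dots> \<le> (\<Sum>\<alpha>\<in>?A. ennreal 2 * T x)"
        using elim x by (intro sum_mono) auto
      also have "\<dots> = of_nat (card ?A) * (ennreal 2 * T x)" by simp
      also have "\<dots> = ennreal (2 * real (card ?A)) * T x"
        by (simp add: ennreal_mult ennreal_of_nat_eq_real_of_nat mult_ac)
      also have "\<dots> \<le> ennreal (line_const TYPE('d) m) * T x"
        unfolding line_const_def using j
        by (intro mult_right_mono ennreal_leI mult_left_mono of_nat_mono card_mono) (auto simp: finite_mindex_le)
      finally show "ennreal (jet_sum U j x) \<le> ennreal (line_const TYPE('d) m) * (\<integral>\<^sup>+t. ennreal (jet_sum U (Suc j) (x + t *\<^sub>R ?e)) * indicator {0..1} t \<partial>lborel)"
        by (simp add: T_def)
    qed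
  qed
qed

text \<open>The first factor is replaced by an average in direction \<open>i\<close>. Neither factor
  depends on \<open>h $ i\<close> before this step, so by resampling the averaging variable can take
  over the role of \<open>h $ i\<close>, while the second factor is untouched.\<close>

lemma product_insert_coordinate:
  fixes \<Phi> \<Phi>' G :: "real ^ 'd::finite \<Rightarrow> ennreal"
  assumes [measurable]: "\<Phi> \<in> borel_measurable borel" "\<Phi>' \<in> borel_measurable borel" "G \<in> borel_measurable borel"
    and le: "AE y in lborel. y \<in> dcube 0 2 \<and> y $ i \<le> 1 \<longrightarrow> \<Phi> y \<le> N * (\<integral>\<^sup>+t. \<Phi>' (y + t *\<^sub>R axis i 1) * indicator {0..1} t \<partial>lborel)"
    and i: "i \<notin> S" "i \<notin> T"
  shows "AE x in lborel. x \<in> dcube 0 1 \<longrightarrow>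
    (\<integral>\<^sup>+h. \<Phi> (x + coord_proj S h) * G (x + coord_proj T h) * indicator (dcube 0 1) h \<partial>lborel) \<le>
    N * (\<integral>\<^sup>+h. \<Phi>' (x + coord_proj (insert i S) h) * G (x + coord_proj T h) * indicator (dcube 0 1) h \<partial>lborel)"
proof -
  let ?Q = "dcube 0 1 :: (real ^ 'd) set" and ?e = "axis i 1 :: real ^ 'd"
  have nth [measurable]: "(\<lambda>h :: real ^ 'd. h $ i) \<in> borel_measurable borel"
    by (intro borel_measurable_continuous_onI continuous_intros)
  let ?P = "\<lambda>y. y \<in> dcube 0 2 \<and> y $ i \<le> 1 \<longrightarrow> \<Phi> y \<le> N * (\<integral>\<^sup>+t. \<Phi>' (y + t *\<^sub>R ?e) * indicator {0..1} t \<partial>lborel)"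
  have "AE x in lborel. AE h in lborel. ?P (x + coord_proj S h)"
  proof (subst lborel_pair.AE_commute)
    show "AE h in lborel. AE x in lborel. ?P (x + coord_proj S h)"
      by (intro AE_I2 AE_shift[OF le])
  qed measurable
  then show ?thesis
  proof eventually_elim
    case (elim x)
    show ?case
    proof
      assume x: "x \<in> ?Q"
      define \<Psi> where "\<Psi> h = \<Phi>' (x + coord_proj (insert i S) h) * G (x + coord_proj T h)" for h
      have [measurable]: "\<Psi> \<in> borel_measurable borel" unfolding \<Psi>_def by measurable
      have \<Psi>: "\<Psi> (h + (\<tau> - h $ i) *\<^sub>R ?e) = \<Phi>' (x + coord_proj S h + \<tau> *\<^sub>R ?e) * G (x + coord_proj T h)" for h \<tau>
      proof -
        have "coord_proj (insert i S) (h + (\<tau> - h $ i) *\<^sub>R ?e) = coord_proj S h + \<tau> *\<^sub>R ?e"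
          "coord_proj T (h + (\<tau> - h $ i) *\<^sub>R ?e) = coord_proj T h"
          using i by (auto simp: vec_eq_iff axis_def)
        then show ?thesis by (simp add: \<Psi>_def add.assoc)
      qed
      have "(\<integral>\<^sup>+h. \<Phi> (x + coord_proj S h) * G (x + coord_proj T h) * indicator ?Q h \<partial>lborel) \<le>
        (\<integral>\<^sup>+h. N * (\<integral>\<^sup>+\<tau>. \<Psi> (h + (\<tau> - h $ i) *\<^sub>R ?e) * indicator {0..1} \<tau> * indicator ?Q h \<partial>lborel) \<partial>lborel)"
      proof (rule nn_integral_mono_AE, use elim in eventually_elim)
        case (elim h)
        show ?case
        proof (cases "h \<in> ?Q")
          case True
          \<comment> \<open>Since \<open>i\<close> is not in \<open>S\<close>, coordinate
            \<open>i\<close> is still that of \<open>x\<close> and hence at most 1, which leaves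
            room in the cube of side 2 for a unit segment in direction \<open>i\<close>.\<close>
          have "x + coord_proj S h \<in> dcube 0 2"
            unfolding mem_dcube
          proof
            fix j
            have "0 \<le> x $ j" "x $ j \<le> 1" "0 \<le> h $ j" "h $ j \<le> 1" using x True by (auto simp: mem_dcube)
            then show "0 \<le> (x + coord_proj S h) $ j \<and> (x + coord_proj S h) $ j \<le> 2" by auto
          qed
          moreover have "(x + coord_proj S h) $ i \<le> 1" using x i by (auto simp: mem_dcube)
          ultimately have "\<Phi> (x + coord_proj S h) \<le> N * (\<integral>\<^sup>+t. \<Phi>' (x + coord_proj S h + t *\<^sub>R ?e) * indicator {0..1} t \<partial>lborel)"
            using elim by blast
          from mult_right_mono[OF this, of "G (x + coord_proj T h)"]
          have "\<Phi> (x + coord_proj S h) * G (x + coord_proj T h) \<le> N * ((\<integral>\<^sup>+t. \<Phi>' (x + coord_proj S h + t *\<^sub>R ?e) * indicator {0..1} t \<partial>lborel) * G (x + coord_proj T h))"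
            by (simp add: mult.assoc)
          also have "(\<integral>\<^sup>+t. \<Phi>' (x + coord_proj S h + t *\<^sub>R ?e) * indicator {0..1} t \<partial>lborel) * G (x + coord_proj T h) =
            (\<integral>\<^sup>+\<tau>. \<Psi> (h + (\<tau> - h $ i) *\<^sub>R ?e) * indicator {0..1} \<tau> * indicator ?Q h \<partial>lborel)"
            unfolding \<Psi> using True by (subst nn_integral_multc[symmetric]) (auto simp: mult_ac)
          finally show ?thesis using True by simp
        qed simp
      qed
      also have "\<dots> = N * (\<integral>\<^sup>+h. \<Psi> h * indicator ?Q h \<partial>lborel)"
        by (subst nn_integral_cmult) (simp_all add: resample_coordinate)
      finally show "(\<integral>\<^sup>+h. \<Phi> (x + coord_proj S h) * G (x + coord_proj T h) * indicator ?Q h \<partial>lborel) \<le>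
        N * (\<integral>\<^sup>+h. \<Phi>' (x + coord_proj (insert i S) h) * G (x + coord_proj T h) * indicator ?Q h \<partial>lborel)"
        by (simp add: \<Psi>_def)
    qed
  qed
qed

section \<open>Factorisation over complementary sets of coordinates\<close>

lemma nn_integral_reflect_coords:
  fixes G :: "real ^ 'd::finite \<Rightarrow> ennreal"
  assumes [measurable]: "G \<in> borel_measurable borel"
  shows "(\<integral>\<^sup>+h. G (x + coord_proj (- S) h - coord_proj S h) \<partial>lborel) = (\<integral>\<^sup>+h. G h \<partial>lborel)"
proof -
  define c :: "real ^ 'd \<Rightarrow> real" where "c b = (if b \<in> (\<lambda>i. axis i 1) ` S then - 1 else 1)" for b
  have c: "c b \<noteq> 0" "\<bar>c b\<bar> = 1" for b by (auto simp: c_def)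
  have ci: "c (axis i 1) = (if i \<in> S then - 1 else 1)" for i
    by (auto simp: c_def axis_eq_axis)
  have T: "x + (\<Sum>j\<in>Basis. (c j * (h \<bullet> j)) *\<^sub>R j) = x + coord_proj (- S) h - coord_proj S h" for h
  proof -
    have "(\<Sum>j\<in>Basis. (c j * (h \<bullet> j)) *\<^sub>R j) $ i = (if i \<in> S then - h $ i else h $ i)" for i
    proof -
      have "(\<Sum>j\<in>Basis. (c j * (h \<bullet> j)) *\<^sub>R j) $ i = (\<Sum>j\<in>Basis. (c j * (h \<bullet> j)) *\<^sub>R j) \<bullet> axis i 1"
        by (simp add: inner_axis)
      also have "\<dots> = c (axis i 1) * (h \<bullet> axis i 1)"
        by (rule inner_sum_left_Basis) (auto simp: Basis_vec_def)
      finally show ?thesis by (simp add: ci inner_axis)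
    qed
    then show ?thesis by (auto simp: vec_eq_iff)
  qed
  have m: "(\<lambda>h. x + coord_proj (- S) h - coord_proj S h) \<in> borel_measurable borel" by measurable
  have "lborel = density (distr lborel borel (\<lambda>h. x + (\<Sum>j\<in>Basis. (c j * (h \<bullet> j)) *\<^sub>R j))) (\<lambda>_. (\<Prod>j\<in>Basis. \<bar>c j\<bar>))"
    by (rule lborel_affine_euclidean) (rule c)
  then have "lborel = distr lborel borel (\<lambda>h. x + coord_proj (- S) h - coord_proj S h)"
    unfolding T by (simp add: c density_1)
  then have "(\<integral>\<^sup>+h. G h \<partial>lborel) = (\<integral>\<^sup>+h. G h \<partial>(distr lborel borel (\<lambda>h. x + coord_proj (- S) h - coord_proj S h)))" by simp
  also have "\<dots> = (\<integral>\<^sup>+h. G (x + coord_proj (- S) h - coord_proj S h) \<partial>lborel)"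
    using m by (subst nn_integral_distr) auto
  finally show ?thesis by simp
qed

text \<open>The pair of arguments of \<open>F\<close> and \<open>G\<close> depends on
  \<open>(x, h)\<close> by a linear bijection that preserves volume: in each coordinate exactly one
  of the two arguments is shifted by \<open>h\<close>.\<close>

lemma split_coordinates_integral:
  fixes F G :: "real ^ 'd::finite \<Rightarrow> ennreal"
  assumes [measurable]: "F \<in> borel_measurable borel" "G \<in> borel_measurable borel"
  shows "(\<integral>\<^sup>+x. \<integral>\<^sup>+h. F (x + coord_proj S h) * G (x + coord_proj (- S) h) \<partial>lborel \<partial>lborel) = (\<integral>\<^sup>+x. F x \<partial>lborel) * (\<integral>\<^sup>+x. G x \<partial>lborel)"
proof -
  have "(\<integral>\<^sup>+x. \<integral>\<^sup>+h. F (x + coord_proj S h) * G (x + coord_proj (- S) h) \<partial>lborel \<partial>lborel)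
    = (\<integral>\<^sup>+h. \<integral>\<^sup>+x. F (x + coord_proj S h) * G (x + coord_proj (- S) h) \<partial>lborel \<partial>lborel)"
    by (rule lborel_pair.Fubini') measurable
  also have "\<dots> = (\<integral>\<^sup>+h. \<integral>\<^sup>+x. F x * G (x + coord_proj (- S) h - coord_proj S h) \<partial>lborel \<partial>lborel)"
  proof (rule nn_integral_cong)
    fix h :: "real ^ 'd"
    have "(\<integral>\<^sup>+x. (\<lambda>x. F x * G (x + coord_proj (- S) h - coord_proj S h)) (x + coord_proj S h) \<partial>lborel) = (\<integral>\<^sup>+x. F x * G (x + coord_proj (- S) h - coord_proj S h) \<partial>lborel)"
      by (rule nn_integral_shift) measurable
    then show "(\<integral>\<^sup>+x. F (x + coord_proj S h) * G (x + coord_proj (- S) h) \<partial>lborel) = (\<integral>\<^sup>+x. F x * G (x + coord_proj (- S) h - coord_proj S h) \<partial>lborel)"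
      by (simp add: algebra_simps)
  qed
  also have "\<dots> = (\<integral>\<^sup>+x. \<integral>\<^sup>+h. F x * G (x + coord_proj (- S) h - coord_proj S h) \<partial>lborel \<partial>lborel)"
    by (rule lborel_pair.Fubini'[symmetric]) measurable
  also have "\<dots> = (\<integral>\<^sup>+x. F x * (\<integral>\<^sup>+h. G h \<partial>lborel) \<partial>lborel)"
    by (intro nn_integral_cong, subst nn_integral_cmult) (simp_all add: nn_integral_reflect_coords)
  also have "\<dots> = (\<integral>\<^sup>+x. F x \<partial>lborel) * (\<integral>\<^sup>+x. G x \<partial>lborel)" by (rule nn_integral_multc) measurable
  finally show ?thesis .
qed

text \<open>For \<open>p = 1\<close> and \<open>m \<ge> d\<close> the derivatives still available for the two factors suffice to bound
  them uniformly in complementary sets of coordinates, so the product integral factorises.\<close>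

lemma local_product_L1:
  fixes U V :: "('d::{finite,linorder} \<Rightarrow> nat) \<Rightarrow> real ^ 'd::{finite,linorder} \<Rightarrow> 'b::euclidean_space"
  assumes m: "CARD('d) \<le> m" and bc: "mindex_order \<beta> + mindex_order \<gamma> \<le> m" and \<Omega>: "open \<Omega>"
    and U: "ac_family \<Omega> m U" and V: "ac_family \<Omega> m V" and Q: "dcube 0 (real m + 1) \<subseteq> \<Omega>"
  shows "(\<integral>\<^sup>+x. ennreal (norm (U \<beta> x) * norm (V \<gamma> x)) * indicator (dcube 0 1) x \<partial>lborel)
    \<le> ennreal (line_const TYPE('d) m ^ CARD('d)) * jet_energy 1 m U * jet_energy 1 m V"
proof -
  let ?b = "mindex_order \<beta>" and ?c = "mindex_order \<gamma>" and ?Q = "dcube 0 1 :: (real ^ 'd::{finite,linorder}) set"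
  let ?N = "ennreal (line_const TYPE('d) m)"
  have N0: "0 \<le> line_const TYPE('d) m" by (simp add: line_const_def)
  have "1 \<le> CARD('d)" by (simp add: Suc_leI)
  then have m1: "1 \<le> m" using m by (rule order_trans)
  have "dcube 0 2 \<subseteq> (dcube 0 (real m + 1) :: (real ^ 'd::{finite,linorder}) set)" using m1 by (intro dcube_mono) auto
  then have Q2: "dcube 0 2 \<subseteq> \<Omega>" using Q by blast
  have seg: "\<forall>s\<in>{0..1}. y + s *\<^sub>R axis i 1 \<in> \<Omega>" if "y \<in> dcube 0 2 \<and> y $ i \<le> 1" for y :: "real ^ 'd::{finite,linorder}" and i
  proof
    fix s :: real assume "s \<in> {0..1}"
    then have "y + s *\<^sub>R axis i 1 \<in> dcube 0 2"
      using that unfolding mem_dcube by (auto simp: axis_def intro: order_trans)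
    then show "y + s *\<^sub>R axis i 1 \<in> \<Omega>" using Q2 by blast
  qed
  have line: "AE y in lborel. y \<in> dcube 0 2 \<and> y $ i \<le> 1 \<longrightarrow> ennreal (jet_sum W j y) \<le> ?N * (\<integral>\<^sup>+t. ennreal (jet_sum W (Suc j) (y + t *\<^sub>R axis i 1)) * indicator {0..1} t \<partial>lborel)"
    if "ac_family \<Omega> m W" "j < m" for W :: "('d \<Rightarrow> nat) \<Rightarrow> real ^ 'd::{finite,linorder} \<Rightarrow> 'b" and i j
    using jet_sum_line_bound[OF \<Omega> that, of i]
    by eventually_elim (use seg in blast)
  have J: "(\<lambda>x. ennreal (jet_sum W j x)) \<in> borel_measurable borel" if "ac_family \<Omega> m W" "j \<le> m" for W :: "('d \<Rightarrow> nat) \<Rightarrow> real ^ 'd::{finite,linorder} \<Rightarrow> 'b" and j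
    using jet_sum_measurable[OF that] by measurable
  \<comment> \<open>\<open>R {} {}\<close> is the product of jets to be estimated. Adding
    \<open>i\<close> to \<open>S\<close> or to \<open>T\<close> spends one derivative of
    \<open>U\<close> or of \<open>V\<close> on direction \<open>i\<close>; once the two sets are
    complementary, the integral factorises.\<close>
  define R where "R S T x = (\<integral>\<^sup>+h. ennreal (jet_sum U (?b + card S) (x + coord_proj S h)) * ennreal (jet_sum V (?c + card T) (x + coord_proj T h)) * indicator ?Q h \<partial>lborel)" for S T x
  have stepU: "AE x in lborel. x \<in> ?Q \<longrightarrow> R S T x \<le> ?N * R (insert i S) T x"
    if "i \<notin> S" "i \<notin> T" "?b + card S < m" "?c + card T \<le> m" for i S T
  proof -
    have "card (insert i S) = Suc (card S)" using that(1) by simp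
    then show ?thesis
      unfolding R_def using product_insert_coordinate[OF J[OF U, of "?b + card S"] J[OF U, of "Suc (?b + card S)"] J[OF V, of "?c + card T"] line[OF U that(3)] that(1,2)] that
      by simp
  qed
  have stepV: "AE x in lborel. x \<in> ?Q \<longrightarrow> R S T x \<le> ?N * R S (insert i T) x"
    if "i \<notin> S" "i \<notin> T" "?b + card S \<le> m" "?c + card T < m" for i S T
  proof -
    have "card (insert i T) = Suc (card T)" using that(2) by simp
    then show ?thesis
      unfolding R_def using product_insert_coordinate[OF J[OF V, of "?c + card T"] J[OF V, of "Suc (?c + card T)"] J[OF U, of "?b + card S"] line[OF V that(4)] that(2,1)] that
      by (simp add: mult.commute)
  qed
  have claimU: "AE x in lborel. x \<in> ?Q \<longrightarrow> R {} {} x \<le> ?N ^ card S * R S {} x" if "?b + card S \<le> m" for S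
    using that
  proof (induction S rule: infinite_finite_induct)
    case (insert i S)
    then have lt: "?b + card S < m" by simp
    have "AE x in lborel. x \<in> ?Q \<longrightarrow> R S {} x \<le> ?N * R (insert i S) {} x"
      using insert.hyps lt bc by (intro stepU) auto
    then show ?case
      using insert.IH[OF less_imp_le[OF lt]]
    proof eventually_elim
      case (elim x)
      show ?case
      proof
        assume x: "x \<in> ?Q"
        have "R {} {} x \<le> ?N ^ card S * R S {} x" using elim x by blast
        also have "\<dots> \<le> ?N ^ card S * (?N * R (insert i S) {} x)" using elim x by (intro mult_left_mono) auto
        finally show "R {} {} x \<le> ?N ^ card (insert i S) * R (insert i S) {} x"
          using insert.hyps by (simp add: mult_ac)
      qed
    qed
  qed auto
  have claimV: "AE x in lborel. x \<in> ?Q \<longrightarrow> R S {} x \<le> ?N ^ card T * R S T x" if "?b + card S \<le> m" "?c + card T \<le> m" "S \<inter> T = {}" for S T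
    using that
  proof (induction T rule: infinite_finite_induct)
    case (insert i T)
    then have lt: "?c + card T < m" and d: "S \<inter> T = {}" by auto
    have "AE x in lborel. x \<in> ?Q \<longrightarrow> R S T x \<le> ?N * R S (insert i T) x"
      using insert.hyps insert.prems lt by (intro stepV) auto
    then show ?case
      using insert.IH[OF insert.prems(1) less_imp_le[OF lt] d]
    proof eventually_elim
      case (elim x)
      show ?case
      proof
        assume x: "x \<in> ?Q"
        have "R S {} x \<le> ?N ^ card T * R S T x" using elim x by blast
        also have "\<dots> \<le> ?N ^ card T * (?N * R S (insert i T) x)" using elim x by (intro mult_left_mono) auto
        finally show "R S {} x \<le> ?N ^ card (insert i T) * R S (insert i T) x"
          using insert.hyps by (simp add: mult_ac)
      qed
    qed
  qed auto
  \<comment> \<open>\<open>U\<close> receives as many directions as its spare derivatives allow, at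
    most \<open>d\<close>, and \<open>V\<close> the others;
    \<open>|\<beta>| + |\<gamma>| \<le> m\<close> and \<open>d \<le> m\<close> ensure that
    \<open>V\<close> has enough derivatives for them.\<close>
  obtain S :: "'d set" where S: "card S = min (m - ?b) (CARD('d))"
    using obtain_subset_with_card_n[of "min (m - ?b) (CARD('d))" "UNIV :: 'd set"] by auto
  have cT: "card (- S) = CARD('d) - card S" by (simp add: Compl_eq_Diff_UNIV card_Diff_subset)
  have bS: "?b + card S \<le> m" and cS: "?c + card (- S) \<le> m" and tot: "card S + card (- S) = CARD('d)"
    using S cT bc m by auto
  have R0: "R {} {} x = ennreal (jet_sum U ?b x) * ennreal (jet_sum V ?c x)" for x
    by (simp add: R_def nn_integral_cmult emeasure_dcube)
  define F where "F x = ennreal (jet_sum U m x) * indicator (dcube 0 (real m + 1)) x" for x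
  define G where "G x = ennreal (jet_sum V m x) * indicator (dcube 0 (real m + 1)) x" for x
  have [measurable]: "F \<in> borel_measurable borel" "G \<in> borel_measurable borel"
    unfolding F_def G_def using J[OF U order_refl] J[OF V order_refl] by measurable
  have FE: "(\<integral>\<^sup>+x. F x \<partial>lborel) = jet_energy 1 m U" "(\<integral>\<^sup>+x. G x \<partial>lborel) = jet_energy 1 m V"
    by (simp_all add: jet_energy_def F_def G_def jet_sum_nonneg)
  have RFG: "R S (- S) x \<le> (\<integral>\<^sup>+h. F (x + coord_proj S h) * G (x + coord_proj (- S) h) \<partial>lborel)" if x: "x \<in> ?Q" for x
    unfolding R_def
  proof (rule nn_integral_mono)
    fix h :: "real ^ 'd::{finite,linorder}"
    show "ennreal (jet_sum U (?b + card S) (x + coord_proj S h)) * ennreal (jet_sum V (?c + card (- S)) (x + coord_proj (- S) h)) * indicator ?Q h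
      \<le> F (x + coord_proj S h) * G (x + coord_proj (- S) h)"
    proof (cases "h \<in> ?Q")
      case True
      have "x + coord_proj T h \<in> dcube 0 (real m + 1)" for T
        unfolding mem_dcube
      proof
        fix j
        have "0 \<le> x $ j" "x $ j \<le> 1" "0 \<le> h $ j" "h $ j \<le> 1" using x True by (auto simp: mem_dcube)
        then show "0 \<le> (x + coord_proj T h) $ j \<and> (x + coord_proj T h) $ j \<le> real m + 1" using m1 by auto
      qed
      then show ?thesis using True bS cS unfolding F_def G_def
        by (simp add: mult_mono ennreal_leI jet_sum_mono)
    qed simp
  qed
  have "(\<integral>\<^sup>+x. ennreal (norm (U \<beta> x) * norm (V \<gamma> x)) * indicator ?Q x \<partial>lborel)
    \<le> (\<integral>\<^sup>+x. ?N ^ CARD('d) * (\<integral>\<^sup>+h. F (x + coord_proj S h) * G (x + coord_proj (- S) h) \<partial>lborel) \<partial>lborel)"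
  proof (rule nn_integral_mono_AE, use claimU[OF bS] claimV[OF bS cS Compl_disjoint] in eventually_elim)
    case (elim x)
    show ?case
    proof (cases "x \<in> ?Q")
      case True
      have "ennreal (norm (U \<beta> x) * norm (V \<gamma> x)) \<le> R {} {} x"
        unfolding R0 by (simp add: ennreal_mult mult_mono ennreal_leI norm_le_jet_sum)
      also have "\<dots> \<le> ?N ^ card S * R S {} x" using elim True by blast
      also have "\<dots> \<le> ?N ^ card S * (?N ^ card (- S) * R S (- S) x)" using elim True by (intro mult_left_mono) auto
      also have "\<dots> = ?N ^ CARD('d) * R S (- S) x" unfolding tot[symmetric] power_add by (simp add: mult.assoc)
      also have "\<dots> \<le> ?N ^ CARD('d) * (\<integral>\<^sup>+h. F (x + coord_proj S h) * G (x + coord_proj (- S) h) \<partial>lborel)"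
        by (intro mult_left_mono RFG True) simp
      finally show ?thesis using True by simp
    qed simp
  qed
  also have "\<dots> = ?N ^ CARD('d) * ((\<integral>\<^sup>+x. F x \<partial>lborel) * (\<integral>\<^sup>+x. G x \<partial>lborel))"
    by (subst nn_integral_cmult) (simp_all add: split_coordinates_integral)
  finally show ?thesis using N0 by (simp add: FE ennreal_power mult.assoc)
qed

section \<open>Whitney averaging and sufficiency\<close>

lemma rho_nonneg: "0 \<le> rho l x" and rho_le_1: "rho l x \<le> 1"
  by (simp_all add: rho_def sum_nonneg)

lemma rho_lipschitz:
  fixes x y :: "real ^ 'd::{finite,linorder}"
  shows "rho l x \<le> rho l y + norm (x - y)"
proof -
  let ?A = "leading_coords (CARD('d) - l) :: 'd set"
  have e: "sqrt (\<Sum>i\<in>?A. \<bar>z $ i\<bar>\<^sup>2) = L2_set (\<lambda>i. z $ i) ?A" for z :: "real ^ 'd::{finite,linorder}"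
    by (simp add: L2_set_def)
  have "L2_set (\<lambda>i. x $ i) ?A = L2_set (\<lambda>i. y $ i + (x - y) $ i) ?A" by simp
  also have "\<dots> \<le> L2_set (\<lambda>i. y $ i) ?A + L2_set (\<lambda>i. (x - y) $ i) ?A" by (rule L2_set_triangle_ineq)
  also have "L2_set (\<lambda>i. (x - y) $ i) ?A \<le> norm (x - y)"
  proof -
    have "(\<Sum>i\<in>?A. ((x - y) $ i)\<^sup>2) \<le> (\<Sum>i\<in>UNIV. ((x - y) $ i)\<^sup>2)" by (rule sum_mono2) auto
    then show ?thesis by (simp add: norm_vec_def L2_set_def)
  qed
  finally show ?thesis unfolding rho_def e by (auto simp: min_def) (use norm_ge_zero[of "x - y"] in linarith)+
qed

lemma powr_comparable:
  fixes s t e :: real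
  assumes "0 < s" "s / 2 \<le> t" "t \<le> 2 * s"
  shows "t powr e \<le> 2 powr \<bar>e\<bar> * s powr e"
proof (cases "0 \<le> e")
  case True
  then have "t powr e \<le> (2 * s) powr e" using assms by (intro powr_mono2) auto
  then show ?thesis using True assms by (simp add: powr_mult)
next
  case False
  then have "t powr e \<le> (s / 2) powr e" using assms by (intro powr_mono2') auto
  also have "\<dots> = 2 powr \<bar>e\<bar> * s powr e" using False assms by (simp add: powr_divide powr_minus_divide)
  finally show ?thesis .
qed

lemma sum_powr_le:
  fixes t :: "'a \<Rightarrow> real"
  assumes "finite A" "\<And>x. x \<in> A \<Longrightarrow> 0 \<le> t x" "0 \<le> p"
  shows "(\<Sum>x\<in>A. t x) powr p \<le> real (card A) powr p * (\<Sum>x\<in>A. t x powr p)"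
proof (cases "A = {}")
  case False
  define M where "M = Max (t ` A)"
  have "M \<in> t ` A" using Max_in[of "t ` A"] False assms(1) by (simp add: M_def)
  then obtain z where z: "z \<in> A" "t z = M" by auto
  have le: "t x \<le> M" if "x \<in> A" for x using that assms(1) by (simp add: M_def)
  have "(\<Sum>x\<in>A. t x) \<le> real (card A) * M" using sum_bounded_above[of A t M] le by simp
  then have "(\<Sum>x\<in>A. t x) powr p \<le> (real (card A) * M) powr p"
    using assms by (intro powr_mono2 sum_nonneg) auto
  also have "\<dots> = real (card A) powr p * t z powr p" using z assms(2)[of z] by (simp add: powr_mult)
  also have "\<dots> \<le> real (card A) powr p * (\<Sum>x\<in>A. t x powr p)"
    using z assms by (intro mult_left_mono member_le_sum) auto
  finally show ?thesis .
qed simp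

text \<open>The constant \<open>\<kappa>\<close> makes every vector in the cube of side
  \<open>\<kappa> * rho l y * L\<close> at corner 0 have norm at most \<open>rho l y / 2\<close>, by
  way of the sum of its coordinates. As \<open>rho\<close> has Lipschitz constant 1, it is
  comparable to \<open>rho l y\<close> on the whole cube attached to \<open>y\<close>.\<close>

context
  fixes l :: nat and L :: real and \<kappa> :: real and d :: "'d::{finite,linorder} itself"
  assumes L: "1 \<le> L" and \<kappa>: "\<kappa> = 1 / (2 * L * real CARD('d))"
begin

lemma kappa: "0 < \<kappa>" "\<kappa> \<le> 1" "\<kappa> * real CARD('d) * L = 1/2"
proof -
  have n: "1 \<le> real CARD('d)" by (simp add: Suc_leI)
  have "1 * 1 \<le> L * real CARD('d)" using L n by (intro mult_mono) auto
  then show "0 < \<kappa>" "\<kappa> \<le> 1" "\<kappa> * real CARD('d) * L = 1/2" using L n by (auto simp: \<kappa> field_simps)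
qed

lemma norm_dcube:
  fixes v :: "real ^ 'd::{finite,linorder}"
  assumes "\<And>i. 0 \<le> v $ i \<and> v $ i \<le> b"
  shows "norm v \<le> real CARD('d) * b"
proof -
  have "norm v \<le> (\<Sum>i\<in>UNIV. \<bar>v $ i\<bar>)" by (rule norm_le_l1_cart)
  also have "\<dots> \<le> (\<Sum>i\<in>(UNIV :: 'd set). b)" using assms by (intro sum_mono) (simp add: abs_of_nonneg)
  finally show ?thesis by simp
qed

lemma rho_comparable:
  fixes x y :: "real ^ 'd::{finite,linorder}"
  assumes "\<And>i. 0 \<le> (x - y) $ i \<and> (x - y) $ i \<le> \<kappa> * rho l y * L"
  shows "rho l y / 2 \<le> rho l x" "rho l x \<le> 3/2 * rho l y"
proof -
  have "norm (x - y) \<le> real CARD('d) * (\<kappa> * rho l y * L)" by (rule norm_dcube) (rule assms)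
  also have "\<dots> = (\<kappa> * real CARD('d) * L) * rho l y" by simp
  also have "\<dots> = rho l y / 2" unfolding kappa(3) by simp
  finally have "norm (x - y) \<le> rho l y / 2" .
  then show "rho l y / 2 \<le> rho l x" "rho l x \<le> 3/2 * rho l y"
    using rho_lipschitz[of l x y] rho_lipschitz[of l y x] by (simp_all add: norm_minus_commute)
qed

lemma rho_comparable_cube:
  fixes y z :: "real ^ 'd::{finite,linorder}"
  assumes z: "z \<in> dcube 0 L"
  shows "rho l y / 2 \<le> rho l (y + (\<kappa> * rho l y) *\<^sub>R z)" "rho l (y + (\<kappa> * rho l y) *\<^sub>R z) \<le> 3/2 * rho l y"
proof -
  have "0 \<le> (y + (\<kappa> * rho l y) *\<^sub>R z - y) $ i \<and> (y + (\<kappa> * rho l y) *\<^sub>R z - y) $ i \<le> \<kappa> * rho l y * L" for i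
    using z kappa rho_nonneg[of l y] by (auto simp: mem_dcube intro!: mult_left_mono)
  from rho_comparable[OF this] show "rho l y / 2 \<le> rho l (y + (\<kappa> * rho l y) *\<^sub>R z)" "rho l (y + (\<kappa> * rho l y) *\<^sub>R z) \<le> 3/2 * rho l y" .
qed

text \<open>For fixed regular \<open>y\<close> this is, up to the total mass \<open>b^d\<close>, the
  uniform density on the cube with corner \<open>y\<close> and side
  \<open>\<kappa> * rho l y * b\<close>. Covering and bounded overlap of a Whitney decomposition
  become lower and upper bounds for the integral over \<open>y\<close>.\<close>

definition whitney_kernel :: "real \<Rightarrow> real ^ 'd::{finite,linorder} \<Rightarrow> real ^ 'd::{finite,linorder} \<Rightarrow> ennreal" where
  "whitney_kernel b x y = ennreal (1 / (\<kappa> * rho l y) ^ CARD('d)) * indicator (dcube 0 b) ((1 / (\<kappa> * rho l y)) *\<^sub>R (x - y)) * indicator (- singular_set l) y"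

lemma sing_measurable [measurable]: "- singular_set l \<in> sets (borel :: (real ^ 'd::{finite,linorder}) measure)"
  using open_regular_set by (rule borel_open)

lemma whitney_kernel_integral:
  fixes H :: "real ^ 'd::{finite,linorder} \<Rightarrow> ennreal"
  assumes [measurable]: "H \<in> borel_measurable borel"
  shows "(\<integral>\<^sup>+y. (\<integral>\<^sup>+z. H (y + (\<kappa> * rho l y) *\<^sub>R z) * indicator (dcube 0 b) z \<partial>lborel) * indicator (- singular_set l) y \<partial>lborel)
    = (\<integral>\<^sup>+x. H x * (\<integral>\<^sup>+y. whitney_kernel b x y \<partial>lborel) \<partial>lborel)"
proof -
  have "(\<integral>\<^sup>+z. H (y + (\<kappa> * rho l y) *\<^sub>R z) * indicator (dcube 0 b) z \<partial>lborel) * indicator (- singular_set l) y =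
      (\<integral>\<^sup>+x. H x * whitney_kernel b x y \<partial>lborel)" for y :: "real ^ 'd::{finite,linorder}"
  proof (cases "y \<in> - singular_set l")
    case True
    then have \<rho>: "0 < rho l y" by (simp add: rho_pos_iff)
    define r where "r = \<kappa> * rho l y"
    have r: "0 < r" using \<rho> kappa by (simp add: r_def)
    let ?F = "\<lambda>x. H x * indicator (dcube 0 b) ((1 / r) *\<^sub>R (x - y))"
    have "(\<integral>\<^sup>+x. H x * whitney_kernel b x y \<partial>lborel) = ennreal (1 / r ^ CARD('d)) * (\<integral>\<^sup>+x. ?F x \<partial>lborel)"
      using True unfolding whitney_kernel_def r_def[symmetric] by (subst nn_integral_cmult[symmetric]) (auto simp: mult_ac)
    also have "(\<integral>\<^sup>+x. ?F x \<partial>lborel) = ennreal (r ^ CARD('d)) * (\<integral>\<^sup>+z. ?F (y + r *\<^sub>R z) \<partial>lborel)"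
      by (rule nn_integral_scale[OF _ r]) measurable
    also have "ennreal (1 / r ^ CARD('d)) * (ennreal (r ^ CARD('d)) * (\<integral>\<^sup>+z. ?F (y + r *\<^sub>R z) \<partial>lborel)) = (\<integral>\<^sup>+z. ?F (y + r *\<^sub>R z) \<partial>lborel)"
      using r by (simp add: mult.assoc[symmetric] ennreal_mult[symmetric])
    also have "\<dots> = (\<integral>\<^sup>+z. H (y + r *\<^sub>R z) * indicator (dcube 0 b) z \<partial>lborel)"
      using r by simp
    finally show ?thesis using True by (simp add: r_def)
  qed (simp add: whitney_kernel_def)
  then have "(\<integral>\<^sup>+y. (\<integral>\<^sup>+z. H (y + (\<kappa> * rho l y) *\<^sub>R z) * indicator (dcube 0 b) z \<partial>lborel) * indicator (- singular_set l) y \<partial>lborel)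
    = (\<integral>\<^sup>+y. \<integral>\<^sup>+x. H x * whitney_kernel b x y \<partial>lborel \<partial>lborel)" by simp
  also have "\<dots> = (\<integral>\<^sup>+x. \<integral>\<^sup>+y. H x * whitney_kernel b x y \<partial>lborel \<partial>lborel)"
    unfolding whitney_kernel_def by (rule lborel_pair.Fubini') measurable
  also have "\<dots> = (\<integral>\<^sup>+x. H x * (\<integral>\<^sup>+y. whitney_kernel b x y \<partial>lborel) \<partial>lborel)"
    by (intro nn_integral_cong nn_integral_cmult) (simp add: whitney_kernel_def)
  finally show ?thesis .
qed

lemma reflected_cube_volume:
  fixes x :: "real ^ 'd::{finite,linorder}"
  assumes "0 \<le> b"
  shows "(\<integral>\<^sup>+y. indicator (dcube 0 b) (x - y) \<partial>lborel) = ennreal (b ^ CARD('d))"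
proof -
  have "(\<integral>\<^sup>+y. indicator (dcube 0 b) (x + coord_proj (- UNIV) y - coord_proj UNIV y) \<partial>lborel) = (\<integral>\<^sup>+y. indicator (dcube 0 b :: (real ^ 'd::{finite,linorder}) set) y \<partial>lborel)"
    by (rule nn_integral_reflect_coords) measurable
  then show ?thesis using assms by (simp add: emeasure_dcube)
qed

lemma scaled_diff_mem:
  fixes x y :: "real ^ 'd::{finite,linorder}"
  assumes "0 < r"
  shows "(1 / r) *\<^sub>R (x - y) \<in> dcube 0 b \<longleftrightarrow> (\<forall>i. 0 \<le> (x - y) $ i \<and> (x - y) $ i \<le> r * b)"
  using assms by (auto simp: mem_dcube field_simps)

text \<open>Bounded overlap: only those \<open>y\<close> contribute at which \<open>rho\<close> is
  comparable to its value at \<open>x\<close>, and they lie in a reflected cube at \<open>x\<close>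
  of comparable size. A singular \<open>x\<close> is met by no cube.\<close>

lemma whitney_kernel_upper:
  fixes x :: "real ^ 'd::{finite,linorder}"
  shows "(\<integral>\<^sup>+y. whitney_kernel L x y \<partial>lborel) \<le> ennreal ((3 * L) ^ CARD('d)) * indicator (- singular_set l) x"
proof (cases "x \<in> - singular_set l")
  case True
  then have \<rho>: "0 < rho l x" by (simp add: rho_pos_iff)
  \<comment> \<open>The side \<open>?b\<close> comes from \<open>rho l y \<le> 2 * rho l x\<close>,
    the bound \<open>?c\<close> on the density from \<open>rho l y \<ge> 2/3 * rho l x\<close>; the
    quotient of the two lengths is \<open>3 L\<close>.\<close>
  let ?b = "2 * \<kappa> * rho l x * L" and ?c = "1 / (2/3 * \<kappa> * rho l x) ^ CARD('d)"
  have c0: "0 < 2/3 * \<kappa> * rho l x" using \<rho> kappa by simp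
  have "whitney_kernel L x y \<le> ennreal ?c * indicator (dcube 0 ?b) (x - y)" for y
  proof (cases "y \<in> - singular_set l \<and> (1 / (\<kappa> * rho l y)) *\<^sub>R (x - y) \<in> dcube 0 L")
    case True
    then have \<rho>y: "0 < rho l y" by (simp add: rho_pos_iff)
    have d: "0 \<le> (x - y) $ i \<and> (x - y) $ i \<le> \<kappa> * rho l y * L" for i
      using True scaled_diff_mem[of "\<kappa> * rho l y" x y L] \<rho>y kappa by auto
    from rho_comparable[OF d] have cmp: "rho l y / 2 \<le> rho l x" "rho l x \<le> 3/2 * rho l y" by auto
    have "\<kappa> * rho l y * L \<le> ?b" using cmp kappa L by (intro mult_right_mono) auto
    then have "x - y \<in> dcube 0 ?b" unfolding mem_dcube using d by (meson order_trans)
    moreover have "1 / (\<kappa> * rho l y) ^ CARD('d) \<le> ?c"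
      using cmp kappa \<rho>y \<rho> by (intro divide_left_mono power_mono mult_pos_pos zero_less_power) auto
    ultimately show ?thesis using True by (simp add: whitney_kernel_def ennreal_leI)
  next
    case False
    then have "whitney_kernel L x y = 0" by (auto simp: whitney_kernel_def)
    then show ?thesis by simp
  qed
  then have "(\<integral>\<^sup>+y. whitney_kernel L x y \<partial>lborel) \<le> (\<integral>\<^sup>+y. ennreal ?c * indicator (dcube 0 ?b) (x - y) \<partial>lborel)"
    by (rule nn_integral_mono)
  also have "\<dots> = ennreal ?c * ennreal (?b ^ CARD('d))"
    using \<rho> kappa L by (subst nn_integral_cmult) (auto simp: reflected_cube_volume)
  also have "\<dots> = ennreal ((3 * L) ^ CARD('d))"
  proof -
    have "?c * ?b ^ CARD('d) = (?b / (2/3 * \<kappa> * rho l x)) ^ CARD('d)"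
      by (simp only: power_divide times_divide_eq_left mult_1_left)
    also have "?b / (2/3 * \<kappa> * rho l x) = 3 * L" using \<rho> kappa by (simp add: field_simps)
    finally have e: "?c * ?b ^ CARD('d) = (3 * L) ^ CARD('d)" .
    have "0 \<le> ?c" "0 \<le> ?b ^ CARD('d)" using \<rho> kappa L by simp_all
    from ennreal_mult[OF this] e show ?thesis by metis
  qed
  finally show ?thesis using True by simp
next
  case False
  then have \<rho>: "rho l x = 0" using rho_pos_iff[of l x] rho_nonneg[of l x] by simp
  have "whitney_kernel L x y = 0" for y
  proof (rule ccontr)
    assume "whitney_kernel L x y \<noteq> 0"
    then have y: "y \<in> - singular_set l" "(1 / (\<kappa> * rho l y)) *\<^sub>R (x - y) \<in> dcube 0 L"
      by (auto simp: whitney_kernel_def indicator_def split: if_splits)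
    then have \<rho>y: "0 < rho l y" by (simp add: rho_pos_iff)
    have "0 \<le> (x - y) $ i \<and> (x - y) $ i \<le> \<kappa> * rho l y * L" for i
      using y scaled_diff_mem[of "\<kappa> * rho l y" x y L] \<rho>y kappa by auto
    from rho_comparable(1)[OF this] show False using \<rho> \<rho>y by simp
  qed
  then show ?thesis by simp
qed

text \<open>Covering: every \<open>y\<close> with \<open>x - y\<close> in the cube of side
  \<open>\<kappa> * rho l x / 2\<close> has \<open>x\<close> in its own unit cube and
  \<open>rho l y \<le> 2 * rho l x\<close>. The quotient of that side and
  \<open>2 * \<kappa> * rho l x\<close> is 1/4.\<close>

lemma whitney_kernel_lower:
  fixes x :: "real ^ 'd::{finite,linorder}"
  assumes x: "x \<in> - singular_set l"
  shows "1 \<le> ennreal (4 ^ CARD('d)) * (\<integral>\<^sup>+y. whitney_kernel 1 x y \<partial>lborel)"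
proof -
  have \<rho>: "0 < rho l x" using x by (simp add: rho_pos_iff)
  let ?b = "\<kappa> * rho l x / 2" and ?c = "1 / (2 * \<kappa> * rho l x) ^ CARD('d)"
  have c0: "0 < 2 * \<kappa> * rho l x" using \<rho> kappa by simp
  have "ennreal ?c * indicator (dcube 0 ?b) (x - y) \<le> whitney_kernel 1 x y" for y
  proof (cases "x - y \<in> dcube 0 ?b")
    case True
    then have d: "0 \<le> (x - y) $ i \<and> (x - y) $ i \<le> ?b" for i by (auto simp: mem_dcube)
    have "norm (x - y) \<le> real CARD('d) * ?b" by (rule norm_dcube) (rule d)
    also have "\<dots> \<le> real CARD('d) * ?b * L"
      using mult_left_mono[OF L, of "real CARD('d) * ?b"] \<rho> kappa by simp
    also have "\<dots> = (\<kappa> * real CARD('d) * L) * (rho l x / 2)" by simp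
    also have "\<dots> = rho l x / 4" unfolding kappa(3) by simp
    finally have nrm: "norm (x - y) \<le> rho l x / 4" .
    then have cmp: "rho l x / 2 \<le> rho l y" "rho l y \<le> 2 * rho l x"
      using rho_lipschitz[of l x y] rho_lipschitz[of l y x] \<rho> by (simp_all add: norm_minus_commute)
    then have \<rho>y: "0 < rho l y" using \<rho> by simp
    then have y: "y \<in> - singular_set l" by (simp add: rho_pos_iff)
    have "?b \<le> \<kappa> * rho l y * 1" using cmp kappa by (simp add: mult_left_mono)
    then have "\<forall>i. 0 \<le> (x - y) $ i \<and> (x - y) $ i \<le> \<kappa> * rho l y * 1"
      using d by (meson order_trans)
    then have "(1 / (\<kappa> * rho l y)) *\<^sub>R (x - y) \<in> dcube 0 1"
      using scaled_diff_mem[of "\<kappa> * rho l y" x y 1] \<rho>y kappa by simp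
    moreover have "?c \<le> 1 / (\<kappa> * rho l y) ^ CARD('d)"
      using cmp kappa \<rho>y \<rho> by (intro divide_left_mono power_mono mult_pos_pos zero_less_power) auto
    ultimately show ?thesis using True y by (simp add: whitney_kernel_def ennreal_leI)
  qed simp
  then have "(\<integral>\<^sup>+y. ennreal ?c * indicator (dcube 0 ?b) (x - y) \<partial>lborel) \<le> (\<integral>\<^sup>+y. whitney_kernel 1 x y \<partial>lborel)"
    by (rule nn_integral_mono)
  moreover have "(\<integral>\<^sup>+y. ennreal ?c * indicator (dcube 0 ?b) (x - y) \<partial>lborel) = ennreal ?c * ennreal (?b ^ CARD('d))"
    using \<rho> kappa by (subst nn_integral_cmult) (auto simp: reflected_cube_volume)
  moreover have "ennreal (4 ^ CARD('d)) * (ennreal ?c * ennreal (?b ^ CARD('d))) = 1"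
  proof -
    have "4 ^ CARD('d) * (?c * ?b ^ CARD('d)) = (4 * (?b / (2 * \<kappa> * rho l x))) ^ CARD('d)"
      by (simp only: power_mult_distrib power_divide) simp
    also have "4 * (?b / (2 * \<kappa> * rho l x)) = 1" using \<rho> kappa by (simp add: field_simps)
    finally show ?thesis using c0 \<rho> kappa by (simp add: ennreal_mult[symmetric])
  qed
  ultimately show ?thesis by (metis mult_left_mono zero_le)
qed

lemma whitney_lower:
  fixes H :: "real ^ 'd::{finite,linorder} \<Rightarrow> ennreal"
  assumes [measurable]: "H \<in> borel_measurable borel"
  shows "(\<integral>\<^sup>+x. H x * indicator (- singular_set l) x \<partial>lborel) \<le> ennreal (4 ^ CARD('d)) *
    (\<integral>\<^sup>+y. (\<integral>\<^sup>+z. H (y + (\<kappa> * rho l y) *\<^sub>R z) * indicator (dcube 0 1) z \<partial>lborel) * indicator (- singular_set l) y \<partial>lborel)"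
proof -
  have "(\<integral>\<^sup>+x. H x * indicator (- singular_set l) x \<partial>lborel) \<le> (\<integral>\<^sup>+x. ennreal (4 ^ CARD('d)) * (H x * (\<integral>\<^sup>+y. whitney_kernel 1 x y \<partial>lborel)) \<partial>lborel)"
  proof (rule nn_integral_mono)
    fix x :: "real ^ 'd::{finite,linorder}"
    show "H x * indicator (- singular_set l) x \<le> ennreal (4 ^ CARD('d)) * (H x * (\<integral>\<^sup>+y. whitney_kernel 1 x y \<partial>lborel))"
    proof (cases "x \<in> - singular_set l")
      case True
      from mult_left_mono[OF whitney_kernel_lower[OF True], of "H x"] show ?thesis using True by (simp add: mult_ac)
    qed simp
  qed
  also have "\<dots> = ennreal (4 ^ CARD('d)) * (\<integral>\<^sup>+x. H x * (\<integral>\<^sup>+y. whitney_kernel 1 x y \<partial>lborel) \<partial>lborel)"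
    unfolding whitney_kernel_def by (rule nn_integral_cmult) measurable
  finally show ?thesis unfolding whitney_kernel_integral[OF assms] .
qed

lemma whitney_upper:
  fixes H :: "real ^ 'd::{finite,linorder} \<Rightarrow> ennreal"
  assumes [measurable]: "H \<in> borel_measurable borel"
  shows "(\<integral>\<^sup>+y. (\<integral>\<^sup>+z. H (y + (\<kappa> * rho l y) *\<^sub>R z) * indicator (dcube 0 L) z \<partial>lborel) * indicator (- singular_set l) y \<partial>lborel)
    \<le> ennreal ((3 * L) ^ CARD('d)) * (\<integral>\<^sup>+x. H x * indicator (- singular_set l) x \<partial>lborel)"
proof -
  have "(\<integral>\<^sup>+x. H x * (\<integral>\<^sup>+y. whitney_kernel L x y \<partial>lborel) \<partial>lborel) \<le> (\<integral>\<^sup>+x. ennreal ((3 * L) ^ CARD('d)) * (H x * indicator (- singular_set l) x) \<partial>lborel)"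
  proof (rule nn_integral_mono)
    fix x :: "real ^ 'd::{finite,linorder}"
    from mult_left_mono[OF whitney_kernel_upper[of x], of "H x"]
    show "H x * (\<integral>\<^sup>+y. whitney_kernel L x y \<partial>lborel) \<le> ennreal ((3 * L) ^ CARD('d)) * (H x * indicator (- singular_set l) x)"
      by (simp only: mult.left_commute) simp
  qed
  also have "\<dots> = ennreal ((3 * L) ^ CARD('d)) * (\<integral>\<^sup>+x. H x * indicator (- singular_set l) x \<partial>lborel)"
    by (rule nn_integral_cmult) measurable
  finally show ?thesis unfolding whitney_kernel_integral[OF assms] .
qed

end

lemma local_product:
  assumes p: "1 \<le> p" and m: "1 \<le> m"
    and cond: "1 < p \<and> real m > real CARD('d) / p \<or> p = 1 \<and> m \<ge> CARD('d)"
    and bc: "mindex_order \<beta> + mindex_order \<gamma> \<le> m"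
  shows "\<exists>B\<ge>0. \<forall>\<Omega> (U :: ('d::{finite,linorder} \<Rightarrow> nat) \<Rightarrow> real ^ 'd::{finite,linorder} \<Rightarrow> 'b::euclidean_space)
      (V :: ('d::{finite,linorder} \<Rightarrow> nat) \<Rightarrow> real ^ 'd::{finite,linorder} \<Rightarrow> 'b::euclidean_space).
    open \<Omega> \<longrightarrow> ac_family \<Omega> m U \<longrightarrow> ac_family \<Omega> m V \<longrightarrow> dcube 0 (real m + 1) \<subseteq> \<Omega> \<longrightarrow>
    jet_energy p m U < \<infinity> \<longrightarrow> jet_energy p m V < \<infinity> \<longrightarrow>
    (\<integral>\<^sup>+x. ennreal ((norm (U \<beta> x) * norm (V \<gamma> x)) powr p) * indicator (dcube 0 1) x \<partial>lborel)
      \<le> ennreal B * jet_energy p m U * jet_energy p m V"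
  using cond
proof
  assume c: "1 < p \<and> real m > real CARD('d) / p"
  then have "real CARD('d) / p < real m" "0 < p" by auto
  then have mp: "real CARD('d) < real m * p" by (simp add: pos_divide_less_eq)
  obtain B where B: "0 \<le> B" "\<And>\<Omega> (U :: ('d::{finite,linorder} \<Rightarrow> nat) \<Rightarrow> real ^ 'd::{finite,linorder} \<Rightarrow> 'b::euclidean_space)
      (V :: ('d::{finite,linorder} \<Rightarrow> nat) \<Rightarrow> real ^ 'd::{finite,linorder} \<Rightarrow> 'b::euclidean_space).
    ac_family \<Omega> m U \<Longrightarrow> ac_family \<Omega> m V \<Longrightarrow> dcube 0 (real m + 1) \<subseteq> \<Omega> \<Longrightarrow> jet_energy p m U \<le> 1 \<Longrightarrow> jet_energy p m V \<le> 1 \<Longrightarrow>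
    (\<integral>\<^sup>+x. ennreal ((norm (U \<beta> x) * norm (V \<gamma> x)) powr p) * indicator (dcube 0 1) x \<partial>lborel) \<le> ennreal B"
    using local_product_normalized[OF p mp m bc, where 'b = 'b] by blast
  show ?thesis
  proof (intro exI[of _ B] conjI allI impI B(1))
    fix \<Omega> and U V :: "('d::{finite,linorder} \<Rightarrow> nat) \<Rightarrow> real ^ 'd::{finite,linorder} \<Rightarrow> 'b::euclidean_space"
    assume UV: "ac_family \<Omega> m U" "ac_family \<Omega> m V" "dcube 0 (real m + 1) \<subseteq> \<Omega>" "jet_energy p m U < \<infinity>" "jet_energy p m V < \<infinity>"
    have "mindex_order \<beta> \<le> m" "mindex_order \<gamma> \<le> m" using bc by auto
    then show "(\<integral>\<^sup>+x. ennreal ((norm (U \<beta> x) * norm (V \<gamma> x)) powr p) * indicator (dcube 0 1) x \<partial>lborel)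
      \<le> ennreal B * jet_energy p m U * jet_energy p m V"
      by (rule local_product_homogeneous[OF p B(1) _ _ _ UV]) (rule B(2))
  qed
next
  assume c: "p = 1 \<and> m \<ge> CARD('d)"
  show ?thesis
  proof (intro exI[of _ "line_const TYPE('d) m ^ CARD('d)"] conjI allI impI)
    show "0 \<le> line_const TYPE('d) m ^ CARD('d)" by (simp add: line_const_def)
    fix \<Omega> and U V :: "('d::{finite,linorder} \<Rightarrow> nat) \<Rightarrow> real ^ 'd::{finite,linorder} \<Rightarrow> 'b::euclidean_space"
    assume "open \<Omega>" "ac_family \<Omega> m U" "ac_family \<Omega> m V" "dcube 0 (real m + 1) \<subseteq> \<Omega>"
    from local_product_L1[OF _ bc this] c
    show "(\<integral>\<^sup>+x. ennreal ((norm (U \<beta> x) * norm (V \<gamma> x)) powr p) * indicator (dcube 0 1) x \<partial>lborel)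
      \<le> ennreal (line_const TYPE('d) m ^ CARD('d)) * jet_energy p m U * jet_energy p m V" by simp
  qed
qed

section \<open>Transport of the cube estimate to the weighted energies\<close>

lemma ac_family_scale:
  fixes U :: "('d::{finite,linorder} \<Rightarrow> nat) \<Rightarrow> real ^ 'd::{finite,linorder} \<Rightarrow> 'b::euclidean_space"
  assumes U: "ac_family \<Omega> m U" and r: "0 < r"
  shows "ac_family {z. y + r *\<^sub>R z \<in> \<Omega>} m (\<lambda>\<alpha> z. r ^ mindex_order \<alpha> *\<^sub>R U \<alpha> (y + r *\<^sub>R z))"
  unfolding ac_family_def
proof (intro conjI allI impI)
  fix \<alpha> :: "'d \<Rightarrow> nat" assume "mindex_order \<alpha> \<le> m"
  then show "loc_int {z. y + r *\<^sub>R z \<in> \<Omega>} (\<lambda>z. r ^ mindex_order \<alpha> *\<^sub>R U \<alpha> (y + r *\<^sub>R z))"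
    by (intro loc_int_scale ac_familyD(1)[OF U] r)
next
  fix \<alpha> :: "'d \<Rightarrow> nat" and i assume "mindex_order \<alpha> < m"
  from ac_on_lines_scale[OF ac_familyD(2)[OF U this] r, of y i "r ^ mindex_order \<alpha>"]
  show "ac_on_lines {z. y + r *\<^sub>R z \<in> \<Omega>} i (\<lambda>z. r ^ mindex_order \<alpha> *\<^sub>R U \<alpha> (y + r *\<^sub>R z))
     (\<lambda>z. r ^ mindex_order (\<alpha>(i := Suc (\<alpha> i))) *\<^sub>R U (\<alpha>(i := Suc (\<alpha> i))) (y + r *\<^sub>R z))"
    by (simp add: mindex_order_upd mult.commute del: fun_upd_apply)
qed

definition energy_density ::
    "nat \<Rightarrow> real \<Rightarrow> real \<Rightarrow> nat \<Rightarrow> (('d::{finite,linorder} \<Rightarrow> nat) \<Rightarrow> real ^ 'd::{finite,linorder} \<Rightarrow> 'b::euclidean_space) \<Rightarrow>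
     real ^ 'd::{finite,linorder} \<Rightarrow> ennreal" where
  "energy_density m a p l U x = (\<Sum>\<alpha> | mindex_order \<alpha> \<le> m.
     ennreal ((rho l x powr (real (mindex_order \<alpha>) - a) * norm (U \<alpha> x)) powr p))"

lemma energy_density_measurable:
  assumes "ac_family \<Omega> m U"
  shows "energy_density m a p l U \<in> borel_measurable borel"
proof -
  have *: "(\<lambda>x. ennreal ((rho l x powr (real (mindex_order \<alpha>) - a) * norm (U \<alpha> x)) powr p)) \<in> borel_measurable borel"
    if "mindex_order \<alpha> \<le> m" for \<alpha>
    using ac_familyD(3)[OF assms that] by measurable
  show ?thesis
    unfolding energy_density_def[abs_def] by (rule borel_measurable_sum, rule *) simp
qed

lemma family_energy_eq_density:
  fixes U :: "('d::{finite,linorder} \<Rightarrow> nat) \<Rightarrow> real ^ 'd::{finite,linorder} \<Rightarrow> 'b::euclidean_space"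
  assumes U: "ac_family \<Omega> m U"
  shows "family_energy m a p l U = (\<integral>\<^sup>+x. energy_density m a p l U x * indicator (- singular_set l) x \<partial>lborel)"
proof -
  have [measurable]: "- singular_set l \<in> sets (borel :: (real ^ 'd::{finite,linorder}) measure)"
    using open_regular_set by (rule borel_open)
  have *: "(\<lambda>x. ennreal ((rho l x powr (real (mindex_order \<alpha>) - a) * norm (U \<alpha> x)) powr p) * indicator (- singular_set l) x) \<in> borel_measurable lborel"
    if "mindex_order \<alpha> \<le> m" for \<alpha>
    using ac_familyD(3)[OF U that] by measurable
  show ?thesis
    unfolding family_energy_def energy_density_def sum_distrib_right
    by (rule nn_integral_sum[symmetric], rule *) simp
qed

text \<open>In the dilated family a derivative of order \<open>k\<close> carries \<open>r^k\<close>,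
  which is at most \<open>s^k\<close>, the product of \<open>s powr a\<close> and
  \<open>s powr (k - a)\<close>. The second factor is comparable to the weight throughout the cube,
  so all orders yield the same factor \<open>s powr a\<close>.\<close>

lemma local_jet_energy_bound:
  fixes U :: "('d::{finite,linorder} \<Rightarrow> nat) \<Rightarrow> real ^ 'd::{finite,linorder} \<Rightarrow> 'b::euclidean_space"
  assumes p: "1 \<le> p" and \<kappa>: "\<kappa> = 1 / (2 * (real m + 1) * real CARD('d))"
    and U: "ac_family (- singular_set l) m U" and y: "y \<in> - singular_set l"
  shows "jet_energy p m (\<lambda>\<alpha> z. (\<kappa> * rho l y) ^ mindex_order \<alpha> *\<^sub>R U \<alpha> (y + (\<kappa> * rho l y) *\<^sub>R z)) \<le>
    ennreal (real (card {\<alpha> :: 'd \<Rightarrow> nat. mindex_order \<alpha> \<le> m}) powr p * 2 powr ((real m + \<bar>a\<bar>) * p) * rho l y powr (a * p)) *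
    (\<integral>\<^sup>+z. energy_density m a p l U (y + (\<kappa> * rho l y) *\<^sub>R z) * indicator (dcube 0 (real m + 1)) z \<partial>lborel)"
proof -
  let ?A = "{\<alpha> :: 'd \<Rightarrow> nat. mindex_order \<alpha> \<le> m}"
  define s where "s = rho l y"
  define r where "r = \<kappa> * s"
  have L: "1 \<le> real m + 1" by simp
  note kap = kappa[OF L \<kappa>]
  have s: "0 < s" "s \<le> 1" using y rho_le_1 by (auto simp: s_def rho_pos_iff)
  have r: "0 < r" "r \<le> s"
    using kap s mult_right_mono[of \<kappa> 1 s] unfolding r_def by simp_all
  note [measurable] = energy_density_measurable[OF U, of a p l]
  define C where "C = real (card ?A) powr p * 2 powr ((real m + \<bar>a\<bar>) * p) * s powr (a * p)"
  have C: "0 \<le> C" by (simp add: C_def)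
  have "ennreal (jet_sum (\<lambda>\<alpha> z. r ^ mindex_order \<alpha> *\<^sub>R U \<alpha> (y + r *\<^sub>R z)) m z powr p) \<le> ennreal C * energy_density m a p l U (y + r *\<^sub>R z)"
    if z: "z \<in> dcube 0 (real m + 1)" for z
  proof -
    let ?x = "y + r *\<^sub>R z"
    define t where "t = rho l ?x"
    have st: "s / 2 \<le> t" "t \<le> 3/2 * s"
      using rho_comparable_cube[OF L \<kappa> z, of l y] by (auto simp: t_def s_def r_def)
    have t: "0 < t" "t / 2 \<le> s" "s \<le> 2 * t" using st s by auto
    have one: "(r ^ mindex_order \<alpha> * norm (U \<alpha> ?x)) powr p \<le> 2 powr ((real m + \<bar>a\<bar>) * p) * s powr (a * p) * (t powr (real (mindex_order \<alpha>) - a) * norm (U \<alpha> ?x)) powr p"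
      if \<alpha>: "\<alpha> \<in> ?A" for \<alpha>
    proof -
      let ?k = "real (mindex_order \<alpha>)"
      have "r ^ mindex_order \<alpha> \<le> s ^ mindex_order \<alpha>" using r by (intro power_mono) auto
      also have "\<dots> = s powr a * s powr (?k - a)" using s by (simp add: powr_realpow powr_add[symmetric])
      also have "\<dots> \<le> s powr a * (2 powr \<bar>?k - a\<bar> * t powr (?k - a))"
        by (intro mult_left_mono powr_comparable t) auto
      also have "\<dots> \<le> s powr a * (2 powr (real m + \<bar>a\<bar>) * t powr (?k - a))"
        using \<alpha> by (intro mult_left_mono mult_right_mono powr_mono) auto
      finally have "r ^ mindex_order \<alpha> * norm (U \<alpha> ?x) \<le> s powr a * 2 powr (real m + \<bar>a\<bar>) * (t powr (?k - a) * norm (U \<alpha> ?x))"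
        by (simp add: mult_right_mono mult.assoc[symmetric])
      then have "(r ^ mindex_order \<alpha> * norm (U \<alpha> ?x)) powr p \<le> (s powr a * 2 powr (real m + \<bar>a\<bar>) * (t powr (?k - a) * norm (U \<alpha> ?x))) powr p"
        using p r by (intro powr_mono2) auto
      also have "\<dots> = 2 powr ((real m + \<bar>a\<bar>) * p) * s powr (a * p) * (t powr (?k - a) * norm (U \<alpha> ?x)) powr p"
        by (simp add: powr_mult powr_powr mult_ac)
      finally show ?thesis .
    qed
    have "jet_sum (\<lambda>\<alpha> z. r ^ mindex_order \<alpha> *\<^sub>R U \<alpha> (y + r *\<^sub>R z)) m z = (\<Sum>\<alpha>\<in>?A. r ^ mindex_order \<alpha> * norm (U \<alpha> ?x))"
      using r by (simp add: jet_sum_def)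
    then have "jet_sum (\<lambda>\<alpha> z. r ^ mindex_order \<alpha> *\<^sub>R U \<alpha> (y + r *\<^sub>R z)) m z powr p \<le> real (card ?A) powr p * (\<Sum>\<alpha>\<in>?A. (r ^ mindex_order \<alpha> * norm (U \<alpha> ?x)) powr p)"
      using sum_powr_le[OF finite_mindex_le, of m "\<lambda>\<alpha>. r ^ mindex_order \<alpha> * norm (U \<alpha> ?x)" p] r p by simp
    also have "\<dots> \<le> real (card ?A) powr p * (\<Sum>\<alpha>\<in>?A. 2 powr ((real m + \<bar>a\<bar>) * p) * s powr (a * p) * (t powr (real (mindex_order \<alpha>) - a) * norm (U \<alpha> ?x)) powr p)"
      by (intro mult_left_mono sum_mono one) auto
    also have "\<dots> = C * (\<Sum>\<alpha>\<in>?A. (t powr (real (mindex_order \<alpha>) - a) * norm (U \<alpha> ?x)) powr p)"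
      by (simp add: C_def sum_distrib_left mult_ac)
    finally have "ennreal (jet_sum (\<lambda>\<alpha> z. r ^ mindex_order \<alpha> *\<^sub>R U \<alpha> (y + r *\<^sub>R z)) m z powr p) \<le> ennreal (C * (\<Sum>\<alpha>\<in>?A. (t powr (real (mindex_order \<alpha>) - a) * norm (U \<alpha> ?x)) powr p))"
      by (rule ennreal_leI)
    also have "\<dots> = ennreal C * energy_density m a p l U ?x"
      using C by (simp add: energy_density_def t_def[symmetric] ennreal_mult sum_nonneg)
    finally show ?thesis .
  qed
  then have "jet_energy p m (\<lambda>\<alpha> z. r ^ mindex_order \<alpha> *\<^sub>R U \<alpha> (y + r *\<^sub>R z)) \<le> (\<integral>\<^sup>+z. ennreal C * (energy_density m a p l U (y + r *\<^sub>R z) * indicator (dcube 0 (real m + 1)) z) \<partial>lborel)"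
    unfolding jet_energy_def by (intro nn_integral_mono) (auto simp: indicator_def)
  also have "\<dots> = ennreal C * (\<integral>\<^sup>+z. energy_density m a p l U (y + r *\<^sub>R z) * indicator (dcube 0 (real m + 1)) z \<partial>lborel)"
    by (rule nn_integral_cmult) measurable
  finally show ?thesis by (simp add: C_def r_def s_def)
qed

text \<open>With \<open>s = rho l y\<close>: undoing the dilation of the product and inserting the
  weight leaves \<open>s powr (- a p)\<close>, each of the two local energies supplies
  \<open>s powr (a p)\<close>, and passing from a local to the whole energy costs \<open>s\<close>
  to the power \<open>-d\<close>.\<close>

lemma weighted_product:
  fixes l :: nat
  assumes p: "1 \<le> p" and m: "1 \<le> m" and a: "a \<ge> real CARD('d) / p"
    and cond: "1 < p \<and> real m > real CARD('d) / p \<or> p = 1 \<and> m \<ge> CARD('d)"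
    and bc: "mindex_order \<beta> + mindex_order \<gamma> \<le> m"
  shows "\<exists>C\<ge>0. \<forall>(U :: ('d::{finite,linorder} \<Rightarrow> nat) \<Rightarrow> real ^ 'd::{finite,linorder} \<Rightarrow> 'b::euclidean_space)
      (V :: ('d::{finite,linorder} \<Rightarrow> nat) \<Rightarrow> real ^ 'd::{finite,linorder} \<Rightarrow> 'b::euclidean_space).
    ac_family (- singular_set l) m U \<longrightarrow> ac_family (- singular_set l) m V \<longrightarrow>
    family_energy m a p l U < \<infinity> \<longrightarrow> family_energy m a p l V < \<infinity> \<longrightarrow>
    (\<integral>\<^sup>+x. ennreal ((rho l x powr (real (mindex_order \<beta> + mindex_order \<gamma>) - a) * (norm (U \<beta> x) * norm (V \<gamma> x))) powr p) * indicator (- singular_set l) x \<partial>lborel)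
      \<le> ennreal C * family_energy m a p l U * family_energy m a p l V"
proof -
  let ?n = "CARD('d)" and ?k = "mindex_order \<beta> + mindex_order \<gamma>" and ?L = "real m + 1"
  let ?N = "real (card {\<alpha> :: 'd \<Rightarrow> nat. mindex_order \<alpha> \<le> m})"
  define \<kappa> where "\<kappa> = 1 / (2 * (real m + 1) * real CARD('d))"
  define e where "e = real ?k - a"
  have L: "1 \<le> ?L" by simp
  note kap = kappa[OF L \<kappa>_def]
  obtain B where B: "0 \<le> B" "\<And>\<Omega> (U :: ('d::{finite,linorder} \<Rightarrow> nat) \<Rightarrow> real ^ 'd::{finite,linorder} \<Rightarrow> 'b::euclidean_space)
      (V :: ('d::{finite,linorder} \<Rightarrow> nat) \<Rightarrow> real ^ 'd::{finite,linorder} \<Rightarrow> 'b::euclidean_space).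
    open \<Omega> \<Longrightarrow> ac_family \<Omega> m U \<Longrightarrow> ac_family \<Omega> m V \<Longrightarrow> dcube 0 (real m + 1) \<subseteq> \<Omega> \<Longrightarrow>
    jet_energy p m U < \<infinity> \<Longrightarrow> jet_energy p m V < \<infinity> \<Longrightarrow>
    (\<integral>\<^sup>+x. ennreal ((norm (U \<beta> x) * norm (V \<gamma> x)) powr p) * indicator (dcube 0 1) x \<partial>lborel)
      \<le> ennreal B * jet_energy p m U * jet_energy p m V"
    using local_product[OF p m cond bc, where 'b = 'b] by blast
  define C3 where "C3 = ?N powr p * 2 powr ((real m + \<bar>a\<bar>) * p)"
  define Q1 where "Q1 = (2 powr \<bar>e\<bar> / \<kappa> ^ ?k) powr p"
  define D1 where "D1 = Q1 * B * C3 * C3 / \<kappa> ^ ?n"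
  have nonneg: "0 \<le> C3" "0 \<le> Q1" "0 \<le> D1" using B kap by (auto simp: C3_def Q1_def D1_def)
  define C where "C = 4 ^ ?n * (D1 * (3 * ?L) ^ ?n)"
  show ?thesis
  proof (intro exI[of _ C] conjI allI impI)
    show "0 \<le> C" using nonneg by (simp add: C_def)
    fix U V :: "('d::{finite,linorder} \<Rightarrow> nat) \<Rightarrow> real ^ 'd::{finite,linorder} \<Rightarrow> 'b::euclidean_space"
    assume U: "ac_family (- singular_set l) m U" and V: "ac_family (- singular_set l) m V"
      and EU: "family_energy m a p l U < \<infinity>" and EV: "family_energy m a p l V < \<infinity>"
    have bcm: "mindex_order \<beta> \<le> m" "mindex_order \<gamma> \<le> m" using bc by auto
    note [measurable] = energy_density_measurable[OF U, of a p l] energy_density_measurable[OF V, of a p l]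
      ac_familyD(3)[OF U bcm(1)] ac_familyD(3)[OF V bcm(2)]
    have [measurable]: "- singular_set l \<in> sets (borel :: (real ^ 'd::{finite,linorder}) measure)"
      using open_regular_set by (rule borel_open)
    define H where "H x = ennreal ((rho l x powr e * (norm (U \<beta> x) * norm (V \<gamma> x))) powr p)" for x
    have [measurable]: "H \<in> borel_measurable borel" unfolding H_def by measurable
    define eU where "eU y = (\<integral>\<^sup>+z. energy_density m a p l U (y + (\<kappa> * rho l y) *\<^sub>R z) * indicator (dcube 0 ?L) z \<partial>lborel)" for y
    define eV where "eV y = (\<integral>\<^sup>+z. energy_density m a p l V (y + (\<kappa> * rho l y) *\<^sub>R z) * indicator (dcube 0 ?L) z \<partial>lborel)" for y
    have key: "(\<integral>\<^sup>+z. H (y + (\<kappa> * rho l y) *\<^sub>R z) * indicator (dcube 0 1) z \<partial>lborel) \<le> ennreal D1 * (eU y * family_energy m a p l V)"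
      if y: "y \<in> - singular_set l" for y
    proof -
      define s where "s = rho l y"
      define r where "r = \<kappa> * s"
      have s: "0 < s" "s \<le> 1" using y rho_le_1 by (auto simp: s_def rho_pos_iff)
      have r: "0 < r" using kap s by (simp add: r_def)
      have inO: "y + r *\<^sub>R z \<in> - singular_set l" if "z \<in> dcube 0 ?L" for z
        using rho_comparable_cube(1)[OF L \<kappa>_def that, of l y] s unfolding rho_pos_iff[symmetric] by (simp add: s_def r_def)
      have loc: "(\<integral>\<^sup>+z. energy_density m a p l W (y + r *\<^sub>R z) * indicator (dcube 0 ?L) z \<partial>lborel) \<le> ennreal (1 / r ^ ?n) * family_energy m a p l W"
        if W: "ac_family (- singular_set l) m W" for W :: "('d::{finite,linorder} \<Rightarrow> nat) \<Rightarrow> real ^ 'd::{finite,linorder} \<Rightarrow> 'b::euclidean_space"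
      proof -
        note [measurable] = energy_density_measurable[OF W, of a p l]
        let ?h = "\<lambda>x. energy_density m a p l W x * indicator (- singular_set l) x"
        have "(\<integral>\<^sup>+z. energy_density m a p l W (y + r *\<^sub>R z) * indicator (dcube 0 ?L) z \<partial>lborel) \<le> (\<integral>\<^sup>+z. ?h (y + r *\<^sub>R z) \<partial>lborel)"
          using inO by (intro nn_integral_mono) (auto simp: indicator_def)
        also have "\<dots> = ennreal (1 / r ^ ?n) * (ennreal (r ^ ?n) * (\<integral>\<^sup>+z. ?h (y + r *\<^sub>R z) \<partial>lborel))"
          using r by (simp add: mult.assoc[symmetric] ennreal_mult[symmetric])
        also have "ennreal (r ^ ?n) * (\<integral>\<^sup>+z. ?h (y + r *\<^sub>R z) \<partial>lborel) = (\<integral>\<^sup>+x. ?h x \<partial>lborel)"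
          by (rule nn_integral_scale[OF _ r, symmetric]) measurable
        finally show ?thesis by (simp add: family_energy_eq_density[OF W])
      qed
      define U' where "U' = (\<lambda>\<alpha> z. r ^ mindex_order \<alpha> *\<^sub>R U \<alpha> (y + r *\<^sub>R z))"
      define V' where "V' = (\<lambda>\<alpha> z. r ^ mindex_order \<alpha> *\<^sub>R V \<alpha> (y + r *\<^sub>R z))"
      have fam: "ac_family {z. y + r *\<^sub>R z \<in> - singular_set l} m U'" "ac_family {z. y + r *\<^sub>R z \<in> - singular_set l} m V'"
        unfolding U'_def V'_def by (intro ac_family_scale U V r)+
      have op: "open {z. y + r *\<^sub>R z \<in> - singular_set l}"
        using open_vimage[OF open_regular_set, of "\<lambda>z. y + r *\<^sub>R z" l] by (simp add: vimage_def continuous_intros)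
      have sub: "dcube 0 ?L \<subseteq> {z. y + r *\<^sub>R z \<in> - singular_set l}" using inO by auto
      have JU: "jet_energy p m U' \<le> ennreal (C3 * s powr (a * p)) * eU y"
        and JV: "jet_energy p m V' \<le> ennreal (C3 * s powr (a * p)) * eV y"
        using local_jet_energy_bound[OF p \<kappa>_def U y, of a] local_jet_energy_bound[OF p \<kappa>_def V y, of a]
        by (simp_all add: U'_def V'_def C3_def eU_def eV_def s_def r_def)
      have eV: "eV y \<le> ennreal (1 / r ^ ?n) * family_energy m a p l V"
        and eU: "eU y \<le> ennreal (1 / r ^ ?n) * family_energy m a p l U"
        using loc[OF V] loc[OF U] by (simp_all add: eV_def eU_def r_def s_def)
      have "eV y < \<infinity>" "eU y < \<infinity>" using eV eU EU EV by (auto simp: ennreal_mult_less_top intro: le_less_trans)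
      then have fin: "jet_energy p m U' < \<infinity>" "jet_energy p m V' < \<infinity>"
        using JU JV by (auto simp: ennreal_mult_less_top intro: le_less_trans)
      note [measurable] = ac_familyD(3)[OF fam(1) bcm(1)] ac_familyD(3)[OF fam(2) bcm(2)]
      define q where "q = Q1 * s powr (- (a * p))"
      have q: "0 \<le> q" using nonneg by (simp add: q_def)
      have point: "H (y + r *\<^sub>R z) \<le> ennreal q * ennreal ((norm (U' \<beta> z) * norm (V' \<gamma> z)) powr p)" if z: "z \<in> dcube 0 1" for z
      proof -
        let ?x = "y + r *\<^sub>R z"
        define t where "t = rho l ?x"
        have "dcube 0 1 \<subseteq> (dcube 0 ?L :: (real ^ 'd::{finite,linorder}) set)" by (rule dcube_mono) auto
        then have zL: "z \<in> dcube 0 ?L" using z by blast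
        have st: "s / 2 \<le> t" "t \<le> 2 * s"
          using rho_comparable_cube[OF L \<kappa>_def zL, of l y] s by (auto simp: t_def s_def r_def)
        have te: "t powr e \<le> 2 powr \<bar>e\<bar> * s powr e" by (rule powr_comparable[OF s(1) st])
        let ?P = "norm (U \<beta> ?x) * norm (V \<gamma> ?x)"
        have P': "norm (U' \<beta> z) * norm (V' \<gamma> z) = r ^ ?k * ?P"
          using r by (simp add: U'_def V'_def power_add mult_ac)
        have "t powr e * ?P \<le> 2 powr \<bar>e\<bar> * s powr e * ?P" by (intro mult_right_mono te) simp
        also have "\<dots> = (2 powr \<bar>e\<bar> / \<kappa> ^ ?k) * s powr (- a) * (norm (U' \<beta> z) * norm (V' \<gamma> z))"
        proof -
          have "s powr e = s powr real ?k * s powr (- a)" unfolding e_def by (simp only: powr_add[symmetric]) simp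
          then have "s powr e = s ^ ?k * s powr (- a)" using s by (simp only: powr_realpow)
          moreover have "r ^ ?k = \<kappa> ^ ?k * s ^ ?k" by (simp add: r_def power_mult_distrib)
          ultimately show ?thesis unfolding P' using kap by simp
        qed
        finally have "(t powr e * ?P) powr p \<le> ((2 powr \<bar>e\<bar> / \<kappa> ^ ?k) * s powr (- a) * (norm (U' \<beta> z) * norm (V' \<gamma> z))) powr p"
          using p by (intro powr_mono2) auto
        also have "\<dots> = q * (norm (U' \<beta> z) * norm (V' \<gamma> z)) powr p"
        proof -
          have "0 \<le> 2 powr \<bar>e\<bar> / \<kappa> ^ ?k" using kap by simp
          then show ?thesis unfolding q_def Q1_def by (simp only: powr_mult mult_nonneg_nonneg powr_ge_zero norm_ge_zero powr_powr) simp
        qed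
        finally have "(t powr e * ?P) powr p \<le> q * (norm (U' \<beta> z) * norm (V' \<gamma> z)) powr p" .
        from ennreal_leI[OF this] show ?thesis
          using q by (simp add: H_def t_def ennreal_mult)
      qed
      have "(\<integral>\<^sup>+z. H (y + r *\<^sub>R z) * indicator (dcube 0 1) z \<partial>lborel) \<le> (\<integral>\<^sup>+z. ennreal q * (ennreal ((norm (U' \<beta> z) * norm (V' \<gamma> z)) powr p) * indicator (dcube 0 1) z) \<partial>lborel)"
        using point by (intro nn_integral_mono) (auto simp: indicator_def)
      also have "\<dots> = ennreal q * (\<integral>\<^sup>+z. ennreal ((norm (U' \<beta> z) * norm (V' \<gamma> z)) powr p) * indicator (dcube 0 1) z \<partial>lborel)"
        by (rule nn_integral_cmult) measurable
      also have "\<dots> \<le> ennreal q * (ennreal B * jet_energy p m U' * jet_energy p m V')"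
        by (intro mult_left_mono B(2)[OF op fam sub fin]) simp
      \<comment> \<open>The factors are treated differently: the energy of \<open>V\<close> becomes
        global, that of \<open>U\<close> stays local so that \<open>whitney_upper\<close> can
        integrate it over \<open>y\<close>. Keeping both local would leave a product of two
        functions of \<open>y\<close>.\<close>
      also have "\<dots> \<le> ennreal q * (ennreal B * (ennreal (C3 * s powr (a * p)) * eU y) * (ennreal (C3 * s powr (a * p)) * (ennreal (1 / r ^ ?n) * family_energy m a p l V)))"
        by (intro mult_left_mono mult_mono JU order_trans[OF JV] eV) auto
      also have "\<dots> = (ennreal q * ennreal B * ennreal (C3 * s powr (a * p)) * ennreal (C3 * s powr (a * p)) * ennreal (1 / r ^ ?n)) * (eU y * family_energy m a p l V)"
        by (simp only: mult_ac)
      also have "ennreal q * ennreal B * ennreal (C3 * s powr (a * p)) * ennreal (C3 * s powr (a * p)) * ennreal (1 / r ^ ?n) =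
          ennreal (q * B * (C3 * s powr (a * p)) * (C3 * s powr (a * p)) * (1 / r ^ ?n))"
      proof -
        have "0 \<le> C3 * s powr (a * p)" "0 \<le> 1 / r ^ ?n" using nonneg r by simp_all
        then show ?thesis using q B(1) by (simp only: ennreal_mult[symmetric] mult_nonneg_nonneg)
      qed
      also have "q * B * (C3 * s powr (a * p)) * (C3 * s powr (a * p)) * (1 / r ^ ?n) \<le> D1"
      proof -
        have "q * B * (C3 * s powr (a * p)) * (C3 * s powr (a * p)) * (1 / r ^ ?n) = D1 * (s powr (- (a * p)) * s powr (a * p) * s powr (a * p) / s ^ ?n)"
          by (simp add: q_def D1_def r_def power_mult_distrib)
        also have "s powr (- (a * p)) * s powr (a * p) * s powr (a * p) / s ^ ?n = s powr (a * p - real ?n)"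
          using s by (simp add: powr_diff powr_realpow[symmetric] powr_add[symmetric])
        also have "D1 * s powr (a * p - real ?n) \<le> D1 * 1"
        proof (rule mult_left_mono)
          \<comment> \<open>Here \<open>a \<ge> d / p\<close> enters: a nonnegative power of
            \<open>s \<le> 1\<close> is bounded uniformly in \<open>y\<close>.\<close>
          have "0 \<le> a * p - real ?n" using a p by (simp add: field_simps)
          then show "s powr (a * p - real ?n) \<le> 1" using s by (intro powr_le1) auto
        qed (use nonneg in auto)
        finally show ?thesis by simp
      qed
      finally show ?thesis by (simp add: r_def s_def ennreal_leI mult_right_mono)
    qed
    have "(\<integral>\<^sup>+x. H x * indicator (- singular_set l) x \<partial>lborel) \<le> ennreal (4 ^ ?n) *
      (\<integral>\<^sup>+y. (\<integral>\<^sup>+z. H (y + (\<kappa> * rho l y) *\<^sub>R z) * indicator (dcube 0 1) z \<partial>lborel) * indicator (- singular_set l) y \<partial>lborel)"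
      by (rule whitney_lower[OF L \<kappa>_def]) measurable
    also have "\<dots> \<le> ennreal (4 ^ ?n) * (\<integral>\<^sup>+y. ennreal D1 * family_energy m a p l V * (eU y * indicator (- singular_set l) y) \<partial>lborel)"
      using key by (intro mult_left_mono nn_integral_mono) (auto simp: indicator_def mult_ac)
    also have "(\<integral>\<^sup>+y. ennreal D1 * family_energy m a p l V * (eU y * indicator (- singular_set l) y) \<partial>lborel) =
      ennreal D1 * family_energy m a p l V * (\<integral>\<^sup>+y. eU y * indicator (- singular_set l) y \<partial>lborel)"
      unfolding eU_def by (rule nn_integral_cmult) measurable
    also have "(\<integral>\<^sup>+y. eU y * indicator (- singular_set l) y \<partial>lborel) \<le> ennreal ((3 * ?L) ^ ?n) * (\<integral>\<^sup>+x. energy_density m a p l U x * indicator (- singular_set l) x \<partial>lborel)"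
      unfolding eU_def by (rule whitney_upper[OF L \<kappa>_def]) measurable
    finally have "(\<integral>\<^sup>+x. H x * indicator (- singular_set l) x \<partial>lborel) \<le>
      ennreal (4 ^ ?n) * (ennreal D1 * family_energy m a p l V * (ennreal ((3 * ?L) ^ ?n) * family_energy m a p l U))"
      by (simp add: family_energy_eq_density[OF U] mult_left_mono)
    also have "\<dots> = ennreal C * family_energy m a p l U * family_energy m a p l V"
      using nonneg by (simp add: C_def ennreal_mult mult_ac del: ennreal_plus)
    finally show "(\<integral>\<^sup>+x. ennreal ((rho l x powr (real (mindex_order \<beta> + mindex_order \<gamma>) - a) * (norm (U \<beta> x) * norm (V \<gamma> x))) powr p) * indicator (- singular_set l) x \<partial>lborel)
      \<le> ennreal C * family_energy m a p l U * family_energy m a p l V"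
      by (simp add: H_def e_def)
  qed
qed

section \<open>Assembly of the multiplication theorem\<close>

lemma norm_sum_list_le:
  fixes f :: "'a \<Rightarrow> 'b::real_normed_vector"
  assumes "finite P" "set xs \<subseteq> P"
  shows "norm (\<Sum>x\<leftarrow>xs. f x) \<le> real (length xs) * (\<Sum>x\<in>P. norm (f x))"
  using assms(2)
proof (induction xs)
  case (Cons x xs)
  have "norm (f x) \<le> (\<Sum>x\<in>P. norm (f x))" using Cons.prems assms(1) by (intro member_le_sum) auto
  moreover have "norm (f x + (\<Sum>x\<leftarrow>xs. f x)) \<le> norm (f x) + norm (\<Sum>x\<leftarrow>xs. f x)" by (rule norm_triangle_ineq)
  ultimately show ?case using Cons by (simp add: algebra_simps)
qed simp

text \<open>On a compact subset of the regular set the weight has a positive lower bound, and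
  \<open>v \<le> 1 + v powr p\<close> passes from integrable powers to integrability.\<close>

lemma loc_int_weighted:
  fixes w :: "real ^ 'd::{finite,linorder} \<Rightarrow> 'b::euclidean_space"
  assumes p: "1 \<le> p" and [measurable]: "w \<in> borel_measurable borel"
    and fin: "(\<integral>\<^sup>+x. ennreal ((rho l x powr e * norm (w x)) powr p) * indicator (- singular_set l) x \<partial>lborel) < \<infinity>"
  shows "loc_int (- singular_set l) w"
  unfolding loc_int_def
proof (intro conjI allI impI)
  fix K :: "(real ^ 'd::{finite,linorder}) set" assume K: "compact K \<and> K \<subseteq> - singular_set l"
  have [measurable]: "K \<in> sets borel" using K by (auto intro: borel_compact)
  have [measurable]: "- singular_set l \<in> sets (borel :: (real ^ 'd::{finite,linorder}) measure)"
    using open_regular_set by (rule borel_open)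
  have cont: "continuous_on K (\<lambda>x. rho l x powr e)"
    using K rho_pos_iff[of l] by (intro continuous_intros continuous_on_subset[OF rho_continuous]) force+
  obtain c where c: "0 < c" "\<And>x. x \<in> K \<Longrightarrow> c \<le> rho l x powr e"
  proof (cases "K = {}")
    case False
    then obtain x0 where x0: "x0 \<in> K" "\<And>x. x \<in> K \<Longrightarrow> rho l x0 powr e \<le> rho l x powr e"
      using continuous_attains_inf[OF _ False cont] K by blast
    have "0 < rho l x0" using x0(1) K rho_pos_iff[of l x0] by blast
    then have "0 < rho l x0 powr e" by simp
    then show ?thesis using x0(2) that by blast
  qed (use that[of 1] in auto)
  have bound: "norm (w x) \<le> 1 + (1 / c) powr p * (rho l x powr e * norm (w x)) powr p" if "x \<in> K" for x
  proof -
    have "norm (w x) \<le> (1 / c) * (rho l x powr e * norm (w x))"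
      using c(1) mult_right_mono[OF c(2)[OF that], of "norm (w x)"] by (simp add: field_simps)
    then have "norm (w x) powr p \<le> ((1 / c) * (rho l x powr e * norm (w x))) powr p"
      using p by (intro powr_mono2) auto
    also have "\<dots> = (1 / c) powr p * (rho l x powr e * norm (w x)) powr p" using c(1) by (intro powr_mult)
    finally show ?thesis using le_one_plus_powr[OF norm_ge_zero p, of "w x"] by linarith
  qed
  have "ennreal (norm (indicat_real K x *\<^sub>R w x)) \<le> indicator K x + ennreal ((1 / c) powr p) * (ennreal ((rho l x powr e * norm (w x)) powr p) * indicator (- singular_set l) x)" for x
  proof (cases "x \<in> K")
    case True
    then have "x \<in> - singular_set l" using K by blast
    have "ennreal (norm (w x)) \<le> ennreal (1 + (1 / c) powr p * (rho l x powr e * norm (w x)) powr p)"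
      using bound[OF True] by (rule ennreal_leI)
    then show ?thesis using True \<open>x \<in> - singular_set l\<close> by (simp add: ennreal_mult)
  qed simp
  then have "(\<integral>\<^sup>+x. ennreal (norm (indicat_real K x *\<^sub>R w x)) \<partial>lborel) \<le>
    (\<integral>\<^sup>+x. indicator K x + ennreal ((1 / c) powr p) * (ennreal ((rho l x powr e * norm (w x)) powr p) * indicator (- singular_set l) x) \<partial>lborel)"
    by (rule nn_integral_mono)
  also have "\<dots> = emeasure lborel K + ennreal ((1 / c) powr p) * (\<integral>\<^sup>+x. ennreal ((rho l x powr e * norm (w x)) powr p) * indicator (- singular_set l) x \<partial>lborel)"
    by (simp add: nn_integral_add nn_integral_cmult)
  also have "\<dots> < \<infinity>"
    using fin emeasure_compact_finite[of K] K by (simp add: ennreal_mult_less_top)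
  finally show "set_integrable lborel K w"
    unfolding set_integrable_def integrable_iff_bounded by simp
qed simp

text \<open>Crude constants are enough: a list has at most \<open>2^m\<close> entries, each bounded
  by the sum over all pairs of the right order, and the power of a sum is bounded termwise at the
  cost of a power of the number of terms.\<close>

lemma product_family_energy:
  fixes U V Z :: "('d::{finite,linorder} \<Rightarrow> nat) \<Rightarrow> real ^ 'd::{finite,linorder} \<Rightarrow> 'b::{real_normed_field,euclidean_space}" and m :: nat
  defines "P \<equiv> {(\<beta>, \<gamma>). mindex_order \<beta> + mindex_order \<gamma> \<le> m} :: (('d \<Rightarrow> nat) \<times> ('d \<Rightarrow> nat)) set"
  assumes p: "1 \<le> p" and U: "ac_family (- singular_set l) m U" and V: "ac_family (- singular_set l) m V"
    and L: "\<And>\<alpha>. mindex_order \<alpha> \<le> m \<Longrightarrow> length (Ls \<alpha>) \<le> 2 ^ m"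
      "\<And>\<alpha> \<beta> \<gamma>. mindex_order \<alpha> \<le> m \<Longrightarrow> (\<beta>, \<gamma>) \<in> set (Ls \<alpha>) \<Longrightarrow> mindex_order \<beta> + mindex_order \<gamma> = mindex_order \<alpha>"
      "\<And>\<alpha> x. mindex_order \<alpha> \<le> m \<Longrightarrow> Z \<alpha> x = product_sum U V (Ls \<alpha>) x"
    and C: "\<And>\<beta> \<gamma>. mindex_order \<beta> + mindex_order \<gamma> \<le> m \<Longrightarrow> 0 \<le> C \<beta> \<gamma>"
      "\<And>\<beta> \<gamma>. mindex_order \<beta> + mindex_order \<gamma> \<le> m \<Longrightarrow>
        (\<integral>\<^sup>+x. ennreal ((rho l x powr (real (mindex_order \<beta> + mindex_order \<gamma>) - a) * (norm (U \<beta> x) * norm (V \<gamma> x))) powr p) * indicator (- singular_set l) x \<partial>lborel)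
        \<le> ennreal (C \<beta> \<gamma>) * E"
  shows "family_energy m a p l Z \<le>
    ennreal (real (card {\<alpha> :: 'd \<Rightarrow> nat. mindex_order \<alpha> \<le> m}) * ((2 ^ m * real (card P)) powr p * (\<Sum>(\<beta>, \<gamma>)\<in>P. C \<beta> \<gamma>))) * E"
proof -
  have finP: "finite P"
  proof (rule finite_subset)
    show "P \<subseteq> {\<alpha>. mindex_order \<alpha> \<le> m} \<times> {\<alpha>. mindex_order \<alpha> \<le> m}" by (auto simp: P_def)
  qed (simp add: finite_mindex_le)
  have [measurable]: "- singular_set l \<in> sets (borel :: (real ^ 'd::{finite,linorder}) measure)"
    using open_regular_set by (rule borel_open)
  have Csum: "0 \<le> (\<Sum>(\<beta>, \<gamma>)\<in>Q. C \<beta> \<gamma>)" if "Q \<subseteq> P" for Q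
    using that C(1) by (intro sum_nonneg) (auto simp: P_def)
  let ?T = "(2 ^ m * real (card P)) powr p"
  have one: "(\<integral>\<^sup>+x. ennreal ((rho l x powr (real (mindex_order \<alpha>) - a) * norm (Z \<alpha> x)) powr p) * indicator (- singular_set l) x \<partial>lborel)
      \<le> ennreal (?T * (\<Sum>(\<beta>, \<gamma>)\<in>P. C \<beta> \<gamma>)) * E" if \<alpha>: "mindex_order \<alpha> \<le> m" for \<alpha>
  proof -
    define Q where "Q = {(\<beta>, \<gamma>). mindex_order \<beta> + mindex_order \<gamma> = mindex_order \<alpha>} \<inter> P"
    have Q: "finite Q" "Q \<subseteq> P" "set (Ls \<alpha>) \<subseteq> Q" using finP L(2)[OF \<alpha>] \<alpha> by (auto simp: Q_def P_def)
    have QD: "mindex_order \<beta> + mindex_order \<gamma> = mindex_order \<alpha>" "mindex_order \<beta> + mindex_order \<gamma> \<le> m" if "(\<beta>, \<gamma>) \<in> Q" for \<beta> \<gamma>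
      using that by (auto simp: Q_def P_def)
    let ?w = "\<lambda>x. rho l x powr (real (mindex_order \<alpha>) - a)"
    let ?t = "\<lambda>x (\<beta>, \<gamma>). ?w x * (norm (U \<beta> x) * norm (V \<gamma> x))"
    have meas: "(\<lambda>x. ennreal (?t x \<beta>\<gamma> powr p) * indicator (- singular_set l) x) \<in> borel_measurable lborel" if \<beta>\<gamma>: "\<beta>\<gamma> \<in> Q" for \<beta>\<gamma>
    proof -
      obtain \<beta> \<gamma> where e: "\<beta>\<gamma> = (\<beta>, \<gamma>)" by (cases \<beta>\<gamma>)
      have "mindex_order \<beta> \<le> m" "mindex_order \<gamma> \<le> m" using QD(2) \<beta>\<gamma> e by fastforce+
      note [measurable] = ac_familyD(3)[OF U this(1)] ac_familyD(3)[OF V this(2)]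
      show ?thesis unfolding e by simp
    qed
    have point: "(?w x * norm (Z \<alpha> x)) powr p \<le> ?T * (\<Sum>\<beta>\<gamma>\<in>Q. ?t x \<beta>\<gamma> powr p)" for x
    proof -
      have "norm (Z \<alpha> x) \<le> real (length (Ls \<alpha>)) * (\<Sum>\<beta>\<gamma>\<in>Q. norm (case \<beta>\<gamma> of (\<beta>, \<gamma>) \<Rightarrow> U \<beta> x * V \<gamma> x))"
        unfolding L(3)[OF \<alpha>] product_sum_def by (rule norm_sum_list_le[OF Q(1,3)])
      also have "\<dots> \<le> 2 ^ m * (\<Sum>\<beta>\<gamma>\<in>Q. norm (case \<beta>\<gamma> of (\<beta>, \<gamma>) \<Rightarrow> U \<beta> x * V \<gamma> x))"
        using L(1)[OF \<alpha>] by (intro mult_right_mono sum_nonneg) (auto simp: of_nat_le_iff[of _ "2 ^ m", where 'a = real, simplified])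
      finally have "?w x * norm (Z \<alpha> x) \<le> ?w x * (2 ^ m * (\<Sum>\<beta>\<gamma>\<in>Q. norm (case \<beta>\<gamma> of (\<beta>, \<gamma>) \<Rightarrow> U \<beta> x * V \<gamma> x)))"
        by (rule mult_left_mono) simp
      also have "\<dots> = 2 ^ m * (\<Sum>\<beta>\<gamma>\<in>Q. ?t x \<beta>\<gamma>)"
        by (simp add: sum_distrib_left norm_mult case_prod_unfold mult_ac)
      finally have "(?w x * norm (Z \<alpha> x)) powr p \<le> (2 ^ m * (\<Sum>\<beta>\<gamma>\<in>Q. ?t x \<beta>\<gamma>)) powr p"
        using p by (intro powr_mono2) auto
      also have "\<dots> = (2 ^ m) powr p * (\<Sum>\<beta>\<gamma>\<in>Q. ?t x \<beta>\<gamma>) powr p"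
        by (intro powr_mult)
      also have "\<dots> \<le> (2 ^ m) powr p * (real (card Q) powr p * (\<Sum>\<beta>\<gamma>\<in>Q. ?t x \<beta>\<gamma> powr p))"
        using p Q(1) by (intro mult_left_mono sum_powr_le) auto
      also have "\<dots> \<le> (2 ^ m) powr p * (real (card P) powr p * (\<Sum>\<beta>\<gamma>\<in>Q. ?t x \<beta>\<gamma> powr p))"
        using p card_mono[OF finP Q(2)] by (intro mult_left_mono mult_right_mono powr_mono2 sum_nonneg) auto
      also have "\<dots> = ?T * (\<Sum>\<beta>\<gamma>\<in>Q. ?t x \<beta>\<gamma> powr p)" by (simp add: powr_mult)
      finally show ?thesis .
    qed
    have "(\<integral>\<^sup>+x. ennreal ((?w x * norm (Z \<alpha> x)) powr p) * indicator (- singular_set l) x \<partial>lborel)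
      \<le> (\<integral>\<^sup>+x. ennreal ?T * (\<Sum>\<beta>\<gamma>\<in>Q. ennreal (?t x \<beta>\<gamma> powr p) * indicator (- singular_set l) x) \<partial>lborel)"
    proof (rule nn_integral_mono)
      fix x
      have "ennreal ((?w x * norm (Z \<alpha> x)) powr p) \<le> ennreal ?T * (\<Sum>\<beta>\<gamma>\<in>Q. ennreal (?t x \<beta>\<gamma> powr p))"
        using ennreal_leI[OF point[of x]] by (simp add: ennreal_mult sum_nonneg)
      from mult_right_mono[OF this zero_le, of "indicator (- singular_set l) x"]
      show "ennreal ((?w x * norm (Z \<alpha> x)) powr p) * indicator (- singular_set l) x \<le>
        ennreal ?T * (\<Sum>\<beta>\<gamma>\<in>Q. ennreal (?t x \<beta>\<gamma> powr p) * indicator (- singular_set l) x)"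
        by (simp only: sum_distrib_right mult.assoc)
    qed
    also have "\<dots> = ennreal ?T * (\<integral>\<^sup>+x. (\<Sum>\<beta>\<gamma>\<in>Q. ennreal (?t x \<beta>\<gamma> powr p) * indicator (- singular_set l) x) \<partial>lborel)"
      by (rule nn_integral_cmult, rule borel_measurable_sum, rule meas)
    also have "(\<integral>\<^sup>+x. (\<Sum>\<beta>\<gamma>\<in>Q. ennreal (?t x \<beta>\<gamma> powr p) * indicator (- singular_set l) x) \<partial>lborel)
      = (\<Sum>\<beta>\<gamma>\<in>Q. \<integral>\<^sup>+x. ennreal (?t x \<beta>\<gamma> powr p) * indicator (- singular_set l) x \<partial>lborel)"
      by (rule nn_integral_sum, rule meas)
    also have "\<dots> \<le> (\<Sum>(\<beta>, \<gamma>)\<in>Q. ennreal (C \<beta> \<gamma>) * E)"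
    proof (rule sum_mono)
      fix \<beta>\<gamma> assume q: "\<beta>\<gamma> \<in> Q"
      obtain \<beta> \<gamma> where e: "\<beta>\<gamma> = (\<beta>, \<gamma>)" by (cases \<beta>\<gamma>)
      show "(\<integral>\<^sup>+x. ennreal (?t x \<beta>\<gamma> powr p) * indicator (- singular_set l) x \<partial>lborel) \<le> (case \<beta>\<gamma> of (\<beta>, \<gamma>) \<Rightarrow> ennreal (C \<beta> \<gamma>) * E)"
        using C(2)[OF QD(2)[OF q[unfolded e]]] unfolding QD(1)[OF q[unfolded e]] e prod.case .
    qed
    also have "\<dots> = ennreal (\<Sum>(\<beta>, \<gamma>)\<in>Q. C \<beta> \<gamma>) * E"
    proof -
      have "(\<Sum>(\<beta>, \<gamma>)\<in>Q. ennreal (C \<beta> \<gamma>)) = ennreal (\<Sum>(\<beta>, \<gamma>)\<in>Q. C \<beta> \<gamma>)"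
        unfolding case_prod_unfold by (rule sum_ennreal) (use QD(2) C(1) in fastforce)
      then show ?thesis by (simp only: sum_distrib_right[symmetric] case_prod_unfold)
    qed
    also have "ennreal (\<Sum>(\<beta>, \<gamma>)\<in>Q. C \<beta> \<gamma>) \<le> ennreal (\<Sum>(\<beta>, \<gamma>)\<in>P. C \<beta> \<gamma>)"
      using C(1) finP Q(2) by (intro ennreal_leI sum_mono2) (auto simp: P_def)
    finally have "(\<integral>\<^sup>+x. ennreal ((?w x * norm (Z \<alpha> x)) powr p) * indicator (- singular_set l) x \<partial>lborel)
      \<le> ennreal ?T * (ennreal (\<Sum>(\<beta>, \<gamma>)\<in>P. C \<beta> \<gamma>) * E)"
      by (simp add: mult_left_mono mult_right_mono)
    then show ?thesis using Csum[OF order_refl] by (simp add: ennreal_mult mult.assoc)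
  qed
  have "family_energy m a p l Z \<le> (\<Sum>\<alpha> :: 'd \<Rightarrow> nat | mindex_order \<alpha> \<le> m. ennreal (?T * (\<Sum>(\<beta>, \<gamma>)\<in>P. C \<beta> \<gamma>)) * E)"
    unfolding family_energy_def by (intro sum_mono one) simp
  also have "\<dots> = ennreal (real (card {\<alpha> :: 'd \<Rightarrow> nat. mindex_order \<alpha> \<le> m}) * (?T * (\<Sum>(\<beta>, \<gamma>)\<in>P. C \<beta> \<gamma>))) * E"
    using Csum[OF order_refl] by (simp add: ennreal_mult ennreal_of_nat_eq_real_of_nat mult.assoc)
  finally show ?thesis .
qed

theorem kondratiev_algebra:
  assumes p: "1 \<le> p" and m: "1 \<le> m" and a: "a \<ge> real CARD('d) / p"
    and cond: "1 < p \<and> real m > real CARD('d) / p \<or> p = 1 \<and> m \<ge> CARD('d)"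
  shows "pointwise_algebra
    (kondratiev_space m a p l :: (real ^ 'd::{finite,linorder} \<Rightarrow> 'b::{real_normed_field,euclidean_space}) set)
    (kondratiev_norm m a p l)"
proof -
  have "\<forall>\<beta> \<gamma>. \<exists>C. mindex_order \<beta> + mindex_order \<gamma> \<le> m \<longrightarrow> 0 \<le> C \<and> (\<forall>(U :: ('d::{finite,linorder} \<Rightarrow> nat) \<Rightarrow> real ^ 'd::{finite,linorder} \<Rightarrow> 'b)
      (V :: ('d::{finite,linorder} \<Rightarrow> nat) \<Rightarrow> real ^ 'd::{finite,linorder} \<Rightarrow> 'b).
    ac_family (- singular_set l) m U \<longrightarrow> ac_family (- singular_set l) m V \<longrightarrow>
    family_energy m a p l U < \<infinity> \<longrightarrow> family_energy m a p l V < \<infinity> \<longrightarrow>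
    (\<integral>\<^sup>+x. ennreal ((rho l x powr (real (mindex_order \<beta> + mindex_order \<gamma>) - a) * (norm (U \<beta> x) * norm (V \<gamma> x))) powr p) * indicator (- singular_set l) x \<partial>lborel)
      \<le> ennreal C * family_energy m a p l U * family_energy m a p l V)"
    using weighted_product[OF p m a cond, where 'b = 'b] by meson
  then obtain C where C: "\<And>\<beta> \<gamma>. mindex_order \<beta> + mindex_order \<gamma> \<le> m \<Longrightarrow> 0 \<le> C \<beta> \<gamma>"
    "\<And>\<beta> \<gamma> (U :: ('d::{finite,linorder} \<Rightarrow> nat) \<Rightarrow> real ^ 'd::{finite,linorder} \<Rightarrow> 'b)
      (V :: ('d::{finite,linorder} \<Rightarrow> nat) \<Rightarrow> real ^ 'd::{finite,linorder} \<Rightarrow> 'b). mindex_order \<beta> + mindex_order \<gamma> \<le> m \<Longrightarrow>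
    ac_family (- singular_set l) m U \<Longrightarrow> ac_family (- singular_set l) m V \<Longrightarrow>
    family_energy m a p l U < \<infinity> \<Longrightarrow> family_energy m a p l V < \<infinity> \<Longrightarrow>
    (\<integral>\<^sup>+x. ennreal ((rho l x powr (real (mindex_order \<beta> + mindex_order \<gamma>) - a) * (norm (U \<beta> x) * norm (V \<gamma> x))) powr p) * indicator (- singular_set l) x \<partial>lborel)
      \<le> ennreal (C \<beta> \<gamma>) * family_energy m a p l U * family_energy m a p l V"
    unfolding choice_iff by (elim exE) blast
  define P where "P = ({(\<beta>, \<gamma>). mindex_order \<beta> + mindex_order \<gamma> \<le> m} :: (('d \<Rightarrow> nat) \<times> ('d \<Rightarrow> nat)) set)"
  define D where "D = real (card {\<alpha> :: 'd \<Rightarrow> nat. mindex_order \<alpha> \<le> m}) * ((2 ^ m * real (card P)) powr p * (\<Sum>(\<beta>, \<gamma>)\<in>P. C \<beta> \<gamma>))"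
  have D: "0 \<le> D" unfolding D_def using C(1) by (intro mult_nonneg_nonneg sum_nonneg) (auto simp: P_def)
  show ?thesis
    unfolding pointwise_algebra_def
  proof (intro exI[of _ "D powr (1 / p)"] ballI)
    fix u v :: "real ^ 'd::{finite,linorder} \<Rightarrow> 'b"
    assume u: "u \<in> kondratiev_space m a p l" and v: "v \<in> kondratiev_space m a p l"
    obtain U where U: "ac_family (- singular_set l) m U" "AE x in lborel. x \<in> - singular_set l \<longrightarrow> u x = U (\<lambda>_. 0) x"
      "u \<in> borel_measurable (lebesgue_on (- singular_set l))"
      "kondratiev_energy m a p l u = family_energy m a p l U" "family_energy m a p l U < \<infinity>"
      by (rule kondratiev_spaceE[OF u])
    obtain V where V: "ac_family (- singular_set l) m V" "AE x in lborel. x \<in> - singular_set l \<longrightarrow> v x = V (\<lambda>_. 0) x"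
      "v \<in> borel_measurable (lebesgue_on (- singular_set l))"
      "kondratiev_energy m a p l v = family_energy m a p l V" "family_energy m a p l V < \<infinity>"
      by (rule kondratiev_spaceE[OF v])
    let ?E = "family_energy m a p l U * family_energy m a p l V"
    \<comment> \<open>The estimate precedes the product rule: the weighted bounds supply the local
      integrability of products that the Leibniz rule assumes.\<close>
    have UV: "loc_int (- singular_set l) (\<lambda>x. U \<beta> x * V \<gamma> x)" if bc: "mindex_order \<beta> + mindex_order \<gamma> \<le> m" for \<beta> \<gamma>
    proof -
      have bcm: "mindex_order \<beta> \<le> m" "mindex_order \<gamma> \<le> m" using bc by auto
      note [measurable] = ac_familyD(3)[OF U(1) bcm(1)] ac_familyD(3)[OF V(1) bcm(2)]
      have "ennreal (C \<beta> \<gamma>) * family_energy m a p l U * family_energy m a p l V < \<infinity>"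
        using U(5) V(5) by (simp add: ennreal_mult_less_top)
      from le_less_trans[OF C(2)[OF bc U(1) V(1) U(5) V(5)] this] show ?thesis
        by (intro loc_int_weighted[OF p, where e = "real (mindex_order \<beta> + mindex_order \<gamma>) - a"]) (auto simp: norm_mult)
    qed
    obtain Z Ls where Z: "ac_family (- singular_set l) m Z" "Z (\<lambda>_. 0) = (\<lambda>x. U (\<lambda>_. 0) x * V (\<lambda>_. 0) x)"
      and Ls: "\<And>\<alpha>. mindex_order \<alpha> \<le> m \<Longrightarrow> length (Ls \<alpha>) \<le> 2 ^ m"
      "\<And>\<alpha> \<beta> \<gamma>. mindex_order \<alpha> \<le> m \<Longrightarrow> (\<beta>, \<gamma>) \<in> set (Ls \<alpha>) \<Longrightarrow> mindex_order \<beta> + mindex_order \<gamma> = mindex_order \<alpha>"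
      "\<And>\<alpha> x. mindex_order \<alpha> \<le> m \<Longrightarrow> Z \<alpha> x = product_sum U V (Ls \<alpha>) x"
    proof (rule leibniz_family[OF open_regular_set U(1) V(1) UV])
      fix Z Ls
      assume A: "ac_family (- singular_set l) m Z" "Z (\<lambda>_. 0) = (\<lambda>x. U (\<lambda>_. 0) x * V (\<lambda>_. 0) x)"
        "\<And>\<alpha>. mindex_order \<alpha> \<le> m \<Longrightarrow> length (Ls \<alpha>) \<le> 2 ^ m"
        "\<And>\<alpha> \<beta> \<gamma>. mindex_order \<alpha> \<le> m \<Longrightarrow> (\<beta>, \<gamma>) \<in> set (Ls \<alpha>) \<Longrightarrow> mindex_order \<beta> + mindex_order \<gamma> = mindex_order \<alpha>"
        "\<And>\<alpha> x. mindex_order \<alpha> \<le> m \<Longrightarrow> Z \<alpha> x = product_sum U V (Ls \<alpha>) x"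
      show thesis by (rule that) (fact A)+
    qed
    have E: "family_energy m a p l Z \<le> ennreal D * ?E"
      unfolding D_def P_def
      by (rule product_family_energy[OF p U(1) V(1) Ls C(1)]) (use C(2)[OF _ U(1) V(1) U(5) V(5)] in \<open>auto simp: mult.assoc\<close>)
    have fin: "ennreal D * ?E < \<infinity>" using U(5) V(5) by (simp add: ennreal_mult_less_top)
    have m: "(\<lambda>x. u x * v x) \<in> borel_measurable (lebesgue_on (- singular_set l))"
      using U(3) V(3) by measurable
    have ae: "AE x in lborel. x \<in> - singular_set l \<longrightarrow> u x * v x = Z (\<lambda>_. 0) x"
      using U(2) V(2) by eventually_elim (auto simp: Z(2))
    have en: "kondratiev_energy m a p l (\<lambda>x. u x * v x) = family_energy m a p l Z"
      by (rule kondratiev_energy_eq[OF m Z(1) ae])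
    have "enn2real (family_energy m a p l Z) \<le> enn2real (ennreal D * ?E)"
      using E fin by (intro enn2real_mono) auto
    also have "\<dots> = D * (enn2real (family_energy m a p l U) * enn2real (family_energy m a p l V))"
      using D by (simp add: enn2real_mult)
    finally have "kondratiev_norm m a p l (\<lambda>x. u x * v x) \<le> (D * (enn2real (family_energy m a p l U) * enn2real (family_energy m a p l V))) powr (1 / p)"
      unfolding kondratiev_norm_def en using p by (intro powr_mono2) auto
    also have "\<dots> = D powr (1 / p) * kondratiev_norm m a p l u * kondratiev_norm m a p l v"
      unfolding kondratiev_norm_def U(4) V(4) using D by (simp add: powr_mult mult.assoc)
    finally have "kondratiev_norm m a p l (\<lambda>x. u x * v x) \<le> D powr (1 / p) * kondratiev_norm m a p l u * kondratiev_norm m a p l v" .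
    then show "(\<lambda>x. u x * v x) \<in> kondratiev_space m a p l \<and>
      kondratiev_norm m a p l (\<lambda>x. u x * v x) \<le> D powr (1 / p) * kondratiev_norm m a p l u * kondratiev_norm m a p l v"
      using kondratiev_spaceI[OF m Z(1) ae le_less_trans[OF E fin]] by blast
  qed
qed

section \<open>Necessity\<close>

text \<open>The lower bound depends on the algebra constant and on \<open>p\<close>, but not on the
  plateau \<open>G\<close>: if the norm is small, the powers decay geometrically and fall below any
  positive number. Hence plateaus may shrink along a sequence.\<close>

lemma plateau_energy_bound:
  assumes p: "1 \<le> p"
    and alg: "pointwise_algebra
      (kondratiev_space m a p l :: (real ^ 'd::{finite,linorder} \<Rightarrow> 'b::{real_normed_field,euclidean_space}) set)
      (kondratiev_norm m a p l)"
  shows "\<exists>\<epsilon>>0. \<forall>(U :: ('d::{finite,linorder} \<Rightarrow> nat) \<Rightarrow> real ^ 'd::{finite,linorder} \<Rightarrow> 'b) G.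
    ac_family (- singular_set l) m U \<longrightarrow> family_energy m a p l U < \<infinity> \<longrightarrow>
    open G \<longrightarrow> G \<noteq> {} \<longrightarrow> G \<subseteq> - singular_set l \<longrightarrow> (\<forall>x\<in>G. U (\<lambda>_. 0) x = 1) \<longrightarrow>
    ennreal \<epsilon> \<le> family_energy m a p l U"
proof -
  let ?K = "kondratiev_space m a p l :: (real ^ 'd::{finite,linorder} \<Rightarrow> 'b) set" and ?N = "kondratiev_norm m a p l"
  obtain c where c: "\<And>u v. u \<in> ?K \<Longrightarrow> v \<in> ?K \<Longrightarrow> (\<lambda>x. u x * v x) \<in> ?K \<and> ?N (\<lambda>x. u x * v x) \<le> c * ?N u * ?N v"
    using alg unfolding pointwise_algebra_def by (elim exE) blast
  \<comment> \<open>The constant \<open>c\<close> of the algebra need not be positive, whereas the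
    threshold \<open>1 / C\<close> requires it.\<close>
  define C where "C = max c 1"
  have C: "c \<le> C" "0 < C" by (auto simp: C_def)
  have N0: "0 \<le> ?N v" for v :: "real ^ 'd::{finite,linorder} \<Rightarrow> 'b" by (simp add: kondratiev_norm_def)
  have main: "ennreal ((1 / C) powr p) \<le> family_energy m a p l U"
    if U: "ac_family (- singular_set l) m U" and fin: "family_energy m a p l U < \<infinity>"
      and G: "open G" "G \<noteq> {}" "G \<subseteq> - singular_set l" and U1: "\<forall>x\<in>G. U (\<lambda>_. 0) x = 1"
    for U :: "('d::{finite,linorder} \<Rightarrow> nat) \<Rightarrow> real ^ 'd::{finite,linorder} \<Rightarrow> 'b" and G
  proof (rule ccontr)
    assume small: "\<not> ennreal ((1 / C) powr p) \<le> family_energy m a p l U"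
    define u where "u = U (\<lambda>_. 0)"
    have ub: "u \<in> borel_measurable borel" unfolding u_def by (rule ac_familyD(3)[OF U]) (simp add: mindex_order_def)
    then have um: "u \<in> borel_measurable (lebesgue_on (- singular_set l))"
      by (intro measurable_restrict_space1 measurable_completion) simp
    have uK: "u \<in> ?K" by (rule kondratiev_spaceI[OF um U _ fin]) (simp add: u_def)
    have en: "kondratiev_energy m a p l u = family_energy m a p l U"
      by (rule kondratiev_energy_eq[OF um U]) (simp add: u_def)
    have pow: "(\<lambda>x. u x ^ Suc n) \<in> ?K \<and> ?N (\<lambda>x. u x ^ Suc n) \<le> (C * ?N u) ^ n * ?N u" for n
    proof (induction n)
      case 0
      then show ?case using uK by simp
    next
      case (Suc n)
      have "?N (\<lambda>x. u x * u x ^ Suc n) \<le> c * ?N u * ?N (\<lambda>x. u x ^ Suc n)" using c[OF uK] Suc by blast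
      also have "\<dots> \<le> C * ?N u * ((C * ?N u) ^ n * ?N u)"
        using Suc C N0 by (intro mult_mono) (auto intro: mult_right_mono)
      finally show ?case using c[OF uK conjunct1[OF Suc]] by (simp add: mult_ac)
    qed
    \<comment> \<open>The contribution of \<open>G\<close> to the order 0 term is the same for all
      powers of \<open>u\<close>; it is positive because the weight is positive on the nonempty open
      set \<open>G\<close>.\<close>
    define I where "I = (\<integral>\<^sup>+x. ennreal ((rho l x powr - a) powr p) * indicator G x \<partial>lborel)"
    have Gm [measurable]: "G \<in> sets borel" using G(1) by simp
    have IE: "I \<le> kondratiev_energy m a p l (\<lambda>x. u x ^ Suc n)" for n
    proof -
      obtain V where V: "ac_family (- singular_set l) m V" "AE x in lborel. x \<in> - singular_set l \<longrightarrow> u x ^ Suc n = V (\<lambda>_. 0) x"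
        "kondratiev_energy m a p l (\<lambda>x. u x ^ Suc n) = family_energy m a p l V"
        by (rule kondratiev_spaceE[OF conjunct1[OF pow[of n]]]) (assumption | rule that)+
      have "I \<le> (\<integral>\<^sup>+x. ennreal ((rho l x powr (real (mindex_order (\<lambda>_ :: 'd. 0)) - a) * norm (V (\<lambda>_. 0) x)) powr p) * indicator (- singular_set l) x \<partial>lborel)"
        unfolding I_def
      proof (rule nn_integral_mono_AE)
        show "AE x in lborel. ennreal ((rho l x powr - a) powr p) * indicator G x \<le>
          ennreal ((rho l x powr (real (mindex_order (\<lambda>_ :: 'd. 0)) - a) * norm (V (\<lambda>_. 0) x)) powr p) * indicator (- singular_set l) x"
          using V(2)
        proof eventually_elim
          case (elim x)
          show ?case
          proof (cases "x \<in> G")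
            case True
            then have "x \<in> - singular_set l" "u x = 1" using G(3) U1 by (auto simp: u_def)
            then have "V (\<lambda>_. 0) x = 1" using elim by simp
            then show ?thesis using True \<open>x \<in> - singular_set l\<close> by (simp add: mindex_order_def)
          qed simp
        qed
      qed
      also have "\<dots> \<le> family_energy m a p l V"
        unfolding family_energy_def
        by (rule member_le_sum[where i = "\<lambda>_ :: 'd. 0"]) (simp_all add: finite_mindex_le mindex_order_0)
      finally show ?thesis using V(3) by simp
    qed
    have "I \<noteq> 0"
    proof
      assume "I = 0"
      then have "AE x in lborel. ennreal ((rho l x powr - a) powr p) * indicator G x = 0"
        unfolding I_def by (subst (asm) nn_integral_0_iff_AE) simp_all
      then have "AE x in lborel. x \<notin> G"
      proof eventually_elim
        case (elim x)
        have "ennreal ((rho l x powr - a) powr p) \<noteq> 0" if "x \<in> G"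
        proof -
          have "0 < rho l x" using that G(3) rho_pos_iff[of l x] by blast
          then show ?thesis by (simp add: ennreal_eq_0_iff)
        qed
        then show ?case using elim by (auto simp: indicator_def)
      qed
      then have "G \<in> null_sets lborel" by (subst AE_iff_null_sets) simp_all
      then have "negligible G" using null_sets_completionI negligible_iff_null_sets by blast
      then show False using open_not_negligible[OF G(1,2)] by blast
    qed
    have "I < \<infinity>" using le_less_trans[OF IE[of 0]] fin en by simp
    then have "0 < enn2real I" using \<open>I \<noteq> 0\<close> by (simp add: enn2real_positive_iff zero_less_iff_neq_zero)
    then have \<delta>0: "0 < enn2real I powr (1 / p)" by simp
    have \<delta>: "enn2real I powr (1 / p) \<le> (C * ?N u) ^ n * ?N u" for n
    proof -
      have "kondratiev_energy m a p l (\<lambda>x. u x ^ Suc n) < \<infinity>"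
        using conjunct1[OF pow[of n]] unfolding kondratiev_space_def by simp
      then have "enn2real I powr (1 / p) \<le> ?N (\<lambda>x. u x ^ Suc n)"
        unfolding kondratiev_norm_def using IE[of n] p by (intro powr_mono2 enn2real_mono) auto
      then show ?thesis using pow[of n] by linarith
    qed
    obtain e where e: "family_energy m a p l U = ennreal e" "0 \<le> e"
      using fin by (cases "family_energy m a p l U") auto
    have "e < (1 / C) powr p" using small e by (simp add: ennreal_le_iff2 not_le)
    then have "e powr (1 / p) < ((1 / C) powr p) powr (1 / p)" using p e(2) by (intro powr_less_mono2) auto
    also have "\<dots> = 1 / C" using p C(2) by (simp add: powr_powr)
    finally have "?N u < 1 / C" unfolding kondratiev_norm_def en e(1) using e(2) by simp
    then have "C * ?N u < 1" using C(2) by (simp add: field_simps)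
    then have "(\<lambda>n. (C * ?N u) ^ n) \<longlonglongrightarrow> 0" using N0[of u] C(2) by (intro LIMSEQ_power_zero) simp
    then have "(\<lambda>n. (C * ?N u) ^ n * ?N u) \<longlonglongrightarrow> 0" by (rule tendsto_mult_left_zero)
    then have "enn2real I powr (1 / p) \<le> 0" by (rule LIMSEQ_le_const) (use \<delta> in blast)
    then show False using \<delta>0 by linarith
  qed
  show ?thesis
    by (rule exI[of _ "(1 / C) powr p"], intro conjI allI impI, use C(2) in simp, rule main)
qed

text \<open>The energies are bounded order by order because the rates of decay may depend on
  \<open>\<alpha>\<close>; only finitely many orders are summed.\<close>

lemma not_algebra_if_plateau_energy_null:
  fixes U :: "nat \<Rightarrow> ('d::{finite,linorder} \<Rightarrow> nat) \<Rightarrow> real ^ 'd::{finite,linorder} \<Rightarrow> 'b::{real_normed_field,euclidean_space}"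
  assumes p: "1 \<le> p" and U: "\<And>n. ac_family (- singular_set l) m (U n)"
    and G: "\<And>n. open (G n)" "\<And>n. G n \<noteq> {}" "\<And>n. G n \<subseteq> - singular_set l" "\<And>n x. x \<in> G n \<Longrightarrow> U n (\<lambda>_. 0) x = 1"
    and b: "\<And>\<alpha> n. mindex_order \<alpha> \<le> m \<Longrightarrow> 0 \<le> b \<alpha> n" "\<And>\<alpha>. mindex_order \<alpha> \<le> m \<Longrightarrow> b \<alpha> \<longlonglongrightarrow> 0"
      "\<And>\<alpha> n. mindex_order \<alpha> \<le> m \<Longrightarrow> (\<integral>\<^sup>+ x \<in> - singular_set l.
        ennreal ((rho l x powr (real (mindex_order \<alpha>) - a) * norm (U n \<alpha> x)) powr p) \<partial>lborel) \<le> ennreal (b \<alpha> n)"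
  shows "\<not> pointwise_algebra (kondratiev_space m a p l :: (real ^ 'd::{finite,linorder} \<Rightarrow> 'b) set) (kondratiev_norm m a p l)"
proof
  assume "pointwise_algebra (kondratiev_space m a p l :: (real ^ 'd::{finite,linorder} \<Rightarrow> 'b) set) (kondratiev_norm m a p l)"
  from plateau_energy_bound[OF p this]
  obtain \<epsilon> where \<epsilon>: "0 < \<epsilon>" and low: "\<forall>(U :: ('d::{finite,linorder} \<Rightarrow> nat) \<Rightarrow> real ^ 'd::{finite,linorder} \<Rightarrow> 'b) G.
    ac_family (- singular_set l) m U \<longrightarrow> family_energy m a p l U < \<infinity> \<longrightarrow>
    open G \<longrightarrow> G \<noteq> {} \<longrightarrow> G \<subseteq> - singular_set l \<longrightarrow> (\<forall>x\<in>G. U (\<lambda>_. 0) x = 1) \<longrightarrow>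
    ennreal \<epsilon> \<le> family_energy m a p l U" by (elim exE conjE)
  define B where "B n = (\<Sum>\<alpha> :: 'd \<Rightarrow> nat | mindex_order \<alpha> \<le> m. b \<alpha> n)" for n
  have B: "family_energy m a p l (U n) \<le> ennreal (B n)" for n
  proof -
    have "family_energy m a p l (U n) \<le> (\<Sum>\<alpha> :: 'd \<Rightarrow> nat | mindex_order \<alpha> \<le> m. ennreal (b \<alpha> n))"
      unfolding family_energy_def by (rule sum_mono, rule b(3)) simp
    also have "\<dots> = ennreal (B n)" unfolding B_def by (rule sum_ennreal) (simp add: b(1))
    finally show ?thesis .
  qed
  have "B \<longlonglongrightarrow> 0" unfolding B_def by (rule tendsto_null_sum) (simp add: b(2))
  then have "eventually (\<lambda>n. B n < \<epsilon>) sequentially" using \<epsilon> by (rule order_tendstoD(2))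
  then obtain n where n: "B n < \<epsilon>" by (auto simp: eventually_sequentially)
  have "family_energy m a p l (U n) < \<infinity>" using le_less_trans[OF B ennreal_less_top, of n] by simp
  then have "ennreal \<epsilon> \<le> family_energy m a p l (U n)"
    using low[rule_format, OF U _ G(1-3)] G(4) by blast
  then have "ennreal \<epsilon> \<le> ennreal (B n)" using B order_trans by blast
  moreover have "0 \<le> B n" unfolding B_def by (rule sum_nonneg) (simp add: b(1))
  ultimately show False using n by simp
qed

section \<open>Families of derivatives built from dilated bumps\<close>

lemma ac_on_lines_of_real:
  fixes f g :: "real ^ 'd::finite \<Rightarrow> real"
  assumes deriv: "\<And>x t. ((\<lambda>t. f (x + t *\<^sub>R axis i 1)) has_real_derivative g (x + t *\<^sub>R axis i 1)) (at t)"
    and cont: "continuous_on UNIV g"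
  shows "ac_on_lines \<Omega> i (\<lambda>x. of_real (f x) :: 'b::{real_normed_field,euclidean_space}) (\<lambda>x. of_real (g x))"
  unfolding ac_on_lines_def
proof (intro allI impI AE_I2)
  fix t :: real and x :: "real ^ 'd" assume t: "0 \<le> t"
  let ?l = "\<lambda>s. x + s *\<^sub>R axis i 1"
  have D: "((\<lambda>s. of_real (f (?l s)) :: 'b) has_vector_derivative of_real (g (?l s))) (at s within {0..t})" for s
    by (rule bounded_linear.has_vector_derivative[OF bounded_linear_of_real])
       (rule has_vector_derivative_at_within[OF deriv[unfolded has_real_derivative_iff_has_vector_derivative]])
  have "continuous_on {0..t} (\<lambda>s. of_real (g (?l s)) :: 'b)"
    by (intro continuous_on_of_real continuous_on_compose2[OF cont] continuous_intros) auto
  from integral_FTC_Icc[OF t D this]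
  show "of_real (f (?l t)) - of_real (f x) = (LINT s:{0..t}|lborel. of_real (g (?l s)) :: 'b)"
    unfolding set_lebesgue_integral_def by simp
qed

lemma loc_int_continuous: "continuous_on UNIV w \<Longrightarrow> loc_int \<Omega> w"
  unfolding loc_int_def set_integrable_def
  by (auto intro: borel_measurable_continuous_onI borel_integrable_compact continuous_on_subset)

text \<open>The \<open>k\<close>-th bump has amplitude \<open>c k\<close>, dilation
  \<open>r k\<close>, and a centre all of whose coordinates are \<open>s k / r k\<close>. The power
  of \<open>r k\<close> is the chain rule factor, so index \<open>\<alpha>\<close> is the actual
  derivative of the sum at index 0.\<close>

definition bump_sum :: "(real \<Rightarrow> real) \<Rightarrow> nat \<Rightarrow> (nat \<Rightarrow> real) \<Rightarrow> (nat \<Rightarrow> real) \<Rightarrow> (nat \<Rightarrow> real) \<Rightarrow>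
    ('d::finite \<Rightarrow> nat) \<Rightarrow> real ^ 'd \<Rightarrow> real" where
  "bump_sum \<eta> n c r s \<alpha> x =
    (\<Sum>k<n. c k * r k ^ mindex_order \<alpha> * tensor (\<lambda>_. \<eta>) \<alpha> (r k *\<^sub>R x - (\<chi> i. s k)))"

lemma continuous_bump_sum:
  assumes "csmooth \<eta>"
  shows "continuous_on UNIV (bump_sum \<eta> n c r s \<alpha>)"
proof -
  have "continuous_on UNIV (tensor (\<lambda>_. \<eta>) \<alpha>)"
    by (rule differentiable_imp_continuous_on, rule tensor_differentiable, rule assms)
  then have "continuous_on UNIV (\<lambda>x. tensor (\<lambda>_. \<eta>) \<alpha> (r k *\<^sub>R x - (\<chi> i. s k)))" for k
    by (rule continuous_on_compose2) (auto intro!: continuous_intros)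
  then show ?thesis
    unfolding bump_sum_def[abs_def] by (intro continuous_intros) auto
qed

lemma ac_family_bump_sum:
  assumes \<eta>: "csmooth \<eta>"
  shows "ac_family \<Omega> m (\<lambda>\<alpha> x. of_real (bump_sum \<eta> n c r s \<alpha> x) :: 'b::{real_normed_field,euclidean_space})"
  unfolding ac_family_def
proof (intro conjI allI impI)
  fix \<alpha> :: "'a::{finite,linorder} \<Rightarrow> nat"
  show "loc_int \<Omega> (\<lambda>x. of_real (bump_sum \<eta> n c r s \<alpha> x) :: 'b)"
    by (intro loc_int_continuous continuous_on_of_real continuous_bump_sum \<eta>)
  fix i
  show "ac_on_lines \<Omega> i (\<lambda>x. of_real (bump_sum \<eta> n c r s \<alpha> x) :: 'b) (\<lambda>x. of_real (bump_sum \<eta> n c r s (\<alpha>(i := Suc (\<alpha> i))) x))"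
  proof (rule ac_on_lines_of_real[OF _ continuous_bump_sum[OF \<eta>]])
    fix x :: "real ^ 'a::{finite,linorder}" and t :: real
    let ?\<beta> = "\<alpha>(i := Suc (\<alpha> i))"
    have "((\<lambda>t. tensor (\<lambda>_. \<eta>) \<alpha> (r k *\<^sub>R (x + t *\<^sub>R axis i 1) - (\<chi> i. s k))) has_real_derivative
      tensor (\<lambda>_. \<eta>) ?\<beta> (r k *\<^sub>R (x + t *\<^sub>R axis i 1) - (\<chi> i. s k)) * r k) (at t)" for k
    proof -
      have e: "r k *\<^sub>R (x + t *\<^sub>R axis i 1) - (\<chi> i. s k) = (r k *\<^sub>R x - (\<chi> i. s k)) + (r k * t) *\<^sub>R axis i 1" for t
        by (simp add: algebra_simps)
      have l: "((\<lambda>t. r k * t) has_real_derivative r k) (at t)" by (auto intro!: derivative_eq_intros)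
      show ?thesis unfolding e by (rule DERIV_chain2[OF tensor_line_deriv l]) (rule \<eta>)
    qed
    then have "((\<lambda>t. bump_sum \<eta> n c r s \<alpha> (x + t *\<^sub>R axis i 1)) has_real_derivative
      (\<Sum>k<n. c k * r k ^ mindex_order \<alpha> * (tensor (\<lambda>_. \<eta>) ?\<beta> (r k *\<^sub>R (x + t *\<^sub>R axis i 1) - (\<chi> i. s k)) * r k))) (at t)"
      unfolding bump_sum_def by (intro DERIV_sum DERIV_cmult)
    also have "(\<Sum>k<n. c k * r k ^ mindex_order \<alpha> * (tensor (\<lambda>_. \<eta>) ?\<beta> (r k *\<^sub>R (x + t *\<^sub>R axis i 1) - (\<chi> i. s k)) * r k))
      = bump_sum \<eta> n c r s ?\<beta> (x + t *\<^sub>R axis i 1)"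
      unfolding bump_sum_def mindex_order_upd by (simp add: mult_ac)
    finally show "((\<lambda>t. bump_sum \<eta> n c r s \<alpha> (x + t *\<^sub>R axis i 1)) has_real_derivative
      bump_sum \<eta> n c r s ?\<beta> (x + t *\<^sub>R axis i 1)) (at t)" .
  qed
qed

lemma singular_set_0: "singular_set 0 = {0 :: real ^ 'd::{finite,linorder}}"
  and rho_0: "rho 0 (x :: real ^ 'd::{finite,linorder}) = min 1 (norm x)"
proof -
  have "leading_coords (CARD('d)) = (UNIV :: 'd set)" by (auto simp: leading_coords_def intro: card_mono)
  then show "singular_set 0 = {0 :: real ^ 'd::{finite,linorder}}" "rho 0 x = min 1 (norm x)"
    by (auto simp: singular_set_def rho_def norm_vec_def L2_set_def vec_eq_iff)
qed

lemma funpow_deriv_locally_const: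
  fixes f :: "real \<Rightarrow> real"
  assumes S: "open S" and f: "\<And>s. s \<in> S \<Longrightarrow> f s = c"
  shows "s \<in> S \<Longrightarrow> (deriv ^^ n) f s = (if n = 0 then c else 0)"
proof (induction n arbitrary: s)
  case (Suc n)
  have "((deriv ^^ n) f has_real_derivative 0) (at s)"
    by (rule has_field_derivative_transform_within_open[OF DERIV_const S Suc.prems]) (simp add: Suc.IH)
  then show ?case by (simp add: DERIV_imp_deriv)
qed (simp add: f)

context
  fixes \<eta> :: "real \<Rightarrow> real"
  assumes \<eta>: "csmooth \<eta>" "\<And>s. 0 \<le> \<eta> s" "\<And>s. \<eta> s \<le> 1"
    "\<And>s. \<bar>s\<bar> \<le> 1 / 2 \<Longrightarrow> \<eta> s = 1" "\<And>s. 1 \<le> \<bar>s\<bar> \<Longrightarrow> \<eta> s = 0"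
begin

text \<open>Both claims use that \<open>\<eta>\<close> is locally constant, outside
  \<open>[-1, 1]\<close> and inside \<open>(-1/2, 1/2)\<close>. Derivatives of positive order thus
  live between two concentric cubes, which is what separates bumps of different scales.\<close>

lemma tensor_bump_support:
  assumes "tensor (\<lambda>_. \<eta>) \<alpha> z \<noteq> 0"
  shows "\<bar>z $ j\<bar> \<le> 1" "0 < mindex_order \<alpha> \<Longrightarrow> \<exists>j. 1 / 2 \<le> \<bar>z $ j\<bar>"
proof -
  have nz: "(deriv ^^ \<alpha> j) \<eta> (z $ j) \<noteq> 0" for j using assms by (auto simp: tensor_def)
  show "\<bar>z $ j\<bar> \<le> 1"
  proof (rule ccontr)
    assume "\<not> \<bar>z $ j\<bar> \<le> 1"
    then have "(deriv ^^ \<alpha> j) \<eta> (z $ j) = (if \<alpha> j = 0 then 0 else 0)"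
      by (intro funpow_deriv_locally_const[where S = "- {-1..1}"]) (auto intro!: \<eta>(5))
    then show False using nz[of j] by simp
  qed
  assume "0 < mindex_order \<alpha>"
  then obtain j where j: "\<alpha> j \<noteq> 0" unfolding mindex_order_def by (metis sum.neutral less_irrefl)
  have "1 / 2 \<le> \<bar>z $ j\<bar>"
  proof (rule ccontr)
    assume "\<not> 1 / 2 \<le> \<bar>z $ j\<bar>"
    then have "(deriv ^^ \<alpha> j) \<eta> (z $ j) = (if \<alpha> j = 0 then 1 else 0)"
      by (intro funpow_deriv_locally_const[where S = "{-1/2<..<1/2}"]) (auto intro!: \<eta>(4))
    then show False using nz[of j] j by simp
  qed
  then show "\<exists>j. 1 / 2 \<le> \<bar>z $ j\<bar>" by blast
qed

lemma tensor_bump_bounded: "\<exists>M>0. \<forall>z. \<bar>tensor (\<lambda>_. \<eta>) \<alpha> z\<bar> \<le> M"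
proof -
  have "continuous_on (dcube (-1) 1) (tensor (\<lambda>_. \<eta>) \<alpha>)"
    by (rule continuous_on_subset[OF differentiable_imp_continuous_on[OF tensor_differentiable]]) (simp_all add: \<eta>(1))
  then have "bounded (tensor (\<lambda>_. \<eta>) \<alpha> ` dcube (-1) 1)"
    using compact_dcube compact_continuous_image compact_imp_bounded by blast
  then obtain M where M: "0 < M" "\<And>z. z \<in> dcube (-1) 1 \<Longrightarrow> \<bar>tensor (\<lambda>_. \<eta>) \<alpha> z\<bar> \<le> M"
    unfolding bounded_pos by auto
  have "\<bar>tensor (\<lambda>_. \<eta>) \<alpha> z\<bar> \<le> M" for z
  proof (cases "tensor (\<lambda>_. \<eta>) \<alpha> z = 0")
    case False
    have "-1 \<le> z $ j \<and> z $ j \<le> 1" for j using tensor_bump_support(1)[OF False, of j] by auto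
    then show ?thesis by (intro M(2)) (simp add: mem_dcube)
  qed (use M(1) in simp)
  then show ?thesis using M(1) by blast
qed

lemma tensor_bump_0: "0 \<le> tensor (\<lambda>_. \<eta>) (\<lambda>_. 0) z" "tensor (\<lambda>_. \<eta>) (\<lambda>_. 0) z \<le> 1"
  "(\<And>j. \<bar>z $ j\<bar> \<le> 1 / 2) \<Longrightarrow> tensor (\<lambda>_. \<eta>) (\<lambda>_. 0) z = 1"
  by (auto simp: tensor_def \<eta>(2-4) intro!: prod_nonneg prod_le_1)

lemma nn_integral_scaled_cubes:
  assumes "\<And>k. 0 \<le> A k" "\<And>k. 0 < r k"
  shows "(\<integral>\<^sup>+x. ennreal (\<Sum>k<n. A k * indicator (dcube ((s k - 1) / r k) ((s k + 1) / r k) :: (real ^ 'd::finite) set) x) \<partial>lborel)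
    = ennreal (\<Sum>k<n. A k * (2 / r k) ^ CARD('d))"
proof -
  let ?Q = "\<lambda>k. dcube ((s k - 1) / r k) ((s k + 1) / r k) :: (real ^ 'd) set"
  have "(\<integral>\<^sup>+x. ennreal (\<Sum>k<n. A k * indicator (?Q k) x) \<partial>lborel) = (\<integral>\<^sup>+x. (\<Sum>k<n. ennreal (A k) * indicator (?Q k) x) \<partial>lborel)"
    by (rule nn_integral_cong, subst sum_ennreal[symmetric])
       (use assms in \<open>auto simp del: sum_ennreal simp: ennreal_mult ennreal_indicator intro!: sum.cong\<close>)
  also have "\<dots> = (\<Sum>k<n. ennreal (A k) * emeasure lborel (?Q k))"
    by (subst nn_integral_sum) (simp_all add: nn_integral_cmult_indicator)
  also have "\<dots> = (\<Sum>k<n. ennreal (A k * (2 / r k) ^ CARD('d)))"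
  proof (rule sum.cong[OF refl])
    fix k
    have "(s k + 1) / r k - (s k - 1) / r k = 2 / r k" by (simp add: diff_divide_distrib[symmetric])
    then have "emeasure lborel (?Q k) = ennreal ((2 / r k) ^ CARD('d))"
      using assms(2)[of k] by (subst emeasure_dcube) (auto simp: divide_right_mono)
    then show "ennreal (A k) * emeasure lborel (?Q k) = ennreal (A k * (2 / r k) ^ CARD('d))"
      using assms(1)[of k] assms(2)[of k] by (simp add: ennreal_mult)
  qed
  also have "\<dots> = ennreal (\<Sum>k<n. A k * (2 / r k) ^ CARD('d))"
    by (rule sum_ennreal) (use assms in \<open>simp add: less_imp_le\<close>)
  finally show ?thesis .
qed

lemma scaled_support:
  assumes "tensor (\<lambda>_. \<eta>) \<alpha> (r *\<^sub>R x - (\<chi> i. s)) \<noteq> 0" and r: "0 < r"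
  shows "x \<in> dcube ((s - 1) / r) ((s + 1) / r)" "\<bar>r * x $ j - s\<bar> \<le> 1"
proof -
  have b: "\<bar>r * x $ j - s\<bar> \<le> 1" for j using tensor_bump_support(1)[OF assms(1), of j] by simp
  show "\<bar>r * x $ j - s\<bar> \<le> 1" by (rule b)
  have "(s - 1) / r \<le> x $ j \<and> x $ j \<le> (s + 1) / r" for j
    using b[of j] r by (auto simp: field_simps abs_le_iff)
  then show "x \<in> dcube ((s - 1) / r) ((s + 1) / r)" by (simp add: mem_dcube)
qed

text \<open>A single bump moved towards the origin.\<close>

lemma not_algebra_weight:
  assumes p: "1 \<le> p" and a: "a < real CARD('d) / p"
  shows "\<not> pointwise_algebra
    (kondratiev_space m a p 0 :: (real ^ 'd::{finite,linorder} \<Rightarrow> 'b::{real_normed_field,euclidean_space}) set)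
    (kondratiev_norm m a p 0)"
proof -
  let ?d = "real CARD('d)"
  \<comment> \<open>On the support of the bump each coordinate of \<open>r n *\<^sub>R x\<close>
    lies between 2 and 4, so the norm of \<open>x\<close> is at most \<open>4 d / r n\<close>. The
    offset \<open>4 * ?d\<close> keeps this at most 1, where \<open>rho\<close> is the norm
    itself.\<close>
  define r where "r n = real n + 4 * ?d" for n :: nat
  have d1: "1 \<le> ?d" by (simp add: Suc_leI)
  have r: "0 < r n" "4 * ?d \<le> r n" for n unfolding r_def using d1 by linarith+
  let ?B = "\<lambda>n. bump_sum \<eta> 1 (\<lambda>_. 1) (\<lambda>_. r n) (\<lambda>_. 3) :: ('d \<Rightarrow> nat) \<Rightarrow> real ^ 'd::{finite,linorder} \<Rightarrow> real"
  have "\<exists>M. \<forall>\<alpha>. 0 < M \<alpha> \<and> (\<forall>z. \<bar>tensor (\<lambda>_. \<eta>) \<alpha> (z :: real ^ 'd::{finite,linorder})\<bar> \<le> M \<alpha>)"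
    using tensor_bump_bounded by (intro choice) blast
  then obtain M :: "('d \<Rightarrow> nat) \<Rightarrow> real" where M: "\<And>\<alpha>. 0 < M \<alpha>" "\<And>\<alpha> z. \<bar>tensor (\<lambda>_. \<eta>) \<alpha> (z :: real ^ 'd::{finite,linorder})\<bar> \<le> M \<alpha>"
    by blast
  \<comment> \<open>Bounds a power of \<open>t\<close> for \<open>t\<close> between 2 and
    \<open>4 d\<close>; one summand for each sign of the exponent.\<close>
  define C where "C \<alpha> = 2 powr (real (mindex_order \<alpha>) - a) + (4 * ?d) powr (real (mindex_order \<alpha>) - a)" for \<alpha> :: "'d \<Rightarrow> nat"
  have C0: "0 \<le> C \<alpha>" for \<alpha> by (simp add: C_def)
  define A where "A \<alpha> n = (C \<alpha> * M \<alpha> * r n powr a) powr p" for \<alpha> n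
  have point: "(rho 0 x powr (real (mindex_order \<alpha>) - a) * \<bar>?B n \<alpha> x\<bar>) powr p
    \<le> A \<alpha> n * indicator (dcube ((3 - 1) / r n) ((3 + 1) / r n)) x" for \<alpha> n x
  proof (cases "tensor (\<lambda>_. \<eta>) \<alpha> (r n *\<^sub>R x - (\<chi> i. 3)) = 0")
    case True
    then show ?thesis by (simp add: bump_sum_def A_def)
  next
    case False
    let ?e = "real (mindex_order \<alpha>) - a"
    have b: "\<bar>r n * x $ j - 3\<bar> \<le> 1" for j by (rule scaled_support(2)[OF False r(1)])
    define t where "t = r n * norm x"
    have t: "t = norm (r n *\<^sub>R x)" using r(1)[of n] by (simp add: t_def)
    have "2 \<le> t"
      using b[of undefined] component_le_norm_cart[of "r n *\<^sub>R x" undefined] unfolding t by simp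
    have "t \<le> (\<Sum>j\<in>UNIV. \<bar>(r n *\<^sub>R x) $ j\<bar>)" unfolding t by (rule norm_le_l1_cart)
    also have "\<dots> \<le> (\<Sum>j\<in>(UNIV :: 'd set). 4)"
    proof (rule sum_mono)
      fix j show "\<bar>(r n *\<^sub>R x) $ j\<bar> \<le> 4" using b[of j] by simp
    qed
    finally have "t \<le> 4 * ?d" by simp
    have "norm x = t / r n" using r(1)[of n] by (simp add: t_def)
    moreover have "t / r n \<le> 1" using \<open>t \<le> 4 * ?d\<close> r[of n] by simp
    ultimately have \<rho>: "rho 0 x = t / r n" by (simp add: rho_0)
    have "t powr ?e \<le> C \<alpha>"
    proof (cases "0 \<le> ?e")
      case True
      then have "t powr ?e \<le> (4 * ?d) powr ?e" using \<open>2 \<le> t\<close> \<open>t \<le> 4 * ?d\<close> by (intro powr_mono2) auto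
      then show ?thesis unfolding C_def by (simp add: add_increasing)
    next
      case False
      then have "t powr ?e \<le> 2 powr ?e" using \<open>2 \<le> t\<close> by (intro powr_mono2') auto
      then show ?thesis unfolding C_def by (simp add: add_increasing2)
    qed
    have "rho 0 x powr ?e * \<bar>?B n \<alpha> x\<bar> = t powr ?e * (r n ^ mindex_order \<alpha> / r n powr ?e) * \<bar>tensor (\<lambda>_. \<eta>) \<alpha> (r n *\<^sub>R x - (\<chi> i. 3))\<bar>"
      unfolding \<rho> bump_sum_def using r(1)[of n] by (simp add: powr_divide abs_mult)
    also have "r n ^ mindex_order \<alpha> / r n powr ?e = r n powr a"
      using r(1)[of n] by (simp add: powr_diff powr_realpow)
    also have "t powr ?e * r n powr a * \<bar>tensor (\<lambda>_. \<eta>) \<alpha> (r n *\<^sub>R x - (\<chi> i. 3))\<bar> \<le> C \<alpha> * r n powr a * M \<alpha>"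
      using \<open>t powr ?e \<le> C \<alpha>\<close> M(2) C0 by (intro mult_mono) auto
    finally have "(rho 0 x powr ?e * \<bar>?B n \<alpha> x\<bar>) powr p \<le> A \<alpha> n"
      unfolding A_def using p by (intro powr_mono2) (auto simp: mult_ac)
    then show ?thesis using scaled_support(1)[OF False r(1)] by simp
  qed
  \<comment> \<open>The part of the bump, centred at \<open>3 / r n\<close> in every coordinate, on
    which all its one-variable factors equal 1.\<close>
  let ?G = "\<lambda>n. box (\<chi> i. 5 / 2 / r n) (\<chi> i. 7 / 2 / r n) :: (real ^ 'd::{finite,linorder}) set"
  show ?thesis
  proof (rule not_algebra_if_plateau_energy_null[OF p, where
      U = "\<lambda>n \<alpha> x. of_real (?B n \<alpha> x)" and G = ?G and b = "\<lambda>\<alpha> n. A \<alpha> n * (2 / r n) ^ CARD('d)"])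
    fix n and \<alpha> :: "'d \<Rightarrow> nat"
    show "ac_family (- singular_set 0) m (\<lambda>\<alpha> x. of_real (?B n \<alpha> x) :: 'b)" by (rule ac_family_bump_sum[OF \<eta>(1)])
    show "open (?G n)" by (rule open_box)
    have "(\<chi> i. 3 / r n) \<in> ?G n" using r(1)[of n] by (simp add: mem_box_cart field_simps)
    then show "?G n \<noteq> {}" by blast
    have G0: "x \<noteq> 0" if "x \<in> ?G n" for x using that r(1)[of n] by (auto simp: mem_box_cart not_less intro: less_imp_le)
    then show "?G n \<subseteq> - singular_set 0" unfolding singular_set_0 by blast
    show "(of_real (?B n (\<lambda>_. 0) x) :: 'b) = 1" if x: "x \<in> ?G n" for x
    proof -
      have "\<bar>(r n *\<^sub>R x - (\<chi> i. 3)) $ j\<bar> \<le> 1 / 2" for j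
      proof -
        have "5 / 2 / r n < x $ j" "x $ j < 7 / 2 / r n" using x by (auto simp: mem_box_cart)
        then have "5 / 2 < r n * x $ j" "r n * x $ j < 7 / 2" using r(1)[of n] by (simp_all add: field_simps)
        then show ?thesis by (intro abs_leI) simp_all
      qed
      from tensor_bump_0(3)[OF this] show ?thesis by (simp add: bump_sum_def mindex_order_0)
    qed
    show "0 \<le> A \<alpha> n * (2 / r n) ^ CARD('d)" using r(1)[of n] by (simp add: A_def)
    \<comment> \<open>Height \<open>r n powr (a p)\<close> times volume of order \<open>r n\<close>
      to the power \<open>-d\<close>. The weight makes every derivative scale alike, so all orders
      decay for the same reason.\<close>
    have e: "A \<alpha> n * (2 / r n) ^ CARD('d) = (C \<alpha> * M \<alpha>) powr p * 2 ^ CARD('d) * r n powr (a * p - ?d)" for n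
      unfolding A_def using r(1)[of n] by (simp add: powr_mult powr_powr powr_diff powr_realpow power_divide)
    have "a * p - ?d < 0" using a p by (simp add: field_simps)
    moreover have "filterlim r at_top sequentially"
      unfolding r_def by (rule filterlim_at_top_mono[OF filterlim_real_sequentially]) (simp add: d1)
    ultimately have "(\<lambda>n. r n powr (a * p - ?d)) \<longlonglongrightarrow> 0" by (rule tendsto_neg_powr)
    then show "(\<lambda>n. A \<alpha> n * (2 / r n) ^ CARD('d)) \<longlonglongrightarrow> 0" unfolding e by (rule tendsto_mult_right_zero)
    have "(\<integral>\<^sup>+ x \<in> - singular_set 0. ennreal ((rho 0 x powr (real (mindex_order \<alpha>) - a) * norm (of_real (?B n \<alpha> x) :: 'b)) powr p) \<partial>lborel)
      \<le> (\<integral>\<^sup>+x. ennreal (\<Sum>k<1::nat. A \<alpha> n * indicator (dcube ((3 - 1) / r n) ((3 + 1) / r n)) (x :: real ^ 'd::{finite,linorder})) \<partial>lborel)"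
    proof (rule nn_integral_mono)
      fix x :: "real ^ 'd::{finite,linorder}"
      show "ennreal ((rho 0 x powr (real (mindex_order \<alpha>) - a) * norm (of_real (?B n \<alpha> x) :: 'b)) powr p) * indicator (- singular_set 0) x
        \<le> ennreal (\<Sum>k<1::nat. A \<alpha> n * indicator (dcube ((3 - 1) / r n) ((3 + 1) / r n)) x)"
        using ennreal_leI[OF point[where x = x and \<alpha> = \<alpha> and n = n]] by (auto simp: indicator_def)
    qed
    also have "\<dots> = ennreal (\<Sum>k<1::nat. A \<alpha> n * (2 / r n) ^ CARD('d))"
      by (rule nn_integral_scaled_cubes) (simp_all add: A_def r(1))
    finally show "(\<integral>\<^sup>+ x \<in> - singular_set 0. ennreal ((rho 0 x powr (real (mindex_order \<alpha>) - a) * norm (of_real (?B n \<alpha> x) :: 'b)) powr p) \<partial>lborel)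
      \<le> ennreal (A \<alpha> n * (2 / r n) ^ CARD('d))" by simp
  qed
qed

text \<open>The average of \<open>n\<close> bumps concentrating at a regular point: their derivatives have disjoint supports.\<close>

lemma not_algebra_smoothness:
  assumes p: "1 \<le> p" and cond: "\<not> (1 < p \<and> real m > real CARD('d) / p \<or> p = 1 \<and> m \<ge> CARD('d))"
  shows "\<not> pointwise_algebra
    (kondratiev_space m a p 0 :: (real ^ 'd::{finite,linorder} \<Rightarrow> 'b::{real_normed_field,euclidean_space}) set)
    (kondratiev_norm m a p 0)"
proof -
  let ?d = "CARD('d)"
  define N where "N n = real (Suc n)" for n
  have N: "0 < N n" "1 \<le> N n" for n by (auto simp: N_def)
  let ?T = "\<lambda>k \<alpha> (x :: real ^ 'd::{finite,linorder}). tensor (\<lambda>_. \<eta>) \<alpha> (4 ^ k *\<^sub>R x - (\<chi> i. 3 * 4 ^ k))"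
  let ?B = "\<lambda>n. bump_sum \<eta> (Suc n) (\<lambda>_. 1 / N n) (\<lambda>k. 4 ^ k) (\<lambda>k. 3 * 4 ^ k) :: ('d \<Rightarrow> nat) \<Rightarrow> real ^ 'd::{finite,linorder} \<Rightarrow> real"
  let ?Q = "\<lambda>k. dcube ((3 * 4 ^ k - 1) / 4 ^ k) ((3 * 4 ^ k + 1) / 4 ^ k) :: (real ^ 'd::{finite,linorder}) set"
  have B: "?B n \<alpha> x = (\<Sum>k<Suc n. 1 / N n * (4 ^ k) ^ mindex_order \<alpha> * ?T k \<alpha> x)" for n \<alpha> x
    by (simp add: bump_sum_def)
  have T: "x \<in> ?Q k" "\<bar>4 ^ k * (x $ j - 3)\<bar> \<le> 1" if "?T k \<alpha> x \<noteq> 0" for k \<alpha> x j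
    using scaled_support(1)[OF that] scaled_support(2)[OF that, of j] by (simp_all add: right_diff_distrib mult_ac)
  \<comment> \<open>The ratio 4 of consecutive scales matters: where the derivative of bump
    \<open>k\<close> lives, \<open>4^k \<bar>x_j - 3\<bar>\<close> is at least 1/2 for some
    \<open>j\<close>, but on the support of a later bump this number is at most 1/4.\<close>
  have disj: "k = k'" if nz: "?T k \<alpha> x \<noteq> 0" "?T k' \<alpha> x \<noteq> 0" and \<alpha>: "0 < mindex_order \<alpha>" for k k' \<alpha> x
  proof -
    have no: False if h: "k < k'" "?T k \<alpha> x \<noteq> 0" "?T k' \<alpha> x \<noteq> 0" for k k'
    proof -
      obtain j where j: "1 / 2 \<le> \<bar>(4 ^ k *\<^sub>R x - (\<chi> i. 3 * 4 ^ k)) $ j\<bar>" using tensor_bump_support(2)[OF h(2) \<alpha>] by blast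
      have "1 / 2 \<le> 4 ^ k * \<bar>x $ j - 3\<bar>"
        using j by (simp add: right_diff_distrib[symmetric] abs_mult mult.commute[of 3])
      moreover have "4 ^ k' * \<bar>x $ j - 3\<bar> \<le> 1" using T(2)[OF h(3), of j] by (simp add: abs_mult)
      moreover have "4 ^ Suc k * \<bar>x $ j - 3\<bar> \<le> 4 ^ k' * \<bar>x $ j - 3\<bar>"
        using h(1) by (intro mult_right_mono power_increasing) auto
      ultimately show False by simp
    qed
    show ?thesis using no[of k k'] no[of k' k] nz by (cases k k' rule: linorder_cases) auto
  qed
  \<comment> \<open>The centre with all coordinates 3 keeps the supports at norm at least 1, so the
    weight is constant and \<open>a\<close> drops out.\<close>
  have \<rho>: "rho 0 x = 1" if "?T k \<alpha> x \<noteq> 0" for k \<alpha> x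
  proof -
    have "4 ^ k * \<bar>x $ undefined - 3\<bar> \<le> 1" using T(2)[OF that, of undefined] by (simp add: abs_mult)
    moreover have "1 * \<bar>x $ undefined - 3\<bar> \<le> 4 ^ k * \<bar>x $ undefined - 3\<bar>" by (intro mult_right_mono) auto
    ultimately have "1 * \<bar>x $ undefined - 3\<bar> \<le> 1" by (rule order_trans[rotated])
    then have "1 \<le> \<bar>x $ undefined\<bar>" by simp
    then show ?thesis using component_le_norm_cart[of x undefined] by (simp add: rho_0)
  qed
  have "\<exists>M. \<forall>\<alpha>. 0 < M \<alpha> \<and> (\<forall>z. \<bar>tensor (\<lambda>_. \<eta>) \<alpha> (z :: real ^ 'd::{finite,linorder})\<bar> \<le> M \<alpha>)"
    using tensor_bump_bounded by (intro choice) blast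
  then obtain M :: "('d \<Rightarrow> nat) \<Rightarrow> real" where M: "\<And>\<alpha>. 0 < M \<alpha>" "\<And>\<alpha> z. \<bar>tensor (\<lambda>_. \<eta>) \<alpha> (z :: real ^ 'd::{finite,linorder})\<bar> \<le> M \<alpha>"
    by blast
  \<comment> \<open>At order 0 the bumps overlap, but their average lies in \<open>[0, 1]\<close>,
    so its power is at most the average itself and can be bounded termwise. At positive order at
    most one bump contributes at each point, so the power is taken of a single term.\<close>
  define A where "A \<alpha> n k = (if mindex_order \<alpha> = 0 then 1 / N n else (1 / N n * (4 ^ k) ^ mindex_order \<alpha> * M \<alpha>) powr p)" for \<alpha> n and k :: nat
  have A0: "0 \<le> A \<alpha> n k" for \<alpha> n k using N(1)[of n] by (simp add: A_def)
  have point: "(rho 0 x powr (real (mindex_order \<alpha>) - a) * \<bar>?B n \<alpha> x\<bar>) powr p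
    \<le> (\<Sum>k<Suc n. A \<alpha> n k * indicator (?Q k) x)" for \<alpha> n x
  proof (cases "\<exists>k<Suc n. ?T k \<alpha> x \<noteq> 0")
    case False
    then have "?B n \<alpha> x = 0" unfolding B by (intro sum.neutral) auto
    then show ?thesis using A0 by (simp add: sum_nonneg del: sum.lessThan_Suc)
  next
    case True
    then obtain k where k: "k < Suc n" "?T k \<alpha> x \<noteq> 0" by blast
    have \<rho>1: "rho 0 x = 1" by (rule \<rho>[OF k(2)])
    show ?thesis
    proof (cases "mindex_order \<alpha> = 0")
      case True
      then have \<alpha>: "\<alpha> = (\<lambda>_. 0)" by (auto simp: mindex_order_def)
      have Bn: "?B n \<alpha> x = (\<Sum>k<Suc n. 1 / N n * ?T k \<alpha> x)" unfolding B using True by simp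
      have B0: "0 \<le> ?B n \<alpha> x" unfolding Bn unfolding \<alpha> using tensor_bump_0(1) N(1)[of n] by (intro sum_nonneg mult_nonneg_nonneg) auto
      have "?B n \<alpha> x \<le> (\<Sum>k<Suc n. 1 / N n * 1)"
        unfolding Bn unfolding \<alpha> using tensor_bump_0(2) N(1)[of n] by (intro sum_mono mult_left_mono) auto
      also have "\<dots> = 1" by (simp add: N_def del: sum.lessThan_Suc)
      finally have B1: "?B n \<alpha> x \<le> 1" .
      have "?B n \<alpha> x powr p \<le> ?B n \<alpha> x powr 1" using B0 B1 p by (intro powr_mono') auto
      also have "\<dots> = ?B n \<alpha> x" using B0 by simp
      also have "\<dots> \<le> (\<Sum>k<Suc n. 1 / N n * indicator (?Q k) x)"
        unfolding Bn
      proof (rule sum_mono, rule mult_left_mono)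
        fix k show "?T k \<alpha> x \<le> indicator (?Q k) x"
          using T(1)[where k = k and \<alpha> = \<alpha> and x = x] tensor_bump_0(2) by (cases "?T k \<alpha> x = 0") (auto simp: \<alpha>)
      qed (use N(1)[of n] in simp)
      finally show ?thesis using \<rho>1 B0 True by (simp add: A_def del: sum.lessThan_Suc)
    next
      case False
      have "?B n \<alpha> x = (\<Sum>k'\<in>{k}. 1 / N n * (4 ^ k') ^ mindex_order \<alpha> * ?T k' \<alpha> x)"
        unfolding B
      proof (intro sum.mono_neutral_right ballI)
        fix k' assume "k' \<in> {..<Suc n} - {k}"
        then have "k \<noteq> k'" by blast
        then have "?T k' \<alpha> x = 0" using disj[OF k(2), of k'] False by blast
        then show "1 / N n * (4 ^ k') ^ mindex_order \<alpha> * ?T k' \<alpha> x = 0" by (simp only: mult_zero_right)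
      qed (use k(1) in simp_all)
      then have "\<bar>?B n \<alpha> x\<bar> = 1 / N n * (4 ^ k) ^ mindex_order \<alpha> * \<bar>?T k \<alpha> x\<bar>"
        using N(1)[of n] by (simp add: abs_mult)
      also have "\<dots> \<le> 1 / N n * (4 ^ k) ^ mindex_order \<alpha> * M \<alpha>"
        using M(2) N(1)[of n] by (intro mult_left_mono) auto
      finally have "\<bar>?B n \<alpha> x\<bar> powr p \<le> A \<alpha> n k"
        unfolding A_def using p False by (auto intro!: powr_mono2)
      also have "\<dots> = A \<alpha> n k * indicator (?Q k) x" using T(1)[OF k(2)] by simp
      also have "\<dots> \<le> (\<Sum>k<Suc n. A \<alpha> n k * indicator (?Q k) x)"
        using k(1) A0 by (intro member_le_sum) auto
      finally show ?thesis using \<rho>1 by simp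
    qed
  qed
  define b where "b \<alpha> n = (\<Sum>k<Suc n. A \<alpha> n k * (2 / 4 ^ k) ^ ?d)" for \<alpha> n
  have b0: "0 \<le> b \<alpha> n" for \<alpha> n unfolding b_def using A0 by (intro sum_nonneg) auto
  have geo: "(\<Sum>k<n. (1 / 4) ^ k :: real) \<le> 2" for n
  proof -
    have "(\<Sum>k<n. (1 / 4) ^ k :: real) = 4 / 3 * (1 - (1 / 4) ^ n)" by (induction n) (simp_all add: algebra_simps)
    also have "\<dots> \<le> 4 / 3 * 1" by (intro mult_left_mono) auto
    finally show ?thesis by simp
  qed
  have lim: "(\<lambda>n. c * N n powr - e) \<longlonglongrightarrow> 0" if "0 < e" for c e
  proof -
    have "filterlim N at_top sequentially"
      unfolding N_def by (rule filterlim_compose[OF filterlim_real_sequentially filterlim_Suc])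
    with tendsto_neg_powr[of "- e" N sequentially] that show ?thesis by (intro tendsto_mult_right_zero) simp
  qed
  have decay: "\<exists>c e. 0 < e \<and> (\<forall>n. b \<alpha> n \<le> c * N n powr - e)" if \<alpha>: "mindex_order \<alpha> \<le> m" for \<alpha>
  proof -
    have geo_bound: "\<exists>c e. 0 < e \<and> (\<forall>n. b \<alpha> n \<le> c * N n powr - e)"
      if "0 \<le> c" "\<And>n k. A \<alpha> n k * (2 / 4 ^ k) ^ ?d \<le> c / N n * (1 / 4) ^ k" for c
    proof (rule exI[of _ "c * 2"], rule exI[of _ 1], intro conjI allI)
      fix n
      have "b \<alpha> n \<le> (\<Sum>k<Suc n. c / N n * (1 / 4) ^ k)" unfolding b_def by (rule sum_mono) (rule that(2))
      also have "\<dots> = c / N n * (\<Sum>k<Suc n. (1 / 4) ^ k)" by (rule sum_distrib_left[symmetric])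
      also have "\<dots> \<le> c / N n * 2" using that(1) N(1)[of n] by (intro mult_left_mono geo) simp
      finally show "b \<alpha> n \<le> c * 2 * N n powr - 1" using N(1)[of n] by (simp add: powr_minus_divide)
    qed simp
    have pow4: "1 / (4 ^ k) ^ i \<le> (1 / 4 :: real) ^ k" if "0 < i" for k i :: nat
    proof -
      have "(4 ^ k) ^ 1 \<le> (4 ^ k :: real) ^ i" using that by (intro power_increasing) auto
      then show ?thesis by (simp add: power_divide frac_le)
    qed
    consider "mindex_order \<alpha> = 0" | "0 < mindex_order \<alpha>" "p = 1" | "0 < mindex_order \<alpha>" "1 < p" using p by linarith
    then show ?thesis
    proof cases
      case 1
      show ?thesis
      proof (rule geo_bound[of "2 ^ ?d"])
        fix n k
        have "1 / N n * (2 ^ ?d * (1 / (4 ^ k) ^ ?d)) \<le> 1 / N n * (2 ^ ?d * (1 / 4) ^ k)"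
          using N(1)[of n] by (intro mult_left_mono pow4) auto
        then show "A \<alpha> n k * (2 / 4 ^ k) ^ ?d \<le> 2 ^ ?d / N n * (1 / 4) ^ k"
          by (simp add: A_def 1 power_divide)
      qed simp
    next
      case 2
      \<comment> \<open>For \<open>p = 1\<close> the failing condition is \<open>m < d\<close>, so
        at least one power of \<open>4^k\<close> is left over from the volume. The series over the
        scales is geometric, and the amplitude \<open>1 / N n\<close> gives the decay.\<close>
      then have "mindex_order \<alpha> < ?d" using cond \<alpha> by simp
      then obtain i where i: "?d = mindex_order \<alpha> + i" "0 < i" using less_imp_add_positive by metis
      show ?thesis
      proof (rule geo_bound[of "2 ^ ?d * M \<alpha>"])
        fix n k
        have "A \<alpha> n k * (2 / 4 ^ k) ^ ?d = 2 ^ ?d * M \<alpha> / N n * ((4 ^ k) ^ mindex_order \<alpha> / (4 ^ k) ^ (mindex_order \<alpha> + i))"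
          unfolding i(1)[symmetric] using 2 M(1)[of \<alpha>] N(1)[of n] by (simp add: A_def power_divide)
        also have "(4 ^ k) ^ mindex_order \<alpha> / (4 ^ k) ^ (mindex_order \<alpha> + i) = 1 / (4 ^ k :: real) ^ i"
          by (simp add: power_add)
        also have "2 ^ ?d * M \<alpha> / N n * (1 / (4 ^ k) ^ i) \<le> 2 ^ ?d * M \<alpha> / N n * (1 / 4) ^ k"
          using N(1)[of n] M(1)[of \<alpha>] i(2) by (intro mult_left_mono pow4) auto
        finally show "A \<alpha> n k * (2 / 4 ^ k) ^ ?d \<le> 2 ^ ?d * M \<alpha> / N n * (1 / 4) ^ k" .
      qed (use M(1)[of \<alpha>] in simp)
    next
      case 3
      \<comment> \<open>For \<open>p > 1\<close> equality \<open>m p = d\<close> may occur, and then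
        no scale is smaller than another at top order. There are \<open>N n\<close> terms of order
        \<open>N n powr - p\<close>, so the decay comes from averaging alone.\<close>
      have "real m \<le> real ?d / p" using cond 3 by auto
      then have "real m * p \<le> real ?d" using p by (simp add: field_simps)
      moreover have "real (mindex_order \<alpha>) * p \<le> real m * p" using \<alpha> p by (intro mult_right_mono) auto
      ultimately have mp: "real (mindex_order \<alpha>) * p \<le> real ?d" by linarith
      have "b \<alpha> n \<le> (M \<alpha> powr p * 2 ^ ?d) * N n powr - (p - 1)" for n
      proof -
        have "A \<alpha> n k * (2 / 4 ^ k) ^ ?d \<le> M \<alpha> powr p * 2 ^ ?d * N n powr - p" for k
        proof -
          have "((4 ^ k) ^ mindex_order \<alpha>) powr p = (4 ^ k :: real) powr (real (mindex_order \<alpha>) * p)"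
            by (simp add: powr_powr powr_realpow[symmetric] mult.assoc)
          also have "\<dots> \<le> (4 ^ k) powr real ?d" using mp by (intro powr_mono) auto
          also have "\<dots> = (4 ^ k) ^ ?d" by (simp add: powr_realpow)
          finally have le: "((4 ^ k) ^ mindex_order \<alpha>) powr p / (4 ^ k :: real) ^ ?d \<le> 1" by simp
          have "A \<alpha> n k * (2 / 4 ^ k) ^ ?d = M \<alpha> powr p * 2 ^ ?d * N n powr - p * (((4 ^ k) ^ mindex_order \<alpha>) powr p / (4 ^ k) ^ ?d)"
            using 3 by (simp add: A_def power_divide powr_mult powr_divide powr_minus_divide)
          also have "\<dots> \<le> M \<alpha> powr p * 2 ^ ?d * N n powr - p * 1"
            by (rule mult_left_mono[OF le]) simp
          finally show ?thesis by simp
        qed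
        then have "b \<alpha> n \<le> (\<Sum>k<Suc n. M \<alpha> powr p * 2 ^ ?d * N n powr - p)" unfolding b_def by (rule sum_mono)
        also have "\<dots> = N n * (M \<alpha> powr p * 2 ^ ?d * N n powr - p)" by (simp add: N_def del: sum.lessThan_Suc)
        also have "\<dots> = (M \<alpha> powr p * 2 ^ ?d) * (N n powr 1 * N n powr - p)" using N(1)[of n] by simp
        also have "N n powr 1 * N n powr - p = N n powr - (p - 1)" unfolding powr_add[symmetric] by simp
        finally show ?thesis .
      qed
      then show ?thesis using 3 by (intro exI[of _ "M \<alpha> powr p * 2 ^ ?d"] exI[of _ "p - 1"]) auto
    qed
  qed
  have blim: "b \<alpha> \<longlonglongrightarrow> 0" if \<alpha>: "mindex_order \<alpha> \<le> m" for \<alpha>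
  proof -
    obtain c e where ce: "0 < e" "\<And>n. b \<alpha> n \<le> c * N n powr - e"
      using decay[OF \<alpha>] by blast
    show ?thesis
      by (rule tendsto_sandwich[OF _ _ tendsto_const lim[OF ce(1), of c]]) (simp_all add: b0 ce(2))
  qed
  \<comment> \<open>The plateau of the narrowest bump, \<open>k = n\<close>; all wider bumps equal 1
    there too, so the average is 1.\<close>
  let ?G = "\<lambda>n. box (\<chi> i. 3 - 1 / 4 ^ n / 2) (\<chi> i. 3 + 1 / 4 ^ n / 2) :: (real ^ 'd::{finite,linorder}) set"
  show ?thesis
  proof (rule not_algebra_if_plateau_energy_null[OF p, where
      U = "\<lambda>n \<alpha> x. of_real (?B n \<alpha> x)" and G = ?G and b = b])
    fix n and \<alpha> :: "'d \<Rightarrow> nat"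
    show "ac_family (- singular_set 0) m (\<lambda>\<alpha> x. of_real (?B n \<alpha> x) :: 'b)" by (rule ac_family_bump_sum[OF \<eta>(1)])
    show "open (?G n)" by (rule open_box)
    have "(\<chi> i. 3) \<in> ?G n" by (simp add: mem_box_cart)
    then show "?G n \<noteq> {}" by blast
    have "x \<noteq> 0" if "x \<in> ?G n" for x
    proof
      assume "x = 0"
      then have "3 < 1 / 4 ^ n / (2 :: real)" using that by (simp add: mem_box_cart)
      also have "1 / 4 ^ n / 2 \<le> 1 / (2 :: real)" by (rule divide_right_mono) simp_all
      finally show False by simp
    qed
    then show "?G n \<subseteq> - singular_set 0" unfolding singular_set_0 by blast
    show "(of_real (?B n (\<lambda>_. 0) x) :: 'b) = 1" if x: "x \<in> ?G n" for x
    proof -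
      have "?T k (\<lambda>_. 0) x = 1" if "k < Suc n" for k
      proof (rule tensor_bump_0(3))
        fix j
        have "3 - 1 / 4 ^ n / 2 < x $ j" "x $ j < 3 + 1 / 4 ^ n / 2" using x by (auto simp: mem_box_cart)
        then have "\<bar>x $ j - 3\<bar> \<le> 1 / 4 ^ n / 2" by (simp add: abs_le_iff)
        then have "4 ^ n * \<bar>x $ j - 3\<bar> \<le> 1 / 2" by (simp add: field_simps)
        moreover have "4 ^ k * \<bar>x $ j - 3\<bar> \<le> 4 ^ n * \<bar>x $ j - 3\<bar>"
          using that by (intro mult_right_mono power_increasing) auto
        ultimately have "4 ^ k * \<bar>x $ j - 3\<bar> \<le> 1 / 2" by linarith
        then have "\<bar>4 ^ k * (x $ j - 3)\<bar> \<le> 1 / 2" by (simp add: abs_mult)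
        then show "\<bar>(4 ^ k *\<^sub>R x - (\<chi> i. 3 * 4 ^ k)) $ j\<bar> \<le> 1 / 2" by (simp add: right_diff_distrib mult.commute)
      qed
      then have "?B n (\<lambda>_. 0) x = (\<Sum>k<Suc n. 1 / N n)"
        unfolding B by (intro sum.cong) (auto simp: mindex_order_0)
      also have "\<dots> = 1" by (simp add: N_def del: sum.lessThan_Suc)
      finally show ?thesis by simp
    qed
    show "0 \<le> b \<alpha> n" by (rule b0)
    show "b \<alpha> \<longlonglongrightarrow> 0" if "mindex_order \<alpha> \<le> m" by (rule blim[OF that])
    have "(\<integral>\<^sup>+ x \<in> - singular_set 0. ennreal ((rho 0 x powr (real (mindex_order \<alpha>) - a) * norm (of_real (?B n \<alpha> x) :: 'b)) powr p) \<partial>lborel)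
      \<le> (\<integral>\<^sup>+x. ennreal (\<Sum>k<Suc n. A \<alpha> n k * indicator (?Q k) x) \<partial>lborel)"
    proof (rule nn_integral_mono)
      fix x :: "real ^ 'd::{finite,linorder}"
      have "ennreal ((rho 0 x powr (real (mindex_order \<alpha>) - a) * norm (of_real (?B n \<alpha> x) :: 'b)) powr p)
        \<le> ennreal (\<Sum>k<Suc n. A \<alpha> n k * indicator (?Q k) x)"
        unfolding norm_of_real by (rule ennreal_leI, rule point)
      then show "ennreal ((rho 0 x powr (real (mindex_order \<alpha>) - a) * norm (of_real (?B n \<alpha> x) :: 'b)) powr p) * indicator (- singular_set 0) x
        \<le> ennreal (\<Sum>k<Suc n. A \<alpha> n k * indicator (?Q k) x)"
        by (cases "x \<in> - singular_set 0") (simp_all del: sum.lessThan_Suc)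
    qed
    also have "\<dots> = ennreal (b \<alpha> n)"
      unfolding b_def by (rule nn_integral_scaled_cubes) (simp_all add: A0)
    finally show "(\<integral>\<^sup>+ x \<in> - singular_set 0. ennreal ((rho 0 x powr (real (mindex_order \<alpha>) - a) * norm (of_real (?B n \<alpha> x) :: 'b)) powr p) \<partial>lborel)
      \<le> ennreal (b \<alpha> n)" .
  qed
qed

end

theorem corollary32:
  fixes p a :: real and m l :: nat
  assumes "1 \<le> p" and "1 \<le> m" and "l < CARD('d::{finite,linorder})"
  shows
    "(a \<ge> real CARD('d) / p \<and>
        (1 < p \<and> real m > real CARD('d) / p \<or> p = 1 \<and> m \<ge> CARD('d)) \<longrightarrow>
      pointwise_algebra
        (kondratiev_space m a p l :: (real ^ 'd::{finite,linorder} \<Rightarrow> 'b::{real_normed_field,euclidean_space}) set)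
        (kondratiev_norm m a p l)) \<and>
     (pointwise_algebra
        (kondratiev_space m a p 0 :: (real ^ 'd::{finite,linorder} \<Rightarrow> 'b) set)
        (kondratiev_norm m a p 0) \<longleftrightarrow>
      a \<ge> real CARD('d) / p \<and>
        (1 < p \<and> real m > real CARD('d) / p \<or> p = 1 \<and> m \<ge> CARD('d)))"
  proof (intro conjI impI iffI)
  obtain \<eta> where \<eta>: "csmooth \<eta>" "\<And>s. 0 \<le> \<eta> s" "\<And>s. \<eta> s \<le> 1"
    "\<And>s. \<bar>s\<bar> \<le> 1 / 2 \<Longrightarrow> \<eta> s = 1" "\<And>s. 1 \<le> \<bar>s\<bar> \<Longrightarrow> \<eta> s = 0"
  proof (rule plateau_exists)
    fix \<eta> :: "real \<Rightarrow> real"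
    assume A: "csmooth \<eta>" "\<And>s. 0 \<le> \<eta> s" "\<And>s. \<eta> s \<le> 1"
      "\<And>s. \<bar>s\<bar> \<le> 1 / 2 \<Longrightarrow> \<eta> s = 1" "\<And>s. 1 \<le> \<bar>s\<bar> \<Longrightarrow> \<eta> s = 0"
    show thesis by (rule that) (fact A)+
  qed
  assume alg: "pointwise_algebra
    (kondratiev_space m a p 0 :: (real ^ 'd::{finite,linorder} \<Rightarrow> 'b) set) (kondratiev_norm m a p 0)"
  show "a \<ge> real CARD('d) / p"
    using not_algebra_weight[OF \<eta> assms(1), where m = m and a = a and 'd = 'd and 'b = 'b] alg by fastforce
  show "1 < p \<and> real m > real CARD('d) / p \<or> p = 1 \<and> m \<ge> CARD('d)"
    using not_algebra_smoothness[OF \<eta> assms(1), where m = m and a = a and 'd = 'd and 'b = 'b] alg by blast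
qed (use kondratiev_algebra[OF assms(1,2)] in blast)+


end
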